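(* Let $\rho_1,\rho_2,k,b,\delta,\gamma>0$. Assume that for $i=1,2$ the function $g_i:\mathbb{R}_+\to\mathbb{R}_+$ is differentiable, nonincreasing and integrable on $\mathbb{R}_+$; that, with $g_i^0=\int_0^\infty g_i(s)\,ds$, there exists a constant $k_0>0$ such that for all $(\varphi,\psi,v)\in H_0^1(0,1)\times H_*^1(0,1)\times H_*^1(0,1)$ $$k_0\left(\|\varphi_x\|^2+\|\psi_x\|^2+\|v_x\|^2\right)\le 3k\|\varphi_x+\psi-v\|^2+3(b-g_2^0)\|\psi_x\|^2+b\|v_x\|^2+4\delta\|v\|^2-3g_1^0\|\varphi_x\|^2;$$ and that there exist constants $\beta_1,\beta_2>0$ such that $-\beta_i g_i(s)\le g_i'(s)$ for all $s\in\mathbb{R}_+$, $i=1,2$. Then, for any $U_0\in\mathcal{H}$, the system $$U_t(t)=\mathcal{A}U(t)\quad (t>0),\qquad U(0)=U_0$$ admits a unique solution $U$ satisfying $$U\in C(\mathbb{R}_+;\mathcal{H}).$$ If $U_0\in\mathcal{D}(\mathcal{A})$, then $U$ satisfies $$U\in C^1(\mathbb{R}_+;\mathcal{H})\cap C(\mathbb{R}_+;\mathcal{D}(\mathcal{A})).$$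
   Context: $\mathbb{R}_+=[0,\infty)$; $\langle\cdot,\cdot\rangle$ and $\|\cdot\|$ are the standard scalar product and norm of $L^2(0,1)$; subscripts $x,t,s$ denote partial derivatives. Spaces: $H_*^1(0,1)=\{h\in H^1(0,1):h(0)=0\}$, $\tilde H_1=H_0^1(0,1)$, $\tilde H_2=H_*^1(0,1)$, and for $i=1,2$ $$L_{g_i}=\Big\{w:\mathbb{R}_+\to\tilde H_i:\ \int_0^\infty g_i(s)\|w_x(s)\|^2ds<\infty\Big\},\qquad \langle w,\tilde w\rangle_{L_{g_i}}=\int_0^\infty g_i(s)\langle w_x(s),\tilde w_x(s)\rangle ds.$$ The energy space is $\mathcal{H}=H_0^1(0,1)\times L^2(0,1)\times[H_*^1(0,1)\times L^2(0,1)]^2\times L_{g_1}\times L_{g_2}$. For $U_j=(\varphi_j,\tilde\varphi_j,\psi_j,\tilde\psi_j,v_j,\tilde v_j,\eta_j,z_j)\in\mathcal{H}$, $j=1,2$, its inner product is $$\langle U_1,U_2\rangle_{\mathcal{H}}=3k\langle\varphi_{1x}+\psi_1-v_1,\varphi_{2x}+\psi_2-v_2\rangle+3(b-g_2^0)\langle\psi_{1x},\psi_{2x}\rangle-3g_1^0\langle\varphi_{1x},\varphi_{2x}\rangle+b\langle v_{1x},v_{2x}\rangle+4\delta\langle v_1,v_2\rangle$$ $$+3\rho_1\langle\tilde\varphi_1,\tilde\varphi_2\rangle+3\rho_2\langle\tilde\psi_1,\tilde\psi_2\rangle+\rho_2\langle\tilde v_1,\tilde v_2\rangle+3\langle\eta_1,\eta_2\rangle_{L_{g_1}}+3\langle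 z_1,z_2\rangle_{L_{g_2}}.$$ Operator: for $U=(\varphi,\tilde\varphi,\psi,\tilde\psi,v,\tilde v,\eta,z)$, $\mathcal{A}U$ is the vector with the eight components (1) $\tilde\varphi$; (2) $\frac{k}{\rho_1}(\varphi_x+\psi-v)_x-\frac{g_1^0}{\rho_1}\varphi_{xx}+\frac1{\rho_1}\int_0^\infty g_1(s)\eta_{xx}(s)\,ds$; (3) $\tilde\psi$; (4) $\frac1{\rho_2}\left[(b-g_2^0)\psi_{xx}-k(\varphi_x+\psi-v)\right]+\frac1{\rho_2}\int_0^\infty g_2(s)z_{xx}(s)\,ds$; (5) $\tilde v$; (6) $\frac1{\rho_2}\left[bv_{xx}+3k(\varphi_x+\psi-v)-4\delta v-4\gamma\tilde v\right]$; (7) $-\eta_s+\tilde\varphi$; (8) $-z_s+\tilde\psi$; (derivatives understood in the weak sense), with domain $$\mathcal{D}(\mathcal{A})=\{U\in\mathcal{H}:\ \mathcal{A}U\in\mathcal{H},\ \psi_x(1)=v_x(1)=\eta(x,0)=z(x,0)=z_x(1,s)=0\}.$$ For $U_0\in\mathcal{D}(\mathcal{A})$ solutions are classical; for general $U_0\in\mathcal{H}$ the solution is understood in the mild (semigroup) sense, i.e. as the limit, uniformly on bounded time intervals in $\mathcal{H}$, of classical solutions with initial data in $\mathcal{D}(\mathcal{A})$ converging to $U_0$ in $\mathcal{H}$.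
   Formalization: In D(A), the conditions ψ_x(1)=0 and z_x(1,s)=0, undefined for ψ, z(s) only in H^1, are imposed jointly in weak form: component (4) is tested against all of H_*^1(0,1) without boundary term at x=1; the separate traces are not asserted. *)

theory Defs
  imports "HOL-Analysis.Analysis"
begin

section \<open>Function spaces on the unit interval\<close>

text \<open>Elements of \<open>L\<^sup>2(0,1)\<close>, of the history spaces and of the energy space are represented by
  functions. Two representatives at distance zero in the energy (semi)norm stand for the same
  element, and all notions below respect this identification.\<close>

abbreviation unit_meas :: "real measure" where
  "unit_meas \<equiv> lebesgue_on {0<..<1}"

abbreviation half_line :: "real measure" where
  "half_line \<equiv> lebesgue_on {0..}"

definition L2 :: "(real \<Rightarrow> real) set" where
  "L2 = {f. f \<in> borel_measurable unit_meas \<and> integrable unit_meas (\<lambda>x. (f x)\<^sup>2)}"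

definition l2ip :: "(real \<Rightarrow> real) \<Rightarrow> (real \<Rightarrow> real) \<Rightarrow> real" where
  "l2ip f h = (LINT x|unit_meas. f x * h x)"

definition l2norm :: "(real \<Rightarrow> real) \<Rightarrow> real" where
  "l2norm f = sqrt (l2ip f f)"

text \<open>\<open>\<theta>\<close> is a \<open>C\<^sup>1\<close> function with compact support in the open set \<open>J\<close>, and \<open>\<theta>'\<close> is its derivative.\<close>

definition test_fun :: "real set \<Rightarrow> (real \<Rightarrow> real) \<Rightarrow> (real \<Rightarrow> real) \<Rightarrow> bool" where
  "test_fun J \<theta> \<theta>' \<longleftrightarrow>
     (\<forall>x. (\<theta> has_real_derivative \<theta>' x) (at x)) \<and> continuous_on UNIV \<theta>' \<and>
     (\<exists>K. compact K \<and> K \<subseteq> J \<and> (\<forall>x. x \<notin> K \<longrightarrow> \<theta> x = 0))"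

definition weak_deriv :: "real set \<Rightarrow> (real \<Rightarrow> real) \<Rightarrow> (real \<Rightarrow> real) \<Rightarrow> bool" where
  "weak_deriv J f f' \<longleftrightarrow>
     (\<forall>K. compact K \<and> K \<subseteq> J \<longrightarrow> integrable (lebesgue_on K) f \<and> integrable (lebesgue_on K) f') \<and>
     (\<forall>\<theta> \<theta>'. test_fun J \<theta> \<theta>' \<longrightarrow>
        (LINT x|lebesgue_on J. f x * \<theta>' x) = - (LINT x|lebesgue_on J. f' x * \<theta> x))"

text \<open>An element of \<open>H\<^sup>1(0,1)\<close> is given by its representative that is continuous on \<open>[0,1]\<close>, so
  that boundary values are ordinary values.\<close>

definition H1 :: "(real \<Rightarrow> real) set" where
  "H1 = {h \<in> L2. continuous_on {0..1} h \<and> (\<exists>h' \<in> L2. weak_deriv {0<..<1} h h')}"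

definition H10 :: "(real \<Rightarrow> real) set" where
  "H10 = {h \<in> H1. h 0 = 0 \<and> h 1 = 0}"

definition Hstar :: "(real \<Rightarrow> real) set" where
  "Hstar = {h \<in> H1. h 0 = 0}"

text \<open>Some representative of the weak derivative \<open>h\<^sub>x \<in> L\<^sup>2(0,1)\<close>; it is determined almost
  everywhere, and is only used below in ways that do not depend on the choice.\<close>

definition wx :: "(real \<Rightarrow> real) \<Rightarrow> real \<Rightarrow> real" where
  "wx h = (SOME h'. h' \<in> L2 \<and> weak_deriv {0<..<1} h h')"

section \<open>History spaces\<close>

definition total_mass :: "(real \<Rightarrow> real) \<Rightarrow> real" where
  "total_mass g = (LINT s|half_line. g s)"

text \<open>A history is written \<open>w s x\<close>. The measurability of \<open>w : \<real>\<^sub>+ \<rightarrow> Hs\<close>, implicit in the integral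
  that defines the space, is stated weakly with respect to the inner product
  \<open>\<langle>h\<^sub>x, h'\<^sub>x\<rangle>\<close>; since \<open>Hs\<close> is separable this is strong measurability (Pettis).\<close>

definition Lg :: "(real \<Rightarrow> real) set \<Rightarrow> (real \<Rightarrow> real) \<Rightarrow> (real \<Rightarrow> real \<Rightarrow> real) set" where
  "Lg Hs g = {w. (\<forall>s\<ge>0. w s \<in> Hs) \<and>
     (\<forall>h\<in>Hs. (\<lambda>s. l2ip (wx (w s)) (wx h)) \<in> borel_measurable half_line) \<and>
     integrable half_line (\<lambda>s. g s * (l2norm (wx (w s)))\<^sup>2)}"

definition Lg_ip ::
  "(real \<Rightarrow> real) \<Rightarrow> (real \<Rightarrow> real \<Rightarrow> real) \<Rightarrow> (real \<Rightarrow> real \<Rightarrow> real) \<Rightarrow> real" where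
  "Lg_ip g w w' = (LINT s|half_line. g s * l2ip (wx (w s)) (wx (w' s)))"

definition Lg_eq ::
  "(real \<Rightarrow> real) \<Rightarrow> (real \<Rightarrow> real \<Rightarrow> real) \<Rightarrow> (real \<Rightarrow> real \<Rightarrow> real) \<Rightarrow> bool" where
  "Lg_eq g w w' \<longleftrightarrow> Lg_ip g (\<lambda>s x. w s x - w' s x) (\<lambda>s x. w s x - w' s x) = 0"

text \<open>\<open>w(\<cdot>,0) = 0\<close>, and \<open>\<zeta>\<close> is the weak derivative \<open>w\<^sub>s\<close>, both as elements of the history space.
  The value at \<open>s = 0\<close> is that of the representative which is continuous in \<open>s\<close>.\<close>

definition history_deriv :: "(real \<Rightarrow> real) set \<Rightarrow> (real \<Rightarrow> real) \<Rightarrow>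
    (real \<Rightarrow> real \<Rightarrow> real) \<Rightarrow> (real \<Rightarrow> real \<Rightarrow> real) \<Rightarrow> bool" where
  "history_deriv Hs g w \<zeta> \<longleftrightarrow>
     (\<exists>w' \<in> Lg Hs g. \<exists>\<zeta>' \<in> Lg Hs g. Lg_eq g w w' \<and> Lg_eq g \<zeta> \<zeta>' \<and>
        (\<forall>x\<in>{0..1}. continuous_on {0..} (\<lambda>s. w' s x) \<and> w' 0 x = 0 \<and>
           weak_deriv {0<..} (\<lambda>s. w' s x) (\<lambda>s. \<zeta>' s x)))"

section \<open>The energy space\<close>

record beam =
  rho1 :: real
  rho2 :: real
  kpar :: real
  bpar :: real
  delta :: real
  gam :: real
  ker1 :: "real \<Rightarrow> real"
  ker2 :: "real \<Rightarrow> real"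

text \<open>The components \<open>(\<phi>, \<phi>~, \<psi>, \<psi>~, v, v~, \<eta>, z)\<close>; the suffix \<open>_t\<close> marks the components with a
  tilde.\<close>

record state =
  phi :: "real \<Rightarrow> real"
  phi_t :: "real \<Rightarrow> real"
  psi :: "real \<Rightarrow> real"
  psi_t :: "real \<Rightarrow> real"
  vee :: "real \<Rightarrow> real"
  vee_t :: "real \<Rightarrow> real"
  eta :: "real \<Rightarrow> real \<Rightarrow> real"
  zet :: "real \<Rightarrow> real \<Rightarrow> real"

definition st_diff :: "state \<Rightarrow> state \<Rightarrow> state" where
  "st_diff U V = \<lparr>
     phi = (\<lambda>x. phi U x - phi V x), phi_t = (\<lambda>x. phi_t U x - phi_t V x),
     psi = (\<lambda>x. psi U x - psi V x), psi_t = (\<lambda>x. psi_t U x - psi_t V x),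
     vee = (\<lambda>x. vee U x - vee V x), vee_t = (\<lambda>x. vee_t U x - vee_t V x),
     eta = (\<lambda>s x. eta U s x - eta V s x), zet = (\<lambda>s x. zet U s x - zet V s x)\<rparr>"

definition st_scale :: "real \<Rightarrow> state \<Rightarrow> state" where
  "st_scale c U = \<lparr>
     phi = (\<lambda>x. c * phi U x), phi_t = (\<lambda>x. c * phi_t U x),
     psi = (\<lambda>x. c * psi U x), psi_t = (\<lambda>x. c * psi_t U x),
     vee = (\<lambda>x. c * vee U x), vee_t = (\<lambda>x. c * vee_t U x),
     eta = (\<lambda>s x. c * eta U s x), zet = (\<lambda>s x. c * zet U s x)\<rparr>"

definition energy_space :: "beam \<Rightarrow> state set" where
  "energy_space B = {U. phi U \<in> H10 \<and> phi_t U \<in> L2 \<and> psi U \<in> Hstar \<and> psi_t U \<in> L2 \<and>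
     vee U \<in> Hstar \<and> vee_t U \<in> L2 \<and> eta U \<in> Lg H10 (ker1 B) \<and> zet U \<in> Lg Hstar (ker2 B)}"

definition shear :: "(real \<Rightarrow> real) \<Rightarrow> (real \<Rightarrow> real) \<Rightarrow> (real \<Rightarrow> real) \<Rightarrow> real \<Rightarrow> real" where
  "shear \<phi> \<psi> v = (\<lambda>x. wx \<phi> x + \<psi> x - v x)"

definition energy_ip :: "beam \<Rightarrow> state \<Rightarrow> state \<Rightarrow> real" where
  "energy_ip B U V =
     3 * kpar B * l2ip (shear (phi U) (psi U) (vee U)) (shear (phi V) (psi V) (vee V))
     + 3 * (bpar B - total_mass (ker2 B)) * l2ip (wx (psi U)) (wx (psi V))
     - 3 * total_mass (ker1 B) * l2ip (wx (phi U)) (wx (phi V))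
     + bpar B * l2ip (wx (vee U)) (wx (vee V))
     + 4 * delta B * l2ip (vee U) (vee V)
     + 3 * rho1 B * l2ip (phi_t U) (phi_t V)
     + 3 * rho2 B * l2ip (psi_t U) (psi_t V)
     + rho2 B * l2ip (vee_t U) (vee_t V)
     + 3 * Lg_ip (ker1 B) (eta U) (eta V)
     + 3 * Lg_ip (ker2 B) (zet U) (zet V)"

definition energy_norm :: "beam \<Rightarrow> state \<Rightarrow> real" where
  "energy_norm B U = sqrt (energy_ip B U U)"

definition energy_dist :: "beam \<Rightarrow> state \<Rightarrow> state \<Rightarrow> real" where
  "energy_dist B U V = energy_norm B (st_diff U V)"

section \<open>The operator\<close>

text \<open>The weak meaning of \<open>h\<^sub>x\<^sub>x\<close>: its pairing with a test function \<open>w\<close>, obtained by integrating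
  \<open>\<langle>h\<^sub>x\<^sub>x, w\<rangle>\<close> by parts and dropping the boundary term \<open>h\<^sub>x(1) w(1) - h\<^sub>x(0) w(0)\<close>. For \<open>w\<close> in \<open>H10\<close>
  there is no boundary term, and this is the distributional derivative. For \<open>w\<close> in \<open>Hstar\<close>
  dropping \<open>h\<^sub>x(1) w(1)\<close> imposes \<open>h\<^sub>x(1) = 0\<close> in the weak sense.\<close>

definition weak_xx :: "(real \<Rightarrow> real) \<Rightarrow> (real \<Rightarrow> real) \<Rightarrow> real" where
  "weak_xx h w = - l2ip (wx h) (wx w)"

text \<open>\<open>has_image B U F\<close>: \<open>U\<close> lies in the domain of \<open>\<A>\<close> and \<open>F \<in> \<H>\<close> represents \<open>\<A> U\<close>. The
  conjuncts are the eight components in order; the sixth is preceded by \<open>v\<^sub>x(1) = 0\<close>.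

  Membership of \<open>\<A> U\<close> in \<open>\<H>\<close> only makes the sums in the second and fourth components square
  integrable, while \<open>\<phi>\<close>, \<open>\<psi>\<close>, \<open>\<eta>(s)\<close>, \<open>z(s)\<close> are \<open>H\<^sup>1\<close> functions for which the individual second
  derivatives are not functions and \<open>\<psi>\<^sub>x(1)\<close>, \<open>z\<^sub>x(1,s)\<close> have no pointwise meaning. The second
  derivatives are therefore taken as functionals, and \<open>\<psi>\<^sub>x(1) = z\<^sub>x(1,s) = 0\<close> is imposed weakly by
  letting the fourth component be tested with all of \<open>Hstar\<close>. In contrast \<open>v\<^sub>x\<close> is itself in
  \<open>H\<^sup>1(0,1)\<close>, with continuous representative \<open>p\<close>.\<close>

definition has_image :: "beam \<Rightarrow> state \<Rightarrow> state \<Rightarrow> bool" where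
  "has_image B U F \<longleftrightarrow> U \<in> energy_space B \<and> F \<in> energy_space B \<and>
     (let \<sigma> = shear (phi U) (psi U) (vee U);
          m1 = total_mass (ker1 B);
          m2 = total_mass (ker2 B) in
      (AE x in unit_meas. phi F x = phi_t U x) \<and>
      (\<forall>w \<in> H10. l2ip (phi_t F) w =
          - (kpar B / rho1 B) * l2ip \<sigma> (wx w)
          - (m1 / rho1 B) * weak_xx (phi U) w
          + (1 / rho1 B) * (LINT s|half_line. ker1 B s * weak_xx (eta U s) w)) \<and>
      (AE x in unit_meas. psi F x = psi_t U x) \<and>
      (\<forall>w \<in> Hstar. l2ip (psi_t F) w =
          (1 / rho2 B) * ((bpar B - m2) * weak_xx (psi U) w - kpar B * l2ip \<sigma> w)
          + (1 / rho2 B) * (LINT s|half_line. ker2 B s * weak_xx (zet U s) w)) \<and>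
      (AE x in unit_meas. vee F x = vee_t U x) \<and>
      (\<exists>p \<in> H1. (AE x in unit_meas. p x = wx (vee U) x) \<and> p 1 = 0 \<and>
         (AE x in unit_meas. vee_t F x =
            (1 / rho2 B) * (bpar B * wx p x + 3 * kpar B * \<sigma> x
               - 4 * delta B * vee U x - 4 * gam B * vee_t U x))) \<and>
      history_deriv H10 (ker1 B) (eta U) (\<lambda>s x. phi F x - eta F s x) \<and>
      history_deriv Hstar (ker2 B) (zet U) (\<lambda>s x. psi F x - zet F s x))"

text \<open>In the last two conjuncts \<open>\<eta>\<^sub>s = \<phi>~ - F\<^sub>7\<close> and \<open>z\<^sub>s = \<psi>~ - F\<^sub>8\<close>, where \<open>phi F\<close> and \<open>psi F\<close> are
  the continuous representatives of \<open>\<phi>~\<close> and \<open>\<psi>~\<close>.\<close>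

definition op_domain :: "beam \<Rightarrow> state set" where
  "op_domain B = {U. \<exists>F. has_image B U F}"

section \<open>Solutions\<close>

definition continuous_H :: "beam \<Rightarrow> (real \<Rightarrow> state) \<Rightarrow> bool" where
  "continuous_H B U \<longleftrightarrow> (\<forall>t\<ge>0. U t \<in> energy_space B) \<and>
     (\<forall>t\<ge>0. ((\<lambda>r. energy_dist B (U r) (U t)) \<longlongrightarrow> 0) (at t within {0..}))"

definition deriv_H :: "beam \<Rightarrow> (real \<Rightarrow> state) \<Rightarrow> state \<Rightarrow> real \<Rightarrow> bool" where
  "deriv_H B U V t \<longleftrightarrow>
     ((\<lambda>r. energy_dist B (st_scale (1 / (r - t)) (st_diff (U r) (U t))) V) \<longlongrightarrow> 0)
       (at t within {0..})"

definition C1_H :: "beam \<Rightarrow> (real \<Rightarrow> state) \<Rightarrow> bool" where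
  "C1_H B U \<longleftrightarrow> continuous_H B U \<and>
     (\<exists>V. continuous_H B V \<and> (\<forall>t\<ge>0. deriv_H B U (V t) t))"

text \<open>Continuity into the domain of the operator, with the graph norm.\<close>

definition continuous_domain :: "beam \<Rightarrow> (real \<Rightarrow> state) \<Rightarrow> bool" where
  "continuous_domain B U \<longleftrightarrow> continuous_H B U \<and>
     (\<exists>F. continuous_H B F \<and> (\<forall>t\<ge>0. has_image B (U t) (F t)))"

definition classical_solution :: "beam \<Rightarrow> state \<Rightarrow> (real \<Rightarrow> state) \<Rightarrow> bool" where
  "classical_solution B U0 U \<longleftrightarrow> continuous_H B U \<and> energy_dist B (U 0) U0 = 0 \<and>
     (\<forall>t>0. \<exists>F. has_image B (U t) F \<and> deriv_H B U F t)"

definition mild_solution :: "beam \<Rightarrow> state \<Rightarrow> (real \<Rightarrow> state) \<Rightarrow> bool" where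
  "mild_solution B U0 U \<longleftrightarrow> (\<forall>t\<ge>0. U t \<in> energy_space B) \<and>
     (\<exists>D W. (\<forall>n::nat. D n \<in> op_domain B \<and> classical_solution B (D n) (W n)) \<and>
        (\<lambda>n. energy_dist B (D n) U0) \<longlonglongrightarrow> 0 \<and>
        (\<forall>T\<ge>0. uniform_limit {0..T} (\<lambda>n t. energy_dist B (W n t) (U t)) (\<lambda>_. 0) sequentially))"

end

theory Submission
  imports Defs
begin

text \<open>
  In the energy inner product the operator is dissipative: pairing \<open>\<A> U\<close> with \<open>U\<close>, all terms cancel
  except \<open>- 4 \<gamma> \<parallel>v~\<parallel>\<^sup>2 - 3 \<langle>\<eta>\<^sub>s, \<eta>\<rangle> - 3 \<langle>z\<^sub>s, z\<rangle>\<close>, and the last two terms are not positive because the kernels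
  decrease. The resolvent equation \<open>U - h \<A> U = F\<close> is solvable for every \<open>h > 0\<close>: the velocities are
  multiples of the positions up to data, the histories solve a first order equation in \<open>s\<close>, and once
  they are eliminated a variational problem for the positions remains whose form is coercive by the
  assumed inequality. A maximal dissipative operator on a Hilbert space generates a semigroup of
  contractions (Hille, Yosida, Lumer and Phillips), and its orbits are the solutions.

  The semigroup is constructed in the locale \<open>m_dissipative\<close> as the limit of \<open>2 ^ n\<close> implicit Euler
  steps of size \<open>t / 2 ^ n\<close>. On the domain of the square of the operator the approximations at levels
  \<open>n\<close> and \<open>n + 1\<close> differ by \<open>O (2 ^ - n)\<close> (\<open>P_step\<close>), and a Taylor estimate that is uniform in \<open>n\<close>
  passes to the limit (\<open>T_Taylor_D2\<close>); density and contractivity give the rest. A classical solution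
  cannot gain energy (\<open>dissipative_solution_decay\<close>), which applied to the difference of two solutions
  gives uniqueness, for classical solutions and then for their limits.

  A state is a tuple of functions, and the energy does not see null sets, so the Hilbert space has to be
  made first. Functions in \<open>H10\<close> and \<open>Hstar\<close> are encoded by their derivatives: \<open>Hstar\<close> corresponds to
  \<open>X1\<close>, which is all of \<open>L\<^sup>2(0,1)\<close>, and \<open>H10\<close> to \<open>X0\<close>, the elements with mean value zero. A history is
  encoded by \<open>sqrt (g s)\<close> times the derivative of its value, an element of \<open>L\<^sup>2\<close> with values in
  \<open>L\<^sup>2\<close>; the type \<open>L2t\<close> serves both levels. The relation \<open>has_image\<close> then becomes the relation \<open>gen\<close> of
  the locale \<open>memory_system\<close> (\<open>has_image_iff\<close>).

  The delicate term is the history derivative. Formally \<open>2 \<langle>w\<^sub>s, w\<rangle> = - \<integral> g' \<parallel>w\<^sub>x\<parallel>\<^sup>2 \<ge> 0\<close>, but this needs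
  boundary terms at infinity to vanish. Instead, \<open>w\<^sub>s + \<lambda> w = f\<close> with \<open>w(0) = 0\<close> is solved by a
  convolution with an exponential, which has norm at most \<open>1 / \<lambda>\<close> in the weighted space by Schur's test
  since the weight decreases (\<open>norm_Vol\<close>). This resolvent bound is equivalent to
  \<open>\<langle>w\<^sub>s, w\<rangle> \<ge> 0\<close> (\<open>hist_accretive\<close>). The bound \<open>- \<beta> g \<le> g'\<close> keeps a kernel that is positive at \<open>0\<close>
  positive everywhere (\<open>exponential_lower_bound\<close>), so that dividing by the weight is legitimate.
\<close>

section \<open>Bounded forms on a Hilbert space\<close>

lemma linear_term_zero:
  fixes a b :: real
  assumes "\<And>t. 0 \<le> 2 * t * a + t\<^sup>2 * b" and "0 \<le> b"
  shows "a = 0"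
proof (rule ccontr)
  assume "a \<noteq> 0"
  have "2 * (- a / (b + 1)) * a + (- a / (b + 1))\<^sup>2 * b = - (a\<^sup>2 * (b + 2) / (b + 1)\<^sup>2)"
    using assms(2) by (simp add: field_simps power2_eq_square add_nonneg_eq_0_iff)
  moreover have "a\<^sup>2 * (b + 2) / (b + 1)\<^sup>2 > 0"
    using \<open>a \<noteq> 0\<close> assms(2) by (intro divide_pos_pos mult_pos_pos) auto
  ultimately show False using assms(1)[of "- a / (b + 1)"] by linarith
qed

text \<open>The functional \<open>J u = u \<bullet> u - 2 * l u\<close> is bounded below, and the parallelogram law makes its minimizing
  sequences Cauchy sequences. The first variation of \<open>J\<close> at the minimizer is the equation.\<close>

lemma riesz_on_closed_subspace:
  fixes S :: "'a::{real_inner, banach} set"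
  assumes S: "subspace S" "closed S" and l: "bounded_linear l"
  shows "\<exists>r\<in>S. \<forall>w\<in>S. r \<bullet> w = l w"
proof -
  interpret l: bounded_linear l by fact
  obtain K where K: "\<And>x. norm (l x) \<le> norm x * K" using l.bounded by blast
  define J where "J u = u \<bullet> u - 2 * l u" for u
  have lower: "- K\<^sup>2 \<le> J u" for u
  proof -
    have "l u \<le> norm u * K" using K[of u] by simp
    moreover have "0 \<le> (norm u - K)\<^sup>2" by simp
    ultimately show ?thesis unfolding J_def dot_square_norm by (simp add: power2_eq_square algebra_simps)
  qed
  define m where "m = Inf (J ` S)"
  have S0: "0 \<in> S" using S subspace_0 by auto
  have bdd: "bdd_below (J ` S)" using lower by (intro bdd_belowI[of _ "- K\<^sup>2"]) auto
  have m_le: "m \<le> J u" if "u \<in> S" for u unfolding m_def using bdd that by (intro cInf_lower) auto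
  have "\<exists>u\<in>S. J u < m + e" if "e > 0" for e :: real
    using that S0 cInf_lessD[of "J ` S" "m + e"] unfolding m_def by auto
  then have "\<forall>n::nat. \<exists>u. u \<in> S \<and> J u < m + 1 / (real n + 1)"
    by (metis (no_types) of_nat_0_le_iff add_nonneg_pos zero_less_one divide_pos_pos)
  then obtain u where u: "\<And>n. u n \<in> S" "\<And>n. J (u n) < m + 1 / (real n + 1)" by metis
  have para: "(norm (x - y))\<^sup>2 \<le> 2 * (J x + J y - 2 * m)" if "x \<in> S" "y \<in> S" for x y
  proof -
    define w where "w = (1/2) *\<^sub>R (x + y)"
    have "w \<in> S" using S that by (simp add: w_def subspace_add subspace_scale)
    then have "m \<le> J w" by (rule m_le)
    moreover have "J x + J y - 2 * J w = (norm (x - y))\<^sup>2 / 2"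
      unfolding J_def w_def l.scaleR l.add power2_norm_eq_inner
      by (simp add: algebra_simps inner_commute)
    then have "(norm (x - y))\<^sup>2 = 2 * (J x + J y - 2 * J w)" by simp
    ultimately show ?thesis by simp
  qed
  have "Cauchy u"
  proof (rule metric_CauchyI)
    fix e :: real assume e: "e > 0"
    obtain M :: nat where M: "M > 4 / e\<^sup>2" using reals_Archimedean2 by blast
    have "dist (u i) (u j) < e" if "i \<ge> M" "j \<ge> M" for i j
    proof -
      have "1 / (real k + 1) < e\<^sup>2 / 4" if "k \<ge> M" for k
      proof -
        have "4 / e\<^sup>2 < real k + 1" using M that by linarith
        then show ?thesis using e by (simp add: field_simps)
      qed
      from this[OF that(1)] this[OF that(2)]
      have "J (u i) + J (u j) - 2 * m < e\<^sup>2 / 2" using u(2)[of i] u(2)[of j] by linarith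
      then have "(norm (u i - u j))\<^sup>2 < e\<^sup>2" using para[OF u(1)[of i] u(1)[of j]] by simp
      then show ?thesis using e by (simp add: dist_norm power2_less_imp_less)
    qed
    then show "\<exists>M. \<forall>i\<ge>M. \<forall>j\<ge>M. dist (u i) (u j) < e" by blast
  qed
  then obtain r where r: "u \<longlonglongrightarrow> r" using Cauchy_convergent convergent_def by blast
  have rS: "r \<in> S" using closed_sequentially[OF S(2) _ r] u by blast
  have "(\<lambda>n. J (u n)) \<longlonglongrightarrow> J r" unfolding J_def by (intro tendsto_intros r l.tendsto)
  moreover have "(\<lambda>n. m + 1 / (real n + 1)) \<longlonglongrightarrow> m + 0"
    by (intro tendsto_intros) (use LIMSEQ_inverse_real_of_nat in \<open>simp add: inverse_eq_divide add.commute\<close>)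
  ultimately have "J r \<le> m" using u(2) by (intro LIMSEQ_le) (auto intro: less_imp_le exI[of _ 0])
  have "r \<bullet> w - l w = 0" if w: "w \<in> S" for w
  proof (rule linear_term_zero)
    fix t :: real
    have "r + t *\<^sub>R w \<in> S" using S rS w by (simp add: subspace_add subspace_scale)
    then have "J r \<le> J (r + t *\<^sub>R w)" using \<open>J r \<le> m\<close> m_le by force
    then show "0 \<le> 2 * t * (r \<bullet> w - l w) + t\<^sup>2 * (w \<bullet> w)"
      unfolding J_def l.add l.scaleR by (simp add: algebra_simps inner_commute power2_eq_square)
  qed simp
  then show ?thesis using rS by auto
qed

lemma subspace_closure:
  fixes A :: "'a::real_normed_vector set"
  assumes "subspace A" shows "subspace (closure A)"
proof (rule subspaceI)
  show "0 \<in> closure A" using assms subspace_0 closure_subset by blast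
next
  fix x y assume "x \<in> closure A" "y \<in> closure A"
  then obtain f g where "\<And>n. f n \<in> A" "f \<longlonglongrightarrow> x" "\<And>n. g n \<in> A" "g \<longlonglongrightarrow> y"
    unfolding closure_sequential by blast
  then show "x + y \<in> closure A" unfolding closure_sequential
    by (intro exI[of _ "\<lambda>n. f n + g n"]) (auto intro: tendsto_add subspace_add[OF assms])
next
  fix r :: real and x assume "x \<in> closure A"
  then obtain f where "\<And>n. f n \<in> A" "f \<longlonglongrightarrow> x" unfolding closure_sequential by blast
  then show "r *\<^sub>R x \<in> closure A" unfolding closure_sequential
    by (intro exI[of _ "\<lambda>n. r *\<^sub>R f n"]) (auto intro: tendsto_scaleR subspace_scale[OF assms])
qed

text \<open>With \<open>r u\<close> the Riesz representative of the residual \<open>l - a u\<close>, the map \<open>u + \<rho> r u\<close> is a contraction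
  for small \<open>\<rho>\<close>, and its fixed point has residual zero.\<close>

lemma Lax_Milgram:
  fixes S :: "'a::{real_inner, banach} set"
  assumes S: "subspace S" "closed S" and a: "bounded_bilinear a" and l: "bounded_linear l"
    and "c > 0" and coercive: "\<And>u. u \<in> S \<Longrightarrow> c * (norm u)\<^sup>2 \<le> a u u"
  shows "\<exists>u\<in>S. \<forall>w\<in>S. a u w = l w"
proof -
  interpret a: bounded_bilinear a by fact
  interpret l: bounded_linear l by fact
  obtain K0 where K0: "\<And>x y. norm (a x y) \<le> norm x * norm y * K0" using a.bounded by blast
  define K where "K = max K0 c"
  have K: "\<bar>a x y\<bar> \<le> norm x * norm y * K" for x y
    using K0[of x y] mult_left_mono[of K0 K "norm x * norm y"] by (simp add: K_def)
  have Kpos: "K > 0" "c \<le> K" using \<open>c > 0\<close> by (auto simp: K_def)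
  \<comment> \<open>The squared contraction factor \<open>1 - 2 \<rho> c + \<rho>\<^sup>2 K\<^sup>2\<close> is minimal for this \<open>\<rho>\<close>, with value \<open>1 - (c / K)\<^sup>2\<close>.\<close>
  define \<rho> where "\<rho> = c / K\<^sup>2"
  have "\<exists>r\<in>S. \<forall>w\<in>S. r \<bullet> w = l w - a u w" for u
    by (rule riesz_on_closed_subspace[OF S]) (intro bounded_linear_sub l a.bounded_linear_right)
  then obtain r where r: "\<And>u. r u \<in> S" "\<And>u w. w \<in> S \<Longrightarrow> r u \<bullet> w = l w - a u w" by metis
  define f where "f u = u + \<rho> *\<^sub>R r u" for u
  define \<kappa> where "\<kappa> = sqrt (1 - (c / K)\<^sup>2)"
  have cK: "0 < (c / K)\<^sup>2" "(c / K)\<^sup>2 \<le> 1"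
    using Kpos \<open>c > 0\<close> by (auto simp: power_le_one)
  have "\<exists>!x. x \<in> S \<and> f x = x"
  proof (rule Banach_fix)
    show "complete S" using S by (simp add: complete_eq_closed)
    show "S \<noteq> {}" using S subspace_0 by auto
    show "0 \<le> \<kappa>" "\<kappa> < 1" using cK by (auto simp: \<kappa>_def)
    show "f ` S \<subseteq> S" using S r by (auto simp: f_def subspace_add subspace_scale)
    fix x y assume xy: "x \<in> S" "y \<in> S"
    define e d where "e = x - y" and "d = r x - r y"
    have dS: "d \<in> S" "e \<in> S" using xy r S by (auto simp: d_def e_def subspace_diff)
    have de: "d \<bullet> w = - a e w" if "w \<in> S" for w
      using r(2)[OF that] by (simp add: d_def e_def inner_diff_left a.diff_left)
    have "norm d * norm d \<le> norm e * norm d * K"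
      using de[OF dS(1)] K[of e d] by (simp add: dot_square_norm power2_eq_square)
    then have dn: "norm d \<le> K * norm e"
      by (cases "norm d = 0") (use Kpos in \<open>auto simp: mult.commute mult.left_commute\<close>)
    have "(norm (f x - f y))\<^sup>2 = (norm e)\<^sup>2 + 2 * \<rho> * (d \<bullet> e) + \<rho>\<^sup>2 * (norm d)\<^sup>2"
    proof -
      have "f x - f y = e + \<rho> *\<^sub>R d" by (simp add: f_def e_def d_def algebra_simps)
      then show ?thesis unfolding power2_norm_eq_inner by (simp add: algebra_simps inner_commute power2_eq_square)
    qed
    also have "\<dots> \<le> (norm e)\<^sup>2 - 2 * \<rho> * (c * (norm e)\<^sup>2) + \<rho>\<^sup>2 * (K * norm e)\<^sup>2"
    proof -
      have "\<rho> \<ge> 0" using \<open>c > 0\<close> by (simp add: \<rho>_def)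
      then have "\<rho> * (c * (norm e)\<^sup>2) \<le> \<rho> * a e e" by (intro mult_left_mono coercive dS)
      moreover have "\<rho>\<^sup>2 * (norm d)\<^sup>2 \<le> \<rho>\<^sup>2 * (K * norm e)\<^sup>2" using dn by (intro mult_left_mono power_mono) auto
      ultimately show ?thesis using de[OF dS(2)] by simp
    qed
    also have "\<dots> = (\<kappa> * norm e)\<^sup>2"
    proof -
      have \<kappa>2: "\<kappa>\<^sup>2 = 1 - (c / K)\<^sup>2" using cK by (simp add: \<kappa>_def)
      have \<rho>1: "\<rho> * c = (c / K)\<^sup>2" "\<rho>\<^sup>2 * K\<^sup>2 = (c / K)\<^sup>2"
        using Kpos by (simp_all add: \<rho>_def power2_eq_square)
      have "(norm e)\<^sup>2 - 2 * \<rho> * (c * (norm e)\<^sup>2) + \<rho>\<^sup>2 * (K * norm e)\<^sup>2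
          = (norm e)\<^sup>2 - 2 * (\<rho> * c) * (norm e)\<^sup>2 + (\<rho>\<^sup>2 * K\<^sup>2) * (norm e)\<^sup>2"
        by (simp add: power_mult_distrib)
      also have "\<dots> = (1 - (c / K)\<^sup>2) * (norm e)\<^sup>2" unfolding \<rho>1 by (simp add: left_diff_distrib)
      finally show ?thesis by (simp add: power_mult_distrib \<kappa>2)
    qed
    finally have "norm (f x - f y) \<le> \<kappa> * norm e"
      by (rule power2_le_imp_le) (simp add: \<kappa>_def cK)
    then show "dist (f x) (f y) \<le> \<kappa> * dist x y" unfolding dist_norm e_def .
  qed
  then obtain u where u: "u \<in> S" "f u = u" by blast
  have "\<rho> \<noteq> 0" using \<open>c > 0\<close> Kpos by (simp add: \<rho>_def)
  then have "r u = 0" using u by (simp add: f_def)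
  then show ?thesis using u(1) r(2)[of _ u] by (metis eq_iff_diff_eq_0 inner_zero_left)
qed

section \<open>The semigroup of a maximal dissipative relation\<close>

text \<open>The generator is given by its graph \<open>G\<close>. The Hilbert space is a closed subspace \<open>S\<close> of an ambient
  one, and dissipativity refers to an equivalent inner product \<open>q\<close>, because the energy differs from the
  inner product of the type.\<close>

locale m_dissipative =
  fixes S :: "'h::{real_inner, banach} set" and q :: "'h \<Rightarrow> 'h \<Rightarrow> real" and c :: real
    and G :: "('h \<times> 'h) set"
  assumes subspace_S: "subspace S" and closed_S: "closed S"
    and bilinear_q: "bounded_bilinear q" and q_sym: "q x y = q y x"
    and c_pos: "c > 0" and coercive_q: "x \<in> S \<Longrightarrow> c * (norm x)\<^sup>2 \<le> q x x"
    and subspace_G: "subspace G" and G_in_S: "(x, y) \<in> G \<Longrightarrow> x \<in> S \<and> y \<in> S"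
    and dissipative: "(x, y) \<in> G \<Longrightarrow> q y x \<le> 0"
    and range: "h > 0 \<Longrightarrow> z \<in> S \<Longrightarrow> \<exists>x y. (x, y) \<in> G \<and> x - h *\<^sub>R y = z"
    and single_valued: "(0, y) \<in> G \<Longrightarrow> y = 0"
begin

sublocale q: bounded_bilinear q by (rule bilinear_q)

definition N :: "'h \<Rightarrow> real" where "N x = sqrt (q x x)"

lemmas S_closed_ops [simp, intro] =
  subspace_add[OF subspace_S] subspace_diff[OF subspace_S] subspace_scale[OF subspace_S] subspace_0[OF subspace_S]

lemma GD: "(x, y) \<in> G \<Longrightarrow> x \<in> S" "(x, y) \<in> G \<Longrightarrow> y \<in> S"
  using G_in_S by auto

lemma G_diff: "(x, y) \<in> G \<Longrightarrow> (x', y') \<in> G \<Longrightarrow> (x - x', y - y') \<in> G"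
  using subspace_diff[OF subspace_G, of "(x, y)" "(x', y')"] by simp

lemma G_scale: "(x, y) \<in> G \<Longrightarrow> (r *\<^sub>R x, r *\<^sub>R y) \<in> G"
  using subspace_scale[OF subspace_G, of "(x, y)"] by simp

lemma q_nonneg: "x \<in> S \<Longrightarrow> 0 \<le> q x x"
  using coercive_q[of x] c_pos by (smt (verit) mult_nonneg_nonneg zero_le_power2)

lemma N_nonneg [simp]: "x \<in> S \<Longrightarrow> 0 \<le> N x" and N_sq: "x \<in> S \<Longrightarrow> (N x)\<^sup>2 = q x x"
  using q_nonneg by (auto simp: N_def)

lemma norm_le_N: "x \<in> S \<Longrightarrow> norm x \<le> N x / sqrt c"
proof -
  assume "x \<in> S"
  then have "sqrt (c * (norm x)\<^sup>2) \<le> N x" unfolding N_def by (intro real_sqrt_le_mono coercive_q)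
  then show ?thesis using c_pos by (simp add: real_sqrt_mult field_simps)
qed

lemma N_eq_0: "x \<in> S \<Longrightarrow> N x = 0 \<Longrightarrow> x = 0"
  using norm_le_N[of x] by simp

lemma N_zero [simp]: "N 0 = 0"
  by (simp add: N_def q.zero_left)

lemma N_scale: "N (r *\<^sub>R x) = \<bar>r\<bar> * N x"
  by (simp add: N_def q.scaleR_left q.scaleR_right real_sqrt_mult flip: mult.assoc)

lemma N_minus: "N (x - y) = N (y - x)"
  using N_scale[of "-1" "x - y"] by simp

lemma q_expand: "q (x + t *\<^sub>R y) (x + t *\<^sub>R y) = q x x + 2 * t * q x y + t\<^sup>2 * q y y"
  by (simp add: q.add_left q.add_right q.scaleR_left q.scaleR_right q_sym[of y x] power2_eq_square algebra_simps)

lemma q_Cauchy_Schwarz: assumes "x \<in> S" "y \<in> S" shows "q x y \<le> N x * N y"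
proof (cases "y = 0")
  case True then show ?thesis by (simp add: q.zero_right)
next
  case False
  then have Ny: "N y > 0" using assms N_eq_0 N_nonneg by (metis less_eq_real_def)
  then have qyy: "q y y > 0" using N_sq[OF assms(2)] by (metis zero_less_power)
  have "0 \<le> q (x + (- q x y / q y y) *\<^sub>R y) (x + (- q x y / q y y) *\<^sub>R y)"
    by (intro q_nonneg) (use assms in auto)
  then have "0 \<le> q x x - (q x y)\<^sup>2 / q y y" unfolding q_expand using qyy by (simp add: power2_eq_square field_simps)
  then have "(q x y)\<^sup>2 \<le> (N x * N y)\<^sup>2" using qyy assms by (simp add: power_mult_distrib N_sq field_simps)
  then show ?thesis using assms by (meson N_nonneg abs_le_square_iff abs_of_nonneg mult_nonneg_nonneg abs_ge_self order_trans power2_le_imp_le)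
qed

lemma N_triangle: assumes "x \<in> S" "y \<in> S" shows "N (x + y) \<le> N x + N y"
proof (rule power2_le_imp_le)
  show "(N (x + y))\<^sup>2 \<le> (N x + N y)\<^sup>2"
    using q_Cauchy_Schwarz[OF assms] q_expand[of x 1 y] assms
    by (simp add: N_sq power2_sum)
qed (use assms in simp)

lemma N_triangle_diff: assumes "x \<in> S" "y \<in> S" shows "N (x - y) \<le> N x + N y"
  using N_triangle[of x "- 1 *\<^sub>R y"] N_scale[of "-1" y] S_closed_ops(3)[of y "-1"] assms by simp

lemma N_continuous: "(f \<longlongrightarrow> x) F \<Longrightarrow> ((\<lambda>n. N (f n)) \<longlongrightarrow> N x) F"
  unfolding N_def by (intro tendsto_intros q.tendsto)

lemma closed_Domain: "closure (Domain G) \<subseteq> S"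
  by (rule closure_minimal[OF _ closed_S]) (auto dest: GD)

text \<open>Maximality together with single-valuedness forces a dense domain: the form \<open>q\<close> projects
  onto the closure of the domain, and a vector orthogonal to the domain is \<open>u - v\<close> with
  \<open>(u, v)\<close> in the relation, so that dissipativity gives \<open>u = 0\<close>.\<close>

lemma Domain_dense: "S \<subseteq> closure (Domain G)"
proof
  fix z assume z: "z \<in> S"
  have "subspace (fst ` G)"
    by (intro linear_subspace_image subspace_G) (simp add: linear_fst)
  then have sub: "subspace (closure (Domain G))"
    by (simp add: subspace_closure Domain_fst)
  have "\<exists>p\<in>closure (Domain G). \<forall>w\<in>closure (Domain G). q p w = q z w"
    by (rule Lax_Milgram[OF sub _ bilinear_q _ c_pos])
      (use closed_Domain in \<open>auto intro!: q.bounded_linear_right coercive_q\<close>)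
  then obtain p where p: "p \<in> closure (Domain G)" "\<And>w. w \<in> closure (Domain G) \<Longrightarrow> q p w = q z w" by blast
  have "z - p \<in> S" using z p(1) closed_Domain by blast
  from range[OF zero_less_one this] have "\<exists>u v. (u, v) \<in> G \<and> u - v = z - p"
    unfolding scaleR_one .
  then obtain u v where uv: "(u, v) \<in> G" "u - v = z - p" by blast
  have "u \<in> closure (Domain G)" using DomainI[OF uv(1)] closure_subset[of "Domain G"] by (rule rev_subsetD)
  then have "q (u - v) u = 0" unfolding uv(2) q.diff_left by (simp only: p(2) diff_self)
  then have "q u u \<le> 0" using dissipative[OF uv(1)] by (simp add: q.diff_left)
  then have "u = 0" using GD[OF uv(1)] by (intro N_eq_0) (auto simp: N_def dest: q_nonneg)
  have "v = 0" using uv(1) unfolding \<open>u = 0\<close> by (rule single_valued)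
  then have "z = p" using uv(2) unfolding \<open>u = 0\<close> by simp
  then show "z \<in> closure (Domain G)" using p(1) by simp
qed

text \<open>The resolvent \<open>(1 - h A)\<^sup>-\<^sup>1\<close>, one step of the implicit Euler method.\<close>

definition J :: "real \<Rightarrow> 'h \<Rightarrow> 'h" where
  "J h z = (if h = 0 then z else SOME x. \<exists>y. (x, y) \<in> G \<and> x - h *\<^sub>R y = z)"

lemma J_0 [simp]: "J 0 z = z" by (simp add: J_def)

lemma J_ex: assumes "h > 0" "z \<in> S" shows "\<exists>y. (J h z, y) \<in> G \<and> J h z - h *\<^sub>R y = z"
  using someI_ex[OF range[OF assms]] assms by (simp add: J_def)

lemma J_in_S [simp]: "h \<ge> 0 \<Longrightarrow> z \<in> S \<Longrightarrow> J h z \<in> S"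
proof (cases "h = 0")
  case False
  assume "h \<ge> 0" "z \<in> S"
  with False have "h > 0" by simp
  from J_ex[OF this \<open>z \<in> S\<close>] obtain y where "(J h z, y) \<in> G" by blast
  then show "J h z \<in> S" by (rule GD(1))
qed simp

lemma J_eq: assumes "h \<ge> 0" "(x, y) \<in> G" shows "J h (x - h *\<^sub>R y) = x"
proof (cases "h = 0")
  case False
  then have h: "h > 0" using assms by simp
  obtain v where v: "(J h (x - h *\<^sub>R y), v) \<in> G" "J h (x - h *\<^sub>R y) - h *\<^sub>R v = x - h *\<^sub>R y"
    using J_ex[OF h S_closed_ops(2)[OF GD(1)[OF assms(2)] S_closed_ops(3)[OF GD(2)[OF assms(2)]]]] by blast
  define u where "u = J h (x - h *\<^sub>R y) - x"
  have g: "(u, v - y) \<in> G" using G_diff v assms by (simp add: u_def)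
  have u: "u = h *\<^sub>R (v - y)" using v by (simp add: u_def algebra_simps)
  have "q u u = h * q (v - y) u" by (subst (1) u) (simp add: q.scaleR_left)
  then have "q u u \<le> 0" using dissipative[OF g] h by (simp add: mult_nonneg_nonpos)
  then have "u = 0" using GD[OF g] by (intro N_eq_0) (auto simp: N_def dest: q_nonneg)
  then show ?thesis by (simp add: u_def)
qed simp

lemma J_contraction: assumes "h \<ge> 0" "z \<in> S" shows "N (J h z) \<le> N z"
proof (cases "h = 0")
  case False
  then have h: "h > 0" using assms by simp
  obtain v where v: "(J h z, v) \<in> G" "J h z - h *\<^sub>R v = z" using J_ex[OF h assms(2)] by blast
  have JS: "J h z \<in> S" using assms by simp
  have Jz: "J h z = z + h *\<^sub>R v" using v(2) unfolding diff_eq_eq .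
  have "(N (J h z))\<^sup>2 = q (z + h *\<^sub>R v) (J h z)" unfolding N_sq[OF JS] by (subst (1) Jz) (rule refl)
  also have "\<dots> \<le> q z (J h z)" using dissipative[OF v(1)] h by (simp add: q.add_left q.scaleR_left mult_nonneg_nonpos)
  also have "\<dots> \<le> N z * N (J h z)" by (intro q_Cauchy_Schwarz assms JS)
  finally have *: "N (J h z) * N (J h z) \<le> N z * N (J h z)" by (simp add: power2_eq_square)
  show ?thesis
  proof (cases "N (J h z) = 0")
    case False
    then have "N (J h z) > 0" using JS by (simp add: less_le)
    then show ?thesis using * by simp
  qed (use assms in simp)
qed simp

lemma J_diff: assumes "h \<ge> 0" "z \<in> S" "w \<in> S" shows "J h (z - w) = J h z - J h w"
proof (cases "h = 0")
  case False
  then have h: "h > 0" using assms by simp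
  obtain v v' where v: "(J h z, v) \<in> G" "J h z - h *\<^sub>R v = z" "(J h w, v') \<in> G" "J h w - h *\<^sub>R v' = w"
    using J_ex[OF h] assms by metis
  have "J h (J h z - J h w - h *\<^sub>R (v - v')) = J h z - J h w" using assms v by (intro J_eq G_diff)
  moreover have "J h z - J h w - h *\<^sub>R (v - v') = z - w" using v(2,4) by (simp add: algebra_simps)
  ultimately show ?thesis by simp
qed simp

lemma J_scale: assumes "h \<ge> 0" "z \<in> S" shows "J h (r *\<^sub>R z) = r *\<^sub>R J h z"
proof (cases "h = 0")
  case False
  then have h: "h > 0" using assms by simp
  obtain v where v: "(J h z, v) \<in> G" "J h z - h *\<^sub>R v = z" using J_ex[OF h] assms by metis
  have "J h (r *\<^sub>R J h z - h *\<^sub>R (r *\<^sub>R v)) = r *\<^sub>R J h z" using assms v by (intro J_eq G_scale)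
  moreover have "r *\<^sub>R J h z - h *\<^sub>R (r *\<^sub>R v) = r *\<^sub>R (J h z - h *\<^sub>R v)" by (simp add: algebra_simps)
  ultimately show ?thesis using v by simp
qed simp

lemma J_G: assumes "h \<ge> 0" "(u, v) \<in> G" shows "(J h u, J h v) \<in> G"
proof (cases "h = 0")
  case False
  then have h: "h > 0" using assms by simp
  obtain w' where w: "(J h u, w') \<in> G" "J h u - h *\<^sub>R w' = u" using J_ex[OF h] GD[OF assms(2)] by blast
  have "(J h u - u, w' - v) \<in> G" using G_diff w(1) assms(2) by simp
  then have "((1 / h) *\<^sub>R (J h u - u), (1 / h) *\<^sub>R (w' - v)) \<in> G" by (rule G_scale)
  moreover have "J h u - u = h *\<^sub>R w'" using w(2) by (simp add: diff_eq_eq add.commute)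
  then have "(1 / h) *\<^sub>R (J h u - u) = w'" using h by simp
  ultimately have "(w', (1 / h) *\<^sub>R (w' - v)) \<in> G" by simp
  then have "J h (w' - h *\<^sub>R ((1 / h) *\<^sub>R (w' - v))) = w'" by (intro J_eq assms(1))
  then have "J h v = w'" using h by simp
  then show ?thesis using w by simp
qed (use assms in simp)

lemma J_resolvent:
  assumes "h \<ge> 0" "k \<ge> 0" "(x, y) \<in> G"
  shows "J h x - J k x = (h - k) *\<^sub>R J h (J k y)"
proof -
  have S: "x \<in> S" "y \<in> S" using GD assms by auto
  have "J k (x - k *\<^sub>R y) = x" using J_eq assms by simp
  then have p: "J k x = x + k *\<^sub>R J k y" using J_diff[of k x "k *\<^sub>R y"] J_scale[of k y k] assms S
    by (simp add: algebra_simps)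
  have "J h (J k x - h *\<^sub>R J k y) = J k x" using assms by (intro J_eq J_G)
  then have "J h (x - (h - k) *\<^sub>R J k y) = J k x" by (simp add: p algebra_simps)
  moreover have "J h (x - (h - k) *\<^sub>R J k y) = J h x - (h - k) *\<^sub>R J h (J k y)"
    using assms S by (simp add: J_diff J_scale)
  ultimately show ?thesis by (simp add: algebra_simps)
qed

lemma J_pow_in_S [simp]: "h \<ge> 0 \<Longrightarrow> z \<in> S \<Longrightarrow> (J h ^^ m) z \<in> S"
  by (induction m) auto

lemma J_pow_contraction: "h \<ge> 0 \<Longrightarrow> z \<in> S \<Longrightarrow> N ((J h ^^ m) z) \<le> N z"
  by (induction m) (auto intro: order_trans[OF J_contraction])

lemma J_pow_diff: "h \<ge> 0 \<Longrightarrow> z \<in> S \<Longrightarrow> w \<in> S \<Longrightarrow> (J h ^^ m) (z - w) = (J h ^^ m) z - (J h ^^ m) w"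
  by (induction m) (auto simp: J_diff)

lemma J_pow_G: "h \<ge> 0 \<Longrightarrow> (u, v) \<in> G \<Longrightarrow> ((J h ^^ m) u, (J h ^^ m) v) \<in> G"
  by (induction m) (auto simp: J_G)

lemma J_diff_bound:
  assumes "h \<ge> 0" "k \<ge> 0" "(x, y) \<in> G" shows "N (J h x - J k x) \<le> \<bar>h - k\<bar> * N y"
proof -
  have "N (J h (J k y)) \<le> N y" using assms GD[OF assms(3)] J_contraction by (meson J_in_S order_trans)
  then show ?thesis using J_resolvent[OF assms] by (simp add: N_scale mult_left_mono)
qed

text \<open>Since \<open>J h\<close> and \<open>J k\<close> are contractions, the errors of the \<open>m\<close> steps add up.\<close>

lemma J_pow_Lipschitz:
  assumes "h \<ge> 0" "k \<ge> 0" "(x, y) \<in> G"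
  shows "N ((J h ^^ m) x - (J k ^^ m) x) \<le> real m * \<bar>h - k\<bar> * N y"
proof (induction m)
  case (Suc m)
  have S: "x \<in> S" "y \<in> S" using GD assms by auto
  let ?a = "J h" and ?b = "J k" and ?am = "(J h ^^ m) x" and ?bm = "(J k ^^ m) x"
  have *: "(J h ^^ Suc m) x - (J k ^^ Suc m) x = J h (?am - ?bm) + (J h ?bm - J k ?bm)"
    using assms S by (simp add: J_diff)
  have "N ((J h ^^ Suc m) x - (J k ^^ Suc m) x) \<le> N (J h (?am - ?bm)) + N (J h ?bm - J k ?bm)"
    unfolding * using assms S by (intro N_triangle) auto
  also have "\<dots> \<le> N (?am - ?bm) + \<bar>h - k\<bar> * N ((J k ^^ m) y)"
    using assms S by (intro add_mono J_contraction J_diff_bound J_pow_G) auto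
  also have "\<dots> \<le> real m * \<bar>h - k\<bar> * N y + \<bar>h - k\<bar> * N y"
    using assms S by (intro add_mono Suc mult_left_mono J_pow_contraction) auto
  finally show ?case by (simp add: algebra_simps)
qed simp

text \<open>A Taylor estimate that is uniform in \<open>m\<close>. By the resolvent identity the linear term is exact in
  each step, up to \<open>J h\<close> in place of \<open>J k\<close>; exchanging them costs \<open>\<bar>h - k\<bar>\<close>, times the coefficient \<open>m \<bar>h - k\<bar>\<close>.\<close>

lemma J_pow_Taylor:
  assumes "h \<ge> 0" "k \<ge> 0" "(x, y) \<in> G" "(y, z) \<in> G"
  shows "N ((J h ^^ m) x - (J k ^^ m) x - (real m * (h - k)) *\<^sub>R (J k ^^ Suc m) y)
      \<le> (real m * (h - k))\<^sup>2 * N z"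
proof (induction m)
  case (Suc m)
  have S: "x \<in> S" "y \<in> S" "z \<in> S" using GD assms by auto
  define D where "D m = (J h ^^ m) x - (J k ^^ m) x - (real m * (h - k)) *\<^sub>R (J k ^^ Suc m) y" for m
  define p where "p = (J k ^^ m) x"
  define r where "r = (J k ^^ Suc m) y"
  have rS: "r \<in> S" "p \<in> S" "(J h ^^ m) x \<in> S" using assms S unfolding r_def p_def by (auto simp del: funpow.simps)
  have DS: "D m \<in> S" unfolding D_def using assms S by (auto simp del: funpow.simps)
  have e1: "J h p - J k p = (h - k) *\<^sub>R J h r"
    using J_resolvent[OF assms(1,2) J_pow_G[OF assms(2,3), of m]] by (simp add: p_def r_def)
  have "J h (D m) = J h ((J h ^^ m) x) - J h p - (real m * (h - k)) *\<^sub>R J h r"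
    unfolding D_def p_def[symmetric] r_def[symmetric] using assms rS by (simp add: J_diff J_scale)
  then have "D (Suc m) = J h (D m) + (real (Suc m) * (h - k)) *\<^sub>R (J h r - J k r)"
  proof -
    have "D (Suc m) = J h ((J h ^^ m) x) - J k p - (real (Suc m) * (h - k)) *\<^sub>R J k r"
      unfolding D_def by (simp add: p_def r_def)
    moreover have "J k p = J h p - (h - k) *\<^sub>R J h r" using e1 by (simp add: algebra_simps)
    ultimately show ?thesis unfolding \<open>J h (D m) = _\<close> by (simp add: algebra_simps)
  qed
  then have "N (D (Suc m)) \<le> N (J h (D m)) + N ((real (Suc m) * (h - k)) *\<^sub>R (J h r - J k r))"
    using DS rS assms by (simp add: N_triangle)
  also have "\<dots> \<le> N (D m) + \<bar>real (Suc m) * (h - k)\<bar> * (\<bar>h - k\<bar> * N z)"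
  proof -
    have "N (J h r - J k r) \<le> \<bar>h - k\<bar> * N ((J k ^^ Suc m) z)"
      unfolding r_def by (intro J_diff_bound J_pow_G assms)
    also have "\<dots> \<le> \<bar>h - k\<bar> * N z" using assms S by (intro mult_left_mono J_pow_contraction) auto
    finally have "N (J h r - J k r) \<le> \<bar>h - k\<bar> * N z" .
    then show ?thesis using DS assms by (auto simp: N_scale intro!: add_mono J_contraction mult_left_mono)
  qed
  also have "\<dots> \<le> (real m * (h - k))\<^sup>2 * N z + real (Suc m) * (h - k)\<^sup>2 * N z"
  proof -
    have "\<bar>real (Suc m) * (h - k)\<bar> * (\<bar>h - k\<bar> * N z) = real (Suc m) * (h - k)\<^sup>2 * N z"
      unfolding abs_mult using abs_mult_self_eq[of "h - k"] by (simp only: power2_eq_square abs_of_nat mult_ac)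
    then show ?thesis using Suc unfolding D_def by linarith
  qed
  also have "\<dots> = ((real m)\<^sup>2 + real (Suc m)) * (h - k)\<^sup>2 * N z"
    by (simp only: power_mult_distrib distrib_right)
  also have "\<dots> \<le> (real (Suc m))\<^sup>2 * (h - k)\<^sup>2 * N z"
  proof -
    have "(real m)\<^sup>2 + real (Suc m) \<le> (real (Suc m))\<^sup>2" by (simp add: power2_eq_square algebra_simps)
    then show ?thesis using S by (intro mult_right_mono) auto
  qed
  finally show ?case unfolding D_def by (simp only: power_mult_distrib)
qed simp

text \<open>The consistency error of the Euler method: one step against two steps of half the size.\<close>

lemma J_halving:
  assumes "h \<ge> 0" "(x, y) \<in> G" "(y, z) \<in> G"
  shows "N (J h x - J (h / 2) (J (h / 2) x)) \<le> h\<^sup>2 / 4 * N z"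
proof -
  have S: "x \<in> S" "y \<in> S" "z \<in> S" using GD assms by auto
  let ?k = "h / 2"
  have k: "?k \<ge> 0" using assms by simp
  have step: "J ?k u = u + ?k *\<^sub>R J ?k v" if "(u, v) \<in> G" for u v
  proof -
    have "u = J ?k (u - ?k *\<^sub>R v)" using J_eq[OF k that] by simp
    also have "\<dots> = J ?k u - ?k *\<^sub>R J ?k v" using GD[OF that] k by (simp add: J_diff J_scale)
    finally show ?thesis by (simp add: algebra_simps)
  qed
  \<comment> \<open>Two half steps solve the full step equation with right-hand side perturbed by \<open>h\<^sup>2 / 4\<close> times a vector of norm at most \<open>N z\<close>.\<close>
  define p where "p = J ?k (J ?k y)"
  have pG: "(J ?k (J ?k x), p) \<in> G" "(p, J ?k (J ?k z)) \<in> G"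
    unfolding p_def by (intro J_G k assms)+
  have pS: "p \<in> S" "J ?k (J ?k z) \<in> S" "J ?k (J ?k x) \<in> S" using GD pG by auto
  have "J ?k (J ?k x) = x + ?k *\<^sub>R J ?k y + ?k *\<^sub>R p"
    using step[OF J_G[OF k assms(2)]] step[OF assms(2)] by (simp add: p_def)
  moreover have "J ?k y = p - ?k *\<^sub>R J ?k (J ?k z)"
    using step[OF J_G[OF k assms(3)]] by (simp add: p_def)
  ultimately have "J ?k (J ?k x) - h *\<^sub>R p = x - (h\<^sup>2 / 4) *\<^sub>R J ?k (J ?k z)"
    by (simp add: algebra_simps power2_eq_square flip: scaleR_add_left)
  then have "J h (x - (h\<^sup>2 / 4) *\<^sub>R J ?k (J ?k z)) = J ?k (J ?k x)"
    using J_eq[OF assms(1) pG(1)] by simp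
  then have "J h x - J ?k (J ?k x) = (h\<^sup>2 / 4) *\<^sub>R J h (J ?k (J ?k z))"
    using assms S pS by (simp add: J_diff J_scale algebra_simps)
  moreover have "N (J h (J ?k (J ?k z))) \<le> N z"
    using S k assms by (intro order_trans[OF J_contraction]) auto
  ultimately show ?thesis by (simp add: N_scale mult_left_mono)
qed

lemma J_pow_halving:
  assumes "h \<ge> 0" "(x, y) \<in> G" "(y, z) \<in> G"
  shows "N ((J h ^^ m) x - (J (h / 2) ^^ (2 * m)) x) \<le> real m * (h\<^sup>2 / 4 * N z)"
proof (induction m)
  case (Suc m)
  have S: "x \<in> S" "y \<in> S" "z \<in> S" using GD assms by auto
  let ?k = "h / 2"
  have k: "?k \<ge> 0" using assms by simp
  define a b where "a = (J h ^^ m) x" and "b = (J ?k ^^ (2 * m)) x"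
  have ab: "a \<in> S" "b \<in> S" using S k assms by (auto simp: a_def b_def)
  have *: "(J h ^^ Suc m) x - (J ?k ^^ (2 * Suc m)) x = J h (a - b) + (J h b - J ?k (J ?k b))"
    using ab assms by (simp add: J_diff a_def b_def)
  have "N ((J h ^^ Suc m) x - (J ?k ^^ (2 * Suc m)) x) \<le> N (J h (a - b)) + N (J h b - J ?k (J ?k b))"
    unfolding * using ab k assms by (intro N_triangle) auto
  also have "\<dots> \<le> N (a - b) + h\<^sup>2 / 4 * N ((J ?k ^^ (2 * m)) z)"
  proof (rule add_mono)
    show "N (J h (a - b)) \<le> N (a - b)" using ab assms by (intro J_contraction) auto
    show "N (J h b - J ?k (J ?k b)) \<le> h\<^sup>2 / 4 * N ((J ?k ^^ (2 * m)) z)"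
      unfolding b_def by (rule J_halving[OF assms(1) J_pow_G[OF k assms(2)] J_pow_G[OF k assms(3)]])
  qed
  also have "\<dots> \<le> real m * (h\<^sup>2 / 4 * N z) + h\<^sup>2 / 4 * N z"
    unfolding a_def b_def by (intro add_mono Suc mult_left_mono J_pow_contraction[OF k S(3)]) simp
  finally show ?case by (simp only: of_nat_Suc distrib_right mult_1 add.commute)
qed simp

text \<open>The domain of the square of the generator.\<close>

definition D2 :: "'h set" where "D2 = {x. \<exists>y z. (x, y) \<in> G \<and> (y, z) \<in> G}"

lemma Domain_N_dense: assumes "x \<in> S" "e > 0" shows "\<exists>u v. (u, v) \<in> G \<and> N (x - u) < e"
proof -
  have "x \<in> closure (Domain G)" using Domain_dense assms(1) by (rule subsetD)
  then obtain f where f: "\<forall>n. f n \<in> Domain G" "f \<longlonglongrightarrow> x"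
    unfolding closure_sequential by (elim exE conjE)
  have "(\<lambda>n. N (x - f n)) \<longlonglongrightarrow> N (x - x)" by (intro N_continuous tendsto_intros f)
  then have "\<forall>\<^sub>F n in sequentially. N (x - f n) < e" using assms by (intro order_tendstoD(2)) auto
  then obtain n where "N (x - f n) < e" using eventually_sequentially by auto
  moreover obtain v where "(f n, v) \<in> G" using f(1) by (elim allE[of _ n] DomainE)
  ultimately show ?thesis by blast
qed

lemma J_near_identity_on_Domain: assumes "h \<ge> 0" "(x, y) \<in> G" shows "N (J h x - x) \<le> h * N y"
  using J_diff_bound[of h 0 x y] assms by simp

text \<open>On the domain the difference is of order \<open>h\<close>; in general \<open>x\<close> is approximated by elements of the
  domain, uniformly in \<open>h\<close> because \<open>J h\<close> is a contraction.\<close>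

lemma J_near_identity:
  assumes "x \<in> S" "e > 0" shows "\<exists>k>0. \<forall>h. 0 \<le> h \<longrightarrow> h \<le> k \<longrightarrow> N (J h x - x) < e"
proof -
  obtain u v where uv: "(u, v) \<in> G" "N (x - u) < e / 3" using Domain_N_dense[of x "e / 3"] assms by auto
  have S: "u \<in> S" "v \<in> S" using GD uv by auto
  define k where "k = e / 3 / (N v + 1)"
  have "N v + 1 > 0" using S by (simp add: add_nonneg_pos)
  then have k: "k > 0" "k * (N v + 1) = e / 3"
    using assms nonzero_eq_divide_eq[THEN iffD1, of "N v + 1" "e / 3 / (N v + 1)" "e / 3"] by (auto simp: k_def)
  have "N (J h x - x) < e" if h: "0 \<le> h" "h \<le> k" for h
  proof -
    have eq: "J h x - x = J h (x - u) + ((J h u - u) + (u - x))"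
      using h S assms by (simp add: J_diff)
    have "N (J h x - x) \<le> N (J h (x - u)) + (N (J h u - u) + N (u - x))"
      unfolding eq using h S assms by (intro order_trans[OF N_triangle] add_left_mono N_triangle) auto
    moreover have "N (J h (x - u)) \<le> N (x - u)" using h S assms by (intro J_contraction) auto
    moreover have "N (J h u - u) \<le> h * N v" by (intro J_near_identity_on_Domain h uv)
    moreover have "h * N v \<le> k * (N v + 1)" using h S k by (intro mult_mono) auto
    ultimately show ?thesis using uv(2) k(2) N_minus[of u x] by linarith
  qed
  then show ?thesis using k(1) by blast
qed

text \<open>\<open>J k\<close> maps the domain into the domain of the square and is close to the identity.\<close>

lemma D2_N_dense:
  assumes "x \<in> S" "e > 0" shows "\<exists>u\<in>D2. N (x - u) < e"
proof -
  obtain u v where uv: "(u, v) \<in> G" "N (x - u) < e / 2" using Domain_N_dense[of x "e / 2"] assms by auto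
  have S: "u \<in> S" "v \<in> S" using GD uv by auto
  have "e / 2 > 0" using assms by simp
  from J_near_identity[OF S(1) this] obtain k where "k > 0" "\<forall>h. 0 \<le> h \<longrightarrow> h \<le> k \<longrightarrow> N (J h u - u) < e / 2" by blast
  then have k: "k > 0" "N (J k u - u) < e / 2" by simp_all
  obtain w where w: "(J k v, w) \<in> G" using J_ex[OF k(1) S(2)] by blast
  have "J k u \<in> D2" using J_G[OF _ uv(1), of k] w k unfolding D2_def by auto
  moreover have "N (x - J k u) < e"
  proof -
    have "x - J k u = (x - u) + (u - J k u)" by simp
    then have "N (x - J k u) \<le> N (x - u) + N (u - J k u)"
      using N_triangle[of "x - u" "u - J k u"] S assms k by simp
    then show ?thesis using uv k N_minus[of u "J k u"] by simp
  qed
  ultimately show ?thesis by blast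
qed

text \<open>The approximation of the semigroup at time \<open>t\<close> by \<open>2 ^ n\<close> implicit Euler steps.\<close>

definition P :: "nat \<Rightarrow> real \<Rightarrow> 'h \<Rightarrow> 'h" where
  "P n t x = (J (t / 2 ^ n) ^^ (2 ^ n)) x"

definition T :: "real \<Rightarrow> 'h \<Rightarrow> 'h" where "T t x = lim (\<lambda>n. P n t x)"

lemma P_in_S [simp]: "t \<ge> 0 \<Longrightarrow> x \<in> S \<Longrightarrow> P n t x \<in> S"
  and P_contraction: "t \<ge> 0 \<Longrightarrow> x \<in> S \<Longrightarrow> N (P n t x) \<le> N x"
  and P_diff: "t \<ge> 0 \<Longrightarrow> x \<in> S \<Longrightarrow> y \<in> S \<Longrightarrow> P n t (x - y) = P n t x - P n t y"
  and P_G: "t \<ge> 0 \<Longrightarrow> (x, v) \<in> G \<Longrightarrow> (P n t x, P n t v) \<in> G"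
  unfolding P_def by (auto intro: J_pow_contraction J_pow_diff J_pow_G)

lemma P_0 [simp]: "P n 0 x = x"
proof -
  have "(J 0 ^^ m) x = x" for m by (induction m) auto
  then show ?thesis by (simp add: P_def)
qed

lemma P_step:
  assumes "t \<ge> 0" "(x, y) \<in> G" "(y, z) \<in> G"
  shows "N (P (Suc n) t x - P n t x) \<le> t\<^sup>2 * N z * (1 / 2) ^ n"
proof -
  have S: "x \<in> S" "y \<in> S" "z \<in> S" using GD assms by auto
  have "N (P n t x - P (Suc n) t x) \<le> 2 ^ n * ((t / 2 ^ n)\<^sup>2 / 4 * N z)"
    using J_pow_halving[OF _ assms(2,3), of "t / 2 ^ n" "2 ^ n"] assms by (simp add: P_def mult.commute)
  also have "\<dots> = (t\<^sup>2 * N z * (1 / 2) ^ n) / 4"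
    by (simp add: power2_eq_square power_one_over field_simps)
  also have "\<dots> \<le> t\<^sup>2 * N z * (1 / 2) ^ n" using S by simp
  finally show ?thesis by (simp add: N_minus)
qed

lemma Cauchy_from_N:
  assumes f: "\<And>n. f n \<in> S"
    and e: "\<And>e. e > 0 \<Longrightarrow> \<exists>M. \<forall>i\<ge>M. \<forall>j\<ge>M. N (f i - f j) < e"
  shows "Cauchy f"
proof (rule metric_CauchyI)
  fix r :: real assume "r > 0"
  then have "r * sqrt c > 0" using c_pos by simp
  from e[OF this] obtain M where M: "\<And>i j. i \<ge> M \<Longrightarrow> j \<ge> M \<Longrightarrow> N (f i - f j) < r * sqrt c" by blast
  have "dist (f i) (f j) < r" if "i \<ge> M" "j \<ge> M" for i j
    using M[OF that] norm_le_N[of "f i - f j"] f c_pos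
    by (simp add: dist_norm) (smt (verit) pos_divide_less_eq real_sqrt_gt_zero)
  then show "\<exists>M. \<forall>i\<ge>M. \<forall>j\<ge>M. dist (f i) (f j) < r" by blast
qed

lemma P_Cauchy_D2: assumes "t \<ge> 0" "x \<in> D2" shows "convergent (\<lambda>n. P n t x)"
proof -
  obtain y z where g: "(x, y) \<in> G" "(y, z) \<in> G" using assms unfolding D2_def by blast
  have S: "x \<in> S" "z \<in> S" using GD g by auto
  have "summable (\<lambda>n. P (Suc n) t x - P n t x)"
  proof (rule summable_comparison_test)
    have "norm (P (Suc n) t x - P n t x) \<le> t\<^sup>2 * N z / sqrt c * (1 / 2) ^ n" for n
    proof -
      have "norm (P (Suc n) t x - P n t x) \<le> N (P (Suc n) t x - P n t x) / sqrt c"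
        using assms S by (intro norm_le_N) auto
      also have "\<dots> \<le> t\<^sup>2 * N z * (1 / 2) ^ n / sqrt c"
        using P_step[OF assms(1) g] c_pos by (intro divide_right_mono) auto
      finally show ?thesis by simp
    qed
    then show "\<exists>M. \<forall>n\<ge>M. norm (P (Suc n) t x - P n t x) \<le> t\<^sup>2 * N z / sqrt c * (1 / 2) ^ n" by blast
    show "summable (\<lambda>n. t\<^sup>2 * N z / sqrt c * (1 / 2 :: real) ^ n)" by (intro summable_mult summable_geometric) simp
  qed
  then have "convergent (\<lambda>n. \<Sum>i<n. P (Suc i) t x - P i t x)" by (simp add: summable_iff_convergent)
  then have "convergent (\<lambda>n. P n t x - P 0 t x)" by (simp only: sum_lessThan_telescope[of "\<lambda>n. P n t x"])
  then show ?thesis by (simp add: convergent_diff_const_right_iff)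
qed

lemma P_convergent: assumes "t \<ge> 0" "x \<in> S" shows "convergent (\<lambda>n. P n t x)"
proof -
  have "Cauchy (\<lambda>n. P n t x)"
  proof (rule Cauchy_from_N)
    fix e :: real assume "e > 0"
    then obtain u where u: "u \<in> D2" "N (x - u) < e / 4" using D2_N_dense[of x "e / 4"] assms by auto
    have uS: "u \<in> S" using u GD by (auto simp: D2_def)
    obtain l where l: "(\<lambda>n. P n t u) \<longlonglongrightarrow> l" using P_Cauchy_D2[OF assms(1) u(1)] convergent_def by blast
    have lS: "l \<in> S" using closed_sequentially[OF closed_S _ l] assms uS by simp
    have "(\<lambda>n. N (P n t u - l)) \<longlonglongrightarrow> N (l - l)" by (intro N_continuous tendsto_intros l)
    then have "\<forall>\<^sub>F n in sequentially. N (P n t u - l) < e / 4" using \<open>e > 0\<close> by (intro order_tendstoD(2)) auto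
    then obtain M where M: "\<And>n. n \<ge> M \<Longrightarrow> N (P n t u - l) < e / 4" unfolding eventually_sequentially by blast
    have near: "N (P n t x - l) < e / 2" if "n \<ge> M" for n
    proof -
      have "P n t x - l = P n t (x - u) + (P n t u - l)" using assms uS by (simp add: P_diff)
      then have "N (P n t x - l) \<le> N (P n t (x - u)) + N (P n t u - l)"
        using assms uS lS by (simp only:) (intro N_triangle, auto)
      then show ?thesis using P_contraction[of t "x - u" n] M[OF that] u assms uS by simp
    qed
    have "N (P i t x - P j t x) < e" if "i \<ge> M" "j \<ge> M" for i j
    proof -
      have "P i t x - P j t x = (P i t x - l) - (P j t x - l)" by simp
      then have "N (P i t x - P j t x) \<le> N (P i t x - l) + N (P j t x - l)"
        using assms lS N_triangle_diff[of "P i t x - l" "P j t x - l"] by simp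
      then show ?thesis using near[OF that(1)] near[OF that(2)] by linarith
    qed
    then show "\<exists>M. \<forall>i\<ge>M. \<forall>j\<ge>M. N (P i t x - P j t x) < e" by blast
  qed (use assms in simp)
  then show ?thesis by (rule Cauchy_convergent)
qed

lemma P_tendsto: "t \<ge> 0 \<Longrightarrow> x \<in> S \<Longrightarrow> (\<lambda>n. P n t x) \<longlonglongrightarrow> T t x"
  unfolding T_def using P_convergent convergent_LIMSEQ_iff by blast

lemma T_in_S [simp]: "t \<ge> 0 \<Longrightarrow> x \<in> S \<Longrightarrow> T t x \<in> S"
  using closed_sequentially[OF closed_S _ P_tendsto] by simp

lemma T_contraction: "t \<ge> 0 \<Longrightarrow> x \<in> S \<Longrightarrow> N (T t x) \<le> N x"
  by (rule LIMSEQ_le_const2[OF N_continuous[OF P_tendsto]]) (auto intro: P_contraction)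

lemma T_diff: "t \<ge> 0 \<Longrightarrow> x \<in> S \<Longrightarrow> y \<in> S \<Longrightarrow> T t (x - y) = T t x - T t y"
  by (rule LIMSEQ_unique[OF P_tendsto]) (auto simp: P_diff intro!: tendsto_diff P_tendsto)

lemma T_0 [simp]: "x \<in> S \<Longrightarrow> T 0 x = x"
  using LIMSEQ_unique[OF P_tendsto[of 0 x]] by simp

text \<open>Closedness comes from the resolvent, which is everywhere defined and continuous:
  \<open>J 1 (f n - g n) = f n\<close> passes to the limit.\<close>

lemma G_closed:
  assumes "\<And>n. (f n, g n) \<in> G" "f \<longlonglongrightarrow> x" "g \<longlonglongrightarrow> y" shows "(x, y) \<in> G"
proof -
  have S: "x \<in> S" "y \<in> S" "\<And>n. f n \<in> S" "\<And>n. g n \<in> S"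
    using closed_sequentially[OF closed_S _ assms(2)] closed_sequentially[OF closed_S _ assms(3)] GD[OF assms(1)] by auto
  have Jf: "J 1 (f n - g n) = f n" for n using J_eq[of 1, OF _ assms(1)] by simp
  have "N (x - J 1 (x - y)) \<le> 0"
  proof (rule LIMSEQ_le_const)
    show "(\<lambda>n. N (x - f n) + N ((f n - g n) - (x - y))) \<longlonglongrightarrow> 0"
      using tendsto_add[OF N_continuous[OF tendsto_diff[OF tendsto_const[of x] assms(2)]]
          N_continuous[OF tendsto_diff[OF tendsto_diff[OF assms(2,3)] tendsto_const[of "x - y"]]]] by simp
    have "N (x - J 1 (x - y)) \<le> N (x - f n) + N ((f n - g n) - (x - y))" for n
    proof -
      have "x - J 1 (x - y) = (x - f n) + J 1 ((f n - g n) - (x - y))" using S by (simp add: J_diff Jf)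
      then have "N (x - J 1 (x - y)) \<le> N (x - f n) + N (J 1 ((f n - g n) - (x - y)))"
        using S by (simp only:) (intro N_triangle, auto)
      then show ?thesis using J_contraction[of 1 "(f n - g n) - (x - y)"] S by simp
    qed
    then show "\<exists>M. \<forall>n\<ge>M. N (x - J 1 (x - y)) \<le> N (x - f n) + N ((f n - g n) - (x - y))" by blast
  qed
  then have "x - J 1 (x - y) = 0" using S by (intro N_eq_0 antisym) auto
  then have Jx: "J 1 (x - y) = x" by simp
  obtain w where w: "(J 1 (x - y), w) \<in> G" "J 1 (x - y) - 1 *\<^sub>R w = x - y" using J_ex[of 1 "x - y"] S by auto
  then have "w = y" unfolding Jx by simp
  then show ?thesis using w(1) unfolding Jx by simp
qed

lemma T_G: "t \<ge> 0 \<Longrightarrow> (x, y) \<in> G \<Longrightarrow> (T t x, T t y) \<in> G"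
  by (rule G_closed[OF P_G P_tendsto P_tendsto]) (auto dest: GD)

lemma T_Lipschitz:
  assumes "s \<ge> 0" "t \<ge> 0" "(x, y) \<in> G" shows "N (T t x - T s x) \<le> \<bar>t - s\<bar> * N y"
proof (rule LIMSEQ_le_const2)
  show "(\<lambda>n. N (P n t x - P n s x)) \<longlonglongrightarrow> N (T t x - T s x)"
    using assms by (intro N_continuous tendsto_diff P_tendsto) (auto dest: GD)
  have "N (P n t x - P n s x) \<le> \<bar>t - s\<bar> * N y" for n
    using J_pow_Lipschitz[OF _ _ assms(3), of "t / 2 ^ n" "s / 2 ^ n" "2 ^ n"] assms
    by (simp add: P_def flip: diff_divide_distrib)
  then show "\<exists>M. \<forall>n\<ge>M. N (P n t x - P n s x) \<le> \<bar>t - s\<bar> * N y" by blast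
qed

text \<open>The limit of \<open>J_pow_Taylor\<close> with \<open>m = 2 ^ n\<close>, where the extra resolvent factor tends to the identity.\<close>

lemma T_Taylor_D2:
  assumes "s \<ge> 0" "t \<ge> 0" "(x, y) \<in> G" "(y, z) \<in> G"
  shows "N (T t x - T s x - (t - s) *\<^sub>R T s y) \<le> (t - s)\<^sup>2 * N z"
proof -
  have S: "x \<in> S" "y \<in> S" "z \<in> S" using GD assms by auto
  let ?R = "\<lambda>n. P n t x - P n s x - (t - s) *\<^sub>R P n s y"
  let ?E = "\<lambda>n. \<bar>t - s\<bar> * (s / 2 ^ n * N z)"
  have lim: "(\<lambda>n. (t - s)\<^sup>2 * N z + ?E n) \<longlonglongrightarrow> (t - s)\<^sup>2 * N z + \<bar>t - s\<bar> * (0 * N z)"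
    by (intro tendsto_intros LIMSEQ_divide_realpow_zero) simp
  have "N (?R n) \<le> (t - s)\<^sup>2 * N z + ?E n" for n
  proof -
    define k where "k = s / 2 ^ n"
    have k: "k \<ge> 0" using assms by (simp add: k_def)
    have yS: "P n s y \<in> S" using assms S by simp
    have "?R n = (P n t x - P n s x - (t - s) *\<^sub>R J k (P n s y)) + (t - s) *\<^sub>R (J k (P n s y) - P n s y)"
      by (simp add: algebra_simps)
    then have "N (?R n) \<le> N (P n t x - P n s x - (t - s) *\<^sub>R J k (P n s y))
        + N ((t - s) *\<^sub>R (J k (P n s y) - P n s y))"
      using assms S k by (simp only:) (intro N_triangle, auto)
    also have "\<dots> \<le> (t - s)\<^sup>2 * N z + ?E n"
    proof (rule add_mono)
      show "N (P n t x - P n s x - (t - s) *\<^sub>R J k (P n s y)) \<le> (t - s)\<^sup>2 * N z"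
        using J_pow_Taylor[OF _ _ assms(3,4), of "t / 2 ^ n" "s / 2 ^ n" "2 ^ n"] assms
        by (simp add: P_def k_def flip: diff_divide_distrib)
      have "N (J k (P n s y) - P n s y) \<le> k * N (P n s z)"
        using k assms by (intro J_near_identity_on_Domain P_G)
      also have "\<dots> \<le> k * N z" using k assms S by (intro mult_left_mono P_contraction)
      finally show "N ((t - s) *\<^sub>R (J k (P n s y) - P n s y)) \<le> ?E n"
        unfolding N_scale k_def by (intro mult_left_mono) auto
    qed
    finally show ?thesis .
  qed
  moreover have "(\<lambda>n. N (?R n)) \<longlonglongrightarrow> N (T t x - T s x - (t - s) *\<^sub>R T s y)"
    using assms S by (intro N_continuous tendsto_intros P_tendsto)
  ultimately show ?thesis using LIMSEQ_le[OF _ lim] by auto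
qed

text \<open>For \<open>(x, y)\<close> in the graph the second derivative may not exist. Replacing \<open>x\<close> by \<open>J k x\<close>, whose image
  \<open>J k y\<close> is close to \<open>y\<close>, costs an error \<open>e \<bar>t - s\<bar>\<close> and makes \<open>T_Taylor_D2\<close> applicable.\<close>

lemma T_Taylor:
  assumes "s \<ge> 0" "(x, y) \<in> G" "e > 0"
  shows "\<exists>C\<ge>0. \<forall>t\<ge>0. N (T t x - T s x - (t - s) *\<^sub>R T s y) \<le> \<bar>t - s\<bar> * (e + \<bar>t - s\<bar> * C)"
proof -
  have S: "x \<in> S" "y \<in> S" using GD assms by auto
  have "e / 2 > 0" using assms by simp
  from J_near_identity[OF S(2) this] obtain k where "k > 0" "\<forall>h. 0 \<le> h \<longrightarrow> h \<le> k \<longrightarrow> N (J h y - y) < e / 2" by blast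
  then have k: "k > 0" "N (J k y - y) < e / 2" by simp_all
  define x' y' where "x' = J k x" and "y' = J k y"
  obtain z where z: "(y', z) \<in> G" using J_ex[OF k(1) S(2)] by (auto simp: y'_def)
  have g: "(x', y') \<in> G" unfolding x'_def y'_def using k assms by (intro J_G) auto
  have S': "x' \<in> S" "y' \<in> S" "z \<in> S" using GD g z by auto
  have ny: "N (y - y') < e / 2" using k by (simp add: y'_def N_minus)
  have "N (T t x - T s x - (t - s) *\<^sub>R T s y) \<le> \<bar>t - s\<bar> * (e + \<bar>t - s\<bar> * N z)" if t: "t \<ge> 0" for t
  proof -
    let ?a = "T t x' - T s x' - (t - s) *\<^sub>R T s y'"
    let ?b = "T t (x - x') - T s (x - x')"
    let ?c = "(t - s) *\<^sub>R T s (y - y')"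
    have "T t x - T s x - (t - s) *\<^sub>R T s y = ?a + (?b - ?c)"
      using t assms S S' by (simp add: T_diff algebra_simps)
    then have "N (T t x - T s x - (t - s) *\<^sub>R T s y) \<le> N ?a + N (?b - ?c)"
      using t assms S S' by (simp only:) (intro N_triangle, auto)
    also have "\<dots> \<le> N ?a + (N ?b + N ?c)"
      using t assms S S' by (intro add_left_mono N_triangle_diff) auto
    also have "\<dots> \<le> (t - s)\<^sup>2 * N z + (\<bar>t - s\<bar> * N (y - y') + \<bar>t - s\<bar> * N (y - y'))"
    proof (intro add_mono)
      show "N ?a \<le> (t - s)\<^sup>2 * N z" by (intro T_Taylor_D2 assms t g z)
      show "N ?b \<le> \<bar>t - s\<bar> * N (y - y')" by (intro T_Lipschitz assms t G_diff g)
      show "N ?c \<le> \<bar>t - s\<bar> * N (y - y')"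
        unfolding N_scale using assms S S' by (intro mult_left_mono T_contraction) auto
    qed
    also have "\<dots> = \<bar>t - s\<bar> * (2 * N (y - y') + \<bar>t - s\<bar> * N z)"
    proof -
      have "(t - s)\<^sup>2 = \<bar>t - s\<bar> * \<bar>t - s\<bar>" by (simp add: power2_eq_square)
      moreover have "a * a * n + (a * m + a * m) = a * (2 * m + a * n)" for a m n :: real
        by (simp add: algebra_simps)
      ultimately show ?thesis by (simp only:)
    qed
    also have "\<dots> \<le> \<bar>t - s\<bar> * (e + \<bar>t - s\<bar> * N z)"
      using ny by (intro mult_left_mono add_right_mono) auto
    finally show ?thesis .
  qed
  then show ?thesis using S' N_nonneg by blast
qed

lemma T_derivative:
  assumes "s \<ge> 0" "(x, y) \<in> G"
  shows "((\<lambda>t. N ((1 / (t - s)) *\<^sub>R (T t x - T s x) - T s y)) \<longlongrightarrow> 0) (at s within {0..})"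
  unfolding tendsto_iff
proof (intro allI impI)
  fix e :: real assume e: "e > 0"
  have S: "x \<in> S" "y \<in> S" using GD assms by auto
  obtain C where C: "C \<ge> 0"
    "\<And>t. t \<ge> 0 \<Longrightarrow> N (T t x - T s x - (t - s) *\<^sub>R T s y) \<le> \<bar>t - s\<bar> * (e / 2 + \<bar>t - s\<bar> * C)"
    using T_Taylor[OF assms, of "e / 2"] e by auto
  define d where "d = e / 2 / (C + 1)"
  have d: "d > 0" "d * (C + 1) = e / 2"
    using e C nonzero_eq_divide_eq[THEN iffD1, of "C + 1" "e / 2 / (C + 1)" "e / 2"] by (auto simp: d_def)
  have "dist (N ((1 / (t - s)) *\<^sub>R (T t x - T s x) - T s y)) 0 < e"
    if t: "t \<in> {0..}" "t \<noteq> s" "dist t s < d" for t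
  proof -
    have ts: "\<bar>t - s\<bar> > 0" "t \<ge> 0" using t by auto
    have eq: "(1 / (t - s)) *\<^sub>R (T t x - T s x) - T s y
        = (1 / (t - s)) *\<^sub>R (T t x - T s x - (t - s) *\<^sub>R T s y)"
      using ts by (simp add: scaleR_diff_right)
    have "N ((1 / (t - s)) *\<^sub>R (T t x - T s x) - T s y) \<le> 1 / \<bar>t - s\<bar> * (\<bar>t - s\<bar> * (e / 2 + \<bar>t - s\<bar> * C))"
      unfolding eq N_scale abs_divide abs_one using ts C(2)[OF ts(2)] by (intro mult_left_mono) auto
    also have "\<dots> = e / 2 + \<bar>t - s\<bar> * C" using ts by simp
    also have "\<dots> < e"
    proof -
      have "\<bar>t - s\<bar> * C \<le> d * C" using t C by (intro mult_right_mono) (auto simp: dist_real_def)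
      then show ?thesis using d by (simp add: algebra_simps)
    qed
    finally show ?thesis using N_nonneg S ts assms by simp
  qed
  then show "\<forall>\<^sub>F t in at s within {0..}. dist (N ((1 / (t - s)) *\<^sub>R (T t x - T s x) - T s y)) 0 < e"
    unfolding eventually_at using d by blast
qed

lemma T_continuous:
  assumes "s \<ge> 0" "x \<in> S"
  shows "((\<lambda>t. N (T t x - T s x)) \<longlongrightarrow> 0) (at s within {0..})"
  unfolding tendsto_iff
proof (intro allI impI)
  fix e :: real assume e: "e > 0"
  obtain u v where uv: "(u, v) \<in> G" "N (x - u) < e / 4" using Domain_N_dense[of x "e / 4"] assms e by auto
  have S: "u \<in> S" "v \<in> S" using GD uv by auto
  define d where "d = e / 2 / (N v + 1)"
  have "N v + 1 > 0" using S by (simp add: add_nonneg_pos)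
  then have d: "d > 0" "d * (N v + 1) = e / 2"
    using e nonzero_eq_divide_eq[THEN iffD1, of "N v + 1" "e / 2 / (N v + 1)" "e / 2"] by (auto simp: d_def)
  have "dist (N (T t x - T s x)) 0 < e" if t: "t \<in> {0..}" "t \<noteq> s" "dist t s < d" for t
  proof -
    have t0: "t \<ge> 0" using t by simp
    have "T t x - T s x = (T t u - T s u) + (T t (x - u) - T s (x - u))"
      using t0 assms S by (simp add: T_diff)
    then have "N (T t x - T s x) \<le> N (T t u - T s u) + N (T t (x - u) - T s (x - u))"
      using t0 assms S by (simp only:) (intro N_triangle, auto)
    also have "\<dots> \<le> N (T t u - T s u) + (N (T t (x - u)) + N (T s (x - u)))"
      using t0 assms S by (intro add_left_mono N_triangle_diff) auto
    also have "\<dots> \<le> \<bar>t - s\<bar> * N v + (N (x - u) + N (x - u))"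
      using t0 assms S uv by (intro add_mono T_Lipschitz T_contraction) auto
    also have "\<dots> < e"
    proof -
      have "\<bar>t - s\<bar> * N v \<le> d * N v" using t S by (intro mult_right_mono) (auto simp: dist_real_def)
      then show ?thesis using d uv by (simp add: algebra_simps)
    qed
    finally show ?thesis using N_nonneg t0 assms by simp
  qed
  then show "\<forall>\<^sub>F t in at s within {0..}. dist (N (T t x - T s x)) 0 < e"
    unfolding eventually_at using d by blast
qed

text \<open>The derivative of \<open>q (u t) (u t)\<close> is \<open>2 q (u' t) (u t) \<le> 0\<close>. Applied to the difference of two
  solutions this is the uniqueness statement.\<close>

lemma dissipative_solution_decay:
  assumes U: "\<And>t. t \<ge> 0 \<Longrightarrow> u t \<in> S"
    and cont: "\<And>t. t \<ge> 0 \<Longrightarrow> ((\<lambda>r. N (u r - u t)) \<longlongrightarrow> 0) (at t within {0..})"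
    and deriv: "\<And>t. t > 0 \<Longrightarrow> \<exists>v. (u t, v) \<in> G \<and>
       ((\<lambda>r. N ((1 / (r - t)) *\<^sub>R (u r - u t) - v)) \<longlongrightarrow> 0) (at t within {0..})"
    and "t \<ge> 0"
  shows "N (u t) \<le> N (u 0)"
proof -
  have norm_lim: "((\<lambda>r. norm (f r)) \<longlongrightarrow> 0) (at t within {0..})"
    if "\<And>r. r \<ge> 0 \<Longrightarrow> f r \<in> S" "((\<lambda>r. N (f r)) \<longlongrightarrow> 0) (at t within {0..})" for f and t :: real
  proof (rule Lim_null_comparison)
    show "\<forall>\<^sub>F r in at t within {0..}. norm (norm (f r)) \<le> N (f r) / sqrt c"
      unfolding eventually_at using that(1) norm_le_N by (intro exI[of _ 1]) auto
    show "((\<lambda>r. N (f r) / sqrt c) \<longlongrightarrow> 0) (at t within {0..})"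
      using tendsto_divide[OF that(2) tendsto_const[of "sqrt c"]] c_pos by simp
  qed
  have c: "continuous_on {0..} u" unfolding continuous_on_def
  proof
    fix r :: real assume "r \<in> {0..}"
    then have "((\<lambda>p. norm (u p - u r)) \<longlongrightarrow> 0) (at r within {0..})" using U by (intro norm_lim cont) auto
    then show "(u \<longlongrightarrow> u r) (at r within {0..})" by (simp add: tendsto_norm_zero_iff Lim_null[of u])
  qed
  have "((\<lambda>t. q (u t) (u t)) has_real_derivative 2 * q v (u r)) (at r)"
    if r: "r > 0" "(u r, v) \<in> G" "((\<lambda>p. N ((1 / (p - r)) *\<^sub>R (u p - u r) - v)) \<longlongrightarrow> 0) (at r within {0..})" for r v
  proof -
    have "v \<in> S" using GD r by blast
    then have "((\<lambda>p. norm ((1 / (p - r)) *\<^sub>R (u p - u r) - v)) \<longlongrightarrow> 0) (at r within {0..})"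
      using r U by (intro norm_lim) auto
    then have "((\<lambda>p. norm ((u p - u r) - (p - r) *\<^sub>R v) / norm (p - r)) \<longlongrightarrow> 0) (at r within {0..})"
    proof (rule Lim_transform_within[where d = 1])
      fix p assume "0 < dist p r"
      then have "(1 / (p - r)) *\<^sub>R (u p - u r) - v = (1 / (p - r)) *\<^sub>R ((u p - u r) - (p - r) *\<^sub>R v)"
        by (simp add: scaleR_diff_right)
      then show "norm ((1 / (p - r)) *\<^sub>R (u p - u r) - v) = norm ((u p - u r) - (p - r) *\<^sub>R v) / norm (p - r)"
        by simp
    qed simp
    then have "(u has_vector_derivative v) (at r within {0..})"
      unfolding has_vector_derivative_def has_derivative_iff_norm by (simp add: bounded_linear_scaleR_left)
    moreover have "at r within {0..} = at r" by (rule at_within_interior) (use r(1) in simp)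
    ultimately have "(u has_vector_derivative v) (at r)" by simp
    then have "((\<lambda>t. q (u t) (u t)) has_vector_derivative (q (u r) v + q v (u r))) (at r)"
      by (intro q.has_vector_derivative)
    then show ?thesis by (simp add: has_real_derivative_iff_has_vector_derivative q_sym[of "u r" v])
  qed
  note der = this
  have *: "\<exists>y. ((\<lambda>t. q (u t) (u t)) has_real_derivative y) (at r) \<and> y \<le> 0" if r: "r > 0" for r
  proof -
    obtain v where v: "(u r, v) \<in> G" "((\<lambda>p. N ((1 / (p - r)) *\<^sub>R (u p - u r) - v)) \<longlongrightarrow> 0) (at r within {0..})"
      using deriv[OF r] by blast
    show ?thesis by (rule exI[of _ "2 * q v (u r)"]) (use der[OF r v] dissipative[OF v(1)] in simp)
  qed
  have "q (u t) (u t) \<le> q (u 0) (u 0)"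
  proof (cases "t = 0")
    case False
    then have "0 < t" using assms by simp
    have "continuous_on {0..t} (\<lambda>t. q (u t) (u t))"
      by (intro q.continuous_on continuous_on_subset[OF c]) auto
    from MVT[OF \<open>0 < t\<close> this] obtain l z where lz: "0 < z"
      "((\<lambda>t. q (u t) (u t)) has_real_derivative l) (at z)" "q (u t) (u t) - q (u 0) (u 0) = (t - 0) * l"
      using * real_differentiable_def by blast
    obtain l' where "((\<lambda>t. q (u t) (u t)) has_real_derivative l') (at z)" "l' \<le> 0" using *[OF lz(1)] by blast
    then have "l \<le> 0" using DERIV_unique[OF lz(2)] by blast
    then have "t * l \<le> 0" using \<open>0 < t\<close> by (simp add: mult_nonneg_nonpos)
    then show ?thesis using lz(3) by simp
  qed simp
  then show ?thesis by (simp add: N_def)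
qed

end

section \<open>The space of square integrable functions on the line with values in a Hilbert space\<close>

definition sq_integrable :: "(real \<Rightarrow> 'b::{real_inner, banach, second_countable_topology}) \<Rightarrow> bool" where
  "sq_integrable f \<longleftrightarrow> f \<in> borel_measurable lebesgue \<and> integrable lebesgue (\<lambda>x. (norm (f x))\<^sup>2)"

lemma sq_integrable_measurable [measurable_dest]: "sq_integrable f \<Longrightarrow> f \<in> borel_measurable lebesgue"
  and sq_integrable_norm: "sq_integrable f \<Longrightarrow> integrable lebesgue (\<lambda>x. (norm (f x))\<^sup>2)"
  by (auto simp: sq_integrable_def)

lemma sq_integrable_bound:
  assumes "f \<in> borel_measurable lebesgue" "integrable lebesgue g" "AE x in lebesgue. (norm (f x))\<^sup>2 \<le> g x"
  shows "sq_integrable f"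
  unfolding sq_integrable_def
proof (intro conjI assms Bochner_Integration.integrable_bound[OF assms(2)])
  show "(\<lambda>x. (norm (f x))\<^sup>2) \<in> borel_measurable lebesgue" using assms(1) by measurable
  show "AE x in lebesgue. norm ((norm (f x))\<^sup>2) \<le> norm (g x)" using assms(3) by eventually_elim auto
qed

lemma sq_integrable_0 [simp]: "sq_integrable (\<lambda>_. 0)"
  by (simp add: sq_integrable_def)

lemma sq_integrable_add:
  assumes "sq_integrable f" "sq_integrable g" shows "sq_integrable (\<lambda>x. f x + g x)"
proof (rule sq_integrable_bound)
  show "integrable lebesgue (\<lambda>x. 2 * (norm (f x))\<^sup>2 + 2 * (norm (g x))\<^sup>2)"
    using assms by (auto simp: sq_integrable_def)
  have "(norm (a + b))\<^sup>2 \<le> 2 * (norm a)\<^sup>2 + 2 * (norm b)\<^sup>2" for a b :: 'a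
  proof -
    have "0 \<le> (a - b) \<bullet> (a - b)" by simp
    then show ?thesis unfolding power2_norm_eq_inner by (simp add: algebra_simps inner_commute)
  qed
  then show "AE x in lebesgue. (norm (f x + g x))\<^sup>2 \<le> 2 * (norm (f x))\<^sup>2 + 2 * (norm (g x))\<^sup>2" by auto
qed (use assms in measurable)

lemma sq_integrable_scaleR:
  assumes "sq_integrable f" shows "sq_integrable (\<lambda>x. c *\<^sub>R f x)"
  using assms by (auto simp: sq_integrable_def power_mult_distrib)

lemma sq_integrable_diff:
  assumes "sq_integrable f" "sq_integrable g" shows "sq_integrable (\<lambda>x. f x - g x)"
  using sq_integrable_add[OF assms(1) sq_integrable_scaleR[OF assms(2), of "-1"]] by simp

lemma integrable_inner_sq:
  assumes [measurable]: "sq_integrable f" "sq_integrable g" shows "integrable lebesgue (\<lambda>x. f x \<bullet> g x)"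
proof (rule Bochner_Integration.integrable_bound)
  show "integrable lebesgue (\<lambda>x. (norm (f x))\<^sup>2 + (norm (g x))\<^sup>2)"
    using assms by (auto simp: sq_integrable_def)
  have "norm (a \<bullet> b) \<le> norm ((norm a)\<^sup>2 + (norm b)\<^sup>2)" for a b :: 'a
  proof -
    have "\<bar>a \<bullet> b\<bar> \<le> norm a * norm b" by (rule Cauchy_Schwarz_ineq2)
    moreover have "2 * (norm a * norm b) \<le> (norm a)\<^sup>2 + (norm b)\<^sup>2"
      using sum_squares_bound[of "norm a" "norm b"] by simp
    moreover have "0 \<le> norm a * norm b" by simp
    ultimately show ?thesis by simp
  qed
  then show "AE x in lebesgue. norm (f x \<bullet> g x) \<le> norm ((norm (f x))\<^sup>2 + (norm (g x))\<^sup>2)" by blast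
qed measurable

text \<open>A single type for \<open>L\<^sup>2(\<real>; H)\<close>, so that it can be iterated: histories are square integrable functions
  whose values are classes of square integrable functions. Spaces over an interval are subspaces.\<close>

definition L2_rel :: "(real \<Rightarrow> 'b::{real_inner, banach, second_countable_topology}) \<Rightarrow> (real \<Rightarrow> 'b) \<Rightarrow> bool" where
  "L2_rel f g \<longleftrightarrow> sq_integrable f \<and> sq_integrable g \<and> (AE x in lebesgue. f x = g x)"

lemma part_equivp_L2_rel: "part_equivp L2_rel"
proof (rule part_equivpI)
  show "\<exists>x. L2_rel x x" by (rule exI[of _ "\<lambda>_. 0"]) (simp add: L2_rel_def)
  show "symp L2_rel" by (auto intro!: sympI simp: L2_rel_def)
  show "transp L2_rel"
    by (rule transpI) (auto simp: L2_rel_def elim: AE_mp)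
qed

quotient_type (overloaded) 'b L2t = "real \<Rightarrow> 'b::{real_inner, banach, second_countable_topology}" / partial: L2_rel
  by (rule part_equivp_L2_rel)

text \<open>\<open>cls f\<close> is the class of \<open>f\<close>, and \<open>fn u\<close> is some representative of \<open>u\<close>.\<close>

definition cls :: "(real \<Rightarrow> 'b::{real_inner, banach, second_countable_topology}) \<Rightarrow> 'b L2t" where "cls = abs_L2t"
definition fn :: "'b::{real_inner, banach, second_countable_topology} L2t \<Rightarrow> real \<Rightarrow> 'b" where "fn = rep_L2t"

lemma cls_fn [simp]: "cls (fn u) = u"
  unfolding cls_def fn_def by (rule Quotient3_abs_rep[OF Quotient3_L2t])

lemma sq_integrable_fn [simp]: "sq_integrable (fn u)"
  using Quotient3_rel_rep[OF Quotient3_L2t, of u u] by (simp add: fn_def L2_rel_def)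

lemma fn_measurable [measurable]: "fn u \<in> borel_measurable lebesgue"
  using sq_integrable_fn[of u] by (rule sq_integrable_measurable)

lemma fn_cls: "sq_integrable f \<Longrightarrow> AE x in lebesgue. fn (cls f) x = f x"
  using Quotient3_rep_abs[OF Quotient3_L2t, of f] by (simp add: fn_def cls_def L2_rel_def)

lemma cls_eqI: "sq_integrable f \<Longrightarrow> sq_integrable g \<Longrightarrow> AE x in lebesgue. f x = g x \<Longrightarrow> cls f = cls g"
  unfolding cls_def by (rule Quotient3_rel_abs[OF Quotient3_L2t]) (simp add: L2_rel_def)

lemma cls_eq_iff:
  assumes "sq_integrable f" "sq_integrable g" shows "cls f = cls g \<longleftrightarrow> (AE x in lebesgue. f x = g x)"
proof
  assume "cls f = cls g"
  then show "AE x in lebesgue. f x = g x" using fn_cls[OF assms(1)] fn_cls[OF assms(2)] by (auto elim: AE_mp)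
qed (intro cls_eqI assms)

lemma L2t_eqI: "AE x in lebesgue. fn u x = fn v x \<Longrightarrow> u = v"
  using cls_eqI[of "fn u" "fn v"] by simp

instantiation L2t :: ("{real_inner, banach, second_countable_topology}") real_vector
begin
definition zero_L2t :: "'a L2t" where "zero_L2t = cls (\<lambda>_. 0)"
definition plus_L2t :: "'a L2t \<Rightarrow> 'a L2t \<Rightarrow> 'a L2t" where "plus_L2t u v = cls (\<lambda>x. fn u x + fn v x)"
definition minus_L2t :: "'a L2t \<Rightarrow> 'a L2t \<Rightarrow> 'a L2t" where "minus_L2t u v = cls (\<lambda>x. fn u x - fn v x)"
definition uminus_L2t :: "'a L2t \<Rightarrow> 'a L2t" where "uminus_L2t u = cls (\<lambda>x. - 1 *\<^sub>R fn u x)"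
definition scaleR_L2t :: "real \<Rightarrow> 'a L2t \<Rightarrow> 'a L2t" where "scaleR_L2t c u = cls (\<lambda>x. c *\<^sub>R fn u x)"

lemma fn_0: "AE x in lebesgue. fn (0::'a L2t) x = 0"
  and fn_add: "AE x in lebesgue. fn (u + v :: 'a L2t) x = fn u x + fn v x"
  and fn_diff: "AE x in lebesgue. fn (u - v :: 'a L2t) x = fn u x - fn v x"
  and fn_uminus: "AE x in lebesgue. fn (- u :: 'a L2t) x = - fn u x"
  and fn_scaleR: "AE x in lebesgue. fn (c *\<^sub>R u :: 'a L2t) x = c *\<^sub>R fn u x"
  unfolding zero_L2t_def plus_L2t_def minus_L2t_def uminus_L2t_def scaleR_L2t_def
  using fn_cls[OF sq_integrable_0]
    fn_cls[OF sq_integrable_add[OF sq_integrable_fn[of u] sq_integrable_fn[of v]]]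
    fn_cls[OF sq_integrable_diff[OF sq_integrable_fn[of u] sq_integrable_fn[of v]]]
    fn_cls[OF sq_integrable_scaleR[OF sq_integrable_fn[of u], of "- 1"]]
    fn_cls[OF sq_integrable_scaleR[OF sq_integrable_fn[of u], of c]]
  by auto

instance
proof
  fix a b c :: "'a L2t" and r s :: real
  show "a + b + c = a + (b + c)"
    by (rule L2t_eqI) (use fn_add[of "a + b" c] fn_add[of a b] fn_add[of a "b + c"] fn_add[of b c] in \<open>eventually_elim, simp add: add.assoc\<close>)
  show "a + b = b + a"
    by (rule L2t_eqI) (use fn_add[of a b] fn_add[of b a] in \<open>eventually_elim, simp add: add.commute\<close>)
  show "0 + a = a"
    by (rule L2t_eqI) (use fn_add[of 0 a] fn_0 in \<open>eventually_elim, simp\<close>)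
  show "- a + a = 0"
    by (rule L2t_eqI) (use fn_add[of "- a" a] fn_uminus[of a] fn_0 in \<open>eventually_elim, simp\<close>)
  show "a - b = a + - b"
    by (rule L2t_eqI) (use fn_add[of a "- b"] fn_diff[of a b] fn_uminus[of b] in \<open>eventually_elim, simp\<close>)
  show "r *\<^sub>R (a + b) = r *\<^sub>R a + r *\<^sub>R b"
    by (rule L2t_eqI) (use fn_scaleR[of r "a + b"] fn_add[of a b] fn_add[of "r *\<^sub>R a" "r *\<^sub>R b"] fn_scaleR[of r a] fn_scaleR[of r b]
        in \<open>eventually_elim, simp add: scaleR_add_right\<close>)
  show "(r + s) *\<^sub>R a = r *\<^sub>R a + s *\<^sub>R a"
    by (rule L2t_eqI) (use fn_scaleR[of "r + s" a] fn_add[of "r *\<^sub>R a" "s *\<^sub>R a"] fn_scaleR[of r a] fn_scaleR[of s a]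
        in \<open>eventually_elim, simp add: scaleR_add_left\<close>)
  show "r *\<^sub>R s *\<^sub>R a = (r * s) *\<^sub>R a"
    by (rule L2t_eqI) (use fn_scaleR[of "r" "s *\<^sub>R a"] fn_scaleR[of s a] fn_scaleR[of "r * s" a] in \<open>eventually_elim, simp\<close>)
  show "1 *\<^sub>R a = a"
    by (rule L2t_eqI) (use fn_scaleR[of 1 a] in \<open>eventually_elim, simp\<close>)
qed
end

instantiation L2t :: ("{real_inner, banach, second_countable_topology}") real_inner
begin
definition inner_L2t :: "'a L2t \<Rightarrow> 'a L2t \<Rightarrow> real" where
  "inner_L2t u v = (LINT x|lebesgue. fn u x \<bullet> fn v x)"
definition norm_L2t :: "'a L2t \<Rightarrow> real" where "norm_L2t u = sqrt (inner u u)"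
definition sgn_L2t :: "'a L2t \<Rightarrow> 'a L2t" where "sgn_L2t u = inverse (norm u) *\<^sub>R u"
definition dist_L2t :: "'a L2t \<Rightarrow> 'a L2t \<Rightarrow> real" where "dist_L2t u v = norm (u - v)"
definition uniformity_L2t :: "('a L2t \<times> 'a L2t) filter" where
  "uniformity_L2t = (INF e\<in>{0 <..}. principal {(x, y). dist x y < e})"
definition open_L2t :: "'a L2t set \<Rightarrow> bool" where
  "open_L2t U = (\<forall>x\<in>U. eventually (\<lambda>(x', y). x' = x \<longrightarrow> y \<in> U) uniformity)"

instance
proof
  fix a b c :: "'a L2t" and r :: real
  show "a \<bullet> b = b \<bullet> a" by (simp add: inner_L2t_def inner_commute)
  have "(a + b) \<bullet> c = (LINT x|lebesgue. fn a x \<bullet> fn c x + fn b x \<bullet> fn c x)"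
    unfolding inner_L2t_def
    by (intro integral_cong_AE) (measurable, use fn_add[of a b] in \<open>eventually_elim, simp add: inner_add_left\<close>)
  then show "(a + b) \<bullet> c = a \<bullet> c + b \<bullet> c"
    by (simp add: inner_L2t_def integrable_inner_sq)
  have "(r *\<^sub>R a) \<bullet> b = (LINT x|lebesgue. r * (fn a x \<bullet> fn b x))"
    unfolding inner_L2t_def
    by (intro integral_cong_AE) (measurable, use fn_scaleR[of r a] in \<open>eventually_elim, simp\<close>)
  then show "r *\<^sub>R a \<bullet> b = r * (a \<bullet> b)" by (simp add: inner_L2t_def)
  show "0 \<le> a \<bullet> a" unfolding inner_L2t_def by simp
  have "a \<bullet> a = 0 \<longleftrightarrow> (AE x in lebesgue. fn a x \<bullet> fn a x = 0)"
    unfolding inner_L2t_def by (intro integral_nonneg_eq_0_iff_AE integrable_inner_sq) auto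
  also have "\<dots> \<longleftrightarrow> a = 0"
  proof
    assume "AE x in lebesgue. fn a x \<bullet> fn a x = 0"
    then have "AE x in lebesgue. fn a x = fn 0 x" using fn_0[where 'a = 'a] by eventually_elim simp
    then show "a = 0" by (rule L2t_eqI)
  next
    assume "a = 0" then show "AE x in lebesgue. fn a x \<bullet> fn a x = 0" using fn_0[where 'a = 'a] by auto
  qed
  finally show "a \<bullet> a = 0 \<longleftrightarrow> a = 0" .
  show "norm a = sqrt (a \<bullet> a)" by (simp add: norm_L2t_def)
  show "dist a b = norm (a - b)" by (simp add: dist_L2t_def)
  show "sgn a = a /\<^sub>R norm a" by (simp add: sgn_L2t_def)
  show "(uniformity :: ('a L2t \<times> 'a L2t) filter) = (INF e\<in>{0 <..}. principal {(x, y). dist x y < e})"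
    by (rule uniformity_L2t_def)
  show "open U = (\<forall>x\<in>U. eventually (\<lambda>(x', y). x' = x \<longrightarrow> y \<in> U) uniformity)" for U :: "'a L2t set"
    by (rule open_L2t_def)
qed
end

lemma cls_add: "sq_integrable f \<Longrightarrow> sq_integrable g \<Longrightarrow> cls f + cls g = cls (\<lambda>x. f x + g x)"
  unfolding plus_L2t_def
  by (intro cls_eqI sq_integrable_add sq_integrable_fn)
    (auto dest!: fn_cls elim: AE_mp)

lemma cls_diff: "sq_integrable f \<Longrightarrow> sq_integrable g \<Longrightarrow> cls f - cls g = cls (\<lambda>x. f x - g x)"
  unfolding minus_L2t_def
  by (intro cls_eqI sq_integrable_diff sq_integrable_fn)
    (auto dest!: fn_cls elim: AE_mp)

lemma cls_scaleR: "sq_integrable f \<Longrightarrow> c *\<^sub>R cls f = cls (\<lambda>x. c *\<^sub>R f x)"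
  unfolding scaleR_L2t_def
  by (intro cls_eqI sq_integrable_scaleR sq_integrable_fn) (auto dest!: fn_cls elim: AE_mp)

lemma inner_cls:
  assumes f: "sq_integrable f" and g: "sq_integrable g"
  shows "cls f \<bullet> cls g = (LINT x|lebesgue. f x \<bullet> g x)"
  unfolding inner_L2t_def
  using fn_cls[OF f] fn_cls[OF g] sq_integrable_measurable[OF f] sq_integrable_measurable[OF g]
  by (intro integral_cong_AE) (auto elim: AE_mp)

lemma inner_fn: "u \<bullet> v = (LINT x|lebesgue. fn u x \<bullet> fn v x)"
  by (rule inner_L2t_def)

lemma inner_cls_right: "sq_integrable g \<Longrightarrow> u \<bullet> cls g = (LINT x|lebesgue. fn u x \<bullet> g x)"
  using inner_cls[of "fn u" g] by simp

lemma norm_sq_fn: "(norm u)\<^sup>2 = (LINT x|lebesgue. (norm (fn u x))\<^sup>2)"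
  unfolding power2_norm_eq_inner by (rule inner_fn)

lemma norm_sq_cls: "sq_integrable f \<Longrightarrow> (norm (cls f))\<^sup>2 = (LINT x|lebesgue. (norm (f x))\<^sup>2)"
  unfolding power2_norm_eq_inner by (rule inner_cls)

lemma nn_integral_fn: "(\<integral>\<^sup>+x. ennreal ((norm (fn u x))\<^sup>2) \<partial>lebesgue) = ennreal ((norm u)\<^sup>2)"
  unfolding norm_sq_fn by (intro nn_integral_eq_integral sq_integrable_norm) auto

text \<open>Riesz--Fischer.  Along a subsequence with increments \<open>4\<^sup>-\<^sup>n\<close> the functions converge almost
  everywhere, because \<open>\<Sum>n. 2\<^sup>n d\<^sub>n\<^sup>2\<close> is integrable for the increments \<open>d\<^sub>n\<close>.\<close>

lemma L2_limit:
  fixes Y :: "nat \<Rightarrow> 'a::{real_inner, banach, second_countable_topology} L2t"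
  assumes Y: "\<And>n m. n \<le> m \<Longrightarrow> norm (Y m - Y n) \<le> (1/4) ^ n"
  shows "\<exists>u. \<forall>n. norm (u - Y n) \<le> (1/4) ^ n"
proof -
  define d where "d n x = fn (Y (Suc n)) x - fn (Y n) x" for n x
  have d_meas [measurable]: "d n \<in> borel_measurable lebesgue" for n unfolding d_def by measurable
  have sq_diff: "(\<integral>\<^sup>+x. ennreal ((norm (fn (Y m) x - fn (Y n) x))\<^sup>2) \<partial>lebesgue) \<le> ennreal (((1/4) ^ n)\<^sup>2)" if "n \<le> m" for n m
  proof -
    have "(\<integral>\<^sup>+x. ennreal ((norm (fn (Y m) x - fn (Y n) x))\<^sup>2) \<partial>lebesgue) = ennreal ((norm (Y m - Y n))\<^sup>2)"
      unfolding nn_integral_fn[symmetric]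
      by (intro nn_integral_cong_AE) (use fn_diff[of "Y m" "Y n"] in \<open>eventually_elim, simp\<close>)
    also have "\<dots> \<le> ennreal (((1/4) ^ n)\<^sup>2)" using Y[OF that] by (intro ennreal_leI power_mono) auto
    finally show ?thesis .
  qed
  have "(\<integral>\<^sup>+x. (\<Sum>n. ennreal (2 ^ n * (norm (d n x))\<^sup>2)) \<partial>lebesgue)
      = (\<Sum>n. \<integral>\<^sup>+x. ennreal (2 ^ n * (norm (d n x))\<^sup>2) \<partial>lebesgue)"
    by (intro nn_integral_suminf) measurable
  also have "\<dots> \<le> (\<Sum>n. ennreal ((1/2) ^ n))"
  proof (intro suminf_le summableI)
    fix n
    have "(\<integral>\<^sup>+x. ennreal (2 ^ n * (norm (d n x))\<^sup>2) \<partial>lebesgue) = ennreal (2 ^ n) * (\<integral>\<^sup>+x. ennreal ((norm (d n x))\<^sup>2) \<partial>lebesgue)"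
      by (subst nn_integral_cmult[symmetric]) (auto simp: ennreal_mult)
    also have "\<dots> \<le> ennreal (2 ^ n) * ennreal (((1/4) ^ n)\<^sup>2)"
      unfolding d_def by (intro mult_left_mono sq_diff) auto
    also have "\<dots> = ennreal (2 ^ n * ((1/4) ^ n)\<^sup>2)" by (simp add: ennreal_mult)
    also have "\<dots> \<le> ennreal ((1/2) ^ n)"
    proof (rule ennreal_leI)
      have "2 ^ n * ((1/4 :: real) ^ n)\<^sup>2 = (1/8) ^ n"
        by (simp add: power2_eq_square flip: power_mult_distrib)
      also have "\<dots> \<le> (1/2) ^ n" by (intro power_mono) auto
      finally show "2 ^ n * ((1/4 :: real) ^ n)\<^sup>2 \<le> (1/2) ^ n" .
    qed
    finally show "(\<integral>\<^sup>+x. ennreal (2 ^ n * (norm (d n x))\<^sup>2) \<partial>lebesgue) \<le> ennreal ((1/2) ^ n)" .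
  qed
  also have "\<dots> < \<infinity>"
    by (subst suminf_ennreal2) (auto intro: summable_geometric)
  finally have "AE x in lebesgue. (\<Sum>n. ennreal (2 ^ n * (norm (d n x))\<^sup>2)) \<noteq> \<infinity>"
    by (intro nn_integral_PInf_AE) auto
  then have conv: "AE x in lebesgue. convergent (\<lambda>n. fn (Y n) x)"
  proof eventually_elim
    fix x assume "(\<Sum>n. ennreal (2 ^ n * (norm (d n x))\<^sup>2)) \<noteq> \<infinity>"
    then have s: "summable (\<lambda>n. 2 ^ n * (norm (d n x))\<^sup>2)" by (intro summable_suminf_not_top) auto
    have "summable (\<lambda>n. d n x)"
    proof (rule summable_comparison_test)
      show "summable (\<lambda>n. (1/2) ^ n + 2 ^ n * (norm (d n x))\<^sup>2)" by (intro summable_add s summable_geometric) auto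
      have "norm (d n x) \<le> (1/2) ^ n + 2 ^ n * (norm (d n x))\<^sup>2" for n
      proof -
        define p :: real where "p = 2 ^ n"
        have p: "p > 0" "(1/2 :: real) ^ n = 1 / p" by (auto simp: p_def power_one_over)
        have "0 \<le> (1 / p) * (1 - p * norm (d n x))\<^sup>2" using p by simp
        also have "\<dots> = 1 / p - 2 * norm (d n x) + p * (norm (d n x))\<^sup>2"
          using p by (simp add: power2_eq_square field_simps)
        finally show ?thesis using norm_ge_zero[of "d n x"] unfolding p p_def[symmetric] by linarith
      qed
      then show "\<exists>N. \<forall>n\<ge>N. norm (d n x) \<le> (1/2) ^ n + 2 ^ n * (norm (d n x))\<^sup>2" by blast
    qed
    then have "convergent (\<lambda>n. \<Sum>i<n. fn (Y (Suc i)) x - fn (Y i) x)" by (simp add: summable_iff_convergent d_def)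
    then have "convergent (\<lambda>n. fn (Y n) x - fn (Y 0) x)"
      by (simp only: sum_lessThan_telescope[of "\<lambda>n. fn (Y n) x"])
    then show "convergent (\<lambda>n. fn (Y n) x)" by (simp add: convergent_diff_const_right_iff)
  qed
  define f where "f x = lim (\<lambda>n. fn (Y n) x)" for x
  have f_meas [measurable]: "f \<in> borel_measurable lebesgue" unfolding f_def by measurable
  have near: "(\<integral>\<^sup>+x. ennreal ((norm (f x - fn (Y n) x))\<^sup>2) \<partial>lebesgue) \<le> ennreal (((1/4) ^ n)\<^sup>2)" for n
  proof -
    have "(\<integral>\<^sup>+x. ennreal ((norm (f x - fn (Y n) x))\<^sup>2) \<partial>lebesgue)
        = (\<integral>\<^sup>+x. liminf (\<lambda>m. ennreal ((norm (fn (Y m) x - fn (Y n) x))\<^sup>2)) \<partial>lebesgue)"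
    proof (intro nn_integral_cong_AE, use conv in eventually_elim)
      fix x assume "convergent (\<lambda>n. fn (Y n) x)"
      then have "(\<lambda>m. fn (Y m) x) \<longlonglongrightarrow> f x" by (simp add: f_def convergent_LIMSEQ_iff)
      then have "(\<lambda>m. ennreal ((norm (fn (Y m) x - fn (Y n) x))\<^sup>2)) \<longlonglongrightarrow> ennreal ((norm (f x - fn (Y n) x))\<^sup>2)"
        by (intro tendsto_intros)
      then show "ennreal ((norm (f x - fn (Y n) x))\<^sup>2) = liminf (\<lambda>m. ennreal ((norm (fn (Y m) x - fn (Y n) x))\<^sup>2))"
        by (intro lim_imp_Liminf[symmetric]) auto
    qed
    also have "\<dots> \<le> liminf (\<lambda>m. \<integral>\<^sup>+x. ennreal ((norm (fn (Y m) x - fn (Y n) x))\<^sup>2) \<partial>lebesgue)"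
      by (intro nn_integral_liminf) measurable
    also have "\<dots> \<le> liminf (\<lambda>m. ennreal (((1/4) ^ n)\<^sup>2))"
      by (intro Liminf_mono) (use sq_diff in \<open>auto simp: eventually_sequentially\<close>)
    also have "\<dots> = ennreal (((1/4) ^ n)\<^sup>2)" by (simp add: Liminf_const)
    finally show ?thesis .
  qed
  have sqd: "sq_integrable (\<lambda>x. f x - fn (Y n) x)" for n
    unfolding sq_integrable_def
  proof (intro conjI integrableI_bounded)
    have "(\<integral>\<^sup>+ x. ennreal (norm ((norm (f x - fn (Y n) x))\<^sup>2)) \<partial>lebesgue) \<le> ennreal (((1/4) ^ n)\<^sup>2)" using near[of n] by simp
    then show "(\<integral>\<^sup>+ x. ennreal (norm ((norm (f x - fn (Y n) x))\<^sup>2)) \<partial>lebesgue) < \<infinity>"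
      by (rule order.strict_trans1) simp
  qed measurable
  have sqf: "sq_integrable f" using sq_integrable_add[OF sqd[of 0] sq_integrable_fn[of "Y 0"]] by simp
  have "norm (cls f - Y n) \<le> (1/4) ^ n" for n
  proof -
    have eq: "cls f - Y n = cls (\<lambda>x. f x - fn (Y n) x)"
      using cls_diff[OF sqf sq_integrable_fn[of "Y n"]] by simp
    have "ennreal ((norm (cls f - Y n))\<^sup>2) = (\<integral>\<^sup>+x. ennreal ((norm (f x - fn (Y n) x))\<^sup>2) \<partial>lebesgue)"
      unfolding eq norm_sq_cls[OF sqd] by (intro nn_integral_eq_integral[symmetric] sq_integrable_norm sqd) auto
    also have "\<dots> \<le> ennreal (((1/4) ^ n)\<^sup>2)" by (rule near)
    finally have "(norm (cls f - Y n))\<^sup>2 \<le> ((1/4) ^ n)\<^sup>2" by (subst (asm) ennreal_le_iff) auto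
    then show ?thesis by (rule power2_le_imp_le) simp
  qed
  then show ?thesis by blast
qed

instance L2t :: ("{real_inner, banach, second_countable_topology}") banach
proof
  fix X :: "nat \<Rightarrow> 'a L2t" assume X: "Cauchy X"
  have "\<exists>M. \<forall>i\<ge>M. \<forall>j\<ge>M. norm (X i - X j) < (1/4) ^ n" for n :: nat
    using CauchyD[OF X, of "(1/4) ^ n"] by simp
  then obtain M where M: "\<And>n i j. i \<ge> M n \<Longrightarrow> j \<ge> M n \<Longrightarrow> norm (X i - X j) < (1/4) ^ n" by metis
  \<comment> \<open>The indices must not decrease for \<open>L2_limit\<close>; the partial sums do not, and they are at least \<open>M n\<close>.\<close>
  define r where "r n = (\<Sum>k\<le>n. M k)" for n
  have r: "M n \<le> r n" for n unfolding r_def by (intro member_le_sum) auto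
  have rmono: "r n \<le> r m" if "n \<le> m" for n m unfolding r_def using that by (intro sum_mono2) auto
  have "\<exists>u. \<forall>n. norm (u - X (r n)) \<le> (1/4) ^ n"
    by (rule L2_limit) (meson M less_imp_le order_trans r rmono)
  then obtain u where u: "\<And>n. norm (u - X (r n)) \<le> (1/4) ^ n" by blast
  have "X \<longlonglongrightarrow> u"
  proof (rule metric_LIMSEQ_I)
    fix e :: real assume "e > 0"
    then obtain n where n: "(1/4 :: real) ^ n < e / 2" using real_arch_pow_inv[of "e / 2" "1/4"] by auto
    have "dist (X i) u < e" if "i \<ge> M n" for i
    proof -
      have "dist (X i) u \<le> dist (X i) (X (r n)) + dist (X (r n)) u" by (rule dist_triangle)
      also have "\<dots> \<le> (1/4) ^ n + (1/4) ^ n"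
        using M[OF that r] u[of n] by (intro add_mono) (auto simp: dist_norm norm_minus_commute)
      finally show ?thesis using n by simp
    qed
    then show "\<exists>no. \<forall>n\<ge>no. dist (X n) u < e" by blast
  qed
  then show "convergent X" by (rule convergentI)
qed

section \<open>Functions with vanishing integrals, and separability\<close>

lemma sigma_finite_lebesgue: "sigma_finite_measure (lebesgue :: real measure)"
proof
  show "\<exists>A::real set set. countable A \<and> A \<subseteq> sets lebesgue \<and> \<Union> A = space lebesgue \<and> (\<forall>a\<in>A. emeasure lebesgue a \<noteq> \<infinity>)"
    by (rule exI[of _ "range (\<lambda>n::nat. {- real n .. real n})"])
      (auto, metis abs_le_iff minus_le_iff real_nat_ceiling_ge order_trans real_arch_simple)
qed

text \<open>The integrals over intervals vanish by approximation with rational end points, then over Borel sets by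
  Dynkin's theorem, then over Lebesgue sets, which differ from Borel sets by null sets.\<close>

lemma AE_zero_if_interval_integrals_zero_integrable:
  fixes f :: "real \<Rightarrow> 'a::{banach, second_countable_topology}"
  assumes f: "integrable lebesgue f"
    and zero_rat: "\<And>a b. a \<in> \<rat> \<Longrightarrow> b \<in> \<rat> \<Longrightarrow> (LINT x:{a..b}|lebesgue. f x) = 0"
  shows "AE x in lebesgue. f x = 0"
proof (rule sigma_finite_measure.density_zero[OF sigma_finite_lebesgue f])
  have int: "set_integrable lebesgue A f" if "A \<in> sets lebesgue" for A
    using f that by (simp add: set_integrable_def integrable_mult_indicator)
  have zero: "(LINT x:{a..b}|lebesgue. f x) = 0" for a b
  proof -
    have "\<exists>q\<in>\<rat>. a - 1 / real (Suc n) < q \<and> q < a" for n using Rats_dense_in_real[of "a - 1 / real (Suc n)" a] by auto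
    then obtain q where q: "\<And>n. q n \<in> \<rat>" "\<And>n. a - 1 / real (Suc n) < q n" "\<And>n. q n < a" by metis
    have "\<exists>q\<in>\<rat>. b < q \<and> q < b + 1 / real (Suc n)" for n using Rats_dense_in_real[of b "b + 1 / real (Suc n)"] by auto
    then obtain r where r: "\<And>n. r n \<in> \<rat>" "\<And>n. b < r n" "\<And>n. r n < b + 1 / real (Suc n)" by metis
    have inv: "(\<lambda>n. 1 / real (Suc n)) \<longlonglongrightarrow> 0"
      using LIMSEQ_inverse_real_of_nat by (simp add: inverse_eq_divide)
    have "(\<lambda>n. a - 1 / real (Suc n)) \<longlonglongrightarrow> a - 0" "(\<lambda>n. b + 1 / real (Suc n)) \<longlonglongrightarrow> b + 0"
      by (intro tendsto_intros inv)+
    then have q_lim: "q \<longlonglongrightarrow> a" and r_lim: "r \<longlonglongrightarrow> b"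
      using q r by (auto intro!: tendsto_sandwich[of "\<lambda>n. a - 1 / real (Suc n)" q _ "\<lambda>_. a"]
          tendsto_sandwich[of "\<lambda>_. b" r _ "\<lambda>n. b + 1 / real (Suc n)"] simp: less_imp_le)
    have ptw: "(\<lambda>n. indicator {q n..r n} x *\<^sub>R f x) \<longlonglongrightarrow> indicator {a..b} x *\<^sub>R f x" for x
    proof (rule tendsto_eventually)
      consider "a \<le> x \<and> x \<le> b" | "x < a" | "b < x" by linarith
      then show "\<forall>\<^sub>F n in sequentially. indicator {q n..r n} x *\<^sub>R f x = indicator {a..b} x *\<^sub>R f x"
      proof cases
        case 1 then show ?thesis using q(3) r(2) by (intro always_eventually allI) (auto simp: indicator_def; meson less_imp_le order_trans)
      next
        case 2
        then have "\<forall>\<^sub>F n in sequentially. x < q n" by (rule order_tendstoD(1)[OF q_lim])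
        then show ?thesis by eventually_elim (use 2 in \<open>auto simp: indicator_def\<close>)
      next
        case 3
        then have "\<forall>\<^sub>F n in sequentially. r n < x" by (rule order_tendstoD(2)[OF r_lim])
        then show ?thesis by eventually_elim (use 3 in \<open>auto simp: indicator_def\<close>)
      qed
    qed
    have "(\<lambda>n. LINT x:{q n..r n}|lebesgue. f x) \<longlonglongrightarrow> (LINT x:{a..b}|lebesgue. f x)"
      unfolding set_lebesgue_integral_def
    proof (rule integral_dominated_convergence[where w = "\<lambda>x. norm (f x)"])
      show "AE x in lebesgue. norm (indicator {q n..r n} x *\<^sub>R f x) \<le> norm (f x)" for n
        by (auto simp: indicator_def)
    qed (use f ptw in \<open>auto intro!: borel_measurable_integrable int[unfolded set_integrable_def]\<close>)
    then show ?thesis using zero_rat q r by (simp add: LIMSEQ_const_iff)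
  qed
  have whole: "integral\<^sup>L lebesgue f = 0"
  proof -
    have "(\<lambda>n. LINT x:{- real n..real n}|lebesgue. f x) \<longlonglongrightarrow> (LINT x:(\<Union>n. {- real n..real n})|lebesgue. f x)"
      by (intro set_integral_cont_up int) (auto simp: incseq_def)
    moreover have "(\<Union>n. {- real n..real n}) = UNIV"
      by (auto, metis abs_le_iff minus_le_iff real_arch_simple)
    ultimately show ?thesis using zero by (simp add: set_lebesgue_integral_def LIMSEQ_const_iff)
  qed
  have borel: "(LINT x:A|lebesgue. f x) = 0" if "A \<in> sets borel" for A
  proof -
    let ?G = "range (\<lambda>(a, b). {a..b::real})"
    have gen: "sets borel = sigma_sets UNIV ?G"
      unfolding borel_eq_atLeastAtMost[where 'a = real] by (simp add: sets_measure_of)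
    have borel_leb: "B \<in> sets lebesgue" if "B \<in> sigma_sets UNIV ?G" for B
      using that unfolding gen[symmetric] by (simp add: sets_completionI_sets)
    have "Int_stable ?G" "?G \<subseteq> Pow UNIV" "A \<in> sigma_sets UNIV ?G"
      using that gen by (auto simp: Int_stable_def)
    then show ?thesis
    proof (induction rule: sigma_sets_induct_disjoint)
      case (basic B) then show ?case using zero by auto
    next
      case empty then show ?case by (simp add: set_lebesgue_integral_def)
    next
      case (compl B)
      have B: "B \<in> sets lebesgue" using compl(1) by (rule borel_leb)
      have "(LINT x:B \<union> (UNIV - B)|lebesgue. f x) = (LINT x:B|lebesgue. f x) + (LINT x:(UNIV - B)|lebesgue. f x)"
        using B by (intro set_integral_Un int) auto
      then show ?case using compl whole by (simp add: set_lebesgue_integral_def)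
    next
      case (union B)
      have B: "B i \<in> sets lebesgue" for i using union(2) by (intro borel_leb) auto
      have "(LINT x:(\<Union>i. B i)|lebesgue. f x) = (\<Sum>i. LINT x:B i|lebesgue. f x)"
        using union(1) B by (intro lebesgue_integral_countable_add int) (auto simp: disjoint_family_on_def)
      then show ?case using union by simp
    qed
  qed
  fix A :: "real set" assume A: "A \<in> sets lebesgue"
  have "(LINT x:A|lebesgue. f x) = (LINT x:main_part lborel A|lebesgue. f x)"
    unfolding set_lebesgue_integral_def
  proof (rule integral_cong_AE)
    have "AE x in lebesgue. x \<notin> null_part lborel A" using AE_notin_null_part[OF A] by (simp add: AE_completion_iff)
    moreover have "A = main_part lborel A \<union> null_part lborel A" using main_part_null_part_Un[OF A] by simp
    ultimately show "AE x in lebesgue. indicator A x *\<^sub>R f x = indicator (main_part lborel A) x *\<^sub>R f x"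
      by (auto simp: indicator_def elim!: AE_mp)
  qed (use A f in \<open>auto intro!: borel_measurable_indicator sets_completionI_sets borel_measurable_scaleR\<close>)
  also have "\<dots> = 0" using A by (intro borel) (metis main_part_sets sets_lborel)
  finally show "(LINT x:A|lebesgue. f x) = 0" .
qed

lemma AE_zero_if_interval_integrals_zero:
  fixes f :: "real \<Rightarrow> 'a::{banach, second_countable_topology}"
  assumes f: "\<And>n::nat. set_integrable lebesgue {- real n..real n} f"
    and zero: "\<And>a b. a \<in> \<rat> \<Longrightarrow> b \<in> \<rat> \<Longrightarrow> (LINT x:{a..b}|lebesgue. f x) = 0"
  shows "AE x in lebesgue. f x = 0"
proof -
  have "AE x in lebesgue. indicator {- real n..real n} x *\<^sub>R f x = 0" for n :: nat
  proof (rule AE_zero_if_interval_integrals_zero_integrable)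
    show "integrable lebesgue (\<lambda>x. indicator {- real n..real n} x *\<^sub>R f x)"
      using f[of n] by (simp add: set_integrable_def)
    fix a b :: real assume ab: "a \<in> \<rat>" "b \<in> \<rat>"
    have "indicator {a..b} x *\<^sub>R indicator {- real n..real n} x *\<^sub>R f x = indicator {max a (- real n)..min b (real n)} x *\<^sub>R f x" for x
      by (auto simp: indicator_def)
    moreover have "max a (- real n) \<in> \<rat>" "min b (real n) \<in> \<rat>" using ab by (auto simp: max_def min_def)
    ultimately show "(LINT x:{a..b}|lebesgue. indicator {- real n..real n} x *\<^sub>R f x) = 0"
      using zero unfolding set_lebesgue_integral_def by (simp only:)
  qed
  then have "AE x in lebesgue. \<forall>n::nat. indicator {- real n..real n} x *\<^sub>R f x = 0" unfolding AE_all_countable by blast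
  then show ?thesis
  proof eventually_elim
    fix x assume *: "\<forall>n::nat. indicator {- real n..real n} x *\<^sub>R f x = 0"
    obtain n :: nat where "\<bar>x\<bar> \<le> real n" using real_arch_simple by blast
    then show "f x = 0" using *[rule_format, of n] by (auto simp: indicator_def)
  qed
qed

lemma sq_integrable_set_integrable:
  fixes f :: "real \<Rightarrow> 'b::{real_inner, banach, second_countable_topology}"
  assumes f[measurable]: "sq_integrable f" and A: "A \<in> sets lebesgue" "emeasure lebesgue A < \<infinity>"
  shows "set_integrable lebesgue A f"
  unfolding set_integrable_def
proof (rule Bochner_Integration.integrable_bound)
  show "integrable lebesgue (\<lambda>x. indicat_real A x + (norm (f x))\<^sup>2)"
    using A sq_integrable_norm[OF f] by (intro Bochner_Integration.integrable_add integrable_real_indicator) auto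
  show "(\<lambda>x. indicat_real A x *\<^sub>R f x) \<in> borel_measurable lebesgue" using A by measurable
  have "norm v \<le> 1 + (norm v)\<^sup>2" for v :: 'b
    using zero_le_power2[of "norm v - 1 / 2"] by (simp add: power2_eq_square algebra_simps)
  then show "AE x in lebesgue. norm (indicat_real A x *\<^sub>R f x) \<le> norm (indicat_real A x + (norm (f x))\<^sup>2)"
    by (auto simp: indicator_def)
qed

lemma sq_integrable_indicator:
  assumes A: "A \<in> sets lebesgue" "emeasure lebesgue A < \<infinity>"
  shows "sq_integrable (\<lambda>x. indicat_real A x *\<^sub>R d)"
proof (rule sq_integrable_bound)
  show "integrable lebesgue (\<lambda>x. indicat_real A x * (norm d)\<^sup>2)"
    using A by (intro integrable_mult_left integrable_real_indicator) auto
  show "(\<lambda>x. indicat_real A x *\<^sub>R d) \<in> borel_measurable lebesgue" using A by measurable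
qed (auto simp: indicator_def)

lemma inner_indicator:
  assumes A: "A \<in> sets lebesgue" "emeasure lebesgue A < \<infinity>"
  shows "u \<bullet> cls (\<lambda>x. indicat_real A x *\<^sub>R d) = (LINT x:A|lebesgue. fn u x \<bullet> d)"
  unfolding inner_cls_right[OF sq_integrable_indicator[OF A]] set_lebesgue_integral_def by simp

lemma countable_dense_set:
  obtains D :: "'a::second_countable_topology set" where "countable D" "closure D = UNIV"
proof -
  obtain D :: "'a set" where D: "countable D" "\<And>X. open X \<Longrightarrow> X \<noteq> {} \<Longrightarrow> \<exists>d \<in> D. d \<in> X"
    using countable_dense_exists by metis
  have "closure D = UNIV"
  proof (rule ccontr)
    assume "closure D \<noteq> UNIV"
    then have "\<exists>d\<in>D. d \<in> - closure D" by (intro D(2)) auto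
    then show False using closure_subset by blast
  qed
  then show ?thesis using that D by blast
qed

lemma zero_if_orthogonal_to_dense:
  fixes v :: "'a::real_inner"
  assumes "closure D = UNIV" "\<And>d. d \<in> D \<Longrightarrow> v \<bullet> d = 0" shows "v = 0"
proof -
  have "closed {d. v \<bullet> d = 0}" by (intro closed_Collect_eq continuous_intros)
  then have "closure D \<subseteq> {d. v \<bullet> d = 0}" using assms(2) by (intro closure_minimal) auto
  then have "v \<bullet> v = 0" using assms(1) by blast
  then show ?thesis by simp
qed

lemma separable_imp_countable_basis:
  fixes D :: "'a::metric_space set"
  assumes "countable D" "closure D = UNIV"
  shows "\<exists>B::'a set set. countable B \<and> topological_basis B"
proof (intro exI conjI)
  let ?B = "(\<lambda>(d, r). ball d r) ` (D \<times> \<rat>)"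
  show "countable ?B" using assms countable_rat by blast
  show "topological_basis ?B"
  proof (rule topological_basisI)
    fix O' :: "'a set" and x assume "open O'" "x \<in> O'"
    then obtain e where e: "e > 0" "ball x e \<subseteq> O'" using openE by blast
    obtain r where r: "r \<in> \<rat>" "0 < r" "r < e / 2" using Rats_dense_in_real[of 0 "e / 2"] e by auto
    have "x \<in> closure D" using assms by simp
    then obtain d where d: "d \<in> D" "dist d x < r" using r closure_approachable by blast
    have "ball d r \<subseteq> ball x e"
    proof
      fix z assume "z \<in> ball d r"
      then have "dist x z < r + r" using d dist_triangle_less_add[of x d r z r] by (simp add: dist_commute)
      then show "z \<in> ball x e" using r by simp
    qed
    then show "\<exists>B'\<in>?B. x \<in> B' \<and> B' \<subseteq> O'" using d r e by (intro bexI[of _ "ball d r"]) auto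
  qed auto
qed

lemma closure_rational_span_subspace:
  fixes R :: "'a::real_normed_vector set"
  assumes R: "0 \<in> R" "\<And>u v. u \<in> R \<Longrightarrow> v \<in> R \<Longrightarrow> u + v \<in> R" "\<And>c u. c \<in> \<rat> \<Longrightarrow> u \<in> R \<Longrightarrow> c *\<^sub>R u \<in> R"
  shows "subspace (closure R)"
proof (rule subspaceI)
  show "0 \<in> closure R" using R(1) closure_subset by blast
next
  fix x y assume "x \<in> closure R" "y \<in> closure R"
  then obtain f g where "\<And>n. f n \<in> R" "f \<longlonglongrightarrow> x" "\<And>n. g n \<in> R" "g \<longlonglongrightarrow> y"
    unfolding closure_sequential by blast
  then show "x + y \<in> closure R" unfolding closure_sequential
    by (intro exI[of _ "\<lambda>n. f n + g n"]) (auto intro: tendsto_add R)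
next
  fix r :: real and x assume "x \<in> closure R"
  then obtain f where f: "\<And>n. f n \<in> R" "f \<longlonglongrightarrow> x" unfolding closure_sequential by blast
  have "r \<in> closure \<rat>" by (simp add: Rats_closure_real)
  then obtain c where c: "\<And>n. c n \<in> \<rat>" "c \<longlonglongrightarrow> r" unfolding closure_sequential by blast
  show "r *\<^sub>R x \<in> closure R" unfolding closure_sequential
    using f c by (intro exI[of _ "\<lambda>n. c n *\<^sub>R f n"]) (auto intro: tendsto_scaleR R)
qed

text \<open>The rational combinations of the functions \<open>1\<^bsub>[a,b]\<^esub> d\<close>, with rational \<open>a\<close>, \<open>b\<close> and \<open>d\<close> from a
  countable dense set, are dense: their closure is a subspace, and nothing is orthogonal to it.\<close>

instance L2t :: ("{real_inner, banach, second_countable_topology}") second_countable_topology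
proof
  obtain D0 :: "'a set" where D0: "countable D0" "closure D0 = UNIV" by (rule countable_dense_set)
  define e where "e a b d = cls (\<lambda>x. indicat_real {a..b} x *\<^sub>R d)" for a b and d :: 'a
  define T where "T = (\<lambda>(a, b, d). e a b d) ` (\<rat> \<times> \<rat> \<times> D0)"
  have T: "countable T" unfolding T_def using D0 countable_rat by (intro countable_image countable_SIGMA) auto
  define R where "R = (\<lambda>xs. \<Sum>(c, t)\<leftarrow>xs. c *\<^sub>R t) ` lists (\<rat> \<times> T)"
  have "countable R" unfolding R_def using T countable_rat by (intro countable_image countable_lists countable_SIGMA) auto
  have sub: "subspace (closure R)"
  proof (rule closure_rational_span_subspace)
    show "0 \<in> R" unfolding R_def by (rule image_eqI[of _ _ "[]"]) auto
    show "u + v \<in> R" if "u \<in> R" "v \<in> R" for u v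
    proof -
      from that obtain xs ys where "xs \<in> lists (\<rat> \<times> T)" "ys \<in> lists (\<rat> \<times> T)"
        "u = (\<Sum>(c, t)\<leftarrow>xs. c *\<^sub>R t)" "v = (\<Sum>(c, t)\<leftarrow>ys. c *\<^sub>R t)" unfolding R_def by blast
      then show ?thesis unfolding R_def by (intro image_eqI[of _ _ "xs @ ys"]) (auto simp: append_in_lists_conv)
    qed
    show "k *\<^sub>R u \<in> R" if "k \<in> \<rat>" "u \<in> R" for k u
    proof -
      from that obtain xs where xs: "xs \<in> lists (\<rat> \<times> T)" "u = (\<Sum>(c, t)\<leftarrow>xs. c *\<^sub>R t)" unfolding R_def by blast
      have "k *\<^sub>R u = (\<Sum>(c, t)\<leftarrow>map (\<lambda>(c, t). (k * c, t)) xs. c *\<^sub>R t)"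
        unfolding xs(2) by (induction xs) (auto simp: scaleR_add_right)
      moreover have "map (\<lambda>(c, t). (k * c, t)) xs \<in> lists (\<rat> \<times> T)" using xs(1) that(1) by (auto intro!: Rats_mult)
      ultimately show ?thesis unfolding R_def by blast
    qed
  qed
  have T_R: "t \<in> R" if "t \<in> T" for t
    unfolding R_def using that by (intro image_eqI[of _ _ "[(1, t)]"]) auto
  have "z \<in> closure R" for z :: "'a L2t"
  proof -
    \<comment> \<open>\<open>p\<close> is the orthogonal projection of \<open>z\<close>; the difference \<open>v\<close> is orthogonal to all indicators, hence zero.\<close>
    have "\<exists>p\<in>closure R. \<forall>w\<in>closure R. p \<bullet> w = z \<bullet> w"
      by (rule riesz_on_closed_subspace[OF sub]) (auto intro: bounded_linear_inner_right)
    then obtain p where p: "p \<in> closure R" "\<And>w. w \<in> closure R \<Longrightarrow> p \<bullet> w = z \<bullet> w" by blast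
    define v where "v = z - p"
    have orth: "v \<bullet> e a b d = 0" if "a \<in> \<rat>" "b \<in> \<rat>" "d \<in> D0" for a b d
    proof -
      have "e a b d \<in> T" unfolding T_def using that by force
      then show ?thesis using p(2)[OF subsetD[OF closure_subset T_R]] by (simp add: v_def inner_diff_left)
    qed
    have fin: "{a..b} \<in> sets lebesgue" "emeasure lebesgue {a..b} < \<infinity>" for a b :: real
      by (auto simp: emeasure_lborel_Icc_eq)
    have "AE x in lebesgue. fn v x \<bullet> d = 0" if d: "d \<in> D0" for d
    proof (rule AE_zero_if_interval_integrals_zero)
      show "set_integrable lebesgue {- real n..real n} (\<lambda>x. fn v x \<bullet> d)" for n
      proof -
        have "set_integrable lebesgue {- real n..real n} (fn v)" by (intro sq_integrable_set_integrable fin) simp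
        then show ?thesis
          using integrable_bounded_linear[OF bounded_linear_inner_left[of d], of lebesgue "\<lambda>x. indicator {- real n..real n} x *\<^sub>R fn v x"]
          by (simp add: set_integrable_def)
      qed
      show "(LINT x:{a..b}|lebesgue. fn v x \<bullet> d) = 0" if "a \<in> \<rat>" "b \<in> \<rat>" for a b
        using orth[OF that d] inner_indicator[OF fin, of v a b d] by (simp add: e_def)
    qed
    then have "AE x in lebesgue. \<forall>d\<in>D0. fn v x \<bullet> d = 0" using D0(1) by (simp add: AE_ball_countable)
    then have "AE x in lebesgue. fn v x = 0"
      by eventually_elim (auto intro: zero_if_orthogonal_to_dense[OF D0(2)])
    moreover note fn_0[where 'a = 'a]
    ultimately have "AE x in lebesgue. fn v x = fn 0 x" by eventually_elim simp
    then have "v = 0" by (rule L2t_eqI)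
    then show ?thesis using p by (simp add: v_def)
  qed
  then have "closure R = UNIV" by auto
  from separable_imp_countable_basis[OF \<open>countable R\<close> this]
  show "\<exists>B::'a L2t set set. countable B \<and> open = generate_topology B"
    using topological_basis_imp_subbasis by blast
qed

text \<open>Pettis: in a separable Hilbert space weak measurability is measurability, because a closed
  ball is a countable intersection of half spaces.\<close>

lemma weakly_measurable_imp_measurable:
  fixes f :: "'m \<Rightarrow> 'b::{real_inner, second_countable_topology}"
  assumes f: "\<And>d. (\<lambda>s. f s \<bullet> d) \<in> borel_measurable M"
  shows "f \<in> borel_measurable M"
proof (rule borel_measurableI)
  obtain D :: "'b set" where D: "countable D" "closure D = UNIV" by (rule countable_dense_set)
  \<comment> \<open>A norm bound is a countable family of bounds on inner products.\<close>
  have cball_iff: "v \<in> cball y r \<longleftrightarrow> (\<forall>d\<in>D. (v - y) \<bullet> d \<le> r * norm d)" if r: "r \<ge> 0" for v y :: 'b and r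
  proof
    assume "v \<in> cball y r"
    then have "norm (v - y) \<le> r" by (simp add: dist_norm norm_minus_commute)
    then show "\<forall>d\<in>D. (v - y) \<bullet> d \<le> r * norm d"
      using norm_cauchy_schwarz[of "v - y"] by (meson mult_right_mono norm_ge_zero order_trans)
  next
    assume *: "\<forall>d\<in>D. (v - y) \<bullet> d \<le> r * norm d"
    have "closed {d. (v - y) \<bullet> d \<le> r * norm d}" by (intro closed_Collect_le continuous_intros)
    then have "closure D \<subseteq> {d. (v - y) \<bullet> d \<le> r * norm d}" using * by (intro closure_minimal) auto
    then have "(v - y) \<bullet> (v - y) \<le> r * norm (v - y)" using D(2) by auto
    then have "norm (v - y) * norm (v - y) \<le> r * norm (v - y)" by (simp add: dot_square_norm power2_eq_square)
    then have "norm (v - y) \<le> r" using r by (cases "norm (v - y) = 0") auto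
    then show "v \<in> cball y r" by (simp add: dist_norm norm_minus_commute)
  qed
  fix S :: "'b set" assume "open S"
  define I where "I = {(y, r). y \<in> D \<and> r \<in> \<rat> \<and> r \<ge> 0 \<and> cball y r \<subseteq> S}"
  have "countable I"
    by (rule countable_subset[of _ "D \<times> \<rat>"]) (use D countable_rat in \<open>auto simp: I_def\<close>)
  have S_eq: "S = (\<Union>(y, r)\<in>I. cball y r)"
  proof
    show "S \<subseteq> (\<Union>(y, r)\<in>I. cball y r)"
    proof
      fix x assume "x \<in> S"
      then obtain e where e: "e > 0" "cball x e \<subseteq> S" using \<open>open S\<close> open_contains_cball by blast
      obtain r where r: "r \<in> \<rat>" "0 < r" "r < e / 2" using Rats_dense_in_real[of 0 "e / 2"] e by auto
      have "x \<in> closure D" using D by simp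
      then obtain d where d: "d \<in> D" "dist d x < r" using r closure_approachable by blast
      have "cball d r \<subseteq> cball x e"
      proof
        fix z assume "z \<in> cball d r"
        then have "dist x z \<le> r + r" using d dist_triangle[of x z d] by (simp add: dist_commute)
        then show "z \<in> cball x e" using r by simp
      qed
      then have "(d, r) \<in> I" using d r e by (auto simp: I_def)
      moreover have "x \<in> cball d r" using d by simp
      ultimately show "x \<in> (\<Union>(y, r)\<in>I. cball y r)" by blast
    qed
  qed (auto simp: I_def)
  have meas: "{s \<in> space M. f s \<in> cball y r} \<in> sets M" if "(y, r) \<in> I" for y r
  proof -
    have "{s \<in> space M. f s \<in> cball y r} = {s \<in> space M. \<forall>d\<in>D. f s \<bullet> d - y \<bullet> d \<le> r * norm d}"
      using that cball_iff[of r] by (auto simp: I_def inner_diff_left)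
    also have "\<dots> \<in> sets M"
      using f D(1) by measurable
    finally show ?thesis .
  qed
  have "f -` S \<inter> space M = (\<Union>p\<in>I. {s \<in> space M. f s \<in> cball (fst p) (snd p)})"
  proof -
    have "x \<in> S \<longleftrightarrow> (\<exists>p\<in>I. x \<in> cball (fst p) (snd p))" for x
      by (subst S_eq) (simp only: UN_iff case_prod_beta)
    then show ?thesis by (auto simp only: vimage_eq Int_iff UN_iff mem_Collect_eq)
  qed
  also have "\<dots> \<in> sets M" using \<open>countable I\<close> meas by (intro sets.countable_UN') auto
  finally show "f -` S \<inter> space M \<in> sets M" .
qed

section \<open>Integration in the history variable\<close>

lemma measurable_ident_lebesgue [measurable]: "(\<lambda>x. x) \<in> borel_measurable (lebesgue :: real measure)"
  by (simp add: measurable_completion)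

lemma measurable_snd_lebesgue [measurable]:
  "(\<lambda>p. snd p) \<in> borel_measurable ((M :: 'a measure) \<Otimes>\<^sub>M (lebesgue :: real measure))"
  using measurable_compose[OF measurable_snd measurable_ident_lebesgue] by auto

interpretation leb: sigma_finite_measure "lebesgue :: real measure"
  by (rule sigma_finite_lebesgue)

interpretation leb_pair: pair_sigma_finite "lebesgue :: real measure" "lebesgue :: real measure" ..

lemma FTC_lebesgue:
  fixes a A :: "real \<Rightarrow> real"
  assumes "u \<le> s" and A: "\<And>r. (A has_real_derivative a r) (at r)" and a: "continuous_on UNIV a"
  shows "set_integrable lebesgue {u..s} a" "(LINT r:{u..s}|lebesgue. a r) = A s - A u"
proof -
  have "has_bochner_integral lborel (\<lambda>r. a r * indicator {u..s} r) (A s - A u)"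
    using assms continuous_on_eq_continuous_at[of UNIV a]
    by (intro has_bochner_integral_FTC_Icc_real) auto
  then have *: "integrable lborel (\<lambda>r. indicat_real {u..s} r *\<^sub>R a r)" "(LINT r|lborel. indicat_real {u..s} r *\<^sub>R a r) = A s - A u"
    by (auto simp: has_bochner_integral_iff mult.commute)
  show "set_integrable lebesgue {u..s} a"
    unfolding set_integrable_def using *(1) by (simp add: integrable_completion borel_measurable_integrable)
  show "(LINT r:{u..s}|lebesgue. a r) = A s - A u"
    unfolding set_lebesgue_integral_def using * by (simp add: integral_completion borel_measurable_integrable)
qed

text \<open>Fubini's theorem on the triangle \<open>0 \<le> u \<le> r \<le> s\<close>.\<close>

lemma integral_triangle:
  fixes d :: "real \<Rightarrow> 'x::{banach, second_countable_topology}" and a :: "real \<Rightarrow> real"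
  assumes d: "set_integrable lebesgue {0..s} d" and a: "set_integrable lebesgue {0..s} a"
  shows "set_integrable lebesgue {0..s} (\<lambda>r. a r *\<^sub>R (LINT u:{0..r}|lebesgue. d u))"
    and "(LINT r:{0..s}|lebesgue. a r *\<^sub>R (LINT u:{0..r}|lebesgue. d u))
      = (LINT u:{0..s}|lebesgue. (LINT r:{u..s}|lebesgue. a r) *\<^sub>R d u)"
proof -
  define d1 where "d1 u = indicator {0..s} u *\<^sub>R d u" for u
  define a1 where "a1 r = indicator {0..s} r *\<^sub>R a r" for r
  have d1: "integrable lebesgue d1" using d unfolding set_integrable_def d1_def[abs_def] .
  have a1: "integrable lebesgue a1" using a unfolding set_integrable_def a1_def[abs_def] .
  have [measurable]: "d1 \<in> borel_measurable lebesgue" "a1 \<in> borel_measurable lebesgue" using d1 a1 by auto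
  define F where "F u r = ((if u \<le> r then 1 else 0) * a1 r) *\<^sub>R d1 u" for u r
  have Fmeas: "case_prod F \<in> borel_measurable (lebesgue \<Otimes>\<^sub>M lebesgue)"
    unfolding F_def case_prod_beta by measurable
  have Fbound: "norm (F u r) \<le> \<bar>a1 r\<bar> * norm (d1 u)" for u r
    by (simp add: F_def)
  have Fu: "integrable lebesgue (\<lambda>r. F u r)" for u
  proof (rule Bochner_Integration.integrable_bound)
    show "integrable lebesgue (\<lambda>r. \<bar>a1 r\<bar> * norm (d1 u))" using a1 by simp
    show "(\<lambda>r. F u r) \<in> borel_measurable lebesgue" unfolding F_def by measurable
  qed (use Fbound in simp)
  have Fint: "integrable (lebesgue \<Otimes>\<^sub>M lebesgue) (case_prod F)"
  proof (rule leb_pair.Fubini_integrable[OF Fmeas])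
    show "AE u in lebesgue. integrable lebesgue (\<lambda>r. case_prod F (u, r))" using Fu by simp
    show "integrable lebesgue (\<lambda>u. LINT r|lebesgue. norm (case_prod F (u, r)))"
    proof (rule Bochner_Integration.integrable_bound)
      show "integrable lebesgue (\<lambda>u. (LINT r|lebesgue. \<bar>a1 r\<bar>) * norm (d1 u))" using d1 by simp
      show "(\<lambda>u. LINT r|lebesgue. norm (case_prod F (u, r))) \<in> borel_measurable lebesgue"
        using Fmeas by measurable
      have "norm (LINT r|lebesgue. norm (F u r)) \<le> norm ((LINT r|lebesgue. \<bar>a1 r\<bar>) * norm (d1 u))" for u
      proof -
        have "(LINT r|lebesgue. norm (F u r)) \<le> (LINT r|lebesgue. \<bar>a1 r\<bar> * norm (d1 u))"
          using Fu a1 Fbound by (intro integral_mono) auto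
        also have "\<dots> = (LINT r|lebesgue. \<bar>a1 r\<bar>) * norm (d1 u)" by simp
        finally show ?thesis by (auto simp: abs_of_nonneg)
      qed
      then show "AE u in lebesgue. norm (LINT r|lebesgue. norm (case_prod F (u, r))) \<le> norm ((LINT r|lebesgue. \<bar>a1 r\<bar>) * norm (d1 u))"
        by simp
    qed
  qed
  have inner1: "(LINT u|lebesgue. F u r) = indicator {0..s} r *\<^sub>R (a r *\<^sub>R (LINT u:{0..r}|lebesgue. d u))" for r
  proof -
    have "F u r = (indicator {0..s} r * a r) *\<^sub>R (indicator {0..r} u *\<^sub>R d u)" for u
      by (auto simp: F_def d1_def a1_def indicator_def)
    then have "(LINT u|lebesgue. F u r) = (LINT u|lebesgue. (indicator {0..s} r * a r) *\<^sub>R (indicator {0..r} u *\<^sub>R d u))"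
      by (simp only:)
    also have "\<dots> = (indicator {0..s} r * a r) *\<^sub>R (LINT u|lebesgue. indicator {0..r} u *\<^sub>R d u)"
      by (rule integral_scaleR_right)
    finally show ?thesis by (simp add: set_lebesgue_integral_def)
  qed
  have inner2: "(LINT r|lebesgue. F u r) = indicator {0..s} u *\<^sub>R ((LINT r:{u..s}|lebesgue. a r) *\<^sub>R d u)" for u
  proof (cases "u \<in> {0..s}")
    case True
    have i: "set_integrable lebesgue {u..s} a" using True by (intro set_integrable_subset[OF a]) auto
    have "F u r = (indicator {u..s} r *\<^sub>R a r) *\<^sub>R d u" for r using True by (auto simp: F_def d1_def a1_def indicator_def)
    then have "(LINT r|lebesgue. F u r) = (LINT r:{u..s}|lebesgue. a r) *\<^sub>R d u"
      using i by (simp add: set_lebesgue_integral_def set_integrable_def)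
    then show ?thesis using True by simp
  qed (simp add: F_def d1_def)
  have "integrable lebesgue (\<lambda>r. LINT u|lebesgue. F u r)" using leb_pair.integrable_snd[OF Fint] .
  then show "set_integrable lebesgue {0..s} (\<lambda>r. a r *\<^sub>R (LINT u:{0..r}|lebesgue. d u))"
    unfolding inner1 set_integrable_def .
  show "(LINT r:{0..s}|lebesgue. a r *\<^sub>R (LINT u:{0..r}|lebesgue. d u)) = (LINT u:{0..s}|lebesgue. (LINT r:{u..s}|lebesgue. a r) *\<^sub>R d u)"
    using leb_pair.Fubini_integral[OF Fint] unfolding inner1 inner2 by (simp add: set_lebesgue_integral_def)
qed

text \<open>When \<open>a\<close> has the primitive \<open>A\<close>, this is integration by parts of \<open>a\<close> against the primitive of \<open>d\<close>,
  without differentiating that primitive.\<close>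

lemma integral_triangle_FTC:
  fixes d :: "real \<Rightarrow> 'x::{banach, second_countable_topology}" and a A :: "real \<Rightarrow> real"
  assumes d: "set_integrable lebesgue {0..s} d"
    and A: "\<And>r. (A has_real_derivative a r) (at r)" and a: "continuous_on UNIV a"
  shows "set_integrable lebesgue {0..s} (\<lambda>r. a r *\<^sub>R (LINT u:{0..r}|lebesgue. d u))"
    and "(LINT r:{0..s}|lebesgue. a r *\<^sub>R (LINT u:{0..r}|lebesgue. d u)) = (LINT u:{0..s}|lebesgue. (A s - A u) *\<^sub>R d u)"
proof -
  have ai: "set_integrable lebesgue {0..s} a"
  proof (cases "0 \<le> s")
    case True then show ?thesis by (rule FTC_lebesgue(1)[OF _ A a])
  qed (simp add: set_integrable_def)
  show "set_integrable lebesgue {0..s} (\<lambda>r. a r *\<^sub>R (LINT u:{0..r}|lebesgue. d u))"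
    by (rule integral_triangle(1)[OF d ai])
  show "(LINT r:{0..s}|lebesgue. a r *\<^sub>R (LINT u:{0..r}|lebesgue. d u)) = (LINT u:{0..s}|lebesgue. (A s - A u) *\<^sub>R d u)"
    unfolding integral_triangle(2)[OF d ai] unfolding set_lebesgue_integral_def[of lebesgue "{0..s}"]
    using FTC_lebesgue(2)[OF _ A a, of _ s] by (intro Bochner_Integration.integral_cong) (auto simp: indicator_def)
qed

lemma set_integrable_scaleR_continuous:
  fixes d :: "real \<Rightarrow> 'x::{banach, second_countable_topology}" and a :: "real \<Rightarrow> real"
  assumes d: "set_integrable lebesgue {0..s} d" and a: "continuous_on UNIV a"
  shows "set_integrable lebesgue {0..s} (\<lambda>u. a u *\<^sub>R d u)"
proof -
  have ameas [measurable]: "a \<in> borel_measurable lebesgue"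
    using borel_measurable_continuous_onI[OF a] by (simp add: measurable_completion)
  have "compact (a ` {0..s})" using a by (intro compact_continuous_image continuous_on_subset[OF a]) auto
  then obtain M where M: "\<And>r. r \<in> {0..s} \<Longrightarrow> norm (a r) \<le> M"
    using compact_imp_bounded bounded_iff by (metis image_eqI)
  have [measurable]: "(\<lambda>u. indicator {0..s} u *\<^sub>R d u) \<in> borel_measurable lebesgue"
    using d unfolding set_integrable_def by auto
  show ?thesis unfolding set_integrable_def
  proof (rule Bochner_Integration.integrable_bound)
    show "integrable lebesgue (\<lambda>u. M *\<^sub>R (indicator {0..s} u *\<^sub>R d u))"
      using d unfolding set_integrable_def by (intro integrable_scaleR_right)
    have "(\<lambda>u. a u *\<^sub>R (indicator {0..s} u *\<^sub>R d u)) \<in> borel_measurable lebesgue" by measurable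
    then show "(\<lambda>u. indicator {0..s} u *\<^sub>R a u *\<^sub>R d u) \<in> borel_measurable lebesgue" by (simp add: mult.commute)
    have "norm (indicator {0..s} u *\<^sub>R a u *\<^sub>R d u) \<le> norm (M *\<^sub>R (indicator {0..s} u *\<^sub>R d u))" for u
      using M[of u] by (auto simp: indicator_def intro!: mult_right_mono)
    then show "AE u in lebesgue. norm (indicator {0..s} u *\<^sub>R a u *\<^sub>R d u) \<le> norm (M *\<^sub>R (indicator {0..s} u *\<^sub>R d u))" by blast
  qed
qed

lemma emeasure_Icc_finite [simp]: "{a..b::real} \<in> sets lebesgue" "emeasure lebesgue {a..b::real} < \<infinity>"
  by (auto simp: emeasure_lborel_Icc_eq)

text \<open>A primitive is continuous from the right, so it vanishes everywhere, and hence so do the integrals of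
  \<open>d\<close> over all intervals.\<close>

lemma primitive_zero_imp_zero:
  fixes d :: "real \<Rightarrow> 'x::{banach, second_countable_topology}"
  assumes d: "\<And>s. set_integrable lebesgue {0..s} d"
    and zero: "AE s in lebesgue. 0 \<le> s \<longrightarrow> (LINT r:{0..s}|lebesgue. d r) = 0"
  shows "AE s in lebesgue. 0 \<le> s \<longrightarrow> d s = 0"
proof -
  have all: "(LINT r:{0..s}|lebesgue. d r) = 0" if s: "0 \<le> s" for s
  proof -
    \<comment> \<open>An interval is not a null set, so zeros of the primitive accumulate at \<open>s\<close> from the right.\<close>
    have "\<exists>t. s < t \<and> t < s + 1 / real (Suc n) \<and> (LINT r:{0..t}|lebesgue. d r) = 0" for n
    proof (rule ccontr)
      assume *: "\<not> ?thesis"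
      obtain Z where Z: "Z \<in> null_sets lebesgue" "{t. \<not> (0 \<le> t \<longrightarrow> (LINT r:{0..t}|lebesgue. d r) = 0)} \<subseteq> Z"
        using zero by (auto elim: AE_E3 simp: eventually_ae_filter)
      have "{s <..< s + 1 / real (Suc n)} \<subseteq> Z" using * Z(2) s by auto
      then have "emeasure lebesgue {s <..< s + 1 / real (Suc n)} \<le> 0"
        using Z(1) by (metis emeasure_mono null_setsD1 null_setsD2)
      then show False by simp
    qed
    then obtain t where t: "\<And>n. s < t n" "\<And>n. t n < s + 1 / real (Suc n)" "\<And>n. (LINT r:{0..t n}|lebesgue. d r) = 0" by metis
    have "(\<lambda>n. s + 1 / real (Suc n)) \<longlonglongrightarrow> s + 0"
      by (intro tendsto_intros) (use LIMSEQ_inverse_real_of_nat in \<open>simp add: inverse_eq_divide\<close>)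
    then have t_lim: "t \<longlonglongrightarrow> s" using t
      by (auto intro!: tendsto_sandwich[of "\<lambda>_. s" t _ "\<lambda>n. s + 1 / real (Suc n)"] simp: less_imp_le)
    have t_le: "t n \<le> s + 1" for n using t(2)[of n] by (auto intro: order_trans[OF less_imp_le])
    have int: "integrable lebesgue (\<lambda>x. indicator {0..s} x *\<^sub>R d x)" for s using d by (simp add: set_integrable_def)
    have "(\<lambda>n. LINT r:{0..t n}|lebesgue. d r) \<longlonglongrightarrow> (LINT r:{0..s}|lebesgue. d r)"
      unfolding set_lebesgue_integral_def
    proof (rule integral_dominated_convergence[where w = "\<lambda>x. norm (indicator {0..s+1} x *\<^sub>R d x)"])
      show "AE x in lebesgue. norm (indicator {0..t n} x *\<^sub>R d x) \<le> norm (indicator {0..s+1} x *\<^sub>R d x)" for n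
        using t_le[of n] by (auto simp: indicator_def)
      have "(\<lambda>n. indicator {0..t n} x *\<^sub>R d x) \<longlonglongrightarrow> indicator {0..s} x *\<^sub>R d x" for x
      proof (cases "x \<le> s")
        case True
        then have "indicat_real {0..t n} x = indicator {0..s} x" for n using t(1)[of n] by (auto simp: indicator_def)
        then show ?thesis by simp
      next
        case False
        then have "\<forall>\<^sub>F n in sequentially. t n < x" by (intro order_tendstoD(2)[OF t_lim]) simp
        then have "\<forall>\<^sub>F n in sequentially. indicator {0..t n} x *\<^sub>R d x = indicator {0..s} x *\<^sub>R d x"
          by eventually_elim (use False in \<open>auto simp: indicator_def\<close>)
        then show ?thesis by (rule tendsto_eventually)
      qed
      then show "AE x in lebesgue. (\<lambda>n. indicator {0..t n} x *\<^sub>R d x) \<longlonglongrightarrow> indicator {0..s} x *\<^sub>R d x" by blast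
      show "integrable lebesgue (\<lambda>x. norm (indicator {0..s+1} x *\<^sub>R d x))" by (rule integrable_norm[OF int])
    qed (use int in \<open>auto intro!: borel_measurable_integrable\<close>)
    then show ?thesis using t(3) by (simp add: LIMSEQ_const_iff)
  qed
  define f where "f x = indicator {0..} x *\<^sub>R d x" for x
  have I: "indicator {a..b} x *\<^sub>R f x = indicator {0..b} x *\<^sub>R d x - indicator {0..<max 0 a} x *\<^sub>R d x" if "max 0 a \<le> b" for a b x
    using that by (auto simp: f_def indicator_def)
  have "AE x in lebesgue. f x = 0"
  proof (rule AE_zero_if_interval_integrals_zero)
    fix n :: nat
    have "indicator {- real n..real n} x *\<^sub>R f x = indicator {0..real n} x *\<^sub>R d x" for x
      by (auto simp: f_def indicator_def)
    then show "set_integrable lebesgue {- real n..real n} f" using d[of "real n"] by (simp add: set_integrable_def)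
  next
    fix a b :: real
    show "(LINT x:{a..b}|lebesgue. f x) = 0"
    proof (cases "max 0 a \<le> b")
      case True
      have "AE x in lebesgue. x \<noteq> max 0 a" by (rule AE_completion) (rule AE_lborel_singleton)
      then have "AE x in lebesgue. indicator {a..b} x *\<^sub>R f x = indicator {0..b} x *\<^sub>R d x - indicator {0..max 0 a} x *\<^sub>R d x"
        by eventually_elim (use I[OF True] in \<open>auto simp: indicator_def\<close>)
      moreover have m: "(\<lambda>x. indicator {0..b} x *\<^sub>R d x - indicator {0..max 0 a} x *\<^sub>R d x) \<in> borel_measurable lebesgue"
        using d by (intro borel_measurable_diff borel_measurable_integrable) (auto simp: set_integrable_def)
      moreover have "(\<lambda>x. indicator {a..b} x *\<^sub>R f x) \<in> borel_measurable lebesgue"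
      proof -
        have eq: "(\<lambda>x. indicator {a..b} x *\<^sub>R f x) = (\<lambda>x. indicat_real {a..b} x *\<^sub>R (indicator {0..b} x *\<^sub>R d x))"
          by (auto simp: f_def indicator_def)
        have *: "(\<lambda>x. indicator {0..b} x *\<^sub>R d x) \<in> borel_measurable lebesgue"
          using d by (intro borel_measurable_integrable) (auto simp: set_integrable_def)
        show ?thesis unfolding eq by (rule borel_measurable_scaleR[OF _ *]) measurable
      qed
      ultimately have "(LINT x:{a..b}|lebesgue. f x) = (LINT x|lebesgue. indicator {0..b} x *\<^sub>R d x - indicator {0..max 0 a} x *\<^sub>R d x)"
        unfolding set_lebesgue_integral_def by (intro integral_cong_AE) auto
      also have "\<dots> = (LINT r:{0..b}|lebesgue. d r) - (LINT r:{0..max 0 a}|lebesgue. d r)"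
        using d by (simp add: set_lebesgue_integral_def set_integrable_def)
      also have "\<dots> = 0" using all[of b] all[of "max 0 a"] True by simp
      finally show ?thesis .
    next
      case False
      then have "(\<lambda>x. indicator {a..b} x *\<^sub>R f x) = (\<lambda>x. 0)" by (auto simp: f_def indicator_def)
      then show ?thesis unfolding set_lebesgue_integral_def by (simp only: integral_zero)
    qed
  qed
  then show ?thesis by eventually_elim (auto simp: f_def)
qed

lemma exp_kernel_integral:
  fixes lam s :: real
  assumes "lam > 0"
  shows "set_integrable lebesgue {0..s} (\<lambda>r. exp (- lam * (s - r)))"
    and "(LINT r:{0..s}|lebesgue. exp (- lam * (s - r))) \<le> 1 / lam"
proof -
  have der: "((\<lambda>r. exp (- lam * (s - r)) / lam) has_real_derivative exp (- lam * (s - r))) (at r)" for r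
    using assms by (auto intro!: derivative_eq_intros)
  have cont: "continuous_on UNIV (\<lambda>r. exp (- lam * (s - r)))" by (intro continuous_intros)
  show "set_integrable lebesgue {0..s} (\<lambda>r. exp (- lam * (s - r)))"
  proof (cases "0 \<le> s")
    case True then show ?thesis by (rule FTC_lebesgue(1)[OF _ der cont])
  qed (simp add: set_integrable_def)
  show "(LINT r:{0..s}|lebesgue. exp (- lam * (s - r))) \<le> 1 / lam"
  proof (cases "0 \<le> s")
    case True then show ?thesis using FTC_lebesgue(2)[OF True der cont] assms by simp
  qed (use assms in \<open>simp add: set_lebesgue_integral_def\<close>)
qed

text \<open>Schur's test for the kernel \<open>exp (- \<lambda> (s - r))\<close> on \<open>0 \<le> r \<le> s\<close>, whose integrals in
  either variable are at most \<open>1 / \<lambda>\<close>.\<close>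

lemma Schur_exp:
  fixes h :: "real \<Rightarrow> real"
  assumes lam: "lam > 0" and h: "integrable lebesgue (\<lambda>r. (h r)\<^sup>2)" and hm[measurable]: "h \<in> borel_measurable lebesgue"
  defines "I \<equiv> \<lambda>s. LINT r:{0..s}|lebesgue. exp (- lam * (s - r)) * h r"
  shows "(\<integral>\<^sup>+s. ennreal ((I s)\<^sup>2) \<partial>lebesgue) \<le> ennreal ((LINT r|lebesgue. (h r)\<^sup>2) / lam\<^sup>2)"
proof -
  define k where "k s r = indicat_real {0..s} r * exp (- lam * (s - r))" for s r
  have k0: "0 \<le> k s r" "k s r \<le> 1" for s r using lam by (auto simp: k_def indicator_def mult_le_0_iff)
  have km: "case_prod k \<in> borel_measurable (lebesgue \<Otimes>\<^sub>M lebesgue)"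
    unfolding k_def case_prod_beta indicator_def atLeastAtMost_iff by measurable
  have km1 [measurable]: "(\<lambda>r. k s r) \<in> borel_measurable lebesgue" for s using measurable_Pair2[OF km, of s] by simp
  have kint: "integrable lebesgue (\<lambda>r. k s r)" "(LINT r|lebesgue. k s r) \<le> 1 / lam" for s
    using exp_kernel_integral[OF lam, of s] by (simp_all add: k_def set_integrable_def set_lebesgue_integral_def)
  have kh2: "integrable lebesgue (\<lambda>r. k s r * (h r)\<^sup>2)" for s
    by (rule Bochner_Integration.integrable_bound[OF h]) (use k0[of s] in \<open>auto intro!: mult_left_le_one_le simp: abs_mult\<close>)
  have kh: "integrable lebesgue (\<lambda>r. k s r * h r)" for s
  proof (rule Bochner_Integration.integrable_bound)
    show "integrable lebesgue (\<lambda>r. k s r + k s r * (h r)\<^sup>2)" by (intro Bochner_Integration.integrable_add kint kh2)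
    have "\<bar>x\<bar> \<le> 1 + x\<^sup>2" for x :: real
      using zero_le_power2[of "\<bar>x\<bar> - 1 / 2"] by (simp add: power2_eq_square algebra_simps)
    then have "k s r * \<bar>h r\<bar> \<le> k s r * (1 + (h r)\<^sup>2)" for r by (intro mult_left_mono k0)
    then show "AE r in lebesgue. norm (k s r * h r) \<le> norm (k s r + k s r * (h r)\<^sup>2)"
      using k0[of s] by (auto simp: abs_mult algebra_simps)
  qed measurable
  have Is: "I s = (LINT r|lebesgue. k s r * h r)" for s
    unfolding I_def k_def set_lebesgue_integral_def by (simp add: mult.assoc)
  have jensen: "(I s)\<^sup>2 \<le> (1 / lam) * (LINT r|lebesgue. k s r * (h r)\<^sup>2)" for s
  proof -
    \<comment> \<open>Expanding \<open>\<integral> k (h - t)\<^sup>2 \<ge> 0\<close> with this \<open>t\<close> is the Cauchy-Schwarz inequality for the measure \<open>k dr\<close> of mass at most \<open>1 / \<lambda>\<close>.\<close>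
    define t where "t = lam * I s"
    have "0 \<le> (LINT r|lebesgue. k s r * (h r - t)\<^sup>2)" using k0 by (intro integral_nonneg_AE) auto
    also have "\<dots> = (LINT r|lebesgue. k s r * (h r)\<^sup>2 - 2 * t * (k s r * h r) + t\<^sup>2 * k s r)"
      by (intro Bochner_Integration.integral_cong) (auto simp: power2_eq_square algebra_simps)
    also have "\<dots> = (LINT r|lebesgue. k s r * (h r)\<^sup>2) - 2 * t * I s + t\<^sup>2 * (LINT r|lebesgue. k s r)"
      using kint kh kh2 by (simp add: Is)
    also have "\<dots> \<le> (LINT r|lebesgue. k s r * (h r)\<^sup>2) - 2 * t * I s + t\<^sup>2 * (1 / lam)"
      by (intro add_left_mono mult_left_mono kint) simp
    also have "\<dots> = (LINT r|lebesgue. k s r * (h r)\<^sup>2) - lam * (I s)\<^sup>2"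
      using lam by (simp add: t_def power2_eq_square)
    finally show ?thesis using lam by (simp add: field_simps)
  qed
  have "(\<integral>\<^sup>+s. ennreal ((I s)\<^sup>2) \<partial>lebesgue) \<le> (\<integral>\<^sup>+s. (\<integral>\<^sup>+r. ennreal (k s r * (h r)\<^sup>2 / lam) \<partial>lebesgue) \<partial>lebesgue)"
  proof (rule nn_integral_mono)
    fix s
    have "ennreal ((I s)\<^sup>2) \<le> ennreal (LINT r|lebesgue. k s r * (h r)\<^sup>2 / lam)"
      using jensen[of s] by (intro ennreal_leI) simp
    also have "\<dots> = (\<integral>\<^sup>+r. ennreal (k s r * (h r)\<^sup>2 / lam) \<partial>lebesgue)"
      using kh2[of s] k0[of s] lam by (intro nn_integral_eq_integral[symmetric]) auto
    finally show "ennreal ((I s)\<^sup>2) \<le> (\<integral>\<^sup>+r. ennreal (k s r * (h r)\<^sup>2 / lam) \<partial>lebesgue)" .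
  qed
  also have "\<dots> = (\<integral>\<^sup>+r. (\<integral>\<^sup>+s. ennreal (k s r * (h r)\<^sup>2 / lam) \<partial>lebesgue) \<partial>lebesgue)"
  proof (rule leb_pair.Fubini'[symmetric])
    show "(\<lambda>(s, r). ennreal (k s r * (h r)\<^sup>2 / lam)) \<in> borel_measurable (lebesgue \<Otimes>\<^sub>M lebesgue)"
      using km unfolding case_prod_beta by measurable
  qed
  also have "\<dots> \<le> (\<integral>\<^sup>+r. ennreal ((h r)\<^sup>2 / lam\<^sup>2) \<partial>lebesgue)"
  proof (rule nn_integral_mono)
    fix r
    have "(\<integral>\<^sup>+s. ennreal (k s r * (h r)\<^sup>2 / lam) \<partial>lebesgue) \<le> (\<integral>\<^sup>+s. ennreal ((h r)\<^sup>2 / lam) * (ennreal (exp (- lam * (s - r))) * indicator {r..} s) \<partial>lebesgue)"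
    proof (rule nn_integral_mono)
      fix s
      show "ennreal (k s r * (h r)\<^sup>2 / lam) \<le> ennreal ((h r)\<^sup>2 / lam) * (ennreal (exp (- lam * (s - r))) * indicator {r..} s)"
        using lam by (auto simp: k_def indicator_def ennreal_mult[symmetric] mult.commute)
    qed
    also have "\<dots> = ennreal ((h r)\<^sup>2 / lam) * (\<integral>\<^sup>+s. ennreal (exp (- lam * (s - r))) * indicator {r..} s \<partial>lborel)"
      by (subst nn_integral_completion) (simp_all add: nn_integral_cmult)
    also have "(\<integral>\<^sup>+s. ennreal (exp (- lam * (s - r))) * indicator {r..} s \<partial>lborel) = ennreal (0 - (- exp (- lam * (r - r)) / lam))"
    proof -
      have der: "((\<lambda>s. - exp (- lam * (s - r)) / lam) has_real_derivative exp (- lam * (s - r))) (at s)" for s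
        using lam by (auto intro!: derivative_eq_intros)
      have "filterlim (\<lambda>s. - lam * (s - r)) at_bot at_top"
      proof (rule filterlim_tendsto_neg_mult_at_bot[OF tendsto_const])
        show "filterlim (\<lambda>s. s - r) at_top at_top"
          using filterlim_tendsto_add_at_top[OF tendsto_const[of "- r"] filterlim_ident] by simp
      qed (use lam in simp)
      then have "((\<lambda>s. exp (- lam * (s - r))) \<longlongrightarrow> 0) at_top" by (rule filterlim_compose[OF exp_at_bot])
      from tendsto_mult_right[OF this, of "- 1 / lam"]
      have lim: "((\<lambda>s. - exp (- lam * (s - r)) / lam) \<longlongrightarrow> 0) at_top" by simp
      show ?thesis by (rule nn_integral_FTC_atLeast[OF _ der _ lim]) auto
    qed
    also have "ennreal ((h r)\<^sup>2 / lam) * ennreal (0 - (- exp (- lam * (r - r)) / lam)) = ennreal ((h r)\<^sup>2 / lam\<^sup>2)"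
      using lam by (simp add: ennreal_mult[symmetric] power2_eq_square)
    finally show "(\<integral>\<^sup>+s. ennreal (k s r * (h r)\<^sup>2 / lam) \<partial>lebesgue) \<le> ennreal ((h r)\<^sup>2 / lam\<^sup>2)" .
  qed
  also have "\<dots> = ennreal (LINT r|lebesgue. (h r)\<^sup>2 / lam\<^sup>2)"
    using h by (intro nn_integral_eq_integral) auto
  finally show ?thesis by simp
qed

section \<open>Histories with a decreasing weight\<close>

text \<open>A history \<open>w\<close> with weight \<open>g\<close> is represented by \<open>y = \<omega> w\<close> with \<open>\<omega> = sqrt g\<close> on the half line,
  which turns the weighted space into a subspace of an unweighted one. Histories take values in
  the range of a projection \<open>pr\<close>.\<close>

locale weight =
  fixes \<omega> :: "real \<Rightarrow> real" and pr :: "'x::{real_inner, banach, second_countable_topology} \<Rightarrow> 'x"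
  assumes w_meas [measurable]: "\<omega> \<in> borel_measurable lebesgue"
    and w_nonneg: "0 \<le> \<omega> s" and w_neg: "s < 0 \<Longrightarrow> \<omega> s = 0"
    and w_antimono: "0 \<le> r \<Longrightarrow> r \<le> s \<Longrightarrow> \<omega> s \<le> \<omega> r"
    and w_sq: "integrable lebesgue (\<lambda>s. (\<omega> s)\<^sup>2)"
    and w_alt: "(\<forall>s\<ge>0. \<omega> s > 0) \<or> (\<forall>s. \<omega> s = 0)"
    and pr_linear: "bounded_linear pr" and pr_idem: "pr (pr a) = pr a"
begin

sublocale pr: bounded_linear pr by (rule pr_linear)

definition supp :: "real \<Rightarrow> real" where "supp s = (if \<omega> s = 0 then 0 else 1)"

lemma supp_meas [measurable]: "supp \<in> borel_measurable lebesgue"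
  unfolding supp_def by measurable

lemma pr_meas [measurable (raw)]: "f \<in> borel_measurable M \<Longrightarrow> (\<lambda>x. pr (f x)) \<in> borel_measurable M"
  by (rule borel_measurable_continuous_on[OF _ ]) (auto intro: linear_continuous_on pr_linear)

text \<open>Outside the support of the weight, in particular on the negative half line, an encoded history is zero.\<close>

definition Hist :: "'x L2t set" where
  "Hist = {y. AE s in lebesgue. fn y s = supp s *\<^sub>R pr (fn y s)}"

lemma sq_integrable_cut: assumes f: "sq_integrable f" shows "sq_integrable (\<lambda>s. supp s *\<^sub>R pr (f s))"
proof -
  note [measurable] = sq_integrable_measurable[OF f]
  obtain K where K: "K \<ge> 0" "\<And>x. norm (pr x) \<le> norm x * K" using pr.nonneg_bounded by blast
  show ?thesis
  proof (rule sq_integrable_bound)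
    show "integrable lebesgue (\<lambda>s. (norm (f s))\<^sup>2 * K\<^sup>2)" using sq_integrable_norm[OF f] by simp
    have "(norm (supp s *\<^sub>R pr (f s)))\<^sup>2 \<le> (norm (f s) * K)\<^sup>2" for s
      using K by (intro power_mono) (auto simp: supp_def)
    then show "AE s in lebesgue. (norm (supp s *\<^sub>R pr (f s)))\<^sup>2 \<le> (norm (f s))\<^sup>2 * K\<^sup>2"
      by (simp add: power_mult_distrib)
  qed measurable
qed

text \<open>The projection onto \<open>Hist\<close>, used to see that \<open>Hist\<close> is a closed subspace.\<close>

definition cut :: "'x L2t \<Rightarrow> 'x L2t" where "cut y = cls (\<lambda>s. supp s *\<^sub>R pr (fn y s))"

lemma fn_cut: "AE s in lebesgue. fn (cut y) s = supp s *\<^sub>R pr (fn y s)"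
  unfolding cut_def by (rule fn_cls[OF sq_integrable_cut]) simp

lemma Hist_iff_cut: "y \<in> Hist \<longleftrightarrow> cut y = y"
proof
  assume "y \<in> Hist"
  then have "AE s in lebesgue. fn y s = supp s *\<^sub>R pr (fn y s)" by (simp add: Hist_def)
  then have "AE s in lebesgue. fn (cut y) s = fn y s" using fn_cut[of y] by eventually_elim simp
  then show "cut y = y" by (rule L2t_eqI)
next
  assume "cut y = y" then show "y \<in> Hist" using fn_cut[of y] by (simp add: Hist_def)
qed

lemma bounded_linear_cut: "bounded_linear cut"
proof -
  obtain K where K: "K \<ge> 0" "\<And>x. norm (pr x) \<le> norm x * K" using pr.nonneg_bounded by blast
  show ?thesis
  proof (rule bounded_linear_intro)
    fix x y :: "'x L2t" and r :: real
    have "AE s in lebesgue. fn (cut (x + y)) s = fn (cut x + cut y) s"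
      using fn_cut[of "x + y"] fn_cut[of x] fn_cut[of y] fn_add[of x y] fn_add[of "cut x" "cut y"]
      by eventually_elim (simp add: pr.add scaleR_add_right)
    then show "cut (x + y) = cut x + cut y" by (rule L2t_eqI)
    have "AE s in lebesgue. fn (cut (r *\<^sub>R x)) s = fn (r *\<^sub>R cut x) s"
      using fn_cut[of "r *\<^sub>R x"] fn_cut[of x] fn_scaleR[of r x] fn_scaleR[of r "cut x"]
      by eventually_elim (simp add: pr.scaleR mult.commute)
    then show "cut (r *\<^sub>R x) = r *\<^sub>R cut x" by (rule L2t_eqI)
    have "(norm (cut x))\<^sup>2 \<le> (LINT s|lebesgue. K\<^sup>2 * (norm (fn x s))\<^sup>2)"
      unfolding cut_def norm_sq_cls[OF sq_integrable_cut[OF sq_integrable_fn]]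
    proof (rule integral_mono)
      show "integrable lebesgue (\<lambda>s. (norm (supp s *\<^sub>R pr (fn x s)))\<^sup>2)"
        by (intro sq_integrable_norm sq_integrable_cut) simp
      have "(norm (supp s *\<^sub>R pr (fn x s)))\<^sup>2 \<le> (norm (fn x s) * K)\<^sup>2" for s
        using K by (intro power_mono) (auto simp: supp_def)
      then show "(norm (supp s *\<^sub>R pr (fn x s)))\<^sup>2 \<le> K\<^sup>2 * (norm (fn x s))\<^sup>2" for s
        by (simp add: power_mult_distrib mult.commute)
    qed (use sq_integrable_norm[OF sq_integrable_fn[of x]] in simp)
    also have "\<dots> = (norm x * K)\<^sup>2" by (simp add: norm_sq_fn power_mult_distrib mult.commute)
    finally show "norm (cut x) \<le> norm x * K" by (rule power2_le_imp_le) (use K in simp)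
  qed
qed

lemma subspace_Hist: "subspace Hist" and closed_Hist: "closed Hist"
proof -
  interpret c: bounded_linear cut by (rule bounded_linear_cut)
  have eq: "Hist = {y. cut y = y}" using Hist_iff_cut by auto
  show "subspace Hist" unfolding eq by (rule subspaceI) (auto simp: c.zero c.add c.scaleR)
  show "closed Hist" unfolding eq
    by (intro closed_Collect_eq linear_continuous_on bounded_linear_cut continuous_on_id)
qed

lemma sq_integrable_const: "sq_integrable (\<lambda>s. \<omega> s *\<^sub>R a)"
  by (rule sq_integrable_bound[where g = "\<lambda>s. (\<omega> s)\<^sup>2 * (norm a)\<^sup>2"])
    (auto simp: power_mult_distrib intro: w_sq)

text \<open>The encoding of the constant history with value \<open>a\<close>.\<close>

definition E :: "'x \<Rightarrow> 'x L2t" where "E a = cls (\<lambda>s. \<omega> s *\<^sub>R a)"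

lemma fn_E: "AE s in lebesgue. fn (E a) s = \<omega> s *\<^sub>R a"
  unfolding E_def by (rule fn_cls[OF sq_integrable_const])

lemma bounded_linear_E: "bounded_linear E"
proof (rule bounded_linear_intro)
  fix a b :: 'x and r :: real
  show "E (a + b) = E a + E b"
    unfolding E_def by (simp add: cls_add[OF sq_integrable_const sq_integrable_const] scaleR_add_right)
  show "E (r *\<^sub>R a) = r *\<^sub>R E a"
    unfolding E_def by (simp add: cls_scaleR[OF sq_integrable_const] mult.commute)
  have "(norm (E a))\<^sup>2 = (norm a * sqrt (LINT s|lebesgue. (\<omega> s)\<^sup>2))\<^sup>2"
    unfolding E_def norm_sq_cls[OF sq_integrable_const] by (simp add: power_mult_distrib mult.commute)
  then show "norm (E a) \<le> norm a * sqrt (LINT s|lebesgue. (\<omega> s)\<^sup>2)" by (rule power2_le_imp_le[OF eq_refl]) (auto intro!: mult_nonneg_nonneg)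
qed

lemma E_in_Hist: assumes "pr a = a" shows "E a \<in> Hist"
  unfolding Hist_def mem_Collect_eq using fn_E[of a]
  by eventually_elim (simp add: supp_def pr.scaleR assms)

definition unweight :: "'x L2t \<Rightarrow> real \<Rightarrow> 'x" where "unweight y s = (1 / \<omega> s) *\<^sub>R fn y s"

lemma unweight_meas [measurable]: "unweight y \<in> borel_measurable lebesgue"
  unfolding unweight_def by measurable

text \<open>Going back in the history the weight only grows. This is the inequality that bounds the
  convolution below.\<close>

lemma unweight_bound: "0 \<le> r \<Longrightarrow> r \<le> s \<Longrightarrow> \<omega> s * norm (unweight y r) \<le> norm (fn y r)"
proof (cases "\<omega> r = 0")
  case False
  assume "0 \<le> r" "r \<le> s"
  then have "\<omega> s / \<omega> r \<le> 1" using w_antimono[of r s] w_nonneg[of r] False by (simp add: divide_le_eq_1)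
  then have "(\<omega> s / \<omega> r) * norm (fn y r) \<le> 1 * norm (fn y r)" by (intro mult_right_mono) auto
  then show ?thesis using w_nonneg[of r] by (simp add: unweight_def)
qed (simp add: unweight_def)

text \<open>On \<open>[0, s]\<close> the weight is bounded below by \<open>\<omega> s\<close>, which is positive unless the weight vanishes
  identically.\<close>

lemma unweight_integrable: "set_integrable lebesgue {0..s} (unweight y)"
proof (cases "\<forall>s. \<omega> s = 0")
  case True
  then show ?thesis by (simp add: unweight_def set_integrable_def)
next
  case False
  show ?thesis
  proof (cases "0 \<le> s")
    case True
    then have pos: "\<omega> s > 0" using False w_alt by blast
    have i: "set_integrable lebesgue {0..s} (fn y)" by (intro sq_integrable_set_integrable emeasure_Icc_finite) simp
    show ?thesis unfolding set_integrable_def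
    proof (rule Bochner_Integration.integrable_bound)
      show "integrable lebesgue (\<lambda>r. (1 / \<omega> s) *\<^sub>R (indicator {0..s} r *\<^sub>R fn y r))"
        using i unfolding set_integrable_def by (intro integrable_scaleR_right)
      have "norm (unweight y r) \<le> (1 / \<omega> s) * norm (fn y r)" if "0 \<le> r" "r \<le> s" for r
        using unweight_bound[OF that, of y] pos by (simp add: field_simps)
      then show "AE r in lebesgue. norm (indicator {0..s} r *\<^sub>R unweight y r) \<le> norm ((1 / \<omega> s) *\<^sub>R (indicator {0..s} r *\<^sub>R fn y r))"
        using pos by (auto simp: indicator_def)
    qed measurable
  qed (simp add: set_integrable_def)
qed

text \<open>\<open>hist y z\<close>: the history of \<open>y\<close> vanishes at \<open>0\<close> and has the derivative represented by \<open>z\<close>.\<close>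

definition hist :: "'x L2t \<Rightarrow> 'x L2t \<Rightarrow> bool" where
  "hist y z \<longleftrightarrow> y \<in> Hist \<and> z \<in> Hist \<and>
     (AE s in lebesgue. 0 \<le> s \<longrightarrow> fn y s = \<omega> s *\<^sub>R (LINT r:{0..s}|lebesgue. unweight z r))"

lemma set_integral_cong_ae:
  fixes f g :: "real \<Rightarrow> 'y::{banach, second_countable_topology}"
  assumes "set_integrable lebesgue A f" "set_integrable lebesgue A g" "AE r in lebesgue. r \<in> A \<longrightarrow> f r = g r"
  shows "(LINT r:A|lebesgue. f r) = (LINT r:A|lebesgue. g r)"
  unfolding set_lebesgue_integral_def
proof (rule integral_cong_AE)
  show "AE r in lebesgue. indicator A r *\<^sub>R f r = indicator A r *\<^sub>R g r"
    using assms(3) by eventually_elim (auto simp: indicator_def)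
qed (use assms in \<open>auto simp: set_integrable_def intro: borel_measurable_integrable\<close>)

text \<open>Existence and uniqueness for \<open>V' + \<lambda> V = c\<close>, \<open>V 0 = 0\<close>, in integrated form: the convolution \<open>V\<close> is a
  solution, and the convolution of \<open>W' + \<lambda> W\<close> recovers \<open>W\<close>.\<close>

lemma exp_convolution_solves:
  fixes c :: "real \<Rightarrow> 'x" and lam :: real
  assumes c: "\<And>s. set_integrable lebesgue {0..s} c"
  defines "V \<equiv> \<lambda>s. LINT r:{0..s}|lebesgue. exp (- lam * (s - r)) *\<^sub>R c r"
    and "W \<equiv> \<lambda>s. LINT r:{0..s}|lebesgue. c r"
  shows "set_integrable lebesgue {0..s} V" "set_integrable lebesgue {0..s} W"
    and "(LINT r:{0..s}|lebesgue. c r - lam *\<^sub>R V r) = V s"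
    and "(LINT r:{0..s}|lebesgue. exp (- lam * (s - r)) *\<^sub>R (c r + lam *\<^sub>R W r)) = W s"
proof -
  define d where "d u = exp (lam * u) *\<^sub>R c u" for u
  have d: "set_integrable lebesgue {0..s} d" for s
    unfolding d_def by (intro set_integrable_scaleR_continuous c continuous_intros)
  have V: "V s = exp (- lam * s) *\<^sub>R (LINT u:{0..s}|lebesgue. d u)" for s
  proof -
    have "exp (- lam * (s - r)) *\<^sub>R c r = exp (- lam * s) *\<^sub>R d r" for r
      by (simp add: d_def algebra_simps flip: exp_add)
    then show ?thesis unfolding V_def by simp
  qed
  have derA: "((\<lambda>r. - exp (- lam * r)) has_real_derivative lam * exp (- lam * r)) (at r)" for r
    by (auto intro!: derivative_eq_intros)
  have contA: "continuous_on UNIV (\<lambda>r. lam * exp (- lam * r))" by (intro continuous_intros)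
  have lamV: "lam *\<^sub>R V r = (lam * exp (- lam * r)) *\<^sub>R (LINT u:{0..r}|lebesgue. d u)" for r by (simp add: V)
  have iV: "set_integrable lebesgue {0..s} (\<lambda>r. lam *\<^sub>R V r)" for s
    unfolding lamV by (rule integral_triangle_FTC(1)[OF d derA contA])
  have der1: "((\<lambda>r. r) has_real_derivative 1) (at r)" for r :: real by (rule DERIV_ident)
  show iW: "set_integrable lebesgue {0..s} W" for s
    using integral_triangle_FTC(1)[OF c der1 continuous_on_const] by (simp add: W_def)
  have "set_integrable lebesgue {0..s} (\<lambda>r. exp (- lam * r) *\<^sub>R (1 *\<^sub>R (LINT u:{0..r}|lebesgue. d u)))" for s
    by (intro set_integrable_scaleR_continuous integral_triangle_FTC(1)[OF d der1 continuous_on_const] continuous_intros)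
  then show "set_integrable lebesgue {0..s} V" for s by (simp add: V[abs_def])
  have "(LINT r:{0..s}|lebesgue. lam *\<^sub>R V r) = (LINT u:{0..s}|lebesgue. (- exp (- lam * s) - - exp (- lam * u)) *\<^sub>R d u)"
    unfolding lamV by (rule integral_triangle_FTC(2)[OF d derA contA])
  also have "\<dots> = (LINT u:{0..s}|lebesgue. c u - exp (- lam * s) *\<^sub>R d u)"
  proof -
    have "(- exp (- lam * s) - - exp (- lam * u)) *\<^sub>R d u = c u - exp (- lam * s) *\<^sub>R d u" for u
      by (simp add: d_def algebra_simps flip: exp_add)
    then show ?thesis by simp
  qed
  also have "\<dots> = W s - V s"
    unfolding V W_def using c d by (subst set_integral_diff(2)) (auto intro: set_integrable_scaleR_right)
  finally have "(LINT r:{0..s}|lebesgue. lam *\<^sub>R V r) = W s - V s" .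
  moreover have "(LINT r:{0..s}|lebesgue. c r - lam *\<^sub>R V r) = W s - (LINT r:{0..s}|lebesgue. lam *\<^sub>R V r)"
    unfolding W_def by (rule set_integral_diff(2)[OF c iV])
  ultimately show "(LINT r:{0..s}|lebesgue. c r - lam *\<^sub>R V r) = V s" by simp
  have derB: "((\<lambda>r. exp (lam * r)) has_real_derivative lam * exp (lam * r)) (at r)" for r
    by (auto intro!: derivative_eq_intros)
  have contB: "continuous_on UNIV (\<lambda>r. lam * exp (lam * r))" by (intro continuous_intros)
  have iB: "set_integrable lebesgue {0..s} (\<lambda>r. (lam * exp (lam * r)) *\<^sub>R W r)"
    unfolding W_def by (rule integral_triangle_FTC(1)[OF c derB contB])
  have "(LINT r:{0..s}|lebesgue. (lam * exp (lam * r)) *\<^sub>R W r) = (LINT u:{0..s}|lebesgue. (exp (lam * s) - exp (lam * u)) *\<^sub>R c u)"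
    unfolding W_def by (rule integral_triangle_FTC(2)[OF c derB contB])
  also have "\<dots> = (LINT u:{0..s}|lebesgue. exp (lam * s) *\<^sub>R c u - d u)"
    by (simp add: d_def scaleR_diff_left)
  also have "\<dots> = exp (lam * s) *\<^sub>R W s - (LINT u:{0..s}|lebesgue. d u)"
    unfolding W_def using c d by (subst set_integral_diff(2)) (auto intro: set_integrable_scaleR_right)
  finally have B: "(LINT r:{0..s}|lebesgue. (lam * exp (lam * r)) *\<^sub>R W r) = exp (lam * s) *\<^sub>R W s - (LINT u:{0..s}|lebesgue. d u)" .
  have "exp (- lam * (s - r)) *\<^sub>R (c r + lam *\<^sub>R W r) = exp (- lam * s) *\<^sub>R (d r + (lam * exp (lam * r)) *\<^sub>R W r)" for r
  proof -
    have "exp (- lam * (s - r)) = exp (- lam * s) * exp (lam * r)" by (simp add: algebra_simps flip: exp_add)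
    then show ?thesis by (simp add: d_def scaleR_add_right mult.commute mult.left_commute)
  qed
  then have "(LINT r:{0..s}|lebesgue. exp (- lam * (s - r)) *\<^sub>R (c r + lam *\<^sub>R W r))
      = exp (- lam * s) *\<^sub>R (LINT r:{0..s}|lebesgue. d r + (lam * exp (lam * r)) *\<^sub>R W r)"
    by simp
  also have "\<dots> = exp (- lam * s) *\<^sub>R (exp (lam * s) *\<^sub>R W s)"
    by (subst set_integral_add(2)[OF d iB]) (simp add: B)
  also have "\<dots> = W s" by (simp flip: exp_add)
  finally show "(LINT r:{0..s}|lebesgue. exp (- lam * (s - r)) *\<^sub>R (c r + lam *\<^sub>R W r)) = W s" .
qed

text \<open>The solution of \<open>w' + \<lambda> w = f\<close>, \<open>w(0) = 0\<close>, in the encoding by \<open>\<omega> w\<close>.\<close>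

definition vol :: "real \<Rightarrow> 'x L2t \<Rightarrow> real \<Rightarrow> 'x" where
  "vol lam f s = \<omega> s *\<^sub>R (LINT r:{0..s}|lebesgue. exp (- lam * (s - r)) *\<^sub>R unweight f r)"

lemma vol_meas [measurable]: "vol lam f \<in> borel_measurable lebesgue"
  unfolding vol_def set_lebesgue_integral_def indicator_def atLeastAtMost_iff by measurable

text \<open>By \<open>unweight_bound\<close> the outer weight can be moved into the integral, where it cancels the
  division by the weight; what remains is the unweighted convolution of Schur's test.\<close>

lemma vol_bound: "norm (vol lam f s) \<le> (LINT r:{0..s}|lebesgue. exp (- lam * (s - r)) * norm (fn f r))"
proof -
  let ?k = "\<lambda>r. exp (- lam * (s - r))"
  have i1: "set_integrable lebesgue {0..s} (\<lambda>r. ?k r *\<^sub>R unweight f r)"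
    by (intro set_integrable_scaleR_continuous unweight_integrable continuous_intros)
  have "set_integrable lebesgue {0..s} (fn f)" by (intro sq_integrable_set_integrable emeasure_Icc_finite) simp
  then have i2: "set_integrable lebesgue {0..s} (\<lambda>r. ?k r *\<^sub>R fn f r)"
    by (intro set_integrable_scaleR_continuous continuous_intros)
  have "norm (vol lam f s) \<le> \<omega> s * (LINT r|lebesgue. norm (indicator {0..s} r *\<^sub>R ?k r *\<^sub>R unweight f r))"
  proof -
    have "norm (vol lam f s) = \<omega> s * norm (LINT r|lebesgue. indicator {0..s} r *\<^sub>R ?k r *\<^sub>R unweight f r)"
      by (simp only: vol_def norm_scaleR abs_of_nonneg[OF w_nonneg] set_lebesgue_integral_def)
    also have "\<dots> \<le> \<omega> s * (LINT r|lebesgue. norm (indicator {0..s} r *\<^sub>R ?k r *\<^sub>R unweight f r))"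
      by (intro mult_left_mono integral_norm_bound w_nonneg)
    finally show ?thesis .
  qed
  also have "\<dots> = (LINT r|lebesgue. \<omega> s * norm (indicator {0..s} r *\<^sub>R ?k r *\<^sub>R unweight f r))" by simp
  also have "\<dots> \<le> (LINT r|lebesgue. norm (indicator {0..s} r *\<^sub>R ?k r *\<^sub>R fn f r))"
  proof (rule integral_mono)
    show "integrable lebesgue (\<lambda>r. \<omega> s * norm (indicator {0..s} r *\<^sub>R ?k r *\<^sub>R unweight f r))"
      using i1 unfolding set_integrable_def by (intro integrable_mult_right integrable_norm)
    show "integrable lebesgue (\<lambda>r. norm (indicator {0..s} r *\<^sub>R ?k r *\<^sub>R fn f r))"
      using i2 unfolding set_integrable_def by (intro integrable_norm)
    show "\<omega> s * norm (indicator {0..s} r *\<^sub>R ?k r *\<^sub>R unweight f r) \<le> norm (indicator {0..s} r *\<^sub>R ?k r *\<^sub>R fn f r)" for r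
    proof (cases "r \<in> {0..s}")
      case True
      then have "?k r * (\<omega> s * norm (unweight f r)) \<le> ?k r * norm (fn f r)"
        by (intro mult_left_mono unweight_bound) auto
      then show ?thesis using True by (simp add: mult.left_commute)
    qed simp
  qed
  also have "\<dots> = (LINT r:{0..s}|lebesgue. ?k r * norm (fn f r))"
    unfolding set_lebesgue_integral_def by (intro Bochner_Integration.integral_cong) (auto simp: indicator_def)
  finally show ?thesis .
qed

lemma vol_nn_integral:
  assumes "lam > 0"
  shows "(\<integral>\<^sup>+s. ennreal ((norm (vol lam f s))\<^sup>2) \<partial>lebesgue) \<le> ennreal ((norm f / lam)\<^sup>2)"
proof -
  have "(\<integral>\<^sup>+s. ennreal ((norm (vol lam f s))\<^sup>2) \<partial>lebesgue)
      \<le> (\<integral>\<^sup>+s. ennreal ((LINT r:{0..s}|lebesgue. exp (- lam * (s - r)) * norm (fn f r))\<^sup>2) \<partial>lebesgue)"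
    by (intro nn_integral_mono ennreal_leI power_mono vol_bound) simp
  also have "\<dots> \<le> ennreal ((LINT r|lebesgue. (norm (fn f r))\<^sup>2) / lam\<^sup>2)"
    by (intro Schur_exp assms sq_integrable_norm) auto
  finally show ?thesis by (simp add: norm_sq_fn power_divide)
qed

lemma sq_integrable_vol: assumes "lam > 0" shows "sq_integrable (vol lam f)"
  unfolding sq_integrable_def
proof (intro conjI integrableI_bounded)
  have "(\<integral>\<^sup>+s. ennreal (norm ((norm (vol lam f s))\<^sup>2)) \<partial>lebesgue) \<le> ennreal ((norm f / lam)\<^sup>2)"
    using vol_nn_integral[OF assms] by simp
  then show "(\<integral>\<^sup>+s. ennreal (norm ((norm (vol lam f s))\<^sup>2)) \<partial>lebesgue) < \<infinity>"
    by (rule order.strict_trans1) simp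
qed measurable

definition Vol :: "real \<Rightarrow> 'x L2t \<Rightarrow> 'x L2t" where "Vol lam f = cls (vol lam f)"

lemma norm_Vol: assumes "lam > 0" shows "norm (Vol lam f) \<le> norm f / lam"
proof -
  have "ennreal ((norm (Vol lam f))\<^sup>2) = (\<integral>\<^sup>+s. ennreal ((norm (vol lam f s))\<^sup>2) \<partial>lebesgue)"
    unfolding Vol_def norm_sq_cls[OF sq_integrable_vol[OF assms]]
    by (intro nn_integral_eq_integral[symmetric] sq_integrable_norm sq_integrable_vol assms) auto
  also have "\<dots> \<le> ennreal ((norm f / lam)\<^sup>2)" by (rule vol_nn_integral[OF assms])
  finally have "(norm (Vol lam f))\<^sup>2 \<le> (norm f / lam)\<^sup>2" by (subst (asm) ennreal_le_iff) auto
  then show ?thesis by (rule power2_le_imp_le) (use assms in simp)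
qed

lemma fn_Vol: "lam > 0 \<Longrightarrow> AE s in lebesgue. fn (Vol lam f) s = vol lam f s"
  unfolding Vol_def by (intro fn_cls sq_integrable_vol)

lemma pr_unweight: assumes "f \<in> Hist" shows "AE s in lebesgue. pr (unweight f s) = unweight f s"
  using assms unfolding Hist_def mem_Collect_eq
proof eventually_elim
  fix s assume *: "fn f s = supp s *\<^sub>R pr (fn f s)"
  have "pr (fn f s) = fn f s" by (subst (1 2) *) (simp add: pr.scaleR pr_idem)
  then show "pr (unweight f s) = unweight f s" by (simp add: unweight_def pr.scaleR)
qed

lemma Vol_in_Hist: assumes "lam > 0" "f \<in> Hist" shows "Vol lam f \<in> Hist"
proof -
  have "pr (vol lam f s) = vol lam f s" for s
  proof -
    have i: "set_integrable lebesgue {0..s} (\<lambda>r. exp (- lam * (s - r)) *\<^sub>R unweight f r)"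
      by (intro set_integrable_scaleR_continuous unweight_integrable continuous_intros)
    have eq: "pr (indicator {0..s} r *\<^sub>R exp (- lam * (s - r)) *\<^sub>R unweight f r)
        = indicator {0..s} r *\<^sub>R exp (- lam * (s - r)) *\<^sub>R pr (unweight f r)" for r by (simp add: pr.scaleR)
    have "pr (LINT r:{0..s}|lebesgue. exp (- lam * (s - r)) *\<^sub>R unweight f r)
        = (LINT r|lebesgue. pr (indicator {0..s} r *\<^sub>R exp (- lam * (s - r)) *\<^sub>R unweight f r))"
      unfolding set_lebesgue_integral_def using i unfolding set_integrable_def
      by (intro integral_bounded_linear[OF pr_linear, symmetric])
    also have "\<dots> = (LINT r|lebesgue. indicator {0..s} r *\<^sub>R exp (- lam * (s - r)) *\<^sub>R unweight f r)"
      unfolding eq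
    proof (rule integral_cong_AE)
      show "AE r in lebesgue. indicator {0..s} r *\<^sub>R exp (- lam * (s - r)) *\<^sub>R pr (unweight f r)
          = indicator {0..s} r *\<^sub>R exp (- lam * (s - r)) *\<^sub>R unweight f r"
        using pr_unweight[OF assms(2)] by eventually_elim simp
      have [measurable]: "(\<lambda>r. exp (- lam * (s - r))) \<in> borel_measurable lebesgue"
      proof -
        have "continuous_on UNIV (\<lambda>r. exp (- lam * (s - r)))" by (intro continuous_intros)
        from borel_measurable_continuous_onI[OF this] show ?thesis by (simp add: measurable_completion)
      qed
      show "(\<lambda>r. indicator {0..s} r *\<^sub>R exp (- lam * (s - r)) *\<^sub>R pr (unweight f r)) \<in> borel_measurable lebesgue"
        "(\<lambda>r. indicator {0..s} r *\<^sub>R exp (- lam * (s - r)) *\<^sub>R unweight f r) \<in> borel_measurable lebesgue"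
        by measurable
    qed
    finally show ?thesis by (simp add: vol_def pr.scaleR set_lebesgue_integral_def)
  qed
  then have vol: "vol lam f s = supp s *\<^sub>R pr (vol lam f s)" for s by (simp add: supp_def) (simp add: vol_def)
  have "AE s in lebesgue. fn (Vol lam f) s = supp s *\<^sub>R pr (fn (Vol lam f) s)"
    using fn_Vol[OF assms(1), of f] by eventually_elim (simp flip: vol)
  then show ?thesis by (simp add: Hist_def)
qed

lemma unweight_Vol:
  assumes "lam > 0"
  shows "AE r in lebesgue. unweight (Vol lam f) r = supp r *\<^sub>R (LINT u:{0..r}|lebesgue. exp (- lam * (r - u)) *\<^sub>R unweight f u)"
  using fn_Vol[OF assms, of f] by eventually_elim (auto simp: unweight_def vol_def supp_def)

lemma unweight_lincomb:
  "AE r in lebesgue. unweight (a + c *\<^sub>R b) r = unweight a r + c *\<^sub>R unweight b r"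
  using fn_add[of a "c *\<^sub>R b"] fn_scaleR[of c b] by eventually_elim (simp add: unweight_def scaleR_add_right)

lemma supp_cases: obtains "\<And>s. \<omega> s = 0" | "\<And>s. 0 \<le> s \<Longrightarrow> supp s = 1"
  using w_alt unfolding supp_def by (metis less_irrefl)

text \<open>\<open>Vol \<lambda>\<close> solves the resolvent equation of the history derivative, and by \<open>hist_imp_Vol\<close> below it is the
  only solution.\<close>

lemma hist_Vol:
  assumes lam: "lam > 0" and f: "f \<in> Hist" shows "hist (Vol lam f) (f - lam *\<^sub>R Vol lam f)"
proof -
  let ?z = "f - lam *\<^sub>R Vol lam f" and ?V = "\<lambda>s. LINT u:{0..s}|lebesgue. exp (- lam * (s - u)) *\<^sub>R unweight f u"
  note V = exp_convolution_solves(1,3)[OF unweight_integrable[of _ f], where lam = lam]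
  have "vol lam f s = \<omega> s *\<^sub>R (LINT r:{0..s}|lebesgue. unweight ?z r)" if s: "0 \<le> s" for s
  proof (cases rule: supp_cases)
    case 1 then show ?thesis by (simp add: vol_def)
  next
    case 2
    have "(LINT r:{0..s}|lebesgue. unweight ?z r) = (LINT r:{0..s}|lebesgue. unweight f r - lam *\<^sub>R ?V r)"
    proof (rule set_integral_cong_ae[OF unweight_integrable])
      show "set_integrable lebesgue {0..s} (\<lambda>r. unweight f r - lam *\<^sub>R ?V r)"
        by (intro set_integral_diff(1) unweight_integrable set_integrable_scaleR_right V(1))
      show "AE r in lebesgue. r \<in> {0..s} \<longrightarrow> unweight ?z r = unweight f r - lam *\<^sub>R ?V r"
        using unweight_lincomb[of f "- lam" "Vol lam f"] unweight_Vol[OF lam, of f]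
        by eventually_elim (use 2 in auto)
    qed
    also have "\<dots> = ?V s" by (rule V(2))
    finally show ?thesis by (simp add: vol_def)
  qed
  then have "AE s in lebesgue. 0 \<le> s \<longrightarrow> fn (Vol lam f) s = \<omega> s *\<^sub>R (LINT r:{0..s}|lebesgue. unweight ?z r)"
    using fn_Vol[OF lam, of f] by (auto elim: AE_mp)
  then show ?thesis unfolding hist_def
    using Vol_in_Hist[OF lam f] f subspace_Hist by (auto intro: subspace_diff subspace_scale)
qed

lemma hist_imp_Vol:
  assumes lam: "lam > 0" and h: "hist y z" shows "y = Vol lam (z + lam *\<^sub>R y)"
proof -
  let ?f = "z + lam *\<^sub>R y" and ?W = "\<lambda>s. LINT u:{0..s}|lebesgue. unweight z u"
  note W = exp_convolution_solves(2)[OF unweight_integrable[of _ z]]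
    exp_convolution_solves(4)[OF unweight_integrable[of _ z], where lam = lam]
  have y: "AE s in lebesgue. 0 \<le> s \<longrightarrow> fn y s = \<omega> s *\<^sub>R ?W s" "y \<in> Hist" using h by (auto simp: hist_def)
  have vol: "vol lam ?f s = \<omega> s *\<^sub>R ?W s" if s: "0 \<le> s" for s
  proof (cases rule: supp_cases)
    case 1 then show ?thesis by (simp add: vol_def)
  next
    case 2
    have uy: "AE r in lebesgue. 0 \<le> r \<longrightarrow> unweight y r = ?W r"
      using y(1) by eventually_elim (use 2 in \<open>auto simp: unweight_def supp_def split: if_splits\<close>)
    have "(LINT r:{0..s}|lebesgue. exp (- lam * (s - r)) *\<^sub>R unweight ?f r)
        = (LINT r:{0..s}|lebesgue. exp (- lam * (s - r)) *\<^sub>R (unweight z r + lam *\<^sub>R ?W r))"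
    proof (rule set_integral_cong_ae)
      show "set_integrable lebesgue {0..s} (\<lambda>r. exp (- lam * (s - r)) *\<^sub>R unweight ?f r)"
        by (intro set_integrable_scaleR_continuous unweight_integrable continuous_intros)
      show "set_integrable lebesgue {0..s} (\<lambda>r. exp (- lam * (s - r)) *\<^sub>R (unweight z r + lam *\<^sub>R ?W r))"
        by (intro set_integrable_scaleR_continuous set_integral_add(1) unweight_integrable set_integrable_scaleR_right W(1) continuous_intros)
      show "AE r in lebesgue. r \<in> {0..s} \<longrightarrow> exp (- lam * (s - r)) *\<^sub>R unweight ?f r = exp (- lam * (s - r)) *\<^sub>R (unweight z r + lam *\<^sub>R ?W r)"
        using unweight_lincomb[of z lam y] uy by eventually_elim auto
    qed
    also have "\<dots> = ?W s" by (rule W(2))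
    finally show ?thesis by (simp add: vol_def)
  qed
  have "AE s in lebesgue. fn y s = supp s *\<^sub>R pr (fn y s)" using y(2) by (simp add: Hist_def)
  then have "AE s in lebesgue. fn y s = fn (Vol lam ?f) s" using y(1) fn_Vol[OF lam, of ?f]
  proof eventually_elim
    fix s assume *: "fn y s = supp s *\<^sub>R pr (fn y s)" "0 \<le> s \<longrightarrow> fn y s = \<omega> s *\<^sub>R ?W s" "fn (Vol lam ?f) s = vol lam ?f s"
    show "fn y s = fn (Vol lam ?f) s"
    proof (cases "0 \<le> s")
      case True then show ?thesis using * vol by simp
    next
      case False
      then have "\<omega> s = 0" using w_neg by simp
      then show ?thesis using *(1,3) by (simp add: supp_def vol_def)
    qed
  qed
  then show ?thesis by (rule L2t_eqI)
qed

text \<open>The monotonicity of the weight enters through the resolvent bound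
  \<open>\<lambda> norm y \<le> norm (z + \<lambda> y)\<close>. Squared, it says \<open>0 \<le> (norm z)\<^sup>2 + 2 \<lambda> (y \<bullet> z)\<close>, which for large \<open>\<lambda>\<close> forces
  \<open>y \<bullet> z \<ge> 0\<close>.\<close>

lemma hist_accretive: assumes "hist y z" shows "0 \<le> y \<bullet> z"
proof (rule ccontr)
  assume neg: "\<not> 0 \<le> y \<bullet> z"
  \<comment> \<open>With this \<open>\<lambda>\<close> the right-hand side of the squared bound is \<open>- 1\<close>.\<close>
  define lam where "lam = ((norm z)\<^sup>2 + 1) / (- 2 * (y \<bullet> z))"
  have lam: "lam > 0" unfolding lam_def by (rule divide_pos_pos) (use neg in \<open>auto intro: add_nonneg_pos\<close>)
  have "norm y \<le> norm (z + lam *\<^sub>R y) / lam"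
    using hist_imp_Vol[OF lam assms] norm_Vol[OF lam, of "z + lam *\<^sub>R y"] by simp
  then have "lam * norm y \<le> norm (z + lam *\<^sub>R y)" using lam by (simp add: field_simps)
  then have "(lam * norm y)\<^sup>2 \<le> (norm (z + lam *\<^sub>R y))\<^sup>2" using lam by (intro power_mono) auto
  also have "\<dots> = (norm z)\<^sup>2 + 2 * lam * (y \<bullet> z) + (lam * norm y)\<^sup>2"
    unfolding power_mult_distrib power2_norm_eq_inner by (simp add: algebra_simps inner_commute power2_eq_square)
  finally have "0 \<le> (norm z)\<^sup>2 + 2 * lam * (y \<bullet> z)" by simp
  moreover have "2 * lam * (y \<bullet> z) = - ((norm z)\<^sup>2 + 1)"
  proof -
    have "y \<bullet> z \<noteq> 0" using neg by auto
    then show ?thesis by (simp add: lam_def field_simps)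
  qed
  ultimately show False by simp
qed

text \<open>If the primitive of the history \<open>z\<close> vanishes, so does \<open>z\<close>: the history derivative is single-valued.\<close>

lemma hist_0_imp_0: assumes "hist 0 z" shows "z = 0"
proof -
  have z: "z \<in> Hist" and 0: "AE s in lebesgue. 0 \<le> s \<longrightarrow> fn (0 :: 'x L2t) s = \<omega> s *\<^sub>R (LINT r:{0..s}|lebesgue. unweight z r)"
    using assms by (auto simp: hist_def)
  have supp0: "AE s in lebesgue. fn z s = supp s *\<^sub>R pr (fn z s)" using z by (simp add: Hist_def)
  have "AE s in lebesgue. fn z s = fn 0 s"
  proof (cases rule: supp_cases)
    case 1
    then have "supp s = 0" for s by (simp add: supp_def)
    then show ?thesis using supp0 fn_0[where 'a = 'x] by (auto elim: AE_mp)
  next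
    case 2
    have "AE s in lebesgue. 0 \<le> s \<longrightarrow> (LINT r:{0..s}|lebesgue. unweight z r) = 0"
      using 0 fn_0[where 'a = 'x]
    proof eventually_elim
      fix s assume *: "0 \<le> s \<longrightarrow> fn (0 :: 'x L2t) s = \<omega> s *\<^sub>R (LINT r:{0..s}|lebesgue. unweight z r)" "fn (0 :: 'x L2t) s = 0"
      show "0 \<le> s \<longrightarrow> (LINT r:{0..s}|lebesgue. unweight z r) = 0"
        using * 2[of s] by (auto simp: supp_def)
    qed
    then have "AE s in lebesgue. 0 \<le> s \<longrightarrow> unweight z s = 0"
      by (rule primitive_zero_imp_zero[OF unweight_integrable])
    then show ?thesis using supp0 fn_0[where 'a = 'x]
    proof eventually_elim
      fix s assume *: "0 \<le> s \<longrightarrow> unweight z s = 0" "fn z s = supp s *\<^sub>R pr (fn z s)" "fn (0 :: 'x L2t) s = 0"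
      show "fn z s = fn 0 s"
      proof (cases "0 \<le> s")
        case True then show ?thesis using * 2[of s] by (auto simp: unweight_def supp_def split: if_splits)
      next
        case False then show ?thesis using * w_neg[of s] by (simp add: supp_def)
      qed
    qed
  qed
  then show ?thesis by (rule L2t_eqI)
qed

lemma hist_lincomb:
  assumes "hist y z" "hist y' z'" shows "hist (y + c *\<^sub>R y') (z + c *\<^sub>R z')"
proof -
  have "(LINT r:{0..s}|lebesgue. unweight (z + c *\<^sub>R z') r) = (LINT r:{0..s}|lebesgue. unweight z r) + c *\<^sub>R (LINT r:{0..s}|lebesgue. unweight z' r)" for s
  proof -
    have "(LINT r:{0..s}|lebesgue. unweight (z + c *\<^sub>R z') r) = (LINT r:{0..s}|lebesgue. unweight z r + c *\<^sub>R unweight z' r)"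
      using unweight_lincomb[of z c z']
      by (intro set_integral_cong_ae unweight_integrable set_integral_add(1) set_integrable_scaleR_right) (auto elim: AE_mp)
    also have "\<dots> = (LINT r:{0..s}|lebesgue. unweight z r) + c *\<^sub>R (LINT r:{0..s}|lebesgue. unweight z' r)"
      by (subst set_integral_add(2)) (auto intro: set_integrable_scaleR_right unweight_integrable)
    finally show ?thesis .
  qed
  moreover have "AE s in lebesgue. fn (y + c *\<^sub>R y') s = fn y s + c *\<^sub>R fn y' s"
    using fn_add[of y "c *\<^sub>R y'"] fn_scaleR[of c y'] by eventually_elim simp
  ultimately have "AE s in lebesgue. 0 \<le> s \<longrightarrow> fn (y + c *\<^sub>R y') s = \<omega> s *\<^sub>R (LINT r:{0..s}|lebesgue. unweight (z + c *\<^sub>R z') r)"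
    using assms unfolding hist_def by (auto elim!: AE_mp simp: scaleR_add_right scaleR_left_commute)
  then show ?thesis using assms subspace_Hist unfolding hist_def by (auto intro: subspace_add subspace_scale)
qed

lemma hist_0: "hist 0 0"
proof -
  have "AE s in lebesgue. unweight (0 :: 'x L2t) s = 0" using fn_0[where 'a = 'x] by eventually_elim (simp add: unweight_def)
  then have "(LINT r:{0..s}|lebesgue. unweight (0 :: 'x L2t) r) = (LINT r:{0..s}|lebesgue. 0)" for s
    by (intro set_integral_cong_ae unweight_integrable) (auto simp: set_integrable_def)
  then have "(LINT r:{0..s}|lebesgue. unweight (0 :: 'x L2t) r) = 0" for s by (simp add: set_lebesgue_integral_def)
  moreover have "AE s in lebesgue. 0 \<le> s \<longrightarrow> fn (0 :: 'x L2t) s = \<omega> s *\<^sub>R 0"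
    using fn_0[where 'a = 'x] by eventually_elim simp
  ultimately show ?thesis unfolding hist_def using subspace_0[OF subspace_Hist] by simp
qed

end

section \<open>A second order system with memory\<close>

lemma bounded_bilinear_add:
  assumes "bounded_bilinear b" "bounded_bilinear b'" shows "bounded_bilinear (\<lambda>x y. b x y + b' x y)"
proof -
  interpret b: bounded_bilinear b by fact
  interpret b': bounded_bilinear b' by fact
  obtain B B' where B: "\<And>x y. norm (b x y) \<le> norm x * norm y * B" "\<And>x y. norm (b' x y) \<le> norm x * norm y * B'"
    using b.bounded b'.bounded by metis
  have "norm (b x y + b' x y) \<le> norm x * norm y * (B + B')" for x y
    using norm_triangle_mono[OF B] by (simp add: distrib_left)
  then show ?thesis
    by unfold_locales (auto simp: b.add_left b'.add_left b.add_right b'.add_right b.scaleR_left b'.scaleR_left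
        b.scaleR_right b'.scaleR_right scaleR_add_right)
qed

lemma bounded_bilinear_scale:
  fixes b :: "'a::real_normed_vector \<Rightarrow> 'b::real_normed_vector \<Rightarrow> real"
  assumes "bounded_bilinear b" shows "bounded_bilinear (\<lambda>x y. c * b x y)"
proof -
  interpret b: bounded_bilinear b by fact
  obtain B where B: "\<And>x y. norm (b x y) \<le> norm x * norm y * B" using b.bounded by metis
  have "norm (c * b x y) \<le> norm x * norm y * (\<bar>c\<bar> * B)" for x y
    using mult_left_mono[OF B[of x y], of "\<bar>c\<bar>"] by (simp add: abs_mult mult.left_commute mult.commute)
  then have "\<exists>K. \<forall>x y. norm (c * b x y) \<le> norm x * norm y * K" by blast
  then show ?thesis
    by unfold_locales (simp_all add: b.add_left b.add_right b.scaleR_left b.scaleR_right distrib_left)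
qed

text \<open>The abstract form of the beam. A position is given by its gradient \<open>f \<in> V\<close>, and \<open>K\<close> integrates it; \<open>a \<in> W\<close> is
  the velocity and \<open>y \<in> Y\<close> the memory. \<open>P\<close> is the potential energy, \<open>M\<close> the kinetic energy and \<open>C\<close> the
  damping. \<open>H y z\<close> says that \<open>z\<close> is the derivative of the history \<open>y\<close>, and \<open>R l\<close> is the resolvent of this
  derivative. \<open>E\<close> forms constant histories; its adjoint is the force that the memory exerts.\<close>

locale memory_system =
  fixes V :: "'v::{real_inner, banach} set" and W :: "'w::{real_inner, banach} set" and Y :: "'y::{real_inner, banach} set"
    and P :: "'v \<Rightarrow> 'v \<Rightarrow> real" and M C :: "'w \<Rightarrow> 'w \<Rightarrow> real"
    and K :: "'v \<Rightarrow> 'w" and E :: "'v \<Rightarrow> 'y" and H :: "'y \<Rightarrow> 'y \<Rightarrow> bool" and R :: "real \<Rightarrow> 'y \<Rightarrow> 'y"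
    and p m :: real
  assumes V: "subspace V" "closed V" and W: "subspace W" "closed W" and Y: "subspace Y" "closed Y"
    and bil: "bounded_bilinear P" "bounded_bilinear M" "bounded_bilinear C"
    and P_sym: "P f f' = P f' f" and M_sym: "M a a' = M a' a"
    and p: "p > 0" "f \<in> V \<Longrightarrow> p * (norm f)\<^sup>2 \<le> P f f"
    and m: "m > 0" "m * (norm a)\<^sup>2 \<le> M a a"
    and C_nonneg: "0 \<le> C a a"
    and K: "bounded_linear K" "f \<in> V \<Longrightarrow> K f \<in> W" "f \<in> V \<Longrightarrow> K f = 0 \<Longrightarrow> f = 0"
    and K_dense: "a \<in> W \<Longrightarrow> (\<And>f. f \<in> V \<Longrightarrow> M a (K f) = 0) \<Longrightarrow> a = 0"
    and E: "bounded_linear E" "f \<in> V \<Longrightarrow> E f \<in> Y"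
    and H_Y: "H y z \<Longrightarrow> y \<in> Y \<and> z \<in> Y" and H_0: "H 0 0"
    and H_lin: "H y z \<Longrightarrow> H y' z' \<Longrightarrow> H (y + c *\<^sub>R y') (z + c *\<^sub>R z')"
    and H_accretive: "H y z \<Longrightarrow> 0 \<le> y \<bullet> z" and H_inj: "H 0 z \<Longrightarrow> z = 0"
    and R: "l > 0 \<Longrightarrow> y \<in> Y \<Longrightarrow> H (R l y) (y - l *\<^sub>R R l y)"
begin

sublocale P: bounded_bilinear P by (rule bil)
sublocale M: bounded_bilinear M by (rule bil)
sublocale C: bounded_bilinear C by (rule bil)
sublocale K: bounded_linear K by (rule K)
sublocale E: bounded_linear E by (rule E)

definition carrier :: "('v \<times> 'w \<times> 'y) set" where "carrier = V \<times> W \<times> Y"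

definition energy :: "'v \<times> 'w \<times> 'y \<Rightarrow> 'v \<times> 'w \<times> 'y \<Rightarrow> real" where
  "energy u u' = P (fst u) (fst u') + M (fst (snd u)) (fst (snd u')) + 3 * (snd (snd u) \<bullet> snd (snd u'))"

text \<open>The equations of motion \<open>K f' = a\<close>, \<open>M a' = - P f - C a - 3 E\<^sup>* y\<close> (tested with all positions) and
  \<open>y' = E f' - H y\<close>, where \<open>E f'\<close> is the velocity as a constant history. The factor \<open>3\<close> is that of the
  histories in the energy.\<close>

definition gen :: "('v \<times> 'w \<times> 'y) \<Rightarrow> ('v \<times> 'w \<times> 'y) \<Rightarrow> bool" where
  "gen u u' \<longleftrightarrow> u \<in> carrier \<and> u' \<in> carrier \<and> fst (snd u) = K (fst u') \<and>
     (\<forall>w\<in>V. M (fst (snd u')) (K w) = - P (fst u) w - C (fst (snd u)) (K w) - 3 * (snd (snd u) \<bullet> E w)) \<and>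
     H (snd (snd u)) (E (fst u') - snd (snd u'))"

text \<open>Potential and kinetic energy exchange and the memory force cancels against \<open>E f'\<close>; damping and the
  accretivity of the history derivative remain.\<close>

lemma gen_dissipative: assumes "gen u u'" shows "energy u' u \<le> 0"
proof -
  obtain f a y f' a' y' where u: "u = (f, a, y)" "u' = (f', a', y')" by (metis prod_cases3)
  have f': "f' \<in> V" and a: "a = K f'"
    and w: "M a' (K f') = - P f f' - C a (K f') - 3 * (y \<bullet> E f')" and h: "H y (E f' - y')"
    using assms by (auto simp: gen_def u carrier_def)
  have "energy u' u = P f' f + M a' a + 3 * (y' \<bullet> y)" by (simp add: energy_def u)
  also have "\<dots> = - C a a - 3 * (y \<bullet> (E f' - y'))"
    using w by (simp add: a P_sym[of f' f] inner_diff_right inner_commute algebra_simps)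
  also have "\<dots> \<le> 0" using C_nonneg[of a] H_accretive[OF h] by simp
  finally show ?thesis .
qed

text \<open>With \<open>l = 1 / h\<close> the velocity is \<open>l K (f - p0)\<close> and the memory is obtained from the position by the
  resolvent \<open>R l\<close>. Substituting both leaves a variational problem for \<open>f\<close>, whose form exceeds \<open>P\<close> by
  nonnegative terms.\<close>

lemma gen_range:
  assumes h: "h > 0" and z: "z \<in> carrier"
  shows "\<exists>u u'. gen u u' \<and> u - h *\<^sub>R u' = z"
proof -
  obtain p0 q0 r0 where z': "z = (p0, q0, r0)" by (metis prod_cases3)
  have z0: "p0 \<in> V" "q0 \<in> W" "r0 \<in> Y" using z by (auto simp: z' carrier_def)
  define l where "l = 1 / h"
  have l: "l > 0" "l * h = 1" using h by (auto simp: l_def)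
  have RY: "R l y \<in> Y" if "y \<in> Y" for y using H_Y[OF R[OF l(1) that]] by simp
  have R_nonneg: "0 \<le> R l y \<bullet> y" and R_bound: "norm (R l y) \<le> norm y * (1 / l)" if "y \<in> Y" for y
  proof -
    have "0 \<le> R l y \<bullet> (y - l *\<^sub>R R l y)" by (rule H_accretive[OF R[OF l(1) that]])
    then have *: "l * (norm (R l y))\<^sup>2 \<le> R l y \<bullet> y" by (simp add: inner_diff_right power2_norm_eq_inner)
    moreover have "0 \<le> l * (norm (R l y))\<^sup>2" using l by simp
    ultimately show "0 \<le> R l y \<bullet> y" by linarith
    have "l * (norm (R l y) * norm (R l y)) \<le> norm (R l y) * norm y"
      using * norm_cauchy_schwarz[of "R l y" y] by (simp add: power2_eq_square)
    then have "l * norm (R l y) \<le> norm y" by (cases "norm (R l y) = 0") (auto simp: mult.left_commute)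
    then show "norm (R l y) \<le> norm y * (1 / l)" using l by (simp add: field_simps)
  qed
  \<comment> \<open>The resolvent equation has no other solution, by accretivity; this makes \<open>R l\<close> linear on \<open>Y\<close>.\<close>
  have R_unique: "y = R l (z + l *\<^sub>R y)" if "H y z" for y z
  proof -
    have YY: "y \<in> Y" "z \<in> Y" using H_Y[OF that] by auto
    then have "H (R l (z + l *\<^sub>R y)) (z + l *\<^sub>R y - l *\<^sub>R R l (z + l *\<^sub>R y))"
      using Y by (intro R l subspace_add subspace_scale)
    from H_accretive[OF H_lin[OF that this, of "- 1"]]
    have "l * (norm (y - R l (z + l *\<^sub>R y)))\<^sup>2 \<le> 0"
      by (simp add: power2_norm_eq_inner inner_diff_right inner_diff_left inner_add_right algebra_simps)
    then show ?thesis using l by (simp add: mult_le_0_iff)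
  qed
  have R_lin: "R l (y + c *\<^sub>R y') = R l y + c *\<^sub>R R l y'" if "y \<in> Y" "y' \<in> Y" for y y' c
  proof -
    have "H (R l y + c *\<^sub>R R l y') (y - l *\<^sub>R R l y + c *\<^sub>R (y' - l *\<^sub>R R l y'))"
      by (intro H_lin R l that)
    from R_unique[OF this] show ?thesis by (simp add: algebra_simps)
  qed
  have R_0: "R l 0 = 0" using R_unique[OF H_0] by simp
  \<comment> \<open>\<open>R l\<close> is only controlled on \<open>Y\<close>; \<open>E\<close> followed by \<open>R l\<close> is extended by a projection onto \<open>V\<close>.\<close>
  have "\<exists>r\<in>V. \<forall>w\<in>V. r \<bullet> w = x \<bullet> w" for x
    by (rule riesz_on_closed_subspace[OF V]) (rule bounded_linear_inner_right)
  then obtain pv where pv: "\<And>x. pv x \<in> V" "\<And>x w. w \<in> V \<Longrightarrow> pv x \<bullet> w = x \<bullet> w" by metis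
  have pv_unique: "v = pv x" if "v \<in> V" "\<And>w. w \<in> V \<Longrightarrow> v \<bullet> w = x \<bullet> w" for v x
  proof -
    have d: "v - pv x \<in> V" using that pv V by (simp add: subspace_diff)
    have "(v - pv x) \<bullet> (v - pv x) = 0" using that(2)[OF d] pv(2)[OF d, of x] by (simp add: inner_diff_left)
    then show ?thesis by simp
  qed
  have pv_id: "pv x = x" if "x \<in> V" for x using pv_unique[OF that] by simp
  have pv_bl: "bounded_linear pv"
  proof (rule bounded_linear_intro[where K = 1])
    show "pv (x + y) = pv x + pv y" for x y
      using pv V by (intro pv_unique[symmetric]) (auto simp: inner_add_left subspace_add)
    show "pv (c *\<^sub>R x) = c *\<^sub>R pv x" for c x
      using pv V by (intro pv_unique[symmetric]) (auto simp: subspace_scale)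
    show "norm (pv x) \<le> norm x * 1" for x
    proof -
      have "norm (pv x) * norm (pv x) \<le> norm x * norm (pv x)"
        using pv(2)[OF pv(1), of x x] norm_cauchy_schwarz[of x "pv x"] by (simp add: dot_square_norm power2_eq_square)
      then show ?thesis by (cases "norm (pv x) = 0") auto
    qed
  qed
  interpret pv: bounded_linear pv by (rule pv_bl)
  define RE where "RE f = R l (E (pv f))" for f
  have RE: "bounded_linear RE"
  proof -
    obtain B where B: "\<And>f. norm (E f) \<le> norm f * B" "B \<ge> 0" using E.nonneg_bounded by blast
    show ?thesis
    proof (rule bounded_linear_intro[where K = "B * (1 / l)"])
      show "RE (x + y) = RE x + RE y" for x y
        using R_lin[of "E (pv x)" "E (pv y)" 1] pv E by (simp add: RE_def pv.add E.add)
      show "RE (c *\<^sub>R x) = c *\<^sub>R RE x" for c x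
        using R_lin[of 0 "E (pv x)" c] pv E Y by (simp add: RE_def pv.scaleR E.scaleR R_0 subspace_0)
      show "norm (RE x) \<le> norm x * (B * (1 / l))" for x
      proof -
        have nx: "norm (pv x) \<le> norm x"
        proof -
          have "norm (pv x) * norm (pv x) \<le> norm x * norm (pv x)"
            using pv(2)[OF pv(1), of x x] norm_cauchy_schwarz[of x "pv x"] by (simp add: dot_square_norm power2_eq_square)
          then show ?thesis by (cases "norm (pv x) = 0") auto
        qed
        have "norm (RE x) \<le> norm (E (pv x)) * (1 / l)" unfolding RE_def by (intro R_bound E pv)
        also have "\<dots> \<le> (norm x * B) * (1 / l)"
          using B nx l by (intro mult_right_mono order_trans[OF B(1)]) auto
        finally show ?thesis by (simp add: mult.assoc)
      qed
    qed
  qed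
  interpret RE: bounded_linear RE by (rule RE)
  define a where "a f w = P f w + (l\<^sup>2 * M (K f) (K w) + (l * C (K f) (K w) + 3 * l * (RE f \<bullet> E w)))" for f w
  define L where "L w = M (l\<^sup>2 *\<^sub>R K p0 + l *\<^sub>R q0) (K w) + (C (l *\<^sub>R K p0) (K w) + (3 * l) * ((RE p0 - R l r0) \<bullet> E w))" for w
  have "\<exists>f\<in>V. \<forall>w\<in>V. a f w = L w"
  proof (rule Lax_Milgram[OF V _ _ p(1)])
    show "bounded_bilinear a" unfolding a_def
      by (intro bounded_bilinear_add bounded_bilinear_scale bil bounded_bilinear.comp[OF bil(2) K(1) K(1)]
          bounded_bilinear.comp[OF bil(3) K(1) K(1)] bounded_bilinear.comp[OF bounded_bilinear_inner RE E(1)])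
    show "bounded_linear L" unfolding L_def
      by (intro bounded_linear_add bounded_linear_const_mult bounded_linear_compose[OF M.bounded_linear_right K(1)]
          bounded_linear_compose[OF C.bounded_linear_right K(1)] bounded_linear_compose[OF bounded_linear_inner_right E(1)])
    fix f assume f: "f \<in> V"
    have "0 \<le> M (K f) (K f)" using m(2)[of "K f"] m(1) by (smt (verit) mult_nonneg_nonneg zero_le_power2)
    moreover have "0 \<le> RE f \<bullet> E f" unfolding RE_def pv_id[OF f] by (intro R_nonneg E f)
    ultimately have "0 \<le> l\<^sup>2 * M (K f) (K f) + (l * C (K f) (K f) + 3 * l * (RE f \<bullet> E f))"
      using l C_nonneg by (intro add_nonneg_nonneg mult_nonneg_nonneg) auto
    then show "p * (norm f)\<^sup>2 \<le> a f f" using p(2)[OF f] by (simp add: a_def)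
  qed
  then obtain f where f: "f \<in> V" "\<And>w. w \<in> V \<Longrightarrow> a f w = L w" by blast
  define f' where "f' = l *\<^sub>R (f - p0)"
  define y where "y = l *\<^sub>R (RE f - RE p0 + R l r0)"
  define u where "u = (f, K f', y)"
  define u' where "u' = (f', l *\<^sub>R (K f' - q0), l *\<^sub>R (y - r0))"
  have f'V: "f' \<in> V" using f z0 V by (simp add: f'_def subspace_diff subspace_scale)
  have yR: "y = R l (l *\<^sub>R (E f - E p0 + r0))"
  proof -
    have "E f - E p0 \<in> Y" "E f \<in> Y" "E p0 \<in> Y" using E f z0 Y by (auto intro: subspace_diff)
    then have "R l (E f - E p0 + r0) = RE f - RE p0 + R l r0"
      using R_lin[of "E f - E p0" r0 1] R_lin[of "E f" "E p0" "- 1"] z0 f by (simp add: RE_def pv_id)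
    moreover have "E f - E p0 + r0 \<in> Y" using \<open>E f - E p0 \<in> Y\<close> z0 Y by (simp add: subspace_add)
    ultimately show ?thesis using R_lin[of 0 "E f - E p0 + r0" l] Y by (simp add: R_0 subspace_0 y_def)
  qed
  have gY: "l *\<^sub>R (E f - E p0 + r0) \<in> Y"
    using E f z0 Y by (auto intro!: subspace_scale subspace_add subspace_diff)
  have yY: "y \<in> Y" unfolding yR by (rule RY[OF gY])
  have "gen u u'"
    unfolding gen_def u_def u'_def fst_conv snd_conv carrier_def
  proof (intro conjI ballI)
    have "E f' - l *\<^sub>R (y - r0) = l *\<^sub>R (E f - E p0 + r0) - l *\<^sub>R y"
      by (simp add: f'_def E.scaleR E.diff algebra_simps)
    then show "H y (E f' - l *\<^sub>R (y - r0))" using R[OF l(1) gY] yR by simp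
    fix w assume w: "w \<in> V"
    have "M (l *\<^sub>R (K f' - q0)) (K w) = l\<^sup>2 * M (K f) (K w) - M (l\<^sup>2 *\<^sub>R K p0 + l *\<^sub>R q0) (K w)"
      by (simp add: f'_def K.scaleR K.diff M.scaleR_left M.diff_left M.add_left power2_eq_square algebra_simps)
    moreover have "C (K f') (K w) = l * C (K f) (K w) - C (l *\<^sub>R K p0) (K w)"
      by (simp add: f'_def K.scaleR K.diff C.scaleR_left C.diff_left algebra_simps)
    moreover have "3 * (y \<bullet> E w) = 3 * l * (RE f \<bullet> E w) - (3 * l) * ((RE p0 - R l r0) \<bullet> E w)"
      by (simp add: y_def inner_diff_left inner_add_left algebra_simps)
    moreover have "a f w = L w" by (rule f(2)[OF w])
    ultimately show "M (l *\<^sub>R (K f' - q0)) (K w) = - P f w - C (K f') (K w) - 3 * (y \<bullet> E w)"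
      unfolding a_def L_def by linarith
  qed (use f f'V z0 V W Y yY K(2)[OF f'V] in \<open>auto intro: subspace_scale subspace_diff\<close>)
  moreover have "u - h *\<^sub>R u' = z"
    using l by (simp add: u_def u'_def z' f'_def mult.commute[of h])
  ultimately show ?thesis by blast
qed

lemma gen_single_valued: assumes "gen 0 u'" shows "u' = 0"
proof -
  obtain f' a' y' where u: "u' = (f', a', y')" by (metis prod_cases3)
  have g: "f' \<in> V" "a' \<in> W" "K f' = 0" "\<And>w. w \<in> V \<Longrightarrow> M a' (K w) = 0" "H 0 (E f' - y')"
    using assms by (auto simp: gen_def u carrier_def P.zero_left C.zero_left)
  then have "f' = 0" "a' = 0" using K(3) K_dense by auto
  moreover have "E f' - y' = 0" by (rule H_inj[OF g(5)])
  ultimately show ?thesis by (simp add: u E.zero zero_prod_def)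
qed

lemma subspace_gen: "subspace {(u, u'). gen u u'}"
proof -
  have sc: "subspace carrier" unfolding carrier_def using V W Y by (intro subspace_Times)
  have lin: "gen (u + c *\<^sub>R v) (u' + c *\<^sub>R v')" if "gen u u'" "gen v v'" for u u' v v' c
  proof -
    have "H (snd (snd u) + c *\<^sub>R snd (snd v)) ((E (fst u') - snd (snd u')) + c *\<^sub>R (E (fst v') - snd (snd v')))"
      using that by (intro H_lin) (auto simp: gen_def)
    moreover have "(E (fst u') - snd (snd u')) + c *\<^sub>R (E (fst v') - snd (snd v'))
        = E (fst (u' + c *\<^sub>R v')) - snd (snd (u' + c *\<^sub>R v'))"
      by (simp add: E.add E.scaleR algebra_simps)
    ultimately have h: "H (snd (snd (u + c *\<^sub>R v))) (E (fst (u' + c *\<^sub>R v')) - snd (snd (u' + c *\<^sub>R v')))" by simp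
    have k: "fst (snd (u + c *\<^sub>R v)) = K (fst (u' + c *\<^sub>R v'))"
      using that by (simp add: gen_def K.add K.scaleR)
    have "M (fst (snd (u' + c *\<^sub>R v'))) (K w) = - P (fst (u + c *\<^sub>R v)) w
        - C (fst (snd (u + c *\<^sub>R v))) (K w) - 3 * (snd (snd (u + c *\<^sub>R v)) \<bullet> E w)" if w: "w \<in> V" for w
    proof -
      have "M (fst (snd u')) (K w) = - P (fst u) w - C (fst (snd u)) (K w) - 3 * (snd (snd u) \<bullet> E w)"
        "M (fst (snd v')) (K w) = - P (fst v) w - C (fst (snd v)) (K w) - 3 * (snd (snd v) \<bullet> E w)"
        using \<open>gen u u'\<close> \<open>gen v v'\<close> w unfolding gen_def by blast+
      then show ?thesis
        by (simp add: M.add_left M.scaleR_left P.add_left P.scaleR_left C.add_left C.scaleR_left inner_add_left)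
          (simp add: algebra_simps)
    qed
    then show ?thesis
      using h k that subspace_add[OF sc] subspace_scale[OF sc] unfolding gen_def by blast
  qed
  have g0: "gen 0 0" using subspace_0[OF sc] H_0
    by (auto simp: gen_def K.zero E.zero M.zero_left P.zero_left C.zero_left)
  show ?thesis
    using lin[of _ _ _ _ 1] lin[OF g0] g0 by (intro subspaceI) (auto simp: zero_prod_def)
qed

definition coer :: real where "coer = min p (min m 3)"

lemma coer: "coer > 0" "u \<in> carrier \<Longrightarrow> coer * (norm u)\<^sup>2 \<le> energy u u"
proof -
  show c: "coer > 0" using p m by (simp add: coer_def)
  assume "u \<in> carrier"
  then obtain f a y where u: "u = (f, a, y)" "f \<in> V" by (auto simp: carrier_def)
  have "coer * (norm u)\<^sup>2 = coer * (norm f)\<^sup>2 + coer * (norm a)\<^sup>2 + coer * (norm y)\<^sup>2"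
    by (simp add: u norm_prod_def algebra_simps)
  also have "\<dots> \<le> p * (norm f)\<^sup>2 + m * (norm a)\<^sup>2 + 3 * (norm y)\<^sup>2"
    by (intro add_mono mult_right_mono) (auto simp: coer_def)
  also have "\<dots> \<le> energy u u"
    using p(2)[OF u(2)] m(2)[of a] by (simp add: energy_def u power2_norm_eq_inner)
  finally show "coer * (norm u)\<^sup>2 \<le> energy u u" .
qed

lemma bounded_bilinear_energy: "bounded_bilinear energy"
  unfolding energy_def
  by (intro bounded_bilinear_add bounded_bilinear_scale bounded_bilinear.comp[OF bil(1)] bounded_bilinear.comp[OF bil(2)]
      bounded_bilinear.comp[OF bounded_bilinear_inner] bounded_linear_fst bounded_linear_compose[OF bounded_linear_fst bounded_linear_snd]
      bounded_linear_compose[OF bounded_linear_snd bounded_linear_snd])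

sublocale sg: m_dissipative carrier energy coer "{(u, u'). gen u u'}"
proof (rule m_dissipative.intro)
  show "subspace carrier" unfolding carrier_def using V W Y by (intro subspace_Times)
  show "closed carrier" unfolding carrier_def using V W Y by (intro closed_Times)
  show "energy x y = energy y x" for x y by (simp add: energy_def P_sym M_sym inner_commute)
  show "coer > 0" "x \<in> carrier \<Longrightarrow> coer * (norm x)\<^sup>2 \<le> energy x x" for x using coer by auto
  show "\<exists>x y. (x, y) \<in> {(u, u'). gen u u'} \<and> x - h *\<^sub>R y = z" if "h > 0" "z \<in> carrier" for h z
    using gen_range[OF that] by simp
  show "subspace {(u, u'). gen u u'}" by (rule subspace_gen)
  show "x \<in> carrier \<and> y \<in> carrier" if "(x, y) \<in> {(u, u'). gen u u'}" for x y
    using that by (simp add: gen_def)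
qed (auto simp: bounded_bilinear_energy gen_dissipative gen_single_valued)

end

section \<open>Weak derivatives on an interval\<close>

text \<open>A \<open>C\<^sup>1\<close> step from \<open>0\<close> to \<open>1\<close> on \<open>[0,1]\<close>, whose derivative is a tent of integral \<open>1\<close>.\<close>

definition tent :: "real \<Rightarrow> real" where "tent u = 4 * (max 0 u - 2 * max 0 (u - 1/2) + max 0 (u - 1))"
definition ramp :: "real \<Rightarrow> real" where
  "ramp u = 2 * ((max 0 u)\<^sup>2 - 2 * (max 0 (u - 1/2))\<^sup>2 + (max 0 (u - 1))\<^sup>2)"

lemma max_sq_deriv: "((\<lambda>u. (max 0 u)\<^sup>2) has_real_derivative 2 * max 0 u) (at u)" for u :: real
proof -
  consider "u < 0" | "u > 0" | "u = 0" by linarith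
  then show ?thesis
  proof cases
    case 1
    have "((\<lambda>u. 0 :: real) has_real_derivative 2 * max 0 u) (at u)" using 1 by simp
    then show ?thesis
      by (rule has_field_derivative_transform_within_open[of _ _ _ "{..<0}"]) (use 1 in auto)
  next
    case 2
    have "((\<lambda>u. u\<^sup>2) has_real_derivative 2 * max 0 u) (at u)" using 2 by (auto intro!: derivative_eq_intros)
    then show ?thesis
      by (rule has_field_derivative_transform_within_open[of _ _ _ "{0<..}"]) (use 2 in auto)
  next
    case 3
    have "((\<lambda>h::real. (max 0 h)\<^sup>2 / h) \<longlongrightarrow> 0) (at 0)"
    proof (rule Lim_null_comparison)
      show "\<forall>\<^sub>F h::real in at 0. norm ((max 0 h)\<^sup>2 / h) \<le> \<bar>h\<bar>"
        unfolding eventually_at by (intro exI[of _ 1]) (auto simp: max_def power2_eq_square)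
      show "((\<lambda>h::real. \<bar>h\<bar>) \<longlongrightarrow> 0) (at 0)" by (intro tendsto_eq_intros) auto
    qed
    then show ?thesis using 3 by (simp add: DERIV_def)
  qed
qed

lemma ramp_deriv: "(ramp has_real_derivative tent u) (at u)"
proof -
  define p where "p c v = (max 0 (v - c))\<^sup>2" for c v :: real
  have d: "(p c has_real_derivative 2 * max 0 (u - c)) (at u)" for c unfolding p_def
    by (rule DERIV_cong[OF DERIV_chain2[where f = "\<lambda>u. (max 0 u)\<^sup>2" and g = "\<lambda>v. v - c" and x = u and Db = 1, OF max_sq_deriv]])
      (auto intro!: derivative_eq_intros)
  have "((\<lambda>v. 2 * (p 0 v - 2 * p (1/2) v + p 1 v)) has_real_derivative
      2 * (2 * max 0 (u - 0) - 2 * (2 * max 0 (u - 1/2)) + 2 * max 0 (u - 1))) (at u)"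
    by (intro DERIV_cmult DERIV_add DERIV_diff d)
  then show ?thesis by (simp add: ramp_def[abs_def] tent_def p_def)
qed

lemma tent_continuous: "continuous_on A (\<lambda>x. tent (f x))" if "continuous_on A f"
  unfolding tent_def by (intro continuous_intros that)

lemma tent_nonneg: "0 \<le> tent u" by (auto simp: tent_def max_def)

lemma tent_outside: "u \<le> 0 \<or> 1 \<le> u \<Longrightarrow> tent u = 0" by (auto simp: tent_def max_def)

lemma ramp_0: "u \<le> 0 \<Longrightarrow> ramp u = 0" by (simp add: ramp_def max_def)

lemma ramp_1: "1 \<le> u \<Longrightarrow> ramp u = 1"
  by (simp add: ramp_def max_def power2_eq_square algebra_simps)

lemma ramp_bounds: "0 \<le> ramp u" "ramp u \<le> 1"
proof -
  have mono: "ramp x \<le> ramp y" if "x \<le> y" for x y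
    using that tent_nonneg ramp_deriv by (intro DERIV_nonneg_imp_nondecreasing[of x y ramp]) auto
  show "0 \<le> ramp u" using mono[of 0 u] ramp_0[of 0] ramp_0[of u] by (cases "u \<le> 0") auto
  show "ramp u \<le> 1" using mono[of u 1] ramp_1[of 1] ramp_1[of u] by (cases "1 \<le> u") auto
qed

lemma scaled_ramp_deriv: "((\<lambda>x. ramp (n * (x - a))) has_real_derivative n * tent (n * (x - a))) (at x)"
  by (rule DERIV_cong[OF DERIV_chain2[where f = ramp and g = "\<lambda>x. n * (x - a)" and x = x and Db = n, OF ramp_deriv]])
    (auto intro!: derivative_eq_intros)

lemma continuous_set_integrable:
  fixes f :: "real \<Rightarrow> real"
  assumes "continuous_on {a..b} f" shows "set_integrable lebesgue {a..b} f"
  using borel_integrable_compact[OF compact_Icc assms]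
  unfolding set_integrable_def by (simp add: integrable_completion borel_measurable_integrable)

text \<open>The scaled tents form an approximate identity concentrated to the right of \<open>a\<close>.\<close>

lemma bump_limit:
  fixes h :: "real \<Rightarrow> real"
  assumes h: "continuous_on {a..c} h" and "a < c"
  shows "(\<lambda>n. LINT x:{a..c}|lebesgue. h x * (real n * tent (real n * (x - a)))) \<longlonglongrightarrow> h a"
proof (rule metric_LIMSEQ_I)
  fix e :: real assume e: "e > 0"
  have "a \<in> {a..c}" using assms by simp
  then obtain d where d: "d > 0" "\<And>x. x \<in> {a..c} \<Longrightarrow> dist x a < d \<Longrightarrow> dist (h x) (h a) < e / 2"
    using h e unfolding continuous_on_iff by (meson half_gt_zero)
  obtain N :: nat where N: "real N > max (1 / d) (1 / (c - a))" using reals_Archimedean2 by blast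
  have "dist (LINT x:{a..c}|lebesgue. h x * (real n * tent (real n * (x - a)))) (h a) < e" if n: "n \<ge> N" for n
  proof -
    define k where "k x = real n * tent (real n * (x - a))" for x
    have "real N \<le> real n" "0 < 1 / d" using n d by auto
    then have nN: "real n > 1 / d" "real n > 1 / (c - a)" "real n > 0" using N by linarith+
    have nd: "1 / real n < d" "1 / real n < c - a"
      using nN d assms by (auto simp: field_simps)
    have k0: "0 \<le> k x" for x by (simp add: k_def tent_nonneg)
    have k_out: "k x = 0" if "x > a + 1 / real n" for x
    proof -
      have "1 \<le> real n * (x - a)" using that nN by (simp add: field_simps)
      then show ?thesis by (simp add: k_def tent_outside)
    qed
    have kc: "continuous_on A k" for A unfolding k_def by (intro continuous_intros tent_continuous)
    have ki: "set_integrable lebesgue {a..c} k" by (intro continuous_set_integrable kc)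
    have "1 \<le> real n * (c - a)" using nd nN assms by (simp add: field_simps)
    then have k1: "(LINT x:{a..c}|lebesgue. k x) = 1"
      using FTC_lebesgue(2)[OF less_imp_le[OF assms(2)] scaled_ramp_deriv, of "real n" a] kc[of UNIV]
      by (simp add: k_def ramp_0 ramp_1)
    have hk: "set_integrable lebesgue {a..c} (\<lambda>x. h x * k x)" by (intro continuous_set_integrable continuous_on_mult h kc)
    have hak: "set_integrable lebesgue {a..c} (\<lambda>x. h a * k x)" using ki by simp
    have "(LINT x:{a..c}|lebesgue. h x * k x) - h a = (LINT x:{a..c}|lebesgue. h x * k x) - (LINT x:{a..c}|lebesgue. h a * k x)"
      by (simp add: k1)
    also have "\<dots> = (LINT x:{a..c}|lebesgue. h x * k x - h a * k x)" by (rule set_integral_diff(2)[OF hk hak, symmetric])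
    also have "\<bar>\<dots>\<bar> \<le> (LINT x:{a..c}|lebesgue. (e / 2) * k x)"
      unfolding set_lebesgue_integral_def
    proof (rule integral_abs_bound_integral)
      show "integrable lebesgue (\<lambda>x. indicator {a..c} x *\<^sub>R (h x * k x - h a * k x))"
        using set_integral_diff(1)[OF hk hak] by (simp add: set_integrable_def)
      show "integrable lebesgue (\<lambda>x. indicator {a..c} x *\<^sub>R (e / 2 * k x))"
        using ki by (simp add: set_integrable_def mult.left_commute)
      fix x
      show "\<bar>indicator {a..c} x *\<^sub>R (h x * k x - h a * k x)\<bar> \<le> indicator {a..c} x *\<^sub>R (e / 2 * k x)"
      proof (cases "x \<in> {a..c} \<and> x \<le> a + 1 / real n")
        case True
        then have "\<bar>h x - h a\<bar> \<le> e / 2" using d(2)[of x] nd by (simp add: dist_real_def)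
        then have "\<bar>h x - h a\<bar> * k x \<le> e / 2 * k x" using k0 by (intro mult_right_mono)
        then show ?thesis using True k0[of x] by (simp add: abs_mult flip: left_diff_distrib)
      next
        case False then show ?thesis using k_out[of x] by (auto simp: indicator_def)
      qed
    qed
    also have "\<dots> = e / 2" using k1 by simp
    finally show ?thesis using e by (simp add: dist_real_def k_def)
  qed
  then show "\<exists>no. \<forall>n\<ge>no. dist (LINT x:{a..c}|lebesgue. h x * (real n * tent (real n * (x - a)))) (h a) < e" by blast
qed

lemma lebesgue_on_integral:
  fixes f :: "real \<Rightarrow> 'b::{banach, second_countable_topology}"
  assumes "J \<in> sets lebesgue"
  shows "(LINT x|lebesgue_on J. f x) = (LINT x:J|lebesgue. f x)"
    "integrable (lebesgue_on J) f \<longleftrightarrow> set_integrable lebesgue J f"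
  using assms by (simp_all add: integral_restrict_space integrable_restrict_space set_lebesgue_integral_def set_integrable_def)

text \<open>Testing with \<open>ramp (n (x - a)) - ramp (n (x - b))\<close>, which tends to the indicator of
  \<open>(a, b]\<close>, turns the weak derivative into an increment.\<close>

lemma weak_deriv_increment:
  assumes wd: "weak_deriv J h f" and J: "open J" and ab: "a \<le> b" "{a..b} \<subseteq> J" and h: "continuous_on J h"
  shows "h b - h a = (LINT x:{a..b}|lebesgue. f x)"
proof (cases "a = b")
  case True
  have eq: "(\<lambda>x. indicator {a..b} x *\<^sub>R f x) = (\<lambda>x. indicator {b} x *\<^sub>R f b)"
    by (auto simp: True indicator_def)
  have "(LINT x|lebesgue. indicator {b} x *\<^sub>R f b) = (LINT x::real|lebesgue. 0)"
  proof (rule integral_cong_AE)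
    have "AE x in lebesgue. x \<noteq> b" by (rule AE_completion) (rule AE_lborel_singleton)
    then show "AE x in lebesgue. indicator {b} x *\<^sub>R f b = 0" by eventually_elim simp
  qed simp_all
  then show ?thesis unfolding set_lebesgue_integral_def eq using True by simp
next
  case False
  then have "a < b" using ab by simp
  have Jl: "J \<in> sets lebesgue" using J by simp
  obtain e where e: "e > 0" "ball b e \<subseteq> J" 
  proof -
    have "b \<in> J" using ab by auto
    then show ?thesis using openE[OF J] that by blast
  qed
  \<comment> \<open>The test functions drop to \<open>0\<close> just to the right of \<open>b\<close>, which has to happen inside \<open>J\<close>.\<close>
  define c where "c = b + e / 2"
  have c: "b < c" "{a..c} \<subseteq> J"
  proof -
    show "b < c" using e by (simp add: c_def)
    have "x \<in> J" if "x \<in> {a..c}" for x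
      using that ab e by (cases "x \<le> b") (auto simp: c_def dist_real_def subset_iff)
    then show "{a..c} \<subseteq> J" by blast
  qed
  have hc: "continuous_on {a'..c} h" if "a \<le> a'" for a' using h that c by (intro continuous_on_subset[OF h]) auto
  have fi: "set_integrable lebesgue {a..c} f"
    using wd c lebesgue_on_integral(2)[of "{a..c}" f] by (auto simp: weak_deriv_def)
  obtain N :: nat where N: "real N > 1 / (c - b)" using reals_Archimedean2 by blast
  define \<theta> where "\<theta> n x = ramp (real n * (x - a)) - ramp (real n * (x - b))" for n x
  define \<theta>' where "\<theta>' n x = real n * tent (real n * (x - a)) - real n * tent (real n * (x - b))" for n x
  have zero: "\<theta> n x = 0 \<and> \<theta>' n x = 0" if n: "n \<ge> N" and x: "x \<notin> {a..c}" for n x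
  proof (cases "x < a")
    case True
    then have "real n * (x - a) \<le> 0" "real n * (x - b) \<le> 0" using \<open>a < b\<close> by (auto simp: mult_le_0_iff)
    then show ?thesis by (simp add: \<theta>_def \<theta>'_def ramp_0 tent_outside)
  next
    case False
    then have xc: "x > c" using x by auto
    have "1 \<le> real N * (c - b)" using N c by (simp add: field_simps)
    also have "\<dots> \<le> real n * (x - b)" using n xc c by (intro mult_mono) auto
    finally have 1: "1 \<le> real n * (x - b)" .
    also have "\<dots> \<le> real n * (x - a)" using \<open>a < b\<close> by (intro mult_left_mono) auto
    finally show ?thesis using 1 by (simp add: \<theta>_def \<theta>'_def ramp_1 tent_outside)
  qed
  have test: "test_fun J (\<theta> n) (\<theta>' n)" if n: "n \<ge> N" for n
    unfolding test_fun_def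
  proof (intro conjI allI exI[of _ "{a..c}"] impI)
    show "(\<theta> n has_real_derivative \<theta>' n x) (at x)" for x
      unfolding \<theta>_def \<theta>'_def by (intro DERIV_diff scaled_ramp_deriv)
    show "continuous_on UNIV (\<theta>' n)" unfolding \<theta>'_def by (intro continuous_intros tent_continuous)
  qed (use c zero[OF n] in auto)
  have eq: "(LINT x:{a..c}|lebesgue. h x * (real n * tent (real n * (x - a)))) - (LINT x:{b..c}|lebesgue. h x * (real n * tent (real n * (x - b))))
      = - (LINT x:{a..c}|lebesgue. f x * \<theta> n x)" if n: "n \<ge> N" for n
  proof -
    let ?k = "\<lambda>a x. real n * tent (real n * (x - a))"
    have i: "set_integrable lebesgue {a..c} (\<lambda>x. h x * ?k a' x)" for a'
      using hc[of a] by (intro continuous_set_integrable continuous_intros tent_continuous) auto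
    have "(LINT x:{b..c}|lebesgue. h x * ?k b x) = (LINT x:{a..c}|lebesgue. h x * ?k b x)"
    proof -
      have "tent (real n * (x - b)) = 0" if "x < b" for x
        using that by (intro tent_outside) (simp add: mult_le_0_iff)
      then show ?thesis unfolding set_lebesgue_integral_def
        using \<open>a < b\<close> by (intro Bochner_Integration.integral_cong) (auto simp: indicator_def)
    qed
    then have "(LINT x:{a..c}|lebesgue. h x * ?k a x) - (LINT x:{b..c}|lebesgue. h x * ?k b x)
        = (LINT x:{a..c}|lebesgue. h x * ?k a x - h x * ?k b x)"
      using set_integral_diff(2)[OF i[of a] i[of b]] by simp
    also have "\<dots> = (LINT x:J|lebesgue. h x * \<theta>' n x)"
      unfolding set_lebesgue_integral_def
      using zero[OF n] c by (intro Bochner_Integration.integral_cong) (auto simp: indicator_def \<theta>'_def right_diff_distrib)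
    also have "\<dots> = - (LINT x:J|lebesgue. f x * \<theta> n x)"
      using wd test[OF n] Jl by (auto simp: weak_deriv_def lebesgue_on_integral)
    also have "(LINT x:J|lebesgue. f x * \<theta> n x) = (LINT x:{a..c}|lebesgue. f x * \<theta> n x)"
      unfolding set_lebesgue_integral_def
      using zero[OF n] c by (intro Bochner_Integration.integral_cong) (auto simp: indicator_def)
    finally show ?thesis .
  qed
  have "(\<lambda>n. (LINT x:{a..c}|lebesgue. h x * (real n * tent (real n * (x - a)))) - (LINT x:{b..c}|lebesgue. h x * (real n * tent (real n * (x - b))))) \<longlonglongrightarrow> h a - h b"
    using \<open>a < b\<close> c by (intro tendsto_diff bump_limit hc) auto
  moreover have "\<forall>\<^sub>F n in sequentially. (LINT x:{a..c}|lebesgue. h x * (real n * tent (real n * (x - a)))) - (LINT x:{b..c}|lebesgue. h x * (real n * tent (real n * (x - b))))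
      = - (LINT x:{a..c}|lebesgue. f x * \<theta> n x)"
    using eq unfolding eventually_sequentially by blast
  ultimately have lim1: "(\<lambda>n. - (LINT x:{a..c}|lebesgue. f x * \<theta> n x)) \<longlonglongrightarrow> h a - h b"
    by (rule Lim_transform_eventually)
  have ramp_lim: "(\<lambda>n. ramp (real n * (x - a))) \<longlonglongrightarrow> (if x > a then 1 else 0)" for x a
  proof (cases "x > a")
    case True
    obtain N :: nat where N: "real N > 1 / (x - a)" using reals_Archimedean2 by blast
    have "ramp (real n * (x - a)) = 1" if "n \<ge> N" for n
    proof -
      have "1 \<le> real N * (x - a)" using N True by (simp add: field_simps)
      also have "\<dots> \<le> real n * (x - a)" using that True by (intro mult_right_mono) auto
      finally show ?thesis by (rule ramp_1)
    qed
    then show ?thesis using True by (intro tendsto_eventually) (auto simp: eventually_sequentially)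
  next
    case False
    then have "ramp (real n * (x - a)) = 0" for n by (intro ramp_0) (simp add: mult_le_0_iff)
    then show ?thesis using False by simp
  qed
  have "(\<lambda>n. LINT x:{a..c}|lebesgue. f x * \<theta> n x) \<longlonglongrightarrow> (LINT x:{a<..b}|lebesgue. f x)"
    unfolding set_lebesgue_integral_def
  proof (rule integral_dominated_convergence[where w = "\<lambda>x. norm (indicator {a..c} x *\<^sub>R f x)"])
    show fm: "(\<lambda>x. indicator {a<..b} x *\<^sub>R f x) \<in> borel_measurable lebesgue"
      using set_integrable_subset[OF fi, of "{a<..b}"] c by (auto simp: set_integrable_def subset_iff)
    show "(\<lambda>x. indicator {a..c} x *\<^sub>R (f x * \<theta> n x)) \<in> borel_measurable lebesgue" for n
    proof -
      have "continuous_on UNIV (\<theta> n)"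
        unfolding \<theta>_def by (intro continuous_intros DERIV_continuous_on[OF scaled_ramp_deriv[THEN has_field_derivative_at_within]])
      from borel_measurable_continuous_onI[OF this] have [measurable]: "\<theta> n \<in> borel_measurable lebesgue" by (simp add: measurable_completion)
      have [measurable]: "(\<lambda>x. indicator {a..c} x *\<^sub>R f x) \<in> borel_measurable lebesgue" using fi by (auto simp: set_integrable_def)
      have "(\<lambda>x. (indicator {a..c} x *\<^sub>R f x) * \<theta> n x) \<in> borel_measurable lebesgue" by measurable
      then show ?thesis by (simp add: mult.assoc)
    qed
    show "integrable lebesgue (\<lambda>x. norm (indicator {a..c} x *\<^sub>R f x))" using fi by (intro integrable_norm) (simp add: set_integrable_def)
    have "\<bar>\<theta> n x\<bar> \<le> 1" for n x
      using ramp_bounds[of "real n * (x - a)"] ramp_bounds[of "real n * (x - b)"] by (auto simp: \<theta>_def)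
    then have "\<bar>f x\<bar> * \<bar>\<theta> n x\<bar> \<le> \<bar>f x\<bar> * 1" for n x by (intro mult_left_mono) auto
    then show "AE x in lebesgue. norm (indicator {a..c} x *\<^sub>R (f x * \<theta> n x)) \<le> norm (indicator {a..c} x *\<^sub>R f x)" for n
      by (auto simp: indicator_def abs_mult)
    have "(\<lambda>n. indicator {a..c} x *\<^sub>R (f x * \<theta> n x)) \<longlonglongrightarrow> indicator {a..c} x *\<^sub>R (f x * ((if x > a then 1 else 0) - (if x > b then 1 else 0)))" for x
      unfolding \<theta>_def by (intro tendsto_intros ramp_lim)
    moreover have "indicator {a..c} x *\<^sub>R (f x * ((if x > a then 1 else 0) - (if x > b then 1 else 0))) = indicator {a<..b} x *\<^sub>R f x" for x
      using \<open>a < b\<close> c by (auto simp: indicator_def)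
    ultimately have "(\<lambda>n. indicator {a..c} x *\<^sub>R (f x * \<theta> n x)) \<longlonglongrightarrow> indicator {a<..b} x *\<^sub>R f x" for x
      by (simp only:)
    then show "AE x in lebesgue. (\<lambda>n. indicator {a..c} x *\<^sub>R (f x * \<theta> n x)) \<longlonglongrightarrow> indicator {a<..b} x *\<^sub>R f x"
      by (rule AE_I2)
  qed
  then have "(\<lambda>n. - (LINT x:{a..c}|lebesgue. f x * \<theta> n x)) \<longlonglongrightarrow> - (LINT x:{a<..b}|lebesgue. f x)" by (rule tendsto_minus)
  with lim1 have "h a - h b = - (LINT x:{a<..b}|lebesgue. f x)" by (rule LIMSEQ_unique)
  moreover have "(LINT x:{a<..b}|lebesgue. f x) = (LINT x:{a..b}|lebesgue. f x)"
  proof (unfold set_lebesgue_integral_def, rule integral_cong_AE)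
    have "AE x in lebesgue. x \<noteq> a" by (rule AE_completion) (rule AE_lborel_singleton)
    then show "AE x in lebesgue. indicator {a<..b} x *\<^sub>R f x = indicator {a..b} x *\<^sub>R f x"
      by eventually_elim (auto simp: indicator_def)
  qed (use set_integrable_subset[OF fi, of "{a<..b}"] set_integrable_subset[OF fi, of "{a..b}"] c in \<open>auto simp: set_integrable_def subset_iff\<close>)
  ultimately show ?thesis by simp
qed

lemma primitive_continuous:
  fixes f :: "real \<Rightarrow> real"
  assumes f: "\<And>s. set_integrable lebesgue {0..s} f"
  shows "continuous_on {0..} (\<lambda>x. LINT r:{0..x}|lebesgue. f r)"
proof -
  have c: "continuous_on {0..s} (\<lambda>x. LINT r:{0..x}|lebesgue. f r)" for s
    using indefinite_integral_continuous_real[of 0 s f] f[of s] by (simp add: lebesgue_on_integral)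
  have co: "continuous_on {0..<s} (\<lambda>x. LINT r:{0..x}|lebesgue. f r)" for s
    by (rule continuous_on_subset[OF c[of s]]) auto
  have "continuous (at x within {0..}) (\<lambda>x. LINT r:{0..x}|lebesgue. f r)" if "x \<in> {0..}" for x
  proof -
    have "continuous (at x within {0..<x+1}) (\<lambda>x. LINT r:{0..x}|lebesgue. f r)"
      using co[of "x + 1"] that by (auto simp: continuous_on_eq_continuous_within)
    moreover have "at x within {0..<x+1} = at x within {0..}"
      by (rule at_within_nhd[of _ "{..<x+1}"]) (use that in auto)
    ultimately show ?thesis by simp
  qed
  then show ?thesis by (simp add: continuous_on_eq_continuous_within)
qed

lemma set_integral_split:
  fixes f :: "real \<Rightarrow> real"
  assumes f: "\<And>s. set_integrable lebesgue {0..s} f" and ab: "0 \<le> a" "a \<le> b"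
  shows "(LINT x:{a..b}|lebesgue. f x) = (LINT x:{0..b}|lebesgue. f x) - (LINT x:{0..a}|lebesgue. f x)"
proof -
  have i: "set_integrable lebesgue A f" if "A \<in> sets lebesgue" "A \<subseteq> {0..b}" for A
    using set_integrable_subset[OF f that] .
  have "{0..b} = {0..a} \<union> {a<..b}" using ab by auto
  then have "(LINT x:{0..b}|lebesgue. f x) = (LINT x:{0..a}|lebesgue. f x) + (LINT x:{a<..b}|lebesgue. f x)"
    using ab by (simp only:) (intro set_integral_Un i, auto)
  moreover have "(LINT x:{a<..b}|lebesgue. f x) = (LINT x:{a..b}|lebesgue. f x)"
  proof (unfold set_lebesgue_integral_def, rule integral_cong_AE)
    have "AE x in lebesgue. x \<noteq> a" by (rule AE_completion) (rule AE_lborel_singleton)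
    then show "AE x in lebesgue. indicator {a<..b} x *\<^sub>R f x = indicator {a..b} x *\<^sub>R f x"
      by eventually_elim (auto simp: indicator_def)
  qed (use i[of "{a<..b}"] i[of "{a..b}"] ab in \<open>auto simp: set_integrable_def subset_iff\<close>)
  ultimately show ?thesis by simp
qed

text \<open>The increments of \<open>h\<close> and of the primitive agree on the interval \<open>J\<close>, so their difference is constant
  there, and on its closure by continuity. It is used for \<open>(0,1)\<close> and for the half line.\<close>

lemma weak_deriv_imp_primitive:
  assumes wd: "weak_deriv J h f" and J: "open J" "J \<subseteq> {0<..}" "0 \<in> closure J"
    and conv: "\<And>x y. x \<in> J \<Longrightarrow> y \<in> J \<Longrightarrow> {x..y} \<subseteq> J"
    and h: "continuous_on (closure J) h" and f: "\<And>s. set_integrable lebesgue {0..s} f"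
    and x: "x \<in> closure J"
  shows "h x = h 0 + (LINT r:{0..x}|lebesgue. f r)"
proof -
  let ?F = "\<lambda>x. LINT r:{0..x}|lebesgue. f r"
  have cJ: "closure J \<subseteq> {0..}" using J by (intro closure_minimal) auto
  have "J \<noteq> {}" using J(3) by auto
  then obtain y where y: "y \<in> J" by blast
  have inc: "h b - ?F b = h a - ?F a" if "a \<in> J" "b \<in> J" "a \<le> b" for a b
    using weak_deriv_increment[OF wd J(1) that(3) conv[OF that(1,2)] continuous_on_subset[OF h closure_subset]]
      set_integral_split[OF f, of a b] that J(2) by (auto simp: subset_iff)
  have c: "h b - ?F b = h y - ?F y" if "b \<in> J" for b
    using inc[of b y] inc[of y b] that y by (cases "b \<le> y") auto
  have "h b - ?F b = h y - ?F y" if "b \<in> closure J" for b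
    by (rule continuous_constant_on_closure[OF _ c that])
      (intro continuous_intros h continuous_on_subset[OF primitive_continuous[OF f] cJ])
  from this[OF x] this[OF J(3)] show ?thesis using set_integral_split[OF f, of 0 0] by simp
qed

text \<open>Integration by parts against a test function is \<open>integral_triangle_FTC\<close>.\<close>

lemma primitive_imp_weak_deriv:
  assumes J: "open J" "J \<subseteq> {0<..}" and f: "\<And>s. set_integrable lebesgue {0..s} f"
    and h: "\<And>x. x \<in> J \<Longrightarrow> h x = c + (LINT r:{0..x}|lebesgue. f r)"
  shows "weak_deriv J h f"
  unfolding weak_deriv_def
proof (intro conjI allI impI)
  let ?F = "\<lambda>x. LINT r:{0..x}|lebesgue. f r"
  have Jl: "J \<in> sets lebesgue" using J by simp
  fix K assume K: "compact K \<and> K \<subseteq> J"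
  then have Kl: "K \<in> sets lebesgue" by (simp add: compact_imp_closed)
  have "bounded K" using K by (simp add: compact_imp_bounded)
  then obtain s where s: "\<forall>x\<in>K. norm x \<le> s" unfolding bounded_iff by (elim exE)
  have pos: "0 < x" if "x \<in> K" for x using that K J(2) by auto
  have Ks: "K \<subseteq> {0..s}"
  proof
    fix x assume "x \<in> K"
    then show "x \<in> {0..s}" using pos[of x] s by auto
  qed
  show "integrable (lebesgue_on K) f"
    using set_integrable_subset[OF f Kl Ks] Kl by (simp add: lebesgue_on_integral)
  have "continuous_on {0..s} (\<lambda>x. c + ?F x)"
    by (intro continuous_intros continuous_on_subset[OF primitive_continuous[OF f]]) auto
  from continuous_set_integrable[OF this]
  have "set_integrable lebesgue K (\<lambda>x. c + ?F x)" using set_integrable_subset Kl Ks by blast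
  moreover have "set_integrable lebesgue K (\<lambda>x. c + ?F x) \<longleftrightarrow> set_integrable lebesgue K h"
    unfolding set_integrable_def using h K by (intro Bochner_Integration.integrable_cong) (auto simp: indicator_def)
  ultimately show "integrable (lebesgue_on K) h" using Kl by (simp add: lebesgue_on_integral)
next
  let ?F = "\<lambda>x. LINT r:{0..x}|lebesgue. f r"
  have Jl: "J \<in> sets lebesgue" using J by simp
  fix \<theta> \<theta>' assume test: "test_fun J \<theta> \<theta>'"
  then obtain K where K: "compact K" "K \<subseteq> J" "\<And>x. x \<notin> K \<Longrightarrow> \<theta> x = 0" and der: "\<And>x. (\<theta> has_real_derivative \<theta>' x) (at x)"
    and cont: "continuous_on UNIV \<theta>'" unfolding test_fun_def by blast
  have \<theta>'0: "\<theta>' x = 0" if "x \<notin> K" for x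
  proof -
    have "((\<lambda>x. 0 :: real) has_real_derivative \<theta>' x) (at x)"
      by (rule has_field_derivative_transform_within_open[OF der, of "- K"])
        (use K that in \<open>auto simp: compact_imp_closed open_Compl\<close>)
    then show ?thesis using DERIV_unique DERIV_const by blast
  qed
  have "bounded K" using K by (simp add: compact_imp_bounded)
  then obtain s where s: "\<forall>x\<in>K. norm x \<le> s" unfolding bounded_iff by (elim exE)
  \<comment> \<open>The test function vanishes at both ends of \<open>[0, b]\<close>, so there are no boundary terms.\<close>
  define b where "b = \<bar>s\<bar> + 1"
  have pos: "0 < x" "x < b" if "x \<in> K" for x using that K(2) J(2) s by (auto simp: b_def)
  have Kb: "K \<subseteq> {0..b}" "b \<notin> K" "0 \<notin> K" "0 \<le> b"
    using pos(1)[of 0] pos(2)[of b] less_imp_le[OF pos(1)] less_imp_le[OF pos(2)] by (auto simp: b_def)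
  have "(LINT x|lebesgue_on J. h x * \<theta>' x) = (LINT x:J|lebesgue. h x * \<theta>' x)" using Jl by (simp add: lebesgue_on_integral)
  also have "\<dots> = (LINT x:{0..b}|lebesgue. c * \<theta>' x + \<theta>' x *\<^sub>R ?F x)"
    unfolding set_lebesgue_integral_def
  proof (intro Bochner_Integration.integral_cong refl)
    fix x show "indicator J x *\<^sub>R (h x * \<theta>' x) = indicator {0..b} x *\<^sub>R (c * \<theta>' x + \<theta>' x *\<^sub>R (LINT r|lebesgue. indicator {0..x} r *\<^sub>R f r))"
    proof (cases "x \<in> K")
      case True
      then have "x \<in> J" "x \<in> {0..b}" using K(2) Kb(1) by auto
      then show ?thesis using h[of x] by (simp add: set_lebesgue_integral_def distrib_left mult.commute)
    qed (use \<theta>'0[of x] in simp)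
  qed
  also have "\<dots> = (LINT x:{0..b}|lebesgue. c * \<theta>' x) + (LINT x:{0..b}|lebesgue. \<theta>' x *\<^sub>R ?F x)"
    by (intro set_integral_add(2) integral_triangle_FTC(1)[OF f der cont]) (use FTC_lebesgue(1)[OF Kb(4) der cont] in simp)
  also have "(LINT x:{0..b}|lebesgue. c * \<theta>' x) = 0"
    using FTC_lebesgue(2)[OF Kb(4) der cont] K(3) Kb by simp
  also have "(LINT x:{0..b}|lebesgue. \<theta>' x *\<^sub>R ?F x) = (LINT u:{0..b}|lebesgue. (\<theta> b - \<theta> u) *\<^sub>R f u)"
    by (rule integral_triangle_FTC(2)[OF f der cont])
  also have "\<dots> = - (LINT x:J|lebesgue. f x * \<theta> x)"
    unfolding set_lebesgue_integral_def Bochner_Integration.integral_minus[symmetric]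
  proof (intro Bochner_Integration.integral_cong refl)
    fix x show "indicator {0..b} x *\<^sub>R (\<theta> b - \<theta> x) *\<^sub>R f x = - (indicator J x *\<^sub>R (f x * \<theta> x))"
    proof (cases "x \<in> K")
      case True
      then have "x \<in> J" "x \<in> {0..b}" using K(2) Kb(1) by auto
      then show ?thesis using K(3)[OF Kb(2)] by simp
    qed (use K(3)[of x] K(3)[OF Kb(2)] in simp)
  qed
  finally show "(LINT x|lebesgue_on J. h x * \<theta>' x) = - (LINT x|lebesgue_on J. f x * \<theta> x)"
    using Jl by (simp add: lebesgue_on_integral)
qed

section \<open>The interval: square integrable and weakly differentiable functions\<close>

text \<open>\<open>L\<^sup>2(0,1)\<close> is the subspace of functions supported in the interval, with orthogonal projection \<open>un\<close>.\<close>

definition ext :: "(real \<Rightarrow> real) \<Rightarrow> real \<Rightarrow> real" where "ext f x = indicat_real {0<..<1} x *\<^sub>R f x"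
definition cl :: "(real \<Rightarrow> real) \<Rightarrow> real L2t" where "cl f = cls (ext f)"
definition un :: "real L2t \<Rightarrow> real L2t" where "un u = cl (fn u)"

lemma L2_iff: "f \<in> L2 \<longleftrightarrow> sq_integrable (ext f)"
proof -
  have "f \<in> borel_measurable unit_meas \<longleftrightarrow> ext f \<in> borel_measurable lebesgue"
    unfolding ext_def[abs_def] by (intro borel_measurable_restrict_space_iff) simp
  moreover have "integrable unit_meas (\<lambda>x. (f x)\<^sup>2) \<longleftrightarrow> integrable lebesgue (\<lambda>x. (norm (ext f x))\<^sup>2)"
    unfolding lebesgue_on_integral(2)[of "{0<..<1}", simplified] set_integrable_def
    by (intro Bochner_Integration.integrable_cong) (auto simp: ext_def indicator_def)
  ultimately show ?thesis by (simp add: L2_def sq_integrable_def)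
qed

lemma ext_lincomb: "ext (\<lambda>x. a * f x + b * g x) = (\<lambda>x. a *\<^sub>R ext f x + b *\<^sub>R ext g x)"
  by (auto simp: ext_def indicator_def)

lemma L2_lincomb: "f \<in> L2 \<Longrightarrow> g \<in> L2 \<Longrightarrow> (\<lambda>x. a * f x + b * g x) \<in> L2"
  unfolding L2_iff ext_lincomb by (intro sq_integrable_add sq_integrable_scaleR)

lemma cl_lincomb: "f \<in> L2 \<Longrightarrow> g \<in> L2 \<Longrightarrow> cl (\<lambda>x. a * f x + b * g x) = a *\<^sub>R cl f + b *\<^sub>R cl g"
  unfolding L2_iff cl_def ext_lincomb 
  by (simp only: cls_scaleR cls_add[OF sq_integrable_scaleR sq_integrable_scaleR])

lemma l2ip_cl: assumes "f \<in> L2" "g \<in> L2" shows "l2ip f g = cl f \<bullet> cl g"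
proof -
  have "l2ip f g = (LINT x:{0<..<1}|lebesgue. f x * g x)"
    unfolding l2ip_def by (intro lebesgue_on_integral) simp
  also have "\<dots> = (LINT x|lebesgue. ext f x \<bullet> ext g x)"
    unfolding set_lebesgue_integral_def by (intro Bochner_Integration.integral_cong) (auto simp: ext_def indicator_def)
  also have "\<dots> = cl f \<bullet> cl g" using assms by (simp add: cl_def inner_cls L2_iff)
  finally show ?thesis .
qed

lemma AE_unit: "(AE x in unit_meas. P x) \<longleftrightarrow> (AE x in lebesgue. x \<in> {0<..<1} \<longrightarrow> P x)"
  by (intro AE_restrict_space_iff) simp

lemma cl_eq_iff: assumes "f \<in> L2" "g \<in> L2" shows "cl f = cl g \<longleftrightarrow> (AE x in unit_meas. f x = g x)"
  using assms unfolding cl_def L2_iff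
  by (subst cls_eq_iff) (auto simp: AE_unit ext_def indicator_def)

lemma sq_integrable_ext: assumes f: "sq_integrable f" shows "sq_integrable (ext f)"
proof (rule sq_integrable_bound[OF _ sq_integrable_norm[OF f]])
  show "ext f \<in> borel_measurable lebesgue"
    using sq_integrable_measurable[OF f] unfolding ext_def[abs_def] by measurable
qed (auto simp: ext_def indicator_def)

lemma fn_L2 [simp]: "fn u \<in> L2"
  by (simp add: L2_iff sq_integrable_ext)

lemma fn_cl: assumes "f \<in> L2" shows "AE x in lebesgue. fn (cl f) x = ext f x"
  unfolding cl_def using assms by (intro fn_cls) (simp add: L2_iff)

lemma un_cl [simp]: assumes "f \<in> L2" shows "un (cl f) = cl f"
  unfolding un_def
  by (subst cl_eq_iff[OF fn_L2 assms]) (use fn_cl[OF assms] in \<open>auto simp: AE_unit ext_def elim!: AE_mp\<close>)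

lemma un_un [simp]: "un (un u) = un u"
  unfolding un_def[of u] by simp

lemma inner_un: "un u \<bullet> v = un u \<bullet> un v"
proof -
  have "un u \<bullet> v = (LINT x|lebesgue. ext (fn u) x \<bullet> fn v x)"
    unfolding un_def cl_def using inner_cls[of "ext (fn u)" "fn v"] by (simp add: sq_integrable_ext)
  also have "\<dots> = (LINT x|lebesgue. ext (fn u) x \<bullet> ext (fn v) x)"
    by (intro Bochner_Integration.integral_cong) (auto simp: ext_def indicator_def)
  also have "\<dots> = un u \<bullet> un v" unfolding un_def cl_def by (simp add: inner_cls sq_integrable_ext)
  finally show ?thesis .
qed

lemma un_inner: "un u \<bullet> v = u \<bullet> un v"
  using inner_un[of u v] inner_un[of v u] by (simp add: inner_commute)

lemma bounded_linear_un: "bounded_linear un"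
proof (rule bounded_linear_intro[where K = 1])
  fix u v :: "real L2t" and r :: real
  show "un (u + v) = un u + un v"
    by (rule inner_eq_zero_iff[THEN iffD1, THEN right_minus_eq[THEN iffD1]])
      (simp add: inner_diff_left inner_add_left inner_diff_right inner_add_right un_inner)
  show "un (r *\<^sub>R u) = r *\<^sub>R un u"
    by (rule inner_eq_zero_iff[THEN iffD1, THEN right_minus_eq[THEN iffD1]])
      (simp add: inner_diff_left inner_diff_right un_inner)
  have "(norm (un u))\<^sup>2 = u \<bullet> un u" unfolding power2_norm_eq_inner by (metis un_inner un_un)
  then have "norm (un u) * norm (un u) \<le> norm u * norm (un u)"
    using norm_cauchy_schwarz[of u "un u"] by (simp add: power2_eq_square)
  then show "norm (un u) \<le> norm u * 1" by (cases "norm (un u) = 0") auto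
qed

definition X1 :: "real L2t set" where "X1 = {u. un u = u}"

lemma cl_X1 [simp]: "f \<in> L2 \<Longrightarrow> cl f \<in> X1" by (simp add: X1_def)

lemma X1_cl_fn: "u \<in> X1 \<Longrightarrow> cl (fn u) = u" by (simp add: X1_def un_def)

text \<open>\<open>u \<bullet> chi x\<close> is the primitive of \<open>u\<close>.\<close>

definition chi :: "real \<Rightarrow> real L2t" where "chi x = cls (\<lambda>y. indicat_real {0..x} y *\<^sub>R 1)"

lemma inner_chi: "u \<bullet> chi x = (LINT r:{0..x}|lebesgue. fn u r)"
  unfolding chi_def by (subst inner_indicator) (auto simp: emeasure_lborel_Icc_eq)

lemma fn_integrable: "set_integrable lebesgue {0..s} (fn (u :: real L2t))"
  by (intro sq_integrable_set_integrable emeasure_Icc_finite) simp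

lemma prim_continuous: "continuous_on {0..} (\<lambda>x. u \<bullet> chi x)"
  unfolding inner_chi by (intro primitive_continuous fn_integrable)

lemma inner_chi_0 [simp]: "u \<bullet> chi 0 = 0"
  unfolding inner_chi using set_integral_split[OF fn_integrable[of _ u], of 0 0] by simp

lemma chi_cl: assumes "0 \<le> x" "x \<le> 1" shows "chi x = cl (indicat_real {0..x})" "indicat_real {0..x} \<in> L2"
proof -
  have e: "sq_integrable (\<lambda>y. indicat_real {0..x} y *\<^sub>R (1 :: real))" by (intro sq_integrable_indicator emeasure_Icc_finite)
  then show i: "indicat_real {0..x} \<in> L2" unfolding L2_iff by (simp add: sq_integrable_ext)
  have "AE y in lebesgue. y \<noteq> 0 \<and> y \<noteq> (1 :: real)"
    by (intro AE_conjI; rule AE_completion; rule AE_lborel_singleton)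
  then have "AE y in lebesgue. indicat_real {0..x} y *\<^sub>R (1 :: real) = ext (indicat_real {0..x}) y"
    by eventually_elim (use assms in \<open>auto simp: ext_def indicator_def\<close>)
  then show "chi x = cl (indicat_real {0..x})"
    unfolding chi_def cl_def using e i by (intro cls_eqI) (auto simp: L2_iff)
qed

lemma chi_X1: "0 \<le> x \<Longrightarrow> x \<le> 1 \<Longrightarrow> chi x \<in> X1"
  using chi_cl by simp

lemma chi_inner_chi: assumes "0 \<le> x" "0 \<le> y" shows "chi x \<bullet> chi y = min x y"
proof -
  have "chi x \<bullet> chi y = (LINT r|lebesgue. (indicat_real {0..x} r *\<^sub>R (1 :: real)) \<bullet> (indicat_real {0..y} r *\<^sub>R 1))"
    unfolding chi_def by (intro inner_cls sq_integrable_indicator emeasure_Icc_finite)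
  also have "\<dots> = (LINT r|lebesgue. indicat_real {0..min x y} r)"
    by (intro Bochner_Integration.integral_cong) (auto simp: indicator_def)
  also have "\<dots> = min x y" using assms by simp
  finally show ?thesis .
qed

lemma inner_chi_ge_1: assumes "u \<in> X1" "1 \<le> x" shows "u \<bullet> chi x = u \<bullet> chi 1"
proof -
  have "un (chi x) = chi 1"
  proof -
    have e: "sq_integrable (\<lambda>y. indicat_real {0..x} y *\<^sub>R (1 :: real))" by (intro sq_integrable_indicator emeasure_Icc_finite)
    have "AE y in lebesgue. ext (fn (chi x)) y = ext (indicat_real {0..1}) y"
      using fn_cls[OF e] unfolding chi_def
      by eventually_elim (use assms in \<open>auto simp: ext_def indicator_def\<close>)
    then have "cl (fn (chi x)) = cl (indicat_real {0..1})"
      unfolding cl_def using chi_cl(2)[of 1] by (intro cls_eqI) (auto simp: L2_iff intro: sq_integrable_ext)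
    then show ?thesis by (simp add: un_def chi_cl)
  qed
  then show ?thesis using assms(1) un_inner[of u "chi x"] by (simp add: X1_def)
qed

text \<open>A class is determined by its primitive.\<close>

lemma zero_if_AE_prim_zero:
  assumes u: "u \<in> X1" and z: "AE x in lebesgue. 0 \<le> x \<longrightarrow> u \<bullet> chi x = 0" shows "u = 0"
proof -
  have "AE s in lebesgue. 0 \<le> s \<longrightarrow> fn u s = 0"
    by (rule primitive_zero_imp_zero[OF fn_integrable]) (use z in \<open>simp add: inner_chi\<close>)
  then have "AE x in unit_meas. fn u x = 0" unfolding AE_unit by eventually_elim auto
  moreover have z0: "(\<lambda>_. 0) \<in> L2" by (simp add: L2_def)
  ultimately have "cl (fn u) = cl (\<lambda>_. 0)" by (simp add: cl_eq_iff)
  then show ?thesis using X1_cl_fn[OF u] cl_lincomb[OF z0 z0, of 0 0] by simp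
qed

lemma zero_if_prim_zero:
  assumes u: "u \<in> X1" and z: "\<And>x. 0 \<le> x \<Longrightarrow> x \<le> 1 \<Longrightarrow> u \<bullet> chi x = 0" shows "u = 0"
proof (rule zero_if_AE_prim_zero[OF u], rule AE_I2, rule impI)
  fix x :: real assume "0 \<le> x"
  then show "u \<bullet> chi x = 0" using z[of x] z[of 1] inner_chi_ge_1[OF u, of x] by (cases "x \<le> 1") auto
qed

text \<open>The primitive, as an operator on classes.\<close>

definition K :: "real L2t \<Rightarrow> real L2t" where "K u = cl (\<lambda>x. u \<bullet> chi x)"

lemma continuous_L2: assumes "continuous_on {0..1} f" shows "f \<in> L2"
proof -
  have i: "integrable lebesgue (\<lambda>x. indicat_real {0..1} x *\<^sub>R (f x)\<^sup>2)" "(\<lambda>x. indicat_real {0..1} x *\<^sub>R f x) \<in> borel_measurable lebesgue"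
    using continuous_set_integrable[OF continuous_on_power[OF assms, of 2]] continuous_set_integrable[OF assms]
    by (auto simp: set_integrable_def)
  have e: "ext f = (\<lambda>x. indicat_real {0<..<1} x *\<^sub>R (indicat_real {0..1} x *\<^sub>R f x))" by (auto simp: ext_def indicator_def)
  have "sq_integrable (ext f)"
  proof (rule sq_integrable_bound[OF _ i(1)])
    show "ext f \<in> borel_measurable lebesgue" unfolding e by (intro borel_measurable_scaleR i(2) borel_measurable_indicator) simp
  qed (auto simp: ext_def indicator_def)
  then show ?thesis by (simp add: L2_iff)
qed

lemma prim_L2 [simp]: "(\<lambda>x. u \<bullet> chi x) \<in> L2"
  by (intro continuous_L2 continuous_on_subset[OF prim_continuous]) auto

lemma K_X1 [simp]: "K u \<in> X1" by (simp add: K_def)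

lemma norm_chi: "0 \<le> x \<Longrightarrow> x \<le> 1 \<Longrightarrow> norm (chi x) \<le> 1"
  unfolding norm_eq_sqrt_inner by (simp add: chi_inner_chi)

lemma bounded_linear_K: "bounded_linear K"
proof (rule bounded_linear_intro[where K = 1])
  fix u v :: "real L2t" and r :: real
  show "K (u + v) = K u + K v"
    using cl_lincomb[OF prim_L2[of u] prim_L2[of v], of 1 1] by (simp add: K_def inner_add_left)
  show "K (r *\<^sub>R u) = r *\<^sub>R K u"
    using cl_lincomb[OF prim_L2[of u] prim_L2[of u], of r 0] by (simp add: K_def)
  have e: "sq_integrable (ext (\<lambda>x. u \<bullet> chi x))" using prim_L2[of u] unfolding L2_iff .
  have "(norm (K u))\<^sup>2 \<le> (LINT x::real|lebesgue. indicat_real {0..1} x * (norm u)\<^sup>2)"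
    unfolding K_def cl_def norm_sq_cls[OF e]
  proof (rule integral_mono[OF sq_integrable_norm[OF e]])
    show "integrable lebesgue (\<lambda>x::real. indicat_real {0..1} x * (norm u)\<^sup>2)"
      by (intro integrable_mult_left integrable_real_indicator) (auto simp: emeasure_lborel_Icc_eq)
    fix x :: real
    show "(norm (ext (\<lambda>x. u \<bullet> chi x) x))\<^sup>2 \<le> indicat_real {0..1} x * (norm u)\<^sup>2"
    proof (cases "x \<in> {0<..<1}")
      case True
      then have "\<bar>u \<bullet> chi x\<bar> \<le> norm u * 1"
        using Cauchy_Schwarz_ineq2[of u "chi x"] norm_chi[of x] mult_left_mono[of "norm (chi x)" 1 "norm u"] by simp
      then have "\<bar>u \<bullet> chi x\<bar>\<^sup>2 \<le> (norm u)\<^sup>2" by (intro power_mono) auto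
      then show ?thesis using True by (simp add: ext_def)
    next
      case False
      then have "ext (\<lambda>x. u \<bullet> chi x) x = 0" by (auto simp: ext_def indicator_def)
      then show ?thesis by simp
    qed
  qed
  also have "\<dots> = (norm u)\<^sup>2" by simp
  finally have "norm (K u) \<le> norm u" by (rule power2_le_imp_le) simp
  then show "norm (K u) \<le> norm u * 1" by simp
qed

lemma prim_AE_const:
  assumes "AE x in lebesgue. x \<in> {0<..<1} \<longrightarrow> u \<bullet> chi x = k" "x \<in> {0..1}" shows "u \<bullet> chi x = k"
proof -
  have c: "continuous_on {0..1} (\<lambda>x. u \<bullet> chi x)" by (rule continuous_on_subset[OF prim_continuous]) auto
  have "closed {x \<in> {0..1}. u \<bullet> chi x = k}" by (intro continuous_closed_preimage_constant c) simp
  moreover have "AE x in lebesgue. x \<in> {0<..<1} \<longrightarrow> x \<in> {x \<in> {0..1}. u \<bullet> chi x = k}"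
    using assms(1) by eventually_elim auto
  ultimately have i: "u \<bullet> chi x = k" if "x \<in> {0<..<1}" for x
    using mem_closed_if_AE_lebesgue_open[of "{0<..<1}" "{x \<in> {0..1}. u \<bullet> chi x = k}" x] that by auto
  have cl: "closure {0<..<1::real} = {0..1}" by simp
  show ?thesis
    by (rule continuous_constant_on_closure[of "{0<..<1}" "\<lambda>x. u \<bullet> chi x" k x]) (use i assms(2) c cl in auto)
qed

lemma K_zero: assumes "u \<in> X1" "K u = 0" shows "u = 0"
proof -
  have z: "(\<lambda>_. 0) \<in> L2" by (simp add: L2_def)
  have "cl (\<lambda>_. 0) = 0" using cl_lincomb[OF z z, of 0 0] by simp
  then have "AE x in unit_meas. u \<bullet> chi x = 0"
    using assms(2) cl_eq_iff[OF prim_L2 z, of u] by (simp add: K_def)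
  then have ae: "AE x in lebesgue. x \<in> {0<..<1} \<longrightarrow> u \<bullet> chi x = 0" unfolding AE_unit .
  show ?thesis by (rule zero_if_prim_zero[OF assms(1)], rule prim_AE_const[OF ae]) simp
qed

text \<open>Integration by parts for the primitives of two square integrable functions.\<close>

lemma K_adjoint: assumes q: "q \<in> X1" and w: "w \<in> X1" shows "q \<bullet> K w + K q \<bullet> w = (q \<bullet> chi 1) * (w \<bullet> chi 1)"
proof -
  have inner_K: "q \<bullet> K w = (LINT r:{0..1}|lebesgue. fn q r *\<^sub>R (LINT u:{0..r}|lebesgue. fn w u))" if q: "q \<in> X1" for q w
  proof -
    have "q \<bullet> K w = l2ip (fn q) (\<lambda>x. w \<bullet> chi x)"
      using X1_cl_fn[OF q] by (simp add: l2ip_cl K_def)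
    also have "\<dots> = (LINT r:{0<..<1}|lebesgue. fn q r * (w \<bullet> chi r))"
      unfolding l2ip_def by (intro lebesgue_on_integral) simp
    also have "\<dots> = (LINT r:{0..1}|lebesgue. fn q r *\<^sub>R (LINT u:{0..r}|lebesgue. fn w u))"
      unfolding set_lebesgue_integral_def[of lebesgue "{0<..<1}"] set_lebesgue_integral_def[of lebesgue "{0..1}"]
    proof (rule integral_cong_AE)
      have "AE y in lebesgue. y \<noteq> 0 \<and> y \<noteq> (1 :: real)"
        by (intro AE_conjI; rule AE_completion; rule AE_lborel_singleton)
      then show "AE x in lebesgue. indicator {0<..<1} x *\<^sub>R (fn q x * (w \<bullet> chi x)) = indicator {0..1} x *\<^sub>R fn q x *\<^sub>R (LINT u:{0..x}|lebesgue. fn w u)"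
        by eventually_elim (auto simp: indicator_def inner_chi)
      have m: "(\<lambda>x. indicator {0..1} x *\<^sub>R fn q x *\<^sub>R (LINT u:{0..x}|lebesgue. fn w u)) \<in> borel_measurable lebesgue"
        using integral_triangle(1)[OF fn_integrable[of 1 w] fn_integrable[of 1 q]] by (auto simp: set_integrable_def)
      then show "(\<lambda>x. indicator {0..1} x *\<^sub>R fn q x *\<^sub>R (LINT u:{0..x}|lebesgue. fn w u)) \<in> borel_measurable lebesgue" .
      have "(\<lambda>x. indicator {0<..<1} x *\<^sub>R (fn q x * (w \<bullet> chi x))) = (\<lambda>x. indicat_real {0<..<1} x *\<^sub>R (indicator {0..1} x *\<^sub>R fn q x *\<^sub>R (LINT u:{0..x}|lebesgue. fn w u)))"
        by (auto simp: indicator_def inner_chi)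
      then show "(\<lambda>x. indicator {0<..<1} x *\<^sub>R (fn q x * (w \<bullet> chi x))) \<in> borel_measurable lebesgue"
        by (simp only:) (intro borel_measurable_scaleR m borel_measurable_indicator, simp)
    qed
    finally show ?thesis .
  qed
  have "q \<bullet> K w = (LINT u:{0..1}|lebesgue. (LINT r:{u..1}|lebesgue. fn q r) *\<^sub>R fn w u)"
    unfolding inner_K[OF q] by (rule integral_triangle(2)[OF fn_integrable fn_integrable])
  also have "\<dots> = (LINT u:{0..1}|lebesgue. (q \<bullet> chi 1) * fn w u - fn w u *\<^sub>R (LINT r:{0..u}|lebesgue. fn q r))"
    unfolding set_lebesgue_integral_def[of lebesgue "{0..1}"]
  proof (intro Bochner_Integration.integral_cong refl)
    fix u :: real
    show "indicator {0..1} u *\<^sub>R (LINT r:{u..1}|lebesgue. fn q r) *\<^sub>R fn w u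
        = indicator {0..1} u *\<^sub>R ((q \<bullet> chi 1) * fn w u - fn w u *\<^sub>R (LINT r:{0..u}|lebesgue. fn q r))"
      using set_integral_split[OF fn_integrable[of _ q], of u 1]
      by (cases "u \<in> {0..1}") (auto simp: inner_chi left_diff_distrib right_diff_distrib mult.commute)
  qed
  also have "\<dots> = (LINT u:{0..1}|lebesgue. (q \<bullet> chi 1) * fn w u) - (LINT u:{0..1}|lebesgue. fn w u *\<^sub>R (LINT r:{0..u}|lebesgue. fn q r))"
    by (intro set_integral_diff(2) integral_triangle(1) fn_integrable) (use fn_integrable[of 1 w] in simp)
  also have "\<dots> = (q \<bullet> chi 1) * (w \<bullet> chi 1) - w \<bullet> K q"
    unfolding inner_K[OF w] by (simp add: inner_chi)
  finally show ?thesis by (simp add: inner_commute)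
qed

text \<open>Derivatives of functions in \<open>H10\<close> are the elements of mean value zero, with orthogonal projection
  \<open>pr0\<close>.\<close>

definition X0 :: "real L2t set" where "X0 = {u \<in> X1. u \<bullet> chi 1 = 0}"
definition pr0 :: "real L2t \<Rightarrow> real L2t" where "pr0 u = un u - (u \<bullet> chi 1) *\<^sub>R chi 1"

lemma un_chi_1 [simp]: "un (chi 1) = chi 1" using chi_X1[of 1] by (simp add: X1_def)
lemma chi_1_1 [simp]: "chi 1 \<bullet> chi 1 = 1" by (simp add: chi_inner_chi)
lemma un_inner_chi_1 [simp]: "un u \<bullet> chi 1 = u \<bullet> chi 1" by (simp add: un_inner)

lemmas un_linear = linear_simps[OF bounded_linear_un]
lemmas K_linear = linear_simps[OF bounded_linear_K]

lemma bounded_linear_pr0: "bounded_linear pr0"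
  unfolding pr0_def
  by (intro bounded_linear_sub bounded_linear_un bounded_linear_compose[OF bounded_linear_scaleR_left bounded_linear_inner_left])

lemma pr0_pr0: "pr0 (pr0 u) = pr0 u"
  by (simp add: pr0_def un_linear inner_diff_left)

lemma pr0_inner: "pr0 u \<bullet> v = u \<bullet> pr0 v"
  unfolding pr0_def inner_diff_left inner_diff_right un_inner by (simp add: inner_commute[of "chi 1" v])

lemma X0_iff: "u \<in> X0 \<longleftrightarrow> pr0 u = u"
proof
  assume "pr0 u = u"
  then have e: "u = un u - (u \<bullet> chi 1) *\<^sub>R chi 1" by (simp add: pr0_def)
  have "un u = un (un u - (u \<bullet> chi 1) *\<^sub>R chi 1)" by (rule arg_cong[OF e])
  also have "\<dots> = un u - (u \<bullet> chi 1) *\<^sub>R chi 1" by (simp add: un_linear)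
  also have "\<dots> = u" by (rule e[symmetric])
  finally have "un u = u" .
  moreover have "u \<bullet> chi 1 = (un u - (u \<bullet> chi 1) *\<^sub>R chi 1) \<bullet> chi 1" by (rule arg_cong[OF e])
  then have "u \<bullet> chi 1 = 0" by (simp add: inner_diff_left)
  ultimately show "u \<in> X0" by (simp add: X0_def X1_def)
qed (auto simp: X0_def X1_def pr0_def)

text \<open>By \<open>K_adjoint\<close>, \<open>K a\<close> is orthogonal to all elements of mean value zero, so it is constant; being a
  primitive that vanishes at \<open>0\<close>, it is zero. In other words \<open>H10\<close> is dense in \<open>L\<^sup>2(0,1)\<close>.\<close>

lemma K_X0_dense: assumes a: "a \<in> X1" and o: "\<And>w. w \<in> X0 \<Longrightarrow> a \<bullet> K w = 0" shows "a = 0"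
proof -
  have "pr0 (K a) \<in> X0" by (simp add: X0_iff pr0_pr0)
  then have "K a \<bullet> pr0 (K a) = 0" using K_adjoint[OF a, of "pr0 (K a)"] o[of "pr0 (K a)"] by (simp add: X0_def)
  then have "pr0 (K a) \<bullet> pr0 (K a) = 0" by (metis pr0_inner pr0_pr0)
  then have "K a = (K a \<bullet> chi 1) *\<^sub>R chi 1" using K_X1[of a] by (simp add: pr0_def X1_def)
  then obtain k where k: "K a = k *\<^sub>R chi 1" by blast
  have "cl (\<lambda>x. k * indicat_real {0..1} x) = k *\<^sub>R chi 1"
    using cl_lincomb[OF chi_cl(2) chi_cl(2), of 1 1 k 0] by (simp add: chi_cl(1))
  then have "cl (\<lambda>x. a \<bullet> chi x) = cl (\<lambda>x. k * indicat_real {0..1} x)" using k by (simp add: K_def)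
  moreover have "(\<lambda>x. k * indicat_real {0..1} x) \<in> L2"
    using L2_lincomb[OF chi_cl(2) chi_cl(2), of 1 1 k 0] by simp
  ultimately have "AE x in unit_meas. a \<bullet> chi x = k * indicat_real {0..1} x"
    by (simp only: cl_eq_iff[OF prim_L2])
  then have "AE x in lebesgue. x \<in> {0<..<1} \<longrightarrow> a \<bullet> chi x = k" unfolding AE_unit by eventually_elim auto
  then have all: "a \<bullet> chi x = k" if "x \<in> {0..1}" for x using that by (rule prim_AE_const)
  from all[of 0] have "k = 0" by simp
  then show ?thesis using all by (intro zero_if_prim_zero a) auto
qed

subsection \<open>Weakly differentiable functions\<close>

text \<open>The choice of representative in \<open>wx\<close> disappears in the class \<open>dh h\<close>.\<close>

definition dh :: "(real \<Rightarrow> real) \<Rightarrow> real L2t" where "dh h = cl (wx h)"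

lemma wx: assumes "h \<in> H1" shows "wx h \<in> L2" "weak_deriv {0<..<1} h (wx h)"
proof -
  have "\<exists>h'. h' \<in> L2 \<and> weak_deriv {0<..<1} h h'" using assms by (auto simp: H1_def)
  from someI_ex[OF this] show "wx h \<in> L2" "weak_deriv {0<..<1} h (wx h)" by (auto simp: wx_def)
qed

lemma dh_X1 [simp]: "h \<in> H1 \<Longrightarrow> dh h \<in> X1" by (simp add: dh_def wx)

lemma weak_deriv_cong:
  assumes "weak_deriv J h f" "J \<in> sets lebesgue" "\<And>x. x \<in> J \<Longrightarrow> h x = h' x" "\<And>x. x \<in> J \<Longrightarrow> f x = f' x"
  shows "weak_deriv J h' f'"
proof -
  have 1: "integrable (lebesgue_on K) h' = integrable (lebesgue_on K) h" "integrable (lebesgue_on K) f' = integrable (lebesgue_on K) f"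
    if "K \<subseteq> J" for K using that assms by (auto intro!: Bochner_Integration.integrable_cong simp: subset_iff)
  have 2: "(LINT x|lebesgue_on J. h' x * \<theta> x) = (LINT x|lebesgue_on J. h x * \<theta> x)"
    "(LINT x|lebesgue_on J. f' x * \<theta> x) = (LINT x|lebesgue_on J. f x * \<theta> x)" for \<theta>
    using assms by (auto intro!: Bochner_Integration.integral_cong)
  show ?thesis using assms(1) unfolding weak_deriv_def 2 using 1 by blast
qed

lemma ext_fn_cl: assumes "f \<in> L2" "x \<in> {0..1}" shows "(LINT r:{0..x}|lebesgue. ext f r) = cl f \<bullet> chi x"
  unfolding inner_chi set_lebesgue_integral_def
proof (rule integral_cong_AE)
  show "AE r in lebesgue. indicator {0..x} r *\<^sub>R ext f r = indicator {0..x} r *\<^sub>R fn (cl f) r"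
    using fn_cl[OF assms(1)] by eventually_elim simp
  have [measurable]: "ext f \<in> borel_measurable lebesgue" using assms(1) by (simp add: L2_iff sq_integrable_measurable)
  show "(\<lambda>r. indicator {0..x} r *\<^sub>R ext f r) \<in> borel_measurable lebesgue" by measurable
qed measurable

text \<open>For a continuous representative the weak derivative is the derivative in the sense of primitives.
  Everything about \<open>H1\<close> below rests on this and on its converse \<open>H1_I\<close>.\<close>

lemma weak_deriv_prim: assumes h: "continuous_on {0..1} h" "weak_deriv {0<..<1} h f" "f \<in> L2" and x: "x \<in> {0..1}"
  shows "h x = h 0 + cl f \<bullet> chi x"
proof -
  have "h x = h 0 + (LINT r:{0..x}|lebesgue. ext f r)"
  proof (rule weak_deriv_imp_primitive[of "{0<..<1}"])
    show "weak_deriv {0<..<1} h (ext f)" by (rule weak_deriv_cong[OF h(2)]) (auto simp: ext_def)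
    show "set_integrable lebesgue {0..s} (ext f)" for s
      using h(3) by (intro sq_integrable_set_integrable emeasure_Icc_finite) (simp add: L2_iff)
  qed (use h x in auto)
  then show ?thesis using ext_fn_cl[OF h(3) x] by simp
qed

lemma H1_prim: "h \<in> H1 \<Longrightarrow> x \<in> {0..1} \<Longrightarrow> h x = h 0 + dh h \<bullet> chi x"
  unfolding dh_def by (intro weak_deriv_prim wx) (auto simp: H1_def)

lemma H1_I:
  assumes u: "u \<in> X1" and h: "\<And>x. x \<in> {0..1} \<Longrightarrow> h x = c + u \<bullet> chi x"
  shows "h \<in> H1" "dh h = u"
proof -
  have cont: "continuous_on {0..1} h"
    by (subst continuous_on_cong[OF refl h]) (auto intro!: continuous_intros continuous_on_subset[OF prim_continuous])
  have wd: "weak_deriv {0<..<1} h (fn u)"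
    by (rule primitive_imp_weak_deriv[where c = c]) (auto simp: fn_integrable h inner_chi)
  show H: "h \<in> H1" unfolding H1_def using cont wd continuous_L2[OF cont] fn_L2 by blast
  have "dh h - u = 0"
  proof (rule zero_if_prim_zero)
    show "dh h - u \<in> X1" using u dh_X1[OF H] by (simp add: X1_def un_linear)
    fix x :: real assume "0 \<le> x" "x \<le> 1"
    then show "(dh h - u) \<bullet> chi x = 0" using H1_prim[OF H, of x] h[of x] h[of 0] by (simp add: inner_diff_left)
  qed
  then show "dh h = u" by simp
qed

lemma H1_lincomb:
  assumes "f \<in> H1" "g \<in> H1"
  shows "(\<lambda>x. a * f x + b * g x) \<in> H1" "dh (\<lambda>x. a * f x + b * g x) = a *\<^sub>R dh f + b *\<^sub>R dh g"
proof -
  have X: "a *\<^sub>R dh f + b *\<^sub>R dh g \<in> X1" using dh_X1[OF assms(1)] dh_X1[OF assms(2)] by (simp add: X1_def un_linear)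
  have p: "a * f x + b * g x = (a * f 0 + b * g 0) + (a *\<^sub>R dh f + b *\<^sub>R dh g) \<bullet> chi x" if "x \<in> {0..1}" for x
  proof -
    have "f x = f 0 + dh f \<bullet> chi x" "g x = g 0 + dh g \<bullet> chi x" using H1_prim assms that by auto
    then show ?thesis by (simp add: inner_add_left algebra_simps)
  qed
  show "(\<lambda>x. a * f x + b * g x) \<in> H1" "dh (\<lambda>x. a * f x + b * g x) = a *\<^sub>R dh f + b *\<^sub>R dh g"
    using H1_I[OF X p] by auto
qed

lemma H1_L2: "h \<in> H1 \<Longrightarrow> h \<in> L2" by (simp add: H1_def)
lemma Hstar_H1: "h \<in> Hstar \<Longrightarrow> h \<in> H1" by (simp add: Hstar_def)
lemma H10_Hstar: "h \<in> H10 \<Longrightarrow> h \<in> Hstar" by (simp add: H10_def Hstar_def)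

lemma Hstar_prim: "h \<in> Hstar \<Longrightarrow> x \<in> {0..1} \<Longrightarrow> h x = dh h \<bullet> chi x"
  using H1_prim[OF Hstar_H1] by (simp add: Hstar_def)

lemma Hstar_I: "u \<in> X1 \<Longrightarrow> (\<lambda>x. u \<bullet> chi x) \<in> Hstar" and dh_prim: "u \<in> X1 \<Longrightarrow> dh (\<lambda>x. u \<bullet> chi x) = u"
  using H1_I[of u "\<lambda>x. u \<bullet> chi x" 0] by (auto simp: Hstar_def)

lemma Hstar_lincomb: "f \<in> Hstar \<Longrightarrow> g \<in> Hstar \<Longrightarrow> (\<lambda>x. a * f x + b * g x) \<in> Hstar"
  using H1_lincomb(1) by (simp add: Hstar_def)

lemma H10_lincomb: "f \<in> H10 \<Longrightarrow> g \<in> H10 \<Longrightarrow> (\<lambda>x. a * f x + b * g x) \<in> H10"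
  using H1_lincomb(1) by (simp add: H10_def)

lemma H10_iff: "h \<in> H10 \<longleftrightarrow> h \<in> Hstar \<and> dh h \<in> X0"
  using Hstar_prim[of h 1] dh_X1[OF Hstar_H1, of h] by (auto simp: H10_def Hstar_def X0_def)

lemma cl_Hstar: "h \<in> Hstar \<Longrightarrow> cl h = K (dh h)"
  unfolding K_def using Hstar_prim by (subst cl_eq_iff) (auto simp: H1_L2 Hstar_H1 AE_unit)

text \<open>The strong form of the equation for \<open>v\<close>, with the condition \<open>v\<^sub>x(1) = 0\<close>, is the weak form
  tested with all of \<open>Hstar\<close>. From the weak form, \<open>v\<^sub>x\<close> is recovered as the primitive of the remaining terms
  that vanishes at \<open>1\<close>.\<close>

lemma strong_iff_weak:
  assumes v: "v \<in> Hstar" and f: "f \<in> L2" "g \<in> L2" and b: "b \<noteq> 0"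
  shows "(\<exists>p\<in>H1. (AE x in unit_meas. p x = wx v x) \<and> p 1 = 0 \<and> (AE x in unit_meas. f x = b * wx p x + g x))
    \<longleftrightarrow> (\<forall>w\<in>X1. cl f \<bullet> K w = - b * (dh v \<bullet> w) + cl g \<bullet> K w)"
proof
  assume "\<exists>p\<in>H1. (AE x in unit_meas. p x = wx v x) \<and> p 1 = 0 \<and> (AE x in unit_meas. f x = b * wx p x + g x)"
  then obtain p where p: "p \<in> H1" "AE x in unit_meas. p x = wx v x" "p 1 = 0" "AE x in unit_meas. f x = b * wx p x + g x" by blast
  define q where "q = dh p"
  have qX: "q \<in> X1" using p by (simp add: q_def)
  have px: "p x = q \<bullet> chi x - q \<bullet> chi 1" if "x \<in> {0..1}" for x
    using H1_prim[OF p(1) that] H1_prim[OF p(1), of 1] p(3) by (simp add: q_def)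
  have "dh v = cl p" unfolding dh_def using p v by (subst cl_eq_iff) (auto simp: H1_L2 Hstar_H1 wx elim: AE_mp)
  also have "\<dots> = cl (\<lambda>x. 1 * (q \<bullet> chi x) + - (q \<bullet> chi 1) * indicat_real {0..1} x)"
    using px L2_lincomb[OF prim_L2 chi_cl(2), of 1 1 q "- (q \<bullet> chi 1)"] p(1)
    by (subst cl_eq_iff) (auto simp: H1_L2 AE_unit)
  also have "\<dots> = K q - (q \<bullet> chi 1) *\<^sub>R chi 1"
    by (subst cl_lincomb[OF prim_L2 chi_cl(2)]) (auto simp: K_def chi_cl)
  finally have dv: "dh v = K q - (q \<bullet> chi 1) *\<^sub>R chi 1" .
  have "cl f = cl (\<lambda>x. b * wx p x + 1 * g x)"
    using p f L2_lincomb[OF wx(1)[OF p(1)] f(2), of b 1] by (subst cl_eq_iff) auto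
  also have "\<dots> = b *\<^sub>R q + cl g" using cl_lincomb[OF wx(1)[OF p(1)] f(2), of b 1] by (simp add: q_def dh_def)
  finally have "cl f = b *\<^sub>R q + cl g" .
  then show "\<forall>w\<in>X1. cl f \<bullet> K w = - b * (dh v \<bullet> w) + cl g \<bullet> K w"
  proof (intro ballI)
    fix w assume "w \<in> X1"
    then have "q \<bullet> K w = (q \<bullet> chi 1) * (w \<bullet> chi 1) - K q \<bullet> w" using K_adjoint[OF qX] by (simp add: eq_diff_eq)
    then have "q \<bullet> K w = - (dh v \<bullet> w)" by (simp add: dv inner_diff_left inner_commute[of "chi 1"])
    then show "cl f \<bullet> K w = - b * (dh v \<bullet> w) + cl g \<bullet> K w"
      by (simp add: \<open>cl f = b *\<^sub>R q + cl g\<close> inner_add_left)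
  qed
next
  assume weak: "\<forall>w\<in>X1. cl f \<bullet> K w = - b * (dh v \<bullet> w) + cl g \<bullet> K w"
  define q where "q = (1 / b) *\<^sub>R (cl f - cl g)"
  have qX: "q \<in> X1" using f cl_X1[OF f(1)] cl_X1[OF f(2)] by (simp add: q_def X1_def un_linear)
  have vX: "dh v \<in> X1" using v by (simp add: Hstar_H1)
  have qK: "q \<bullet> K w = - (dh v \<bullet> w)" if "w \<in> X1" for w
    using weak[rule_format, OF that] b by (simp add: q_def inner_diff_left field_simps)
  \<comment> \<open>The expected primitive of \<open>q\<close> vanishing at \<open>1\<close> is \<open>K q - (q \<bullet> chi 1) chi 1\<close>; testing with \<open>d\<close> itself shows that \<open>dh v\<close> is this primitive.\<close>
  define d where "d = dh v - (K q - (q \<bullet> chi 1) *\<^sub>R chi 1)"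
  have dX: "d \<in> X1" using vX K_X1[of q] by (simp add: d_def X1_def un_linear)
  have "d \<bullet> d = 0"
  proof -
    have "d \<bullet> e = dh v \<bullet> e - (K q \<bullet> e - (q \<bullet> chi 1) * (e \<bullet> chi 1))" for e
      by (simp add: d_def inner_diff_left inner_commute[of "chi 1"])
    then show ?thesis using K_adjoint[OF qX dX] qK[OF dX] by simp
  qed
  then have dv: "dh v = K q - (q \<bullet> chi 1) *\<^sub>R chi 1" by (simp add: d_def)
  define p where "p x = - (q \<bullet> chi 1) + q \<bullet> chi x" for x
  have pH: "p \<in> H1" and dp: "dh p = q" using H1_I[OF qX, of p "- (q \<bullet> chi 1)"] by (auto simp: p_def)
  have "cl p = cl (\<lambda>x. 1 * (q \<bullet> chi x) + - (q \<bullet> chi 1) * indicat_real {0..1} x)"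
    using L2_lincomb[OF prim_L2 chi_cl(2), of 1 1 q "- (q \<bullet> chi 1)"] pH
    by (subst cl_eq_iff) (auto simp: H1_L2 AE_unit p_def)
  also have "\<dots> = dh v"
    unfolding dv by (subst cl_lincomb[OF prim_L2 chi_cl(2)]) (auto simp: K_def chi_cl)
  finally have "AE x in unit_meas. p x = wx v x"
    unfolding dh_def using pH v by (subst (asm) cl_eq_iff) (auto simp: H1_L2 Hstar_H1 wx)
  moreover have "AE x in unit_meas. f x = b * wx p x + g x"
  proof -
    have "cl (\<lambda>x. b * wx p x + 1 * g x) = b *\<^sub>R q + cl g"
      using cl_lincomb[OF wx(1)[OF pH] f(2), of b 1] dp by (simp add: dh_def)
    also have "\<dots> = cl f" using b by (simp add: q_def)
    finally have "cl f = cl (\<lambda>x. b * wx p x + 1 * g x)" by simp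
    then show ?thesis using f L2_lincomb[OF wx(1)[OF pH] f(2), of b 1] by (subst (asm) cl_eq_iff) auto
  qed
  ultimately show "\<exists>p\<in>H1. (AE x in unit_meas. p x = wx v x) \<and> p 1 = 0 \<and> (AE x in unit_meas. f x = b * wx p x + g x)"
    using pH by (intro bexI[of _ p]) (auto simp: p_def)
qed

section \<open>Histories with values in function spaces on the interval\<close>

text \<open>The two cases \<open>H10\<close> and \<open>Hstar\<close> are treated together: in both, taking the derivative is an
  isometry onto the range of an orthogonal projection of \<open>L\<^sup>2\<close>.\<close>

locale history_space =
  fixes Hs :: "(real \<Rightarrow> real) set" and pr :: "real L2t \<Rightarrow> real L2t"
  assumes Hs_pr: "(Hs = H10 \<and> pr = pr0) \<or> (Hs = Hstar \<and> pr = un)"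
begin

lemma pr_bl: "bounded_linear pr"
  using Hs_pr bounded_linear_un bounded_linear_pr0 by auto

lemma pr_pr: "pr (pr u) = pr u"
  using Hs_pr pr0_pr0 un_un by auto

lemma pr_self_adjoint: "pr u \<bullet> v = u \<bullet> pr v"
  using Hs_pr pr0_inner un_inner by auto

lemma Hs_Hstar: "h \<in> Hs \<Longrightarrow> h \<in> Hstar"
  using Hs_pr H10_Hstar by auto

lemma Hs_iff: "h \<in> Hs \<longleftrightarrow> h \<in> Hstar \<and> pr (dh h) = dh h"
  using Hs_pr H10_iff[of h] X0_iff[of "dh h"] dh_X1[OF Hstar_H1, of h] by (auto simp: X1_def)

lemma pr_X1: "pr u = u \<Longrightarrow> u \<in> X1"
  using Hs_pr X0_iff[of u] by (auto simp: X1_def X0_def)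

lemma prim_Hs: "pr u = u \<Longrightarrow> (\<lambda>x. u \<bullet> chi x) \<in> Hs" and dh_prim_Hs: "pr u = u \<Longrightarrow> dh (\<lambda>x. u \<bullet> chi x) = u"
  using pr_X1[of u] dh_prim[of u] Hstar_I[of u] by (auto simp: Hs_iff)

lemma Hs_lincomb: "f \<in> Hs \<Longrightarrow> g \<in> Hs \<Longrightarrow> (\<lambda>x. a * f x + b * g x) \<in> Hs"
  using Hs_pr Hstar_lincomb H10_lincomb by auto

lemma Hs_H1: "h \<in> Hs \<Longrightarrow> h \<in> H1" using Hs_Hstar Hstar_H1 by blast

lemma l2ip_wx: "h \<in> Hs \<Longrightarrow> h' \<in> Hs \<Longrightarrow> l2ip (wx h) (wx h') = dh h \<bullet> dh h'"
  unfolding dh_def by (intro l2ip_cl wx Hs_H1)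

end

text \<open>The alternative \<open>g_alt\<close> is what the lower bound on \<open>g'\<close> is needed for: a kernel with bounded support
  would leave the history undetermined beyond it.\<close>

locale kernel = history_space Hs pr for Hs and pr +
  fixes g :: "real \<Rightarrow> real"
  assumes g_nonneg: "\<And>s. s \<ge> 0 \<Longrightarrow> g s \<ge> 0" and g_antimono: "antimono_on {0..} g"
    and g_int: "integrable (lebesgue_on {0..}) g"
    and g_alt: "(\<forall>s\<ge>0. g s > 0) \<or> (\<forall>s\<ge>0. g s = 0)"
begin

definition om :: "real \<Rightarrow> real" where "om s = indicat_real {0..} s * sqrt (g s)"

lemma om_sq: "(om s)\<^sup>2 = indicat_real {0..} s * g s"
  using g_nonneg[of s] by (auto simp: om_def indicator_def power_mult_distrib)

lemma om_measurable: "om \<in> borel_measurable lebesgue"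
proof -
  have "integrable lebesgue (\<lambda>s. indicat_real {0..} s *\<^sub>R g s)"
    using g_int lebesgue_on_integral(2)[of "{0..}" g] by (simp add: set_integrable_def)
  then have [measurable]: "(\<lambda>s. indicat_real {0..} s *\<^sub>R g s) \<in> borel_measurable lebesgue" by auto
  have "om = (\<lambda>s. sqrt (indicat_real {0..} s *\<^sub>R g s))" by (auto simp: om_def indicator_def)
  moreover have "(\<lambda>s. sqrt (indicat_real {0..} s *\<^sub>R g s)) \<in> borel_measurable lebesgue" by measurable
  ultimately show ?thesis by (simp only:)
qed

sublocale weight om pr
proof
  show "om \<in> borel_measurable lebesgue" by (rule om_measurable)
  show "0 \<le> om s" for s using g_nonneg[of s] by (auto simp: om_def indicator_def)
  show "om s = 0" if "s < 0" for s using that by (simp add: om_def)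
  show "om s \<le> om r" if "0 \<le> r" "r \<le> s" for r s
    using that g_antimono by (auto simp: om_def monotone_on_def)
  show "integrable lebesgue (\<lambda>s. (om s)\<^sup>2)"
    using g_int lebesgue_on_integral(2)[of "{0..}" g] by (simp add: set_integrable_def om_sq)
  show "(\<forall>s\<ge>0. om s > 0) \<or> (\<forall>s. om s = 0)"
    using g_alt by (auto simp: om_def indicator_def)
  show "pr (a + b) = pr a + pr b" for a b by (rule linear_simps(1)[OF pr_bl])
  show "pr (r *\<^sub>R a) = r *\<^sub>R pr a" for r a by (rule linear_simps(5)[OF pr_bl])
  show "\<exists>K. \<forall>x. norm (pr x) \<le> norm x * K" using bounded_linear.bounded[OF pr_bl] .
qed (rule pr_pr)

lemma half_line_measurable_iff:
  fixes f :: "real \<Rightarrow> 'b::real_normed_vector"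
  shows "f \<in> borel_measurable half_line \<longleftrightarrow> (\<lambda>s. indicat_real {0..} s *\<^sub>R f s) \<in> borel_measurable lebesgue"
  by (intro borel_measurable_restrict_space_iff) simp

text \<open>Membership in the history space is square integrability of the weighted derivatives; the
  weak measurability in the definition becomes measurability by Pettis.\<close>

lemma Lg_iff:
  "w \<in> Lg Hs g \<longleftrightarrow> (\<forall>s\<ge>0. w s \<in> Hs) \<and>
     (\<lambda>s. indicat_real {0..} s *\<^sub>R dh (w s)) \<in> borel_measurable lebesgue \<and> sq_integrable (\<lambda>s. om s *\<^sub>R dh (w s))"
proof (cases "\<forall>s\<ge>0. w s \<in> Hs")
  case True
  have "(\<forall>h\<in>Hs. (\<lambda>s. l2ip (wx (w s)) (wx h)) \<in> borel_measurable half_line)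
      \<longleftrightarrow> (\<lambda>s. indicat_real {0..} s *\<^sub>R dh (w s)) \<in> borel_measurable lebesgue" (is "?L \<longleftrightarrow> ?R")
  proof -
    have eq: "indicat_real {0..} s *\<^sub>R l2ip (wx (w s)) (wx h) = (indicat_real {0..} s *\<^sub>R dh (w s)) \<bullet> dh h" if "h \<in> Hs" for h s
      using True that by (auto simp: indicator_def l2ip_wx)
    show ?thesis
    proof
      assume L: ?L
      show ?R
      proof (rule weakly_measurable_imp_measurable)
        fix d
        have Hs: "(\<lambda>x. pr d \<bullet> chi x) \<in> Hs" by (intro prim_Hs pr_pr)
        have "(indicat_real {0..} s *\<^sub>R dh (w s)) \<bullet> d = (indicat_real {0..} s *\<^sub>R dh (w s)) \<bullet> dh (\<lambda>x. pr d \<bullet> chi x)" for s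
          using True pr_self_adjoint[of "dh (w s)" d] by (auto simp: indicator_def dh_prim_Hs pr_pr Hs_iff)
        then have "(indicat_real {0..} s *\<^sub>R dh (w s)) \<bullet> d = indicat_real {0..} s *\<^sub>R l2ip (wx (w s)) (wx (\<lambda>x. pr d \<bullet> chi x))" for s
          by (simp only: eq[OF Hs])
        moreover have "(\<lambda>s. indicat_real {0..} s *\<^sub>R l2ip (wx (w s)) (wx (\<lambda>x. pr d \<bullet> chi x))) \<in> borel_measurable lebesgue"
          using L Hs by (subst half_line_measurable_iff[symmetric]) auto
        ultimately show "(\<lambda>s. (indicat_real {0..} s *\<^sub>R dh (w s)) \<bullet> d) \<in> borel_measurable lebesgue" by (simp only:)
      qed
    next
      assume R[measurable]: ?R
      show ?L
      proof
        fix h assume h: "h \<in> Hs"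
        have "(\<lambda>s. (indicat_real {0..} s *\<^sub>R dh (w s)) \<bullet> dh h) \<in> borel_measurable lebesgue" by measurable
        then show "(\<lambda>s. l2ip (wx (w s)) (wx h)) \<in> borel_measurable half_line"
          unfolding half_line_measurable_iff eq[OF h] .
      qed
    qed
  qed
  moreover have "integrable half_line (\<lambda>s. g s * (l2norm (wx (w s)))\<^sup>2) \<longleftrightarrow> integrable lebesgue (\<lambda>s. (norm (om s *\<^sub>R dh (w s)))\<^sup>2)"
  proof -
    have "indicat_real {0..} s *\<^sub>R (g s * (l2norm (wx (w s)))\<^sup>2) = (norm (om s *\<^sub>R dh (w s)))\<^sup>2" for s
    proof (cases "s \<ge> 0")
      case True
      then have "(l2norm (wx (w s)))\<^sup>2 = (norm (dh (w s)))\<^sup>2"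
        using \<open>\<forall>s\<ge>0. w s \<in> Hs\<close> by (simp add: l2norm_def l2ip_wx power2_norm_eq_inner)
      then show ?thesis using True by (simp add: power_mult_distrib om_sq)
    qed (simp add: om_def)
    then show ?thesis using lebesgue_on_integral(2)[of "{0..}" "\<lambda>s. g s * (l2norm (wx (w s)))\<^sup>2"]
      by (simp only: set_integrable_def) simp
  qed
  moreover have "(\<lambda>s. om s *\<^sub>R dh (w s)) \<in> borel_measurable lebesgue"
    if R: "(\<lambda>s. indicat_real {0..} s *\<^sub>R dh (w s)) \<in> borel_measurable lebesgue"
  proof -
    have "(\<lambda>s. om s *\<^sub>R dh (w s)) = (\<lambda>s. om s *\<^sub>R (indicat_real {0..} s *\<^sub>R dh (w s)))"
      by (auto simp: om_def indicator_def)
    then show ?thesis by (simp only:) (rule borel_measurable_scaleR[OF om_measurable R])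
  qed
  ultimately show ?thesis using True unfolding Lg_def sq_integrable_def by blast
qed (auto simp: Lg_def)

text \<open>The encoding of a history, an isometry onto \<open>Hist\<close> by \<open>Lg_ip_Tg\<close> and \<open>con_Lg\<close>.\<close>

definition Tg :: "(real \<Rightarrow> real \<Rightarrow> real) \<Rightarrow> real L2t L2t" where "Tg w = cls (\<lambda>s. om s *\<^sub>R dh (w s))"

lemma Lg_Hs: "w \<in> Lg Hs g \<Longrightarrow> s \<ge> 0 \<Longrightarrow> w s \<in> Hs"
  and Lg_sq: "w \<in> Lg Hs g \<Longrightarrow> sq_integrable (\<lambda>s. om s *\<^sub>R dh (w s))"
  and Lg_meas: "w \<in> Lg Hs g \<Longrightarrow> (\<lambda>s. indicat_real {0..} s *\<^sub>R dh (w s)) \<in> borel_measurable lebesgue"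
  by (auto simp: Lg_iff)

lemma fn_Tg: "w \<in> Lg Hs g \<Longrightarrow> AE s in lebesgue. fn (Tg w) s = om s *\<^sub>R dh (w s)"
  unfolding Tg_def by (intro fn_cls Lg_sq)

lemma Tg_Hist: assumes w: "w \<in> Lg Hs g" shows "Tg w \<in> Hist"
  unfolding Hist_def mem_Collect_eq using fn_Tg[OF w]
proof eventually_elim
  fix s assume *: "fn (Tg w) s = om s *\<^sub>R dh (w s)"
  show "fn (Tg w) s = supp s *\<^sub>R pr (fn (Tg w) s)"
  proof (cases "s \<ge> 0")
    case True
    then have "pr (dh (w s)) = dh (w s)" using Lg_Hs[OF w] Hs_iff by blast
    then show ?thesis using * by (simp add: supp_def pr.scaleR)
  qed (use * in \<open>simp add: w_neg supp_def\<close>)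
qed

lemma Lg_lincomb:
  assumes w: "w \<in> Lg Hs g" and w': "w' \<in> Lg Hs g"
  shows "(\<lambda>s x. a * w s x + b * w' s x) \<in> Lg Hs g" "Tg (\<lambda>s x. a * w s x + b * w' s x) = a *\<^sub>R Tg w + b *\<^sub>R Tg w'"
proof -
  have d: "dh (\<lambda>x. a * w s x + b * w' s x) = a *\<^sub>R dh (w s) + b *\<^sub>R dh (w' s)" if "s \<ge> 0" for s
    using Lg_Hs[OF w that] Lg_Hs[OF w' that] by (intro H1_lincomb Hs_H1)
  have e1: "(\<lambda>s. indicat_real {0..} s *\<^sub>R dh (\<lambda>x. a * w s x + b * w' s x))
      = (\<lambda>s. a *\<^sub>R (indicat_real {0..} s *\<^sub>R dh (w s)) + b *\<^sub>R (indicat_real {0..} s *\<^sub>R dh (w' s)))"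
    by (auto simp: indicator_def d)
  have e2: "(\<lambda>s. om s *\<^sub>R dh (\<lambda>x. a * w s x + b * w' s x)) = (\<lambda>s. a *\<^sub>R (om s *\<^sub>R dh (w s)) + b *\<^sub>R (om s *\<^sub>R dh (w' s)))"
    by (auto simp: om_def indicator_def d scaleR_add_right mult.commute mult.left_commute)
  show "(\<lambda>s x. a * w s x + b * w' s x) \<in> Lg Hs g"
    unfolding Lg_iff e1 e2
    by (intro conjI allI impI Hs_lincomb Lg_Hs[OF w] Lg_Hs[OF w'] sq_integrable_add sq_integrable_scaleR Lg_sq[OF w] Lg_sq[OF w']
        borel_measurable_add[OF borel_measurable_scaleR[OF borel_measurable_const Lg_meas[OF w]]
          borel_measurable_scaleR[OF borel_measurable_const Lg_meas[OF w']]])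
  show "Tg (\<lambda>s x. a * w s x + b * w' s x) = a *\<^sub>R Tg w + b *\<^sub>R Tg w'"
    unfolding Tg_def e2
    by (simp only: cls_scaleR[OF Lg_sq[OF w]] cls_scaleR[OF Lg_sq[OF w']]
        cls_add[OF sq_integrable_scaleR[OF Lg_sq[OF w]] sq_integrable_scaleR[OF Lg_sq[OF w']]])
qed

lemma Lg_diff: "w \<in> Lg Hs g \<Longrightarrow> w' \<in> Lg Hs g \<Longrightarrow> (\<lambda>s x. w s x - w' s x) \<in> Lg Hs g"
  and Tg_diff: "w \<in> Lg Hs g \<Longrightarrow> w' \<in> Lg Hs g \<Longrightarrow> Tg (\<lambda>s x. w s x - w' s x) = Tg w - Tg w'"
  using Lg_lincomb[of w w' 1 "- 1"] by simp_all

lemma Lg_ip_Tg: assumes w: "w \<in> Lg Hs g" and w': "w' \<in> Lg Hs g" shows "Lg_ip g w w' = Tg w \<bullet> Tg w'"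
proof -
  have "Lg_ip g w w' = (LINT s:{0..}|lebesgue. g s * l2ip (wx (w s)) (wx (w' s)))"
    unfolding Lg_ip_def by (intro lebesgue_on_integral) simp
  also have "\<dots> = (LINT s|lebesgue. (om s *\<^sub>R dh (w s)) \<bullet> (om s *\<^sub>R dh (w' s)))"
    unfolding set_lebesgue_integral_def
  proof (intro Bochner_Integration.integral_cong refl)
    fix s :: real
    show "indicator {0..} s *\<^sub>R (g s * l2ip (wx (w s)) (wx (w' s))) = (om s *\<^sub>R dh (w s)) \<bullet> (om s *\<^sub>R dh (w' s))"
    proof (cases "s \<ge> 0")
      case True
      then have "om s * om s = g s" using om_sq[of s] by (simp add: power2_eq_square)
      then show ?thesis using True Lg_Hs[OF w] Lg_Hs[OF w'] by (simp add: l2ip_wx mult.assoc[symmetric])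
    qed (simp add: om_def)
  qed
  also have "\<dots> = Tg w \<bullet> Tg w'" unfolding Tg_def by (intro inner_cls[symmetric] Lg_sq w w')
  finally show ?thesis .
qed

lemma Lg_eq_Tg: "w \<in> Lg Hs g \<Longrightarrow> w' \<in> Lg Hs g \<Longrightarrow> Lg_eq g w w' \<longleftrightarrow> Tg w = Tg w'"
  unfolding Lg_eq_def by (simp add: Lg_ip_Tg Lg_diff Tg_diff)

lemma Lg_const: assumes "h \<in> Hs" shows "(\<lambda>s. h) \<in> Lg Hs g" "Tg (\<lambda>s. h) = E (dh h)"
proof -
  have "(\<lambda>s::real. indicat_real {0..} s *\<^sub>R dh h) \<in> borel_measurable lebesgue" by measurable
  then show "(\<lambda>s. h) \<in> Lg Hs g" using assms sq_integrable_const[of "dh h"] by (simp add: Lg_iff)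
  show "Tg (\<lambda>s. h) = E (dh h)" by (simp add: Tg_def E_def)
qed

lemma Tg_inner_E: assumes w: "w \<in> Lg Hs g" and h: "h \<in> Hs"
  shows "(LINT s|half_line. g s * l2ip (wx (w s)) (wx h)) = Tg w \<bullet> E (dh h)"
  using Lg_ip_Tg[OF w Lg_const(1)[OF h]] Lg_const(2)[OF h] by (simp add: Lg_ip_def)

text \<open>The inverse encoding. Representatives of \<open>y\<close> take values in the range of \<open>pr\<close> only almost everywhere,
  while a history has to lie in \<open>Hs\<close> for every \<open>s\<close>; hence the projection.\<close>

definition con :: "real L2t L2t \<Rightarrow> real \<Rightarrow> real \<Rightarrow> real" where "con y s x = pr (unweight y s) \<bullet> chi x"

lemma dh_con: "dh (con y s) = pr (unweight y s)" and con_Hs: "con y s \<in> Hs"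
  unfolding con_def[abs_def] by (auto intro!: dh_prim_Hs prim_Hs pr_pr)

lemma con_Lg: assumes "y \<in> Hist" shows "con y \<in> Lg Hs g" "Tg (con y) = y"
proof -
  have e: "(\<lambda>s. om s *\<^sub>R dh (con y s)) = (\<lambda>s. supp s *\<^sub>R pr (fn y s))"
    by (auto simp: dh_con unweight_def pr.scaleR supp_def)
  show "con y \<in> Lg Hs g"
    unfolding Lg_iff e
  proof (intro conjI allI impI con_Hs sq_integrable_cut sq_integrable_fn)
    show "(\<lambda>s. indicat_real {0..} s *\<^sub>R dh (con y s)) \<in> borel_measurable lebesgue" unfolding dh_con by measurable
  qed
  have "Tg (con y) = cut y" unfolding Tg_def e cut_def ..
  then show "Tg (con y) = y" using assms Hist_iff_cut by simp
qed

lemma unweight_Tg: assumes w: "w \<in> Lg Hs g"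
  shows "AE s in lebesgue. om s \<noteq> 0 \<longrightarrow> unweight (Tg w) s = dh (w s)"
  using fn_Tg[OF w] by eventually_elim (simp add: unweight_def)

text \<open>The derivative \<open>w\<^sub>s\<close> is defined pointwise in \<open>x\<close>. Evaluation at \<open>x\<close> is the functional \<open>chi x\<close>, which
  commutes with integration in \<open>s\<close>, and these functionals separate the points of \<open>X1\<close>.\<close>

lemma history_deriv_imp_hist:
  assumes w: "w \<in> Lg Hs g" and z: "z \<in> Lg Hs g"
    and c: "\<And>x. x \<in> {0..1} \<Longrightarrow> continuous_on {0..} (\<lambda>s. w s x)" "\<And>x. x \<in> {0..1} \<Longrightarrow> w 0 x = 0"
    and d: "\<And>x. x \<in> {0..1} \<Longrightarrow> weak_deriv {0<..} (\<lambda>s. w s x) (\<lambda>s. z s x)"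
  shows "hist (Tg w) (Tg z)"
  unfolding hist_def
proof (intro conjI Tg_Hist w z)
  show "AE s in lebesgue. 0 \<le> s \<longrightarrow> fn (Tg w) s = om s *\<^sub>R (LINT r:{0..s}|lebesgue. unweight (Tg z) r)"
  proof (cases rule: supp_cases)
    case 1
    show ?thesis using fn_Tg[OF w] by eventually_elim (simp add: 1)
  next
    case 2
    have om0: "om s \<noteq> 0" if "0 \<le> s" for s using 2[OF that] by (auto simp: supp_def split: if_splits)
    have uz: "AE r in lebesgue. 0 \<le> r \<longrightarrow> unweight (Tg z) r = dh (z r)"
      using unweight_Tg[OF z] by eventually_elim (use om0 in auto)
    have zx: "z r x = dh (z r) \<bullet> chi x" "w r x = dh (w r) \<bullet> chi x" if "0 \<le> r" "x \<in> {0..1}" for r x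
      using Hstar_prim[OF Hs_Hstar[OF Lg_Hs[OF z that(1)]] that(2)] Hstar_prim[OF Hs_Hstar[OF Lg_Hs[OF w that(1)]] that(2)] by auto
    have iu: "integrable lebesgue (\<lambda>r. (indicator {0..s} r *\<^sub>R unweight (Tg z) r) \<bullet> chi x)" for s x
      using unweight_integrable[of s "Tg z"] unfolding set_integrable_def
      by (intro integrable_bounded_linear[OF bounded_linear_inner_left])
    have aez: "AE r in lebesgue. (indicator {0..s} r *\<^sub>R unweight (Tg z) r) \<bullet> chi x = indicator {0..s} r *\<^sub>R z r x" if "x \<in> {0..1}" for s x
      using uz by eventually_elim (use zx that in \<open>auto simp: indicator_def\<close>)
    have mz: "(\<lambda>r. indicator {0..s} r *\<^sub>R z r x) \<in> borel_measurable lebesgue" if "x \<in> {0..1}" for s x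
    proof -
      have [measurable]: "(\<lambda>s. indicat_real {0..} s *\<^sub>R dh (z s)) \<in> borel_measurable lebesgue" by (rule Lg_meas[OF z])
      have "(\<lambda>r. indicator {0..s} r *\<^sub>R z r x) = (\<lambda>r. indicat_real {0..s} r * ((indicat_real {0..} r *\<^sub>R dh (z r)) \<bullet> chi x))"
        using zx that by (auto simp: indicator_def)
      moreover have "(\<lambda>r. indicat_real {0..s} r * ((indicat_real {0..} r *\<^sub>R dh (z r)) \<bullet> chi x)) \<in> borel_measurable lebesgue" by measurable
      ultimately show ?thesis by (simp only:)
    qed
    have iz: "set_integrable lebesgue {0..s} (\<lambda>r. z r x)" if "x \<in> {0..1}" for s x
      unfolding set_integrable_def by (rule integrable_cong_AE_imp[OF iu mz[OF that] aez[OF that]])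
    have "dh (w s) = (LINT r:{0..s}|lebesgue. unweight (Tg z) r)" if s: "0 \<le> s" for s
    proof -
      let ?I = "LINT r:{0..s}|lebesgue. unweight (Tg z) r"
      have "un ?I = (LINT r|lebesgue. un (indicator {0..s} r *\<^sub>R unweight (Tg z) r))"
        unfolding set_lebesgue_integral_def using unweight_integrable[of s "Tg z"] unfolding set_integrable_def
        by (intro integral_bounded_linear[OF bounded_linear_un, symmetric])
      also have "\<dots> = ?I"
        unfolding set_lebesgue_integral_def
      proof (rule integral_cong_AE)
        show "AE r in lebesgue. un (indicator {0..s} r *\<^sub>R unweight (Tg z) r) = indicator {0..s} r *\<^sub>R unweight (Tg z) r"
          using pr_unweight[OF Tg_Hist[OF z]] by eventually_elim (auto simp: un_linear X1_def dest: pr_X1)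
        show m: "(\<lambda>r. indicator {0..s} r *\<^sub>R unweight (Tg z) r) \<in> borel_measurable lebesgue" by measurable
        show "(\<lambda>r. un (indicator {0..s} r *\<^sub>R unweight (Tg z) r)) \<in> borel_measurable lebesgue"
          by (rule borel_measurable_continuous_on[OF _ m]) (rule linear_continuous_on[OF bounded_linear_un])
      qed
      finally have IX: "?I \<in> X1" by (simp add: X1_def)
      have wX: "dh (w s) \<in> X1" by (intro dh_X1 Hs_H1 Lg_Hs[OF w s])
      have "dh (w s) - ?I = 0"
      proof (rule zero_if_prim_zero)
        show "dh (w s) - ?I \<in> X1" using IX wX by (simp add: X1_def un_linear)
        fix x :: real assume "0 \<le> x" "x \<le> 1"
        then have x: "x \<in> {0..1}" by simp
        have "w s x = w 0 x + (LINT r:{0..s}|lebesgue. z r x)"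
        proof (rule weak_deriv_imp_primitive[OF d[OF x]])
          show "{x..y} \<subseteq> {0<..}" if "x \<in> {0<..}" "y \<in> {0<..}" for x y :: real using that by auto
        qed (use c[OF x] s iz[OF x] in auto)
        also have "\<dots> = (LINT r|lebesgue. (indicator {0..s} r *\<^sub>R unweight (Tg z) r) \<bullet> chi x)"
          unfolding c(2)[OF x] set_lebesgue_integral_def
          using integral_cong_AE[OF _ mz[OF x] aez[OF x], of s] iu by auto
        also have "\<dots> = ?I \<bullet> chi x"
          unfolding set_lebesgue_integral_def using unweight_integrable[of s "Tg z"] unfolding set_integrable_def
          by (intro integral_bounded_linear[OF bounded_linear_inner_left])
        finally show "(dh (w s) - ?I) \<bullet> chi x = 0" using zx(2)[OF s x] by (simp add: inner_diff_left)
      qed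
      then show ?thesis by simp
    qed
    then show ?thesis using fn_Tg[OF w] by (auto elim: AE_mp)
  qed
qed

text \<open>The integral of the derivative, taken in the Hilbert space, is the representative of the history that
  is continuous in \<open>s\<close> for every \<open>x\<close>.\<close>

lemma hist_imp_history_deriv:
  assumes w: "w \<in> Lg Hs g" and z: "z \<in> Lg Hs g" and h: "hist (Tg w) (Tg z)"
  shows "history_deriv Hs g w z"
proof -
  define z1 where "z1 r = pr (unweight (Tg z) r)" for r
  define I where "I s = (LINT r:{0..s}|lebesgue. z1 r)" for s
  have z1_int: "set_integrable lebesgue {0..s} z1" for s
  proof -
    have "integrable lebesgue (\<lambda>r. pr (indicator {0..s} r *\<^sub>R unweight (Tg z) r))"
      using unweight_integrable[of s "Tg z"] unfolding set_integrable_def by (rule integrable_bounded_linear[OF pr_bl])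
    then show ?thesis by (simp add: set_integrable_def z1_def pr.scaleR)
  qed
  have z1_meas [measurable]: "z1 \<in> borel_measurable lebesgue" unfolding z1_def by measurable
  have I_meas [measurable]: "I \<in> borel_measurable lebesgue"
    unfolding I_def set_lebesgue_integral_def indicator_def atLeastAtMost_iff by measurable
  have I_unweight: "I s = (LINT r:{0..s}|lebesgue. unweight (Tg z) r)" for s
    unfolding I_def
    by (rule set_integral_cong_ae[OF z1_int unweight_integrable])
      (use pr_unweight[OF Tg_Hist[OF z]] in \<open>auto simp: z1_def elim: AE_mp\<close>)
  have prI: "pr (I s) = I s" for s
  proof -
    have "pr (I s) = (LINT r|lebesgue. pr (indicator {0..s} r *\<^sub>R z1 r))"
      unfolding I_def set_lebesgue_integral_def using z1_int[of s] unfolding set_integrable_def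
      by (intro integral_bounded_linear[OF pr_bl, symmetric])
    then show ?thesis by (simp add: I_def set_lebesgue_integral_def pr.scaleR z1_def pr_pr)
  qed
  define w' where "w' s x = I s \<bullet> chi x" for s x
  have w'Hs: "w' s \<in> Hs" "dh (w' s) = I s" for s
    unfolding w'_def[abs_def] by (auto intro!: prim_Hs dh_prim_Hs prI)
  have ae: "AE s in lebesgue. fn (Tg w) s = om s *\<^sub>R I s"
  proof -
    have "AE s in lebesgue. fn (Tg w) s = supp s *\<^sub>R pr (fn (Tg w) s)" using Tg_Hist[OF w] by (simp add: Hist_def)
    moreover have "AE s in lebesgue. 0 \<le> s \<longrightarrow> fn (Tg w) s = om s *\<^sub>R I s" using h by (simp add: hist_def I_unweight)
    ultimately show ?thesis
    proof eventually_elim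
      fix s assume *: "fn (Tg w) s = supp s *\<^sub>R pr (fn (Tg w) s)" "0 \<le> s \<longrightarrow> fn (Tg w) s = om s *\<^sub>R I s"
      show "fn (Tg w) s = om s *\<^sub>R I s"
        using * w_neg[of s] by (cases "0 \<le> s") (auto simp: supp_def)
    qed
  qed
  have sq: "sq_integrable (\<lambda>s. om s *\<^sub>R I s)"
  proof (rule sq_integrable_bound[OF _ sq_integrable_norm[OF sq_integrable_fn[of "Tg w"]]])
    show "(\<lambda>s. om s *\<^sub>R I s) \<in> borel_measurable lebesgue" by measurable
  qed (use ae in \<open>auto elim: AE_mp\<close>)
  have "(\<lambda>s. indicat_real {0..} s *\<^sub>R I s) \<in> borel_measurable lebesgue" by measurable
  then have w'L: "w' \<in> Lg Hs g" unfolding Lg_iff w'Hs using w'Hs(1) sq by blast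
  have "Tg w' = Tg w"
  proof -
    have "AE s in lebesgue. fn (Tg w') s = fn (Tg w) s" using fn_Tg[OF w'L] ae unfolding w'Hs by eventually_elim simp
    then show ?thesis by (rule L2t_eqI)
  qed
  have zL: "con (Tg z) \<in> Lg Hs g" "Tg (con (Tg z)) = Tg z" using con_Lg[OF Tg_Hist[OF z]] by auto
  have prim: "w' s x = (LINT r:{0..s}|lebesgue. con (Tg z) r x)" for s x
  proof -
    have "w' s x = (LINT r|lebesgue. (indicator {0..s} r *\<^sub>R z1 r) \<bullet> chi x)"
      unfolding w'_def I_def set_lebesgue_integral_def using z1_int[of s] unfolding set_integrable_def
      by (intro integral_bounded_linear[OF bounded_linear_inner_left, symmetric])
    then show ?thesis by (simp add: set_lebesgue_integral_def con_def z1_def)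
  qed
  have ci: "set_integrable lebesgue {0..s} (\<lambda>r. con (Tg z) r x)" for s x
  proof -
    have "integrable lebesgue (\<lambda>r. (indicator {0..s} r *\<^sub>R z1 r) \<bullet> chi x)"
      using z1_int[of s] unfolding set_integrable_def by (intro integrable_bounded_linear[OF bounded_linear_inner_left])
    then show ?thesis by (simp add: set_integrable_def con_def z1_def)
  qed
  show ?thesis
    unfolding history_deriv_def
  proof (intro bexI conjI ballI)
    show "Lg_eq g w w'" using w w'L \<open>Tg w' = Tg w\<close> by (simp add: Lg_eq_Tg)
    show "Lg_eq g z (con (Tg z))" using z zL by (simp add: Lg_eq_Tg)
    fix x :: real
    show "continuous_on {0..} (\<lambda>s. w' s x)" unfolding prim by (intro primitive_continuous ci)
    show "w' 0 x = 0" unfolding prim using set_integral_split[OF ci[of _ x], of 0 0] by simp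
    show "weak_deriv {0<..} (\<lambda>s. w' s x) (\<lambda>s. con (Tg z) s x)"
      by (rule primitive_imp_weak_deriv[where c = 0]) (auto simp: prim ci)
  qed (fact zL(1), fact w'L)
qed

lemma history_deriv_iff:
  assumes w: "w \<in> Lg Hs g" and z: "z \<in> Lg Hs g"
  shows "history_deriv Hs g w z \<longleftrightarrow> hist (Tg w) (Tg z)"
proof
  assume "history_deriv Hs g w z"
  then obtain w' z' where *: "w' \<in> Lg Hs g" "z' \<in> Lg Hs g" "Lg_eq g w w'" "Lg_eq g z z'"
    "\<forall>x\<in>{0..1}. continuous_on {0..} (\<lambda>s. w' s x) \<and> w' 0 x = 0 \<and> weak_deriv {0<..} (\<lambda>s. w' s x) (\<lambda>s. z' s x)"
    unfolding history_deriv_def by blast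
  have "hist (Tg w') (Tg z')" by (rule history_deriv_imp_hist) (use * in auto)
  then show "hist (Tg w) (Tg z)" using * w z by (simp add: Lg_eq_Tg)
qed (rule hist_imp_history_deriv[OF assms])

end

section \<open>The beam as a system with memory\<close>

lemma subspace_X1: "subspace X1" and closed_X1: "closed X1"
proof -
  show "subspace X1" unfolding X1_def by (rule subspaceI) (auto simp: un_linear)
  show "closed X1" unfolding X1_def
    by (intro closed_Collect_eq linear_continuous_on[OF bounded_linear_un] continuous_on_id)
qed

lemma subspace_X0: "subspace X0" and closed_X0: "closed X0"
proof -
  have eq: "X0 = {u. pr0 u = u}" using X0_iff by auto
  show "subspace X0" unfolding eq by (rule subspaceI) (auto simp: linear_simps[OF bounded_linear_pr0])
  show "closed X0" unfolding eq
    by (intro closed_Collect_eq linear_continuous_on[OF bounded_linear_pr0] continuous_on_id)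
qed

lemma dh_X0: "h \<in> H10 \<Longrightarrow> dh h \<in> X0"
  by (simp add: H10_iff)

lemma H10_prim: "u \<in> X0 \<Longrightarrow> (\<lambda>x. u \<bullet> chi x) \<in> H10"
  using Hstar_I[of u] dh_prim[of u] by (simp add: H10_iff X0_def)

lemma l2norm_sq: "f \<in> L2 \<Longrightarrow> (l2norm f)\<^sup>2 = (norm (cl f))\<^sup>2"
  by (simp add: l2norm_def l2ip_cl power2_norm_eq_inner)

lemma eq_iff_multiple_eq: "r > 0 \<Longrightarrow> r * y = y' \<Longrightarrow> x = y \<longleftrightarrow> r * x = y'" for x y :: real
  by auto

lemma shear_L2:
  assumes "\<phi> \<in> Hstar" "\<psi> \<in> Hstar" "v \<in> Hstar"
  shows "shear \<phi> \<psi> v \<in> L2" "cl (shear \<phi> \<psi> v) = dh \<phi> + K (dh \<psi>) - K (dh v)"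
proof -
  have L: "wx \<phi> \<in> L2" "\<psi> \<in> L2" "v \<in> L2" using assms by (auto intro: wx H1_L2 Hstar_H1)
  have e: "shear \<phi> \<psi> v = (\<lambda>x. 1 * (1 * wx \<phi> x + 1 * \<psi> x) + - 1 * v x)" by (simp add: shear_def)
  show "shear \<phi> \<psi> v \<in> L2" unfolding e by (intro L2_lincomb L)
  show "cl (shear \<phi> \<psi> v) = dh \<phi> + K (dh \<psi>) - K (dh v)"
    unfolding e cl_lincomb[OF L2_lincomb[OF L(1,2)] L(3)] cl_lincomb[OF L(1,2)]
    using assms by (simp add: cl_Hstar dh_def)
qed

locale beam_problem =
  fixes B :: beam and k0 :: real
  assumes pos: "rho1 B > 0" "rho2 B > 0" "kpar B > 0" "bpar B > 0" "delta B > 0" "gam B > 0" "k0 > 0"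
    and ker1: "kernel H10 pr0 (ker1 B)" and ker2: "kernel Hstar un (ker2 B)"
    and coercive: "\<And>\<phi> \<psi> v. \<phi> \<in> H10 \<Longrightarrow> \<psi> \<in> Hstar \<Longrightarrow> v \<in> Hstar \<Longrightarrow>
       k0 * ((l2norm (wx \<phi>))\<^sup>2 + (l2norm (wx \<psi>))\<^sup>2 + (l2norm (wx v))\<^sup>2)
       \<le> 3 * kpar B * (l2norm (shear \<phi> \<psi> v))\<^sup>2
         + 3 * (bpar B - total_mass (ker2 B)) * (l2norm (wx \<psi>))\<^sup>2
         + bpar B * (l2norm (wx v))\<^sup>2 + 4 * delta B * (l2norm v)\<^sup>2
         - 3 * total_mass (ker1 B) * (l2norm (wx \<phi>))\<^sup>2"
begin

sublocale m1: kernel H10 pr0 "ker1 B" by (rule ker1)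
sublocale m2: kernel Hstar un "ker2 B" by (rule ker2)

text \<open>The shear \<open>\<phi>\<^sub>x + \<psi> - v\<close> in terms of the derivatives.\<close>

definition sig :: "real L2t \<times> real L2t \<times> real L2t \<Rightarrow> real L2t" where
  "sig f = fst f + K (fst (snd f)) - K (snd (snd f))"

definition stiff :: "real L2t \<times> real L2t \<times> real L2t \<Rightarrow> real L2t \<times> real L2t \<times> real L2t \<Rightarrow> real" where
  "stiff f w = 3 * kpar B * (sig f \<bullet> sig w) + (3 * (bpar B - total_mass (ker2 B)) * (fst (snd f) \<bullet> fst (snd w))
     + (- (3 * total_mass (ker1 B)) * (fst f \<bullet> fst w) + (bpar B * (snd (snd f) \<bullet> snd (snd w))
     + 4 * delta B * (K (snd (snd f)) \<bullet> K (snd (snd w))))))"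

definition mass :: "real L2t \<times> real L2t \<times> real L2t \<Rightarrow> real L2t \<times> real L2t \<times> real L2t \<Rightarrow> real" where
  "mass a a' = 3 * rho1 B * (fst a \<bullet> fst a') + (3 * rho2 B * (fst (snd a) \<bullet> fst (snd a')) + rho2 B * (snd (snd a) \<bullet> snd (snd a')))"

definition damp :: "real L2t \<times> real L2t \<times> real L2t \<Rightarrow> real L2t \<times> real L2t \<times> real L2t \<Rightarrow> real" where
  "damp a a' = 4 * gam B * (snd (snd a) \<bullet> snd (snd a'))"

definition KK :: "real L2t \<times> real L2t \<times> real L2t \<Rightarrow> real L2t \<times> real L2t \<times> real L2t" where
  "KK f = (K (fst f), K (fst (snd f)), K (snd (snd f)))"

definition EE :: "real L2t \<times> real L2t \<times> real L2t \<Rightarrow> real L2t L2t \<times> real L2t L2t" where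
  "EE f = (m1.E (fst f), m2.E (fst (snd f)))"

definition HH :: "real L2t L2t \<times> real L2t L2t \<Rightarrow> real L2t L2t \<times> real L2t L2t \<Rightarrow> bool" where
  "HH y z \<longleftrightarrow> m1.hist (fst y) (fst z) \<and> m2.hist (snd y) (snd z)"

definition RR :: "real \<Rightarrow> real L2t L2t \<times> real L2t L2t \<Rightarrow> real L2t L2t \<times> real L2t L2t" where
  "RR l y = (m1.Vol l (fst y), m2.Vol l (snd y))"

definition mlow :: real where "mlow = min (3 * rho1 B) (min (3 * rho2 B) (rho2 B))"

lemmas bl_components = bounded_linear_fst bounded_linear_compose[OF bounded_linear_fst bounded_linear_snd]
  bounded_linear_compose[OF bounded_linear_snd bounded_linear_snd]

lemma bounded_linear_sig: "bounded_linear sig"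
  unfolding sig_def[abs_def]
  by (intro bounded_linear_add bounded_linear_sub bounded_linear_compose[OF bounded_linear_K] bl_components)

lemma stiff_coercive:
  assumes f: "f \<in> X0 \<times> X1 \<times> X1" shows "k0 * (norm f)\<^sup>2 \<le> stiff f f"
proof -
  obtain f1 f2 f3 where f': "f = (f1, f2, f3)" "f1 \<in> X0" "f2 \<in> X1" "f3 \<in> X1" using f by auto
  let ?p = "\<lambda>f x. f \<bullet> chi x"
  have H: "?p f1 \<in> H10" "?p f2 \<in> Hstar" "?p f3 \<in> Hstar" using f' by (auto intro: H10_prim Hstar_I)
  have f1: "f1 \<in> X1" using f' by (simp add: X0_def)
  have d: "dh (?p f1) = f1" "dh (?p f2) = f2" "dh (?p f3) = f3" using f' f1 by (auto intro: dh_prim)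
  have n: "(l2norm (wx (?p f1)))\<^sup>2 = (norm f1)\<^sup>2" "(l2norm (wx (?p f2)))\<^sup>2 = (norm f2)\<^sup>2" "(l2norm (wx (?p f3)))\<^sup>2 = (norm f3)\<^sup>2"
    using H d by (auto simp: l2norm_sq wx Hstar_H1 H10_Hstar simp flip: dh_def)
  have s: "(l2norm (shear (?p f1) (?p f2) (?p f3)))\<^sup>2 = (norm (sig f))\<^sup>2"
    using shear_L2[OF H10_Hstar[OF H(1)] H(2,3)] by (simp add: l2norm_sq sig_def f' d)
  have v: "(l2norm (?p f3))\<^sup>2 = (norm (K f3))\<^sup>2" using l2norm_sq[of "?p f3"] cl_Hstar[OF H(3)] d by simp
  have nf: "(norm f)\<^sup>2 = (norm f1)\<^sup>2 + (norm f2)\<^sup>2 + (norm f3)\<^sup>2" by (simp add: f' norm_prod_def)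
  have st: "stiff f f = 3 * kpar B * (norm (sig f))\<^sup>2 + 3 * (bpar B - total_mass (ker2 B)) * (norm f2)\<^sup>2
    + bpar B * (norm f3)\<^sup>2 + 4 * delta B * (norm (K f3))\<^sup>2 - 3 * total_mass (ker1 B) * (norm f1)\<^sup>2"
    unfolding stiff_def power2_norm_eq_inner by (simp add: f')
  show ?thesis using coercive[OF H] unfolding n s v nf st .
qed

sublocale ms: memory_system "X0 \<times> X1 \<times> X1" "X1 \<times> X1 \<times> X1" "m1.Hist \<times> m2.Hist" stiff mass damp KK EE HH RR k0 mlow
proof (rule memory_system.intro)
  show "subspace (X0 \<times> X1 \<times> X1)" "subspace (X1 \<times> X1 \<times> X1)" "subspace (m1.Hist \<times> m2.Hist)"
    by (intro subspace_Times subspace_X0 subspace_X1 m1.subspace_Hist m2.subspace_Hist)+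
  show "closed (X0 \<times> X1 \<times> X1)" "closed (X1 \<times> X1 \<times> X1)" "closed (m1.Hist \<times> m2.Hist)"
    by (intro closed_Times closed_X0 closed_X1 m1.closed_Hist m2.closed_Hist)+
  note ip = bounded_bilinear.comp[OF bounded_bilinear_inner]
  note Kc = bounded_linear_compose[OF bounded_linear_K]
  show "bounded_bilinear stiff" unfolding stiff_def[abs_def]
    by (intro bounded_bilinear_add bounded_bilinear_scale ip bounded_linear_sig bl_components Kc)
  show "bounded_bilinear mass" unfolding mass_def[abs_def]
    by (intro bounded_bilinear_add bounded_bilinear_scale ip bl_components)
  show "bounded_bilinear damp" unfolding damp_def[abs_def]
    by (intro bounded_bilinear_scale ip bl_components)
  show "stiff f f' = stiff f' f" for f f' by (simp add: stiff_def inner_commute)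
  show "mass a a' = mass a' a" for a a' by (simp add: mass_def inner_commute)
  show "k0 > 0" by (rule pos)
  show "k0 * (norm f)\<^sup>2 \<le> stiff f f" if "f \<in> X0 \<times> X1 \<times> X1" for f by (rule stiff_coercive[OF that])
  show "mlow > 0" using pos by (simp add: mlow_def)
  show "mlow * (norm a)\<^sup>2 \<le> mass a a" for a
  proof -
    have "mlow * (norm a)\<^sup>2 = mlow * (norm (fst a))\<^sup>2 + mlow * (norm (fst (snd a)))\<^sup>2 + mlow * (norm (snd (snd a)))\<^sup>2"
      by (cases a) (simp add: norm_prod_def algebra_simps)
    also have "\<dots> \<le> 3 * rho1 B * (norm (fst a))\<^sup>2 + 3 * rho2 B * (norm (fst (snd a)))\<^sup>2 + rho2 B * (norm (snd (snd a)))\<^sup>2"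
      by (intro add_mono mult_right_mono) (auto simp: mlow_def)
    finally show ?thesis by (simp add: mass_def power2_norm_eq_inner)
  qed
  show "0 \<le> damp a a" for a using pos by (simp add: damp_def)
  show "bounded_linear KK" unfolding KK_def[abs_def] by (intro bounded_linear_Pair Kc bl_components)
  show "KK f \<in> X1 \<times> X1 \<times> X1" for f by (simp add: KK_def)
  show "f = 0" if "f \<in> X0 \<times> X1 \<times> X1" "KK f = 0" for f
    using that K_zero by (cases f) (auto simp: KK_def X0_def zero_prod_def)
  show "a = 0" if a: "a \<in> X1 \<times> X1 \<times> X1" and o: "\<And>f. f \<in> X0 \<times> X1 \<times> X1 \<Longrightarrow> mass a (KK f) = 0" for a
  proof -
    obtain a1 a2 a3 where a': "a = (a1, a2, a3)" "a1 \<in> X1" "a2 \<in> X1" "a3 \<in> X1" using a by auto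
    have z: "0 \<in> X1" "0 \<in> X0" using subspace_0[OF subspace_X1] subspace_0[OF subspace_X0] by auto
    have X0X1: "w \<in> X1" if "w \<in> X0" for w using that by (simp add: X0_def)
    have "a1 \<bullet> K w = 0" if "w \<in> X0" for w
      using o[of "(w, 0, 0)"] that z pos by (simp add: mass_def KK_def a' K_linear)
    moreover have "a2 \<bullet> K w = 0" "a3 \<bullet> K w = 0" if "w \<in> X1" for w
      using o[of "(0, w, 0)"] o[of "(0, 0, w)"] that z pos by (auto simp: mass_def KK_def a' K_linear)
    ultimately show ?thesis using K_X0_dense a' X0X1 by (simp add: zero_prod_def)
  qed
  show "bounded_linear EE" unfolding EE_def[abs_def]
    by (intro bounded_linear_Pair bounded_linear_compose[OF m1.bounded_linear_E] bounded_linear_compose[OF m2.bounded_linear_E] bl_components)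
  show "EE f \<in> m1.Hist \<times> m2.Hist" if "f \<in> X0 \<times> X1 \<times> X1" for f
    using that m1.E_in_Hist[of "fst f"] m2.E_in_Hist[of "fst (snd f)"] by (auto simp: EE_def X0_iff X1_def)
  show "y \<in> m1.Hist \<times> m2.Hist \<and> z \<in> m1.Hist \<times> m2.Hist" if "HH y z" for y z
    using that by (cases y, cases z) (auto simp: HH_def m1.hist_def m2.hist_def)
  show "HH 0 0" by (simp add: HH_def m1.hist_0 m2.hist_0)
  show "HH (y + c *\<^sub>R y') (z + c *\<^sub>R z')" if "HH y z" "HH y' z'" for y z y' z' c
    using that by (simp add: HH_def m1.hist_lincomb m2.hist_lincomb)
  show "0 \<le> y \<bullet> z" if "HH y z" for y z
    using that m1.hist_accretive[of "fst y" "fst z"] m2.hist_accretive[of "snd y" "snd z"]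
    by (simp add: HH_def inner_prod_def)
  show "z = 0" if "HH 0 z" for z
    using that m1.hist_0_imp_0[of "fst z"] m2.hist_0_imp_0[of "snd z"] by (simp add: HH_def prod_eq_iff)
  show "HH (RR l y) (y - l *\<^sub>R RR l y)" if "l > 0" "y \<in> m1.Hist \<times> m2.Hist" for l y
    using that m1.hist_Vol[of l "fst y"] m2.hist_Vol[of l "snd y"] by (auto simp: HH_def RR_def)
qed

text \<open>The weak equation of the abstract system is the sum of the three equations of the beam, tested
  independently of each other. Their weights \<open>3 \<rho>\<^sub>1\<close>, \<open>3 \<rho>\<^sub>2\<close>, \<open>\<rho>\<^sub>2\<close> are those of the energy.\<close>

lemma weak_equation_split:
  "(\<forall>w\<in>X0 \<times> X1 \<times> X1. mass (a1', a2', a3') (KK w) = - stiff (f1, f2, f3) w - damp (a1, a2, a3) (KK w) - 3 * ((y1, y2) \<bullet> EE w))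
   \<longleftrightarrow> (\<forall>w\<in>X0. rho1 B * (a1' \<bullet> K w) = - kpar B * (sig (f1, f2, f3) \<bullet> w) + total_mass (ker1 B) * (f1 \<bullet> w) - y1 \<bullet> m1.E w) \<and>
     (\<forall>w\<in>X1. rho2 B * (a2' \<bullet> K w) = - (bpar B - total_mass (ker2 B)) * (f2 \<bullet> w) - kpar B * (sig (f1, f2, f3) \<bullet> K w) - y2 \<bullet> m2.E w) \<and>
     (\<forall>w\<in>X1. rho2 B * (a3' \<bullet> K w) = - bpar B * (f3 \<bullet> w) + 3 * kpar B * (sig (f1, f2, f3) \<bullet> K w)
        - 4 * delta B * (K f3 \<bullet> K w) - 4 * gam B * (a3 \<bullet> K w))" (is "?L \<longleftrightarrow> ?R1 \<and> ?R2 \<and> ?R3")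
proof -
  have z: "0 \<in> X1" "0 \<in> X0" using subspace_0[OF subspace_X1] subspace_0[OF subspace_X0] by auto
  let ?s = "sig (f1, f2, f3)"
  have e: "(mass (a1', a2', a3') (KK (w1, w2, w3)) = - stiff (f1, f2, f3) (w1, w2, w3) - damp (a1, a2, a3) (KK (w1, w2, w3)) - 3 * ((y1, y2) \<bullet> EE (w1, w2, w3)))
    \<longleftrightarrow> 3 * (rho1 B * (a1' \<bullet> K w1) - (- kpar B * (?s \<bullet> w1) + total_mass (ker1 B) * (f1 \<bullet> w1) - y1 \<bullet> m1.E w1))
      + 3 * (rho2 B * (a2' \<bullet> K w2) - (- (bpar B - total_mass (ker2 B)) * (f2 \<bullet> w2) - kpar B * (?s \<bullet> K w2) - y2 \<bullet> m2.E w2))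
      + (rho2 B * (a3' \<bullet> K w3) - (- bpar B * (f3 \<bullet> w3) + 3 * kpar B * (?s \<bullet> K w3)
        - 4 * delta B * (K f3 \<bullet> K w3) - 4 * gam B * (a3 \<bullet> K w3))) = 0" for w1 w2 w3
  proof -
    have "?s \<bullet> sig (w1, w2, w3) = ?s \<bullet> w1 + ?s \<bullet> K w2 - ?s \<bullet> K w3"
      unfolding sig_def[of "(w1, w2, w3)"] by (simp add: inner_add_right inner_diff_right)
    then have st: "stiff (f1, f2, f3) (w1, w2, w3) = 3 * kpar B * (?s \<bullet> w1 + ?s \<bullet> K w2 - ?s \<bullet> K w3)
        + (3 * (bpar B - total_mass (ker2 B)) * (f2 \<bullet> w2) + (- (3 * total_mass (ker1 B)) * (f1 \<bullet> w1)
        + (bpar B * (f3 \<bullet> w3) + 4 * delta B * (K f3 \<bullet> K w3))))"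
      unfolding stiff_def fst_conv snd_conv by simp
    have ms: "mass (a1', a2', a3') (KK (w1, w2, w3))
        = 3 * rho1 B * (a1' \<bullet> K w1) + (3 * rho2 B * (a2' \<bullet> K w2) + rho2 B * (a3' \<bullet> K w3))"
      "damp (a1, a2, a3) (KK (w1, w2, w3)) = 4 * gam B * (a3 \<bullet> K w3)"
      "(y1, y2) \<bullet> EE (w1, w2, w3) = y1 \<bullet> m1.E w1 + y2 \<bullet> m2.E w2"
      by (simp_all add: mass_def damp_def KK_def EE_def)
    show ?thesis unfolding st ms by argo
  qed
  have E0: "m1.E 0 = 0" "m2.E 0 = 0" using linear_0 bounded_linear.linear m1.bounded_linear_E m2.bounded_linear_E by blast+
  show ?thesis
  proof
    assume L: ?L
    have "?R1" proof fix w assume "w \<in> X0"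
      then show "rho1 B * (a1' \<bullet> K w) = - kpar B * (?s \<bullet> w) + total_mass (ker1 B) * (f1 \<bullet> w) - y1 \<bullet> m1.E w"
        using L[rule_format, of "(w, 0, 0)"] z unfolding e by (simp add: K_linear E0) qed
    moreover have "?R2" proof fix w assume "w \<in> X1"
      then show "rho2 B * (a2' \<bullet> K w) = - (bpar B - total_mass (ker2 B)) * (f2 \<bullet> w) - kpar B * (?s \<bullet> K w) - y2 \<bullet> m2.E w"
        using L[rule_format, of "(0, w, 0)"] z unfolding e by (simp add: K_linear E0) qed
    moreover have "?R3" proof fix w assume "w \<in> X1"
      then show "rho2 B * (a3' \<bullet> K w) = - bpar B * (f3 \<bullet> w) + 3 * kpar B * (?s \<bullet> K w) - 4 * delta B * (K f3 \<bullet> K w) - 4 * gam B * (a3 \<bullet> K w)"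
        using L[rule_format, of "(0, 0, w)"] z unfolding e by (simp add: K_linear E0) qed
    ultimately show "?R1 \<and> ?R2 \<and> ?R3" by blast
  next
    assume R: "?R1 \<and> ?R2 \<and> ?R3"
    show ?L
    proof
      fix w assume "w \<in> X0 \<times> X1 \<times> X1"
      then obtain w1 w2 w3 where w: "w = (w1, w2, w3)" "w1 \<in> X0" "w2 \<in> X1" "w3 \<in> X1" by auto
      show "mass (a1', a2', a3') (KK w) = - stiff (f1, f2, f3) w - damp (a1, a2, a3) (KK w) - 3 * ((y1, y2) \<bullet> EE w)"
        unfolding w(1) e using R w by simp
    qed
  qed
qed

section \<open>Translation between states and elements of the Hilbert space\<close>

text \<open>\<open>embed\<close> forgets exactly what the energy does not see, and \<open>realize\<close> chooses a representative, with
  positions that are continuous.\<close>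

definition embed :: "state \<Rightarrow> (real L2t \<times> real L2t \<times> real L2t) \<times> (real L2t \<times> real L2t \<times> real L2t) \<times> (real L2t L2t \<times> real L2t L2t)" where
  "embed U = ((dh (phi U), dh (psi U), dh (vee U)), (cl (phi_t U), cl (psi_t U), cl (vee_t U)), (m1.Tg (eta U), m2.Tg (zet U)))"

definition realize :: "(real L2t \<times> real L2t \<times> real L2t) \<times> (real L2t \<times> real L2t \<times> real L2t) \<times> (real L2t L2t \<times> real L2t L2t) \<Rightarrow> state" where
  "realize = (\<lambda>((f1, f2, f3), (a1, a2, a3), (y1, y2)). \<lparr>phi = (\<lambda>x. f1 \<bullet> chi x), phi_t = fn a1, psi = (\<lambda>x. f2 \<bullet> chi x), psi_t = fn a2,
     vee = (\<lambda>x. f3 \<bullet> chi x), vee_t = fn a3, eta = m1.con y1, zet = m2.con y2\<rparr>)"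

lemma energy_spaceD:
  assumes "U \<in> energy_space B"
  shows "phi U \<in> H10" "phi U \<in> Hstar" "phi_t U \<in> L2" "psi U \<in> Hstar" "psi_t U \<in> L2" "vee U \<in> Hstar" "vee_t U \<in> L2"
    "eta U \<in> Lg H10 (ker1 B)" "zet U \<in> Lg Hstar (ker2 B)" "phi U \<in> H1" "psi U \<in> H1" "vee U \<in> H1"
  using assms by (auto simp: energy_space_def H10_Hstar Hstar_H1)

lemma embed_carrier: assumes "U \<in> energy_space B" shows "embed U \<in> ms.carrier"
  using energy_spaceD[OF assms] by (auto simp: embed_def ms.carrier_def dh_X0 m1.Tg_Hist m2.Tg_Hist)

lemma realize: assumes "s \<in> ms.carrier" shows "realize s \<in> energy_space B" "embed (realize s) = s"
proof -
  obtain f1 f2 f3 a1 a2 a3 y1 y2 where s: "s = ((f1, f2, f3), (a1, a2, a3), (y1, y2))" by (metis prod.exhaust)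
  have m: "f1 \<in> X0" "f1 \<in> X1" "f2 \<in> X1" "f3 \<in> X1" "a1 \<in> X1" "a2 \<in> X1" "a3 \<in> X1" "y1 \<in> m1.Hist" "y2 \<in> m2.Hist"
    using assms X0_def unfolding ms.carrier_def s by auto
  show "realize s \<in> energy_space B"
    using m by (simp add: s realize_def energy_space_def H10_prim Hstar_I m1.con_Lg m2.con_Lg)
  show "embed (realize s) = s"
    using m by (simp add: s realize_def embed_def dh_prim X1_cl_fn m1.con_Lg m2.con_Lg)
qed

lemma energy_ip_embed: assumes U: "U \<in> energy_space B" and V: "V \<in> energy_space B"
  shows "energy_ip B U V = ms.energy (embed U) (embed V)"
proof -
  note u = energy_spaceD[OF U] and v = energy_spaceD[OF V]
  have d: "l2ip (wx h) (wx h') = dh h \<bullet> dh h'" if "h \<in> H1" "h' \<in> H1" for h h'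
    unfolding dh_def using that by (intro l2ip_cl wx)
  have s: "l2ip (shear (phi U) (psi U) (vee U)) (shear (phi V) (psi V) (vee V)) = sig (fst (embed U)) \<bullet> sig (fst (embed V))"
    using shear_L2[OF u(2,4,6)] shear_L2[OF v(2,4,6)] by (simp add: l2ip_cl sig_def embed_def)
  show ?thesis
    unfolding energy_ip_def s
    using u v by (simp add: d l2ip_cl H1_L2 cl_Hstar m1.Lg_ip_Tg m2.Lg_ip_Tg)
      (simp add: ms.energy_def stiff_def mass_def embed_def inner_prod_def algebra_simps)
qed

lemma st_diff_embed: assumes U: "U \<in> energy_space B" and V: "V \<in> energy_space B"
  shows "st_diff U V \<in> energy_space B" "embed (st_diff U V) = embed U - embed V"
proof -
  note u = energy_spaceD[OF U] and v = energy_spaceD[OF V]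
  have H: "(\<lambda>x. f x - h x) \<in> H10" if "f \<in> H10" "h \<in> H10" for f h using H10_lincomb[OF that, of 1 "- 1"] by simp
  have S: "(\<lambda>x. f x - h x) \<in> Hstar" if "f \<in> Hstar" "h \<in> Hstar" for f h using Hstar_lincomb[OF that, of 1 "- 1"] by simp
  have D: "dh (\<lambda>x. f x - h x) = dh f - dh h" if "f \<in> H1" "h \<in> H1" for f h using H1_lincomb(2)[OF that, of 1 "- 1"] by simp
  have L: "(\<lambda>x. f x - h x) \<in> L2" "cl (\<lambda>x. f x - h x) = cl f - cl h" if "f \<in> L2" "h \<in> L2" for f h
    using L2_lincomb[OF that, of 1 "- 1"] cl_lincomb[OF that, of 1 "- 1"] by auto
  show "st_diff U V \<in> energy_space B"
    using u v by (simp add: st_diff_def energy_space_def H S L m1.Lg_diff m2.Lg_diff)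
  show "embed (st_diff U V) = embed U - embed V"
    using u v by (simp add: st_diff_def embed_def D L m1.Tg_diff m2.Tg_diff)
qed

lemma st_scale_embed: assumes U: "U \<in> energy_space B"
  shows "st_scale c U \<in> energy_space B" "embed (st_scale c U) = c *\<^sub>R embed U"
proof -
  note u = energy_spaceD[OF U]
  have H: "(\<lambda>x. c * f x) \<in> H10" if "f \<in> H10" for f using H10_lincomb[OF that that, of c 0] by simp
  have S: "(\<lambda>x. c * f x) \<in> Hstar" if "f \<in> Hstar" for f using Hstar_lincomb[OF that that, of c 0] by simp
  have D: "dh (\<lambda>x. c * f x) = c *\<^sub>R dh f" if "f \<in> H1" for f using H1_lincomb(2)[OF that that, of c 0] by simp
  have L: "(\<lambda>x. c * f x) \<in> L2" "cl (\<lambda>x. c * f x) = c *\<^sub>R cl f" if "f \<in> L2" for f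
    using L2_lincomb[OF that that, of c 0] cl_lincomb[OF that that, of c 0] by auto
  show "st_scale c U \<in> energy_space B"
    using u m1.Lg_lincomb(1)[OF u(8) u(8), of c 0] m2.Lg_lincomb(1)[OF u(9) u(9), of c 0]
    by (simp add: st_scale_def energy_space_def H S L)
  show "embed (st_scale c U) = c *\<^sub>R embed U"
    using u m1.Lg_lincomb(2)[OF u(8) u(8), of c 0] m2.Lg_lincomb(2)[OF u(9) u(9), of c 0]
    by (simp add: st_scale_def embed_def D L)
qed

lemma energy_dist_embed: assumes "U \<in> energy_space B" "V \<in> energy_space B"
  shows "energy_dist B U V = ms.sg.N (embed U - embed V)"
  using st_diff_embed[OF assms] by (simp add: energy_dist_def energy_norm_def energy_ip_embed ms.sg.N_def)

text \<open>Component by component, the operator of the beam is the abstract generator: first, third and fifth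
  are \<open>K f' = a\<close>, the second, fourth and sixth are the weak equation, and the last two are the history
  derivatives.\<close>

lemma has_image_iff:
  assumes U: "U \<in> energy_space B" and F: "F \<in> energy_space B"
  shows "has_image B U F \<longleftrightarrow> ms.gen (embed U) (embed F)"
proof -
  note u = energy_spaceD[OF U] and f = energy_spaceD[OF F]
  let ?s = "shear (phi U) (psi U) (vee U)"
  let ?\<sigma> = "sig (dh (phi U), dh (psi U), dh (vee U))"
  have s: "?s \<in> L2" "cl ?s = ?\<sigma>" using shear_L2[OF u(2,4,6)] by (auto simp: sig_def)
  have d: "l2ip (wx h) (wx h') = dh h \<bullet> dh h'" if "h \<in> H1" "h' \<in> H1" for h h'
    unfolding dh_def using that by (intro l2ip_cl wx)
  have velocity: "(AE x in unit_meas. h x = a x) \<longleftrightarrow> cl a = K (dh h)" if "h \<in> Hstar" "a \<in> L2" for h a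
    using cl_eq_iff[OF H1_L2[OF Hstar_H1[OF that(1)]] that(2)] cl_Hstar[OF that(1)] by auto
  have H10_all: "(\<forall>w\<in>H10. Q (dh w)) \<longleftrightarrow> (\<forall>w\<in>X0. Q w)" for Q
    using H10_prim dh_X0 dh_prim by (metis (no_types, lifting) X0_def mem_Collect_eq)
  have Hstar_all: "(\<forall>w\<in>Hstar. Q (dh w)) \<longleftrightarrow> (\<forall>w\<in>X1. Q w)" for Q
    using Hstar_I dh_prim dh_X1 Hstar_H1 by metis
  have eq1: "(\<forall>w \<in> H10. l2ip (phi_t F) w = - (kpar B / rho1 B) * l2ip ?s (wx w) - (total_mass (ker1 B) / rho1 B) * weak_xx (phi U) w
          + (1 / rho1 B) * (LINT s|half_line. ker1 B s * weak_xx (eta U s) w))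
      \<longleftrightarrow> (\<forall>w\<in>X0. rho1 B * (cl (phi_t F) \<bullet> K w) = - kpar B * (?\<sigma> \<bullet> w) + total_mass (ker1 B) * (dh (phi U) \<bullet> w) - m1.Tg (eta U) \<bullet> m1.E w)"
    unfolding H10_all[symmetric]
  proof (rule ball_cong[OF refl])
    fix w assume w: "w \<in> H10"
    have w': "w \<in> Hstar" "w \<in> H1" "wx w \<in> L2" "w \<in> L2" using w by (auto intro: H10_Hstar Hstar_H1 wx H1_L2)
    have 1: "l2ip (phi_t F) w = cl (phi_t F) \<bullet> K (dh w)" using f w' by (simp add: l2ip_cl cl_Hstar)
    have 2: "l2ip ?s (wx w) = ?\<sigma> \<bullet> dh w" using s w' by (simp add: l2ip_cl dh_def)
    have 3: "weak_xx (phi U) w = - (dh (phi U) \<bullet> dh w)" using u w' by (simp add: weak_xx_def d)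
    have 4: "(LINT s|half_line. ker1 B s * weak_xx (eta U s) w) = - (m1.Tg (eta U) \<bullet> m1.E (dh w))"
      using m1.Tg_inner_E[OF u(8) w] by (simp add: weak_xx_def)
    show "(l2ip (phi_t F) w = - (kpar B / rho1 B) * l2ip ?s (wx w) - (total_mass (ker1 B) / rho1 B) * weak_xx (phi U) w
          + (1 / rho1 B) * (LINT s|half_line. ker1 B s * weak_xx (eta U s) w))
      \<longleftrightarrow> (rho1 B * (cl (phi_t F) \<bullet> K (dh w)) = - kpar B * (?\<sigma> \<bullet> dh w) + total_mass (ker1 B) * (dh (phi U) \<bullet> dh w) - m1.Tg (eta U) \<bullet> m1.E (dh w))"
      unfolding 1 2 3 4 by (rule eq_iff_multiple_eq[OF pos(1)]) (use pos in \<open>simp add: algebra_simps\<close>)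
  qed
  have eq2: "(\<forall>w \<in> Hstar. l2ip (psi_t F) w = (1 / rho2 B) * ((bpar B - total_mass (ker2 B)) * weak_xx (psi U) w - kpar B * l2ip ?s w)
          + (1 / rho2 B) * (LINT s|half_line. ker2 B s * weak_xx (zet U s) w))
      \<longleftrightarrow> (\<forall>w\<in>X1. rho2 B * (cl (psi_t F) \<bullet> K w) = - (bpar B - total_mass (ker2 B)) * (dh (psi U) \<bullet> w) - kpar B * (?\<sigma> \<bullet> K w) - m2.Tg (zet U) \<bullet> m2.E w)"
    unfolding Hstar_all[symmetric]
  proof (rule ball_cong[OF refl])
    fix w assume w: "w \<in> Hstar"
    have w': "w \<in> H1" "wx w \<in> L2" "w \<in> L2" using w by (auto intro: Hstar_H1 wx H1_L2)
    have 1: "l2ip (psi_t F) w = cl (psi_t F) \<bullet> K (dh w)" using f w w' by (simp add: l2ip_cl cl_Hstar)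
    have 2: "l2ip ?s w = ?\<sigma> \<bullet> K (dh w)" using s w w' by (simp add: l2ip_cl cl_Hstar)
    have 3: "weak_xx (psi U) w = - (dh (psi U) \<bullet> dh w)" using u w' by (simp add: weak_xx_def d)
    have 4: "(LINT s|half_line. ker2 B s * weak_xx (zet U s) w) = - (m2.Tg (zet U) \<bullet> m2.E (dh w))"
      using m2.Tg_inner_E[OF u(9) w] by (simp add: weak_xx_def)
    show "(l2ip (psi_t F) w = (1 / rho2 B) * ((bpar B - total_mass (ker2 B)) * weak_xx (psi U) w - kpar B * l2ip ?s w)
          + (1 / rho2 B) * (LINT s|half_line. ker2 B s * weak_xx (zet U s) w))
      \<longleftrightarrow> (rho2 B * (cl (psi_t F) \<bullet> K (dh w)) = - (bpar B - total_mass (ker2 B)) * (dh (psi U) \<bullet> dh w) - kpar B * (?\<sigma> \<bullet> K (dh w)) - m2.Tg (zet U) \<bullet> m2.E (dh w))"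
      unfolding 1 2 3 4 by (rule eq_iff_multiple_eq[OF pos(2)]) (use pos in \<open>simp add: algebra_simps\<close>)
  qed
  define g where "g x = (3 * kpar B / rho2 B) * ?s x + 1 * ((- 4 * delta B / rho2 B) * vee U x + (- 4 * gam B / rho2 B) * vee_t U x)" for x
  have gL: "g \<in> L2" "cl g = (3 * kpar B / rho2 B) *\<^sub>R ?\<sigma> + ((- 4 * delta B / rho2 B) *\<^sub>R K (dh (vee U)) + (- 4 * gam B / rho2 B) *\<^sub>R cl (vee_t U))"
  proof -
    have L: "?s \<in> L2" "vee U \<in> L2" "vee_t U \<in> L2" using s(1) u(7) H1_L2[OF u(12)] by auto
    note i = L2_lincomb[OF L(2,3), of "- 4 * delta B / rho2 B" "- 4 * gam B / rho2 B"]
    show "g \<in> L2" unfolding g_def[abs_def] by (rule L2_lincomb[OF L(1) i])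
    show "cl g = (3 * kpar B / rho2 B) *\<^sub>R ?\<sigma> + ((- 4 * delta B / rho2 B) *\<^sub>R K (dh (vee U)) + (- 4 * gam B / rho2 B) *\<^sub>R cl (vee_t U))"
      unfolding g_def[abs_def] cl_lincomb[OF L(1) i] cl_lincomb[OF L(2,3)] s(2) cl_Hstar[OF u(6)] by simp
  qed
  have eq3: "(\<exists>p \<in> H1. (AE x in unit_meas. p x = wx (vee U) x) \<and> p 1 = 0 \<and>
         (AE x in unit_meas. vee_t F x = (1 / rho2 B) * (bpar B * wx p x + 3 * kpar B * ?s x - 4 * delta B * vee U x - 4 * gam B * vee_t U x)))
      \<longleftrightarrow> (\<forall>w\<in>X1. rho2 B * (cl (vee_t F) \<bullet> K w) = - bpar B * (dh (vee U) \<bullet> w) + 3 * kpar B * (?\<sigma> \<bullet> K w)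
        - 4 * delta B * (K (dh (vee U)) \<bullet> K w) - 4 * gam B * (cl (vee_t U) \<bullet> K w))"
  proof -
    have pw: "(1 / rho2 B) * (bpar B * wx p x + 3 * kpar B * ?s x - 4 * delta B * vee U x - 4 * gam B * vee_t U x)
        = (bpar B / rho2 B) * wx p x + g x" for p x
      using pos(2) by (simp add: g_def field_simps)
    have "bpar B / rho2 B \<noteq> 0" using pos by simp
    note strong = strong_iff_weak[OF u(6) f(7) gL(1) this]
    have "rho2 B \<noteq> 0" using pos by simp
    then show ?thesis unfolding pw strong gL(2) inner_add_left inner_scaleR_left
      by (intro ball_cong[OF refl] eq_iff_multiple_eq[OF pos(2)]) (simp add: field_simps)
  qed
  have eq7: "history_deriv H10 (ker1 B) (eta U) (\<lambda>s x. phi F x - eta F s x) \<longleftrightarrow> m1.hist (m1.Tg (eta U)) (m1.E (dh (phi F)) - m1.Tg (eta F))"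
    using m1.history_deriv_iff[OF u(8) m1.Lg_diff[OF m1.Lg_const(1)[OF f(1)] f(8)]]
      m1.Tg_diff[OF m1.Lg_const(1)[OF f(1)] f(8)] m1.Lg_const(2)[OF f(1)] by simp
  have eq8: "history_deriv Hstar (ker2 B) (zet U) (\<lambda>s x. psi F x - zet F s x) \<longleftrightarrow> m2.hist (m2.Tg (zet U)) (m2.E (dh (psi F)) - m2.Tg (zet F))"
    using m2.history_deriv_iff[OF u(9) m2.Lg_diff[OF m2.Lg_const(1)[OF f(4)] f(9)]]
      m2.Tg_diff[OF m2.Lg_const(1)[OF f(4)] f(9)] m2.Lg_const(2)[OF f(4)] by simp
  have vel: "fst (snd (embed U)) = KK (fst (embed F)) \<longleftrightarrow>
      (AE x in unit_meas. phi F x = phi_t U x) \<and> (AE x in unit_meas. psi F x = psi_t U x) \<and> (AE x in unit_meas. vee F x = vee_t U x)"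
    using velocity[OF f(2) u(3)] velocity[OF f(4) u(5)] velocity[OF f(6) u(7)] by (simp add: embed_def KK_def)
  have HH: "HH (snd (snd (embed U))) (EE (fst (embed F)) - snd (snd (embed F))) \<longleftrightarrow>
      m1.hist (m1.Tg (eta U)) (m1.E (dh (phi F)) - m1.Tg (eta F)) \<and> m2.hist (m2.Tg (zet U)) (m2.E (dh (psi F)) - m2.Tg (zet F))"
    by (simp add: HH_def EE_def embed_def)
  have weak: "(\<forall>w\<in>X0 \<times> X1 \<times> X1. mass (fst (snd (embed F))) (KK w) = - stiff (fst (embed U)) w - damp (fst (snd (embed U))) (KK w) - 3 * (snd (snd (embed U)) \<bullet> EE w))
    \<longleftrightarrow> (\<forall>w\<in>X0. rho1 B * (cl (phi_t F) \<bullet> K w) = - kpar B * (?\<sigma> \<bullet> w) + total_mass (ker1 B) * (dh (phi U) \<bullet> w) - m1.Tg (eta U) \<bullet> m1.E w)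
     \<and> (\<forall>w\<in>X1. rho2 B * (cl (psi_t F) \<bullet> K w) = - (bpar B - total_mass (ker2 B)) * (dh (psi U) \<bullet> w) - kpar B * (?\<sigma> \<bullet> K w) - m2.Tg (zet U) \<bullet> m2.E w)
     \<and> (\<forall>w\<in>X1. rho2 B * (cl (vee_t F) \<bullet> K w) = - bpar B * (dh (vee U) \<bullet> w) + 3 * kpar B * (?\<sigma> \<bullet> K w)
        - 4 * delta B * (K (dh (vee U)) \<bullet> K w) - 4 * gam B * (cl (vee_t U) \<bullet> K w))"
    unfolding embed_def fst_conv snd_conv by (rule weak_equation_split)
  show ?thesis
    unfolding has_image_def Let_def ms.gen_def vel HH weak eq1 eq2 eq3 eq7 eq8
    using U F embed_carrier[OF U] embed_carrier[OF F] by blast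
qed

end

section \<open>Well-posedness\<close>

lemma eventually_at_half_line: "eventually (\<lambda>r::real. 0 \<le> r) (at t within {0..})"
  by (simp add: eventually_at_filter)

context beam_problem
begin

lemma energy_dist_quotient:
  assumes "U \<in> energy_space B" "V \<in> energy_space B" "W \<in> energy_space B"
  shows "energy_dist B (st_scale c (st_diff U V)) W = ms.sg.N (c *\<^sub>R (embed U - embed V) - embed W)"
  using assms by (simp add: energy_dist_embed st_scale_embed st_diff_embed)

lemma continuous_H_embed:
  "continuous_H B U \<longleftrightarrow> (\<forall>t\<ge>0. U t \<in> energy_space B) \<and>
     (\<forall>t\<ge>0. ((\<lambda>r. ms.sg.N (embed (U r) - embed (U t))) \<longlongrightarrow> 0) (at t within {0..}))"
proof -
  have "((\<lambda>r. energy_dist B (U r) (U t)) \<longlongrightarrow> 0) (at t within {0..})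
      \<longleftrightarrow> ((\<lambda>r. ms.sg.N (embed (U r) - embed (U t))) \<longlongrightarrow> 0) (at t within {0..})"
    if "\<forall>t\<ge>0. U t \<in> energy_space B" "t \<ge> 0" for t
    by (rule tendsto_cong) (use that eventually_at_half_line[of t] in \<open>auto elim!: eventually_mono simp: energy_dist_embed\<close>)
  then show ?thesis unfolding continuous_H_def by blast
qed

lemma deriv_H_embed:
  assumes "\<And>t. t \<ge> 0 \<Longrightarrow> U t \<in> energy_space B" "V \<in> energy_space B" "t \<ge> 0"
  shows "deriv_H B U V t \<longleftrightarrow>
     ((\<lambda>r. ms.sg.N ((1 / (r - t)) *\<^sub>R (embed (U r) - embed (U t)) - embed V)) \<longlongrightarrow> 0) (at t within {0..})"
  unfolding deriv_H_def
  by (rule tendsto_cong) (use assms eventually_at_half_line[of t] in \<open>auto elim!: eventually_mono simp: energy_dist_quotient\<close>)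

lemma has_image_gen: "has_image B U F \<Longrightarrow> (embed U, embed F) \<in> {(u, u'). ms.gen u u'}"
  using has_image_iff by (auto simp: has_image_def)

lemma realize_has_image: assumes "(u, v) \<in> {(u, u'). ms.gen u u'}" shows "has_image B (realize u) (realize v)"
proof -
  have "u \<in> ms.carrier" "v \<in> ms.carrier" using ms.sg.GD[OF assms] .
  then show ?thesis using assms by (simp add: has_image_iff realize)
qed

text \<open>The mild solution with initial state \<open>U0\<close>.\<close>

definition flow :: "state \<Rightarrow> real \<Rightarrow> state" where
  "flow U0 t = realize (ms.sg.T t (embed U0))"

lemma flow:
  assumes "U0 \<in> energy_space B" "t \<ge> 0"
  shows "flow U0 t \<in> energy_space B" "embed (flow U0 t) = ms.sg.T t (embed U0)"
  using assms by (auto simp: flow_def realize embed_carrier)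

lemma flow_continuous: "U0 \<in> energy_space B \<Longrightarrow> continuous_H B (flow U0)"
proof -
  assume U0: "U0 \<in> energy_space B"
  have "((\<lambda>r. ms.sg.N (embed (flow U0 r) - embed (flow U0 t))) \<longlongrightarrow> 0) (at t within {0..})" if t: "t \<ge> 0" for t
  proof (rule Lim_transform_eventually[OF ms.sg.T_continuous[OF t embed_carrier[OF U0]]])
    show "\<forall>\<^sub>F r in at t within {0..}. ms.sg.N (ms.sg.T r (embed U0) - ms.sg.T t (embed U0))
        = ms.sg.N (embed (flow U0 r) - embed (flow U0 t))"
      using eventually_at_half_line[of t] by (rule eventually_mono) (simp add: flow U0 t)
  qed
  then show ?thesis using U0 by (simp add: continuous_H_embed flow)
qed

lemma flow_domain:
  assumes i: "has_image B U0 F0" and t: "t \<ge> 0"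
  shows "has_image B (flow U0 t) (flow F0 t)" "deriv_H B (flow U0) (flow F0 t) t"
proof -
  have E: "U0 \<in> energy_space B" "F0 \<in> energy_space B" using i by (auto simp: has_image_def)
  note g = has_image_gen[OF i]
  show "has_image B (flow U0 t) (flow F0 t)"
    unfolding flow_def by (rule realize_has_image) (rule ms.sg.T_G[OF t g])
  show "deriv_H B (flow U0) (flow F0 t) t"
  proof (subst deriv_H_embed)
    show "flow U0 r \<in> energy_space B" if "r \<ge> 0" for r by (rule flow(1)[OF E(1) that])
    show "flow F0 t \<in> energy_space B" "t \<ge> 0" by (rule flow(1)[OF E(2) t], rule t)
    show "((\<lambda>r. ms.sg.N ((1 / (r - t)) *\<^sub>R (embed (flow U0 r) - embed (flow U0 t)) - embed (flow F0 t))) \<longlongrightarrow> 0) (at t within {0..})"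
  proof (rule Lim_transform_eventually[OF ms.sg.T_derivative[OF t g]])
    show "\<forall>\<^sub>F r in at t within {0..}. ms.sg.N ((1 / (r - t)) *\<^sub>R (ms.sg.T r (embed U0) - ms.sg.T t (embed U0)) - ms.sg.T t (embed F0))
       = ms.sg.N ((1 / (r - t)) *\<^sub>R (embed (flow U0 r) - embed (flow U0 t)) - embed (flow F0 t))"
      using eventually_at_half_line[of t] by (rule eventually_mono) (simp add: flow E t)
    qed
  qed
qed

lemma flow_initial: assumes "U0 \<in> energy_space B" shows "energy_dist B (flow U0 0) U0 = 0"
  using flow[OF assms, of 0] assms by (simp add: energy_dist_embed embed_carrier)

lemma flow_classical:
  assumes i: "U0 \<in> op_domain B"
  shows "classical_solution B U0 (flow U0)" "C1_H B (flow U0)" "continuous_domain B (flow U0)"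
proof -
  obtain F0 where F0: "has_image B U0 F0" using i by (auto simp: op_domain_def)
  have E: "U0 \<in> energy_space B" "F0 \<in> energy_space B" using F0 by (auto simp: has_image_def)
  note c = flow_continuous[OF E(1)] flow_continuous[OF E(2)] and d = flow_domain[OF F0]
  show "classical_solution B U0 (flow U0)"
    unfolding classical_solution_def using c d flow_initial[OF E(1)] by (meson less_imp_le)
  show "C1_H B (flow U0)" unfolding C1_H_def using c d by blast
  show "continuous_domain B (flow U0)" unfolding continuous_domain_def using c d by blast
qed

text \<open>A classical solution is required to satisfy the equation only for \<open>t > 0\<close>, so it is compared with an
  orbit of the semigroup starting in the domain; the difference is again a solution and loses energy.\<close>

lemma classical_near_semigroup:
  assumes W: "classical_solution B D W" and D: "D \<in> energy_space B"
    and g: "(u, v) \<in> {(u, u'). ms.gen u u'}" and t: "t \<ge> 0"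
  shows "ms.sg.N (embed (W t) - ms.sg.T t u) \<le> ms.sg.N (embed D - u)"
proof -
  have u: "u \<in> ms.carrier" "v \<in> ms.carrier" using ms.sg.GD[OF g] .
  have WE: "W t \<in> energy_space B" if "t \<ge> 0" for t
    using W that by (simp add: classical_solution_def continuous_H_def)
  note WC = embed_carrier[OF WE]
  define e where "e t = embed (W t) - ms.sg.T t u" for t
  have "ms.sg.N (e t) \<le> ms.sg.N (e 0)"
  proof (rule ms.sg.dissipative_solution_decay[OF _ _ _ t])
    show eC: "e t \<in> ms.carrier" if "t \<ge> 0" for t using WC[OF that] u that by (simp add: e_def)
    show "((\<lambda>r. ms.sg.N (e r - e t)) \<longlongrightarrow> 0) (at t within {0..})" if t: "t \<ge> 0" for t
    proof (rule tendsto_sandwich[OF _ _ tendsto_const])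
      have "((\<lambda>r. ms.sg.N (embed (W r) - embed (W t))) \<longlongrightarrow> 0) (at t within {0..})"
        using W t by (simp add: classical_solution_def continuous_H_embed)
      from tendsto_add[OF this ms.sg.T_continuous[OF t u(1)]]
      show "((\<lambda>r. ms.sg.N (embed (W r) - embed (W t)) + ms.sg.N (ms.sg.T r u - ms.sg.T t u)) \<longlongrightarrow> 0) (at t within {0..})" by simp
      show "\<forall>\<^sub>F r in at t within {0..}. 0 \<le> ms.sg.N (e r - e t)"
        using eventually_at_half_line[of t] by (rule eventually_mono) (use eC t in simp)
      show "\<forall>\<^sub>F r in at t within {0..}. ms.sg.N (e r - e t) \<le> ms.sg.N (embed (W r) - embed (W t)) + ms.sg.N (ms.sg.T r u - ms.sg.T t u)"
      proof (rule eventually_mono[OF eventually_at_half_line[of t]])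
        fix r :: real assume r: "0 \<le> r"
        have eq: "e r - e t = (embed (W r) - embed (W t)) - (ms.sg.T r u - ms.sg.T t u)" by (simp add: e_def)
        show "ms.sg.N (e r - e t) \<le> ms.sg.N (embed (W r) - embed (W t)) + ms.sg.N (ms.sg.T r u - ms.sg.T t u)"
          unfolding eq by (rule ms.sg.N_triangle_diff) (use WC r t u in auto)
      qed
    qed
    show "\<exists>v. (e t, v) \<in> {(u, u'). ms.gen u u'} \<and>
       ((\<lambda>r. ms.sg.N ((1 / (r - t)) *\<^sub>R (e r - e t) - v)) \<longlongrightarrow> 0) (at t within {0..})" if t: "t > 0" for t
    proof -
      have t0: "t \<ge> 0" using t by simp
      obtain F where F: "has_image B (W t) F" "deriv_H B W F t"
        using W t by (auto simp: classical_solution_def)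
      have FE: "F \<in> energy_space B" using F by (simp add: has_image_def)
      note FC = embed_carrier[OF FE]
      have "(e t, embed F - ms.sg.T t v) \<in> {(u, u'). ms.gen u u'}"
        unfolding e_def by (intro ms.sg.G_diff has_image_gen F ms.sg.T_G t0 g)
      moreover have "((\<lambda>r. ms.sg.N ((1 / (r - t)) *\<^sub>R (e r - e t) - (embed F - ms.sg.T t v))) \<longlongrightarrow> 0) (at t within {0..})"
      proof (rule tendsto_sandwich[OF _ _ tendsto_const])
        have "((\<lambda>r. ms.sg.N ((1 / (r - t)) *\<^sub>R (embed (W r) - embed (W t)) - embed F)) \<longlongrightarrow> 0) (at t within {0..})"
          using F(2) deriv_H_embed[OF WE FE t0] by simp
        from tendsto_add[OF this ms.sg.T_derivative[OF t0 g]]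
        show "((\<lambda>r. ms.sg.N ((1 / (r - t)) *\<^sub>R (embed (W r) - embed (W t)) - embed F)
            + ms.sg.N ((1 / (r - t)) *\<^sub>R (ms.sg.T r u - ms.sg.T t u) - ms.sg.T t v)) \<longlongrightarrow> 0) (at t within {0..})" by simp
        show "\<forall>\<^sub>F r in at t within {0..}. 0 \<le> ms.sg.N ((1 / (r - t)) *\<^sub>R (e r - e t) - (embed F - ms.sg.T t v))"
          using eventually_at_half_line[of t]
          by (rule eventually_mono) (use eC t0 FC u in \<open>intro ms.sg.N_nonneg ms.sg.S_closed_ops; simp\<close>)
        show "\<forall>\<^sub>F r in at t within {0..}. ms.sg.N ((1 / (r - t)) *\<^sub>R (e r - e t) - (embed F - ms.sg.T t v))
            \<le> ms.sg.N ((1 / (r - t)) *\<^sub>R (embed (W r) - embed (W t)) - embed F)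
              + ms.sg.N ((1 / (r - t)) *\<^sub>R (ms.sg.T r u - ms.sg.T t u) - ms.sg.T t v)"
        proof (rule eventually_mono[OF eventually_at_half_line[of t]])
          fix r :: real assume r: "0 \<le> r"
          have eq: "(1 / (r - t)) *\<^sub>R (e r - e t) - (embed F - ms.sg.T t v)
            = ((1 / (r - t)) *\<^sub>R (embed (W r) - embed (W t)) - embed F)
              - ((1 / (r - t)) *\<^sub>R (ms.sg.T r u - ms.sg.T t u) - ms.sg.T t v)"
            by (simp add: e_def scaleR_diff_right)
          show "ms.sg.N ((1 / (r - t)) *\<^sub>R (e r - e t) - (embed F - ms.sg.T t v))
            \<le> ms.sg.N ((1 / (r - t)) *\<^sub>R (embed (W r) - embed (W t)) - embed F)
              + ms.sg.N ((1 / (r - t)) *\<^sub>R (ms.sg.T r u - ms.sg.T t u) - ms.sg.T t v)"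
            unfolding eq using WC[OF r] WC[OF t0] u FC r t0
            by (intro ms.sg.N_triangle_diff ms.sg.S_closed_ops ms.sg.T_in_S)
        qed
      qed
      ultimately show ?thesis by blast
    qed
  qed
  moreover have "embed (W 0) = embed D"
  proof -
    have "ms.sg.N (embed (W 0) - embed D) = 0"
      using W energy_dist_embed[OF WE[of 0] D] by (simp add: classical_solution_def)
    then show ?thesis using ms.sg.N_eq_0[of "embed (W 0) - embed D"] WC[of 0] embed_carrier[OF D] by simp
  qed
  ultimately show ?thesis using u by (simp add: e_def)
qed

lemma flow_mild: assumes U0: "U0 \<in> energy_space B" shows "mild_solution B U0 (flow U0)"
proof -
  have "\<exists>u v. (u, v) \<in> {(u, u'). ms.gen u u'} \<and> ms.sg.N (embed U0 - u) < 1 / (real n + 1)" for n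
    by (rule ms.sg.Domain_N_dense) (auto simp: embed_carrier U0)
  then obtain u v where uv: "\<And>n. (u n, v n) \<in> {(u, u'). ms.gen u u'}"
    "\<And>n::nat. ms.sg.N (embed U0 - u n) < 1 / (real n + 1)" by metis
  have u: "u n \<in> ms.carrier" for n using ms.sg.GD(1)[OF uv(1)] .
  define D where "D n = realize (u n)" for n
  have D: "D n \<in> op_domain B" for n using realize_has_image[OF uv(1)] by (auto simp: D_def op_domain_def)
  have DE: "D n \<in> energy_space B" "embed (D n) = u n" for n using u by (simp_all add: D_def realize)
  have lim: "(\<lambda>n. 1 / (real n + 1)) \<longlonglongrightarrow> 0"
    using LIMSEQ_inverse_real_of_nat by (simp add: inverse_eq_divide add.commute)
  have dist_flow: "energy_dist B (flow (D n) t) (flow U0 t) \<le> 1 / (real n + 1)" and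
    dist_flow_nonneg: "0 \<le> energy_dist B (flow (D n) t) (flow U0 t)" if "t \<ge> 0" for n t
  proof -
    have e: "energy_dist B (flow (D n) t) (flow U0 t) = ms.sg.N (ms.sg.T t (u n - embed U0))"
      using that u U0 DE by (simp add: energy_dist_embed flow ms.sg.T_diff embed_carrier)
    have "\<dots> \<le> ms.sg.N (u n - embed U0)" using that u U0 by (intro ms.sg.T_contraction) (auto simp: embed_carrier)
    also have "\<dots> \<le> 1 / (real n + 1)" using uv(2)[of n] ms.sg.N_minus[of "u n"] by simp
    finally show "energy_dist B (flow (D n) t) (flow U0 t) \<le> 1 / (real n + 1)" by (simp add: e)
    show "0 \<le> energy_dist B (flow (D n) t) (flow U0 t)" unfolding e using that u U0 by (auto simp: embed_carrier)
  qed
  show ?thesis unfolding mild_solution_def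
  proof (intro conjI exI[of _ D] exI[of _ "\<lambda>n. flow (D n)"] allI impI)
    show "flow U0 t \<in> energy_space B" if "t \<ge> 0" for t by (rule flow(1)[OF U0 that])
    show "D n \<in> op_domain B" "classical_solution B (D n) (flow (D n))" for n using D flow_classical by auto
    show "(\<lambda>n. energy_dist B (D n) U0) \<longlonglongrightarrow> 0"
    proof (rule tendsto_sandwich[OF _ _ tendsto_const lim])
      have "energy_dist B (D n) U0 = ms.sg.N (embed U0 - u n)" for n
        using DE U0 ms.sg.N_minus by (simp add: energy_dist_embed)
      then show "\<forall>\<^sub>F n in sequentially. 0 \<le> energy_dist B (D n) U0" "\<forall>\<^sub>F n in sequentially. energy_dist B (D n) U0 \<le> 1 / (real n + 1)"
        using uv(2) u U0 by (auto simp: embed_carrier less_imp_le)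
    qed
    show "uniform_limit {0..T} (\<lambda>n t. energy_dist B (flow (D n) t) (flow U0 t)) (\<lambda>_. 0) sequentially" for T
    proof (rule uniform_limitI)
      fix e :: real assume "e > 0"
      with lim have "\<forall>\<^sub>F n in sequentially. 1 / (real n + 1) < e" by (rule order_tendstoD)
      then show "\<forall>\<^sub>F n in sequentially. \<forall>t\<in>{0..T}. dist (energy_dist B (flow (D n) t) (flow U0 t)) 0 < e"
        by (rule eventually_mono) (use dist_flow dist_flow_nonneg in \<open>auto intro: le_less_trans[OF dist_flow]\<close>)
    qed
  qed
qed

text \<open>The approximating classical solutions are orbits of the semigroup, by \<open>classical_near_semigroup\<close> with
  \<open>u = embed (D n)\<close>, and therefore converge to the orbit of \<open>U0\<close>.\<close>

lemma mild_unique: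
  assumes U0: "U0 \<in> energy_space B" and V: "mild_solution B U0 V" and t: "t \<ge> 0"
  shows "energy_dist B (V t) (flow U0 t) = 0"
proof -
  obtain D W where D: "\<And>n::nat. D n \<in> op_domain B" and W: "\<And>n. classical_solution B (D n) (W n)"
    and lim: "(\<lambda>n. energy_dist B (D n) U0) \<longlonglongrightarrow> 0"
    and unif: "uniform_limit {0..t} (\<lambda>n t. energy_dist B (W n t) (V t)) (\<lambda>_. 0) sequentially"
    using V t unfolding mild_solution_def by blast
  have VE: "V t \<in> energy_space B" using V t by (simp add: mild_solution_def)
  have DE: "D n \<in> energy_space B" for n using D[of n] by (auto simp: op_domain_def has_image_def)
  have WE: "W n t \<in> energy_space B" for n using W[of n] t by (simp add: classical_solution_def continuous_H_def)
  have lim2: "(\<lambda>n. energy_dist B (W n t) (V t)) \<longlonglongrightarrow> 0"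
    using tendsto_uniform_limitI[OF unif, of t] t by simp
  have "ms.sg.N (embed (V t) - ms.sg.T t (embed U0)) \<le> energy_dist B (W n t) (V t) + energy_dist B (D n) U0" for n
  proof -
    obtain F where F: "has_image B (D n) F" using D[of n] by (auto simp: op_domain_def)
    note c = embed_carrier[OF VE] embed_carrier[OF WE[of n]] embed_carrier[OF DE[of n]] embed_carrier[OF U0]
    have "embed (W n t) - ms.sg.T t (embed (D n)) = 0"
      using classical_near_semigroup[OF W[of n] DE[of n] has_image_gen[OF F] t] c t ms.sg.N_nonneg[of "embed (W n t) - ms.sg.T t (embed (D n))"]
      by (intro ms.sg.N_eq_0 order_antisym) auto
    then have eq: "embed (V t) - ms.sg.T t (embed U0) = (embed (V t) - embed (W n t)) + ms.sg.T t (embed (D n) - embed U0)"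
      using c t by (simp add: ms.sg.T_diff)
    have "ms.sg.N (embed (V t) - ms.sg.T t (embed U0))
        \<le> ms.sg.N (embed (V t) - embed (W n t)) + ms.sg.N (ms.sg.T t (embed (D n) - embed U0))"
      unfolding eq using c t by (intro ms.sg.N_triangle) auto
    also have "\<dots> \<le> ms.sg.N (embed (W n t) - embed (V t)) + ms.sg.N (embed (D n) - embed U0)"
      by (intro add_mono eq_refl[OF ms.sg.N_minus] ms.sg.T_contraction t ms.sg.S_closed_ops c)
    finally show ?thesis by (simp add: energy_dist_embed VE WE DE U0)
  qed
  then have "ms.sg.N (embed (V t) - ms.sg.T t (embed U0)) \<le> 0 + 0"
    by (intro LIMSEQ_le_const[OF tendsto_add[OF lim2 lim]]) auto
  moreover have "0 \<le> ms.sg.N (embed (V t) - ms.sg.T t (embed U0))"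
    using embed_carrier[OF VE] embed_carrier[OF U0] t by simp
  ultimately show ?thesis using flow[OF U0 t] VE by (simp add: energy_dist_embed)
qed

end

text \<open>\<open>g s exp (\<beta> s)\<close> is nondecreasing.\<close>

lemma exponential_lower_bound:
  fixes g :: "real \<Rightarrow> real"
  assumes deriv: "\<And>s. s \<ge> 0 \<Longrightarrow> (g has_real_derivative g' s) (at s within {0..})"
    and lower: "\<And>s. s \<ge> 0 \<Longrightarrow> - \<beta> * g s \<le> g' s" and s: "s \<ge> 0"
  shows "g 0 * exp (- \<beta> * s) \<le> g s"
proof -
  have "g 0 * exp (\<beta> * 0) \<le> g s * exp (\<beta> * s)"
  proof (rule DERIV_nonneg_imp_increasing_open[OF s])
    show "\<exists>y. ((\<lambda>s. g s * exp (\<beta> * s)) has_real_derivative y) (at x) \<and> 0 \<le> y" if x: "0 < x" "x < s" for x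
    proof (intro exI conjI)
      have "at x within {0..} = at x" using x by (intro at_within_interior) (simp add: interior_real_atLeast)
      then have "(g has_real_derivative g' x) (at x)" using deriv[of x] x by simp
      then show "((\<lambda>s. g s * exp (\<beta> * s)) has_real_derivative (g' x + \<beta> * g x) * exp (\<beta> * x)) (at x)"
        by (auto intro!: derivative_eq_intros simp: algebra_simps)
      show "0 \<le> (g' x + \<beta> * g x) * exp (\<beta> * x)" using lower[of x] x by simp
    qed
    have "continuous_on {0..} g" using deriv DERIV_continuous_on[of "{0..}" g g'] by auto
    then have "continuous_on {0..s} g" by (rule continuous_on_subset) auto
    then show "continuous_on {0..s} (\<lambda>s. g s * exp (\<beta> * s))" by (intro continuous_intros)
  qed
  then have "g 0 * exp (- \<beta> * s) \<le> g s * exp (\<beta> * s) * exp (- \<beta> * s)" by (intro mult_right_mono) auto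
  then show ?thesis by (simp add: mult.assoc flip: exp_add)
qed

lemma kernel_from_decay:
  assumes H: "history_space Hs pr" and nonneg: "\<And>s. s \<ge> 0 \<Longrightarrow> g s \<ge> 0"
    and deriv: "\<And>s. s \<ge> 0 \<Longrightarrow> (g has_real_derivative g' s) (at s within {0..})"
    and noninc: "antimono_on {0..} g" and int: "integrable (lebesgue_on {0..}) g"
    and lower: "\<And>s. s \<ge> 0 \<Longrightarrow> - \<beta> * g s \<le> g' s"
  shows "kernel Hs pr g"
proof (intro kernel.intro H kernel_axioms.intro nonneg noninc int)
  show "(\<forall>s\<ge>0. g s > 0) \<or> (\<forall>s\<ge>0. g s = 0)"
  proof (cases "g 0 = 0")
    case True
    have "g s = 0" if "s \<ge> 0" for s
      using monotone_onD[OF noninc, of 0 s] nonneg[OF that] that True by simp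
    then show ?thesis by blast
  next
    case False
    then have "0 < g 0 * exp (- \<beta> * s)" for s using nonneg[of 0] by simp
    moreover have "g 0 * exp (- \<beta> * s) \<le> g s" if "s \<ge> 0" for s
      using deriv lower that by (rule exponential_lower_bound)
    ultimately show ?thesis by (meson less_le_trans)
  qed
qed
  
theorem theorem2p1:
  fixes B :: beam and g1' g2' :: "real \<Rightarrow> real" and k0 beta1 beta2 :: real
  assumes "rho1 B > 0" and "rho2 B > 0" and "kpar B > 0" and "bpar B > 0"
    and "delta B > 0" and "gam B > 0"
    and g1_nonneg: "\<And>s. s \<ge> 0 \<Longrightarrow> ker1 B s \<ge> 0"
    and g2_nonneg: "\<And>s. s \<ge> 0 \<Longrightarrow> ker2 B s \<ge> 0"
    and g1_deriv: "\<And>s. s \<ge> 0 \<Longrightarrow> (ker1 B has_real_derivative g1' s) (at s within {0..})"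
    and g2_deriv: "\<And>s. s \<ge> 0 \<Longrightarrow> (ker2 B has_real_derivative g2' s) (at s within {0..})"
    and g1_noninc: "antimono_on {0..} (ker1 B)"
    and g2_noninc: "antimono_on {0..} (ker2 B)"
    and g1_int: "integrable (lebesgue_on {0..}) (ker1 B)"
    and g2_int: "integrable (lebesgue_on {0..}) (ker2 B)"
    and "k0 > 0"
    and coercive: "\<And>\<phi> \<psi> v. \<phi> \<in> H10 \<Longrightarrow> \<psi> \<in> Hstar \<Longrightarrow> v \<in> Hstar \<Longrightarrow>
       k0 * ((l2norm (wx \<phi>))\<^sup>2 + (l2norm (wx \<psi>))\<^sup>2 + (l2norm (wx v))\<^sup>2)
       \<le> 3 * kpar B * (l2norm (shear \<phi> \<psi> v))\<^sup>2
         + 3 * (bpar B - total_mass (ker2 B)) * (l2norm (wx \<psi>))\<^sup>2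
         + bpar B * (l2norm (wx v))\<^sup>2 + 4 * delta B * (l2norm v)\<^sup>2
         - 3 * total_mass (ker1 B) * (l2norm (wx \<phi>))\<^sup>2"
    and "beta1 > 0" and "beta2 > 0"
    and g1_lower: "\<And>s. s \<ge> 0 \<Longrightarrow> - beta1 * ker1 B s \<le> g1' s"
    and g2_lower: "\<And>s. s \<ge> 0 \<Longrightarrow> - beta2 * ker2 B s \<le> g2' s"
  shows "\<forall>U0 \<in> energy_space B.
     \<exists>U. mild_solution B U0 U \<and> continuous_H B U \<and>
         (\<forall>V. mild_solution B U0 V \<longrightarrow> (\<forall>t\<ge>0. energy_dist B (V t) (U t) = 0)) \<and>
         (U0 \<in> op_domain B \<longrightarrow>
            classical_solution B U0 U \<and> C1_H B U \<and> continuous_domain B U)"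
proof
  fix U0 assume U0: "U0 \<in> energy_space B"
  have k1: "kernel H10 pr0 (ker1 B)"
    by (rule kernel_from_decay[OF _ g1_nonneg g1_deriv g1_noninc g1_int g1_lower]) (simp add: history_space_def)
  have k2: "kernel Hstar un (ker2 B)"
    by (rule kernel_from_decay[OF _ g2_nonneg g2_deriv g2_noninc g2_int g2_lower]) (simp add: history_space_def)
  interpret beam_problem B k0
    by (rule beam_problem.intro) (fact assms k1 k2)+
  show "\<exists>U. mild_solution B U0 U \<and> continuous_H B U \<and>
         (\<forall>V. mild_solution B U0 V \<longrightarrow> (\<forall>t\<ge>0. energy_dist B (V t) (U t) = 0)) \<and>
         (U0 \<in> op_domain B \<longrightarrow> classical_solution B U0 U \<and> C1_H B U \<and> continuous_domain B U)"
    using flow_mild[OF U0] flow_continuous[OF U0] mild_unique[OF U0] flow_classical by blast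
qed

end
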